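(* Let $m\le n$ be positive integers. In the commutative diagram with rows $\boldsymbol\zeta(n)^{(m)}\rightleftarrows\boldsymbol\zeta(n+1)^{(m)}$ (maps $\mathbf i_{n+1,n}$ and $\boldsymbol\pi_{n,n+1}$) and $\Lambda^*(n)^{(m)}\rightleftarrows\Lambda^*(n+1)^{(m)}$ (maps $\mathbf i^*_{n+1,n}$ and $\boldsymbol\pi^*_{n,n+1}$), and with columns the restrictions of the Harish-Chandra isomorphisms $\chi_n$ and $\chi_{n+1}$, each pair of horizontal arrows consists of mutually inverse isomorphisms. That is, the restrictions $\mathbf i_{n+1,n}:\boldsymbol\zeta(n)^{(m)}\to\boldsymbol\zeta(n+1)^{(m)}$ and $\boldsymbol\pi_{n,n+1}:\boldsymbol\zeta(n+1)^{(m)}\to\boldsymbol\zeta(n)^{(m)}$ are mutually inverse isomorphisms, and the restrictions $\mathbf i^*_{n+1,n}:\Lambda^*(n)^{(m)}\to\Lambda^*(n+1)^{(m)}$ and $\boldsymbol\pi^*_{n,n+1}:\Lambda^*(n+1)^{(m)}\to\Lambda^*(n)^{(m)}$ are mutually inverse isomorphisms.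
   Context: $\boldsymbol\zeta(n)$ is the center of $\mathbf U(gl(n))$ (over $\mathbb C$), with $\boldsymbol\zeta(n)^{(m)}$ the $m$-th filtration element induced by the standard filtration of $\mathbf U(gl(n))$. Capelli elements: for $k=1,\dots,n$, $\mathbf H_k(n)=\sum_{1\le i_1<\cdots<i_k\le n}\mathbf{cdet}[e_{i_r,i_s}+\delta_{rs}(k-s)]_{r,s=1}^k$, where $\mathbf{cdet}(A)=\sum_\sigma(-1)^{|\sigma|}a_{\sigma(1),1}\cdots a_{\sigma(k),k}$; they are algebraically independent generators of $\boldsymbol\zeta(n)$. $\mathbf i_{n+1,n}:\boldsymbol\zeta(n)\to\boldsymbol\zeta(n+1)$ is the algebra monomorphism with $\mathbf H_k(n)\mapsto\mathbf H_k(n+1)$, $k=1,\dots,n$; $\boldsymbol\pi_{n,n+1}:\boldsymbol\zeta(n+1)\to\boldsymbol\zeta(n)$ is the algebra epimorphism with $\mathbf H_k(n+1)\mapsto\mathbf H_k(n)$, $k=1,\dots,n$, and $\mathbf H_{n+1}(n+1)\mapsto0$. $\Lambda^*(n)$ is the algebra of shifted symmetric polynomials: polynomials over $\mathbb C$ with $p(\dots,x_i,x_{i+1},\dots)=p(\dots,x_{i+1}-1,x_i+1,\dots)$ for $i=1,\dots,n-1$; $\Lambda^*(n)^{(m)}$ is its subspace of elements of degree at most $m$. It is freely generated by $\mathbf e^*_k(x_1,\dots,x_n)=\sum_{1\le i_1<\cdots<i_k\le n}(x_{i_1}+k-1)(x_{i_2}+k-2)\cdots x_{i_k}$, $k=1,\dots,n$.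 $\mathbf i^*_{n+1,n}:\Lambda^*(n)\to\Lambda^*(n+1)$ is the algebra monomorphism with $\mathbf e^*_k(x_1,\dots,x_n)\mapsto\mathbf e^*_k(x_1,\dots,x_{n+1})$, $k\le n$; $\boldsymbol\pi^*_{n,n+1}:\Lambda^*(n+1)\to\Lambda^*(n)$ is the algebra epimorphism with $\mathbf e^*_k(x_1,\dots,x_{n+1})\mapsto\mathbf e^*_k(x_1,\dots,x_n)$, $k\le n$, and $\mathbf e^*_{n+1}(x_1,\dots,x_{n+1})\mapsto0$. The Harish-Chandra isomorphism $\chi_n:\boldsymbol\zeta(n)\to\Lambda^*(n)$ sends $A$ to the shifted symmetric polynomial whose value at $(\mu_1,\dots,\mu_n)$ is the eigenvalue of $A$ on the highest weight module $V_\mu$; $\chi_n(\mathbf H_k(n))=\mathbf e^*_k(x_1,\dots,x_n)$. *)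

theory Defs
  imports
    Complex_Main
    "HOL-Library.Poly_Mapping"
    "HOL-Library.FuncSet"
    "HOL-Combinatorics.Permutations"
    "HOL-Algebra.QuotRing"
    "HOL-Algebra.Module"
begin

section \<open>Linear maps and algebra homomorphisms over the complex numbers\<close>

definition complex_ring :: "complex ring" where
  "complex_ring = \<lparr>carrier = UNIV, mult = (*), one = 1, zero = 0, add = (+)\<rparr>"

text \<open>
  Complex algebras, commutative or not, are carried by the record type \<^typ>\<open>(complex, 'a) module\<close>,
  which has both the ring operations and the scalar multiplication.  The record is also used for
  mere vector spaces; the multiplicative part is then ignored.
\<close>

definition lin_hom ::
    "(complex, 'a) module \<Rightarrow> (complex, 'b) module \<Rightarrow> ('a \<Rightarrow> 'b) set" where
  "lin_hom V W = {f \<in> carrier V \<rightarrow> carrier W.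
     (\<forall>x\<in>carrier V. \<forall>y\<in>carrier V. f (x \<oplus>\<^bsub>V\<^esub> y) = f x \<oplus>\<^bsub>W\<^esub> f y) \<and>
     (\<forall>c. \<forall>x\<in>carrier V. f (c \<odot>\<^bsub>V\<^esub> x) = c \<odot>\<^bsub>W\<^esub> f x)}"

definition lin_iso ::
    "(complex, 'a) module \<Rightarrow> (complex, 'b) module \<Rightarrow> ('a \<Rightarrow> 'b) set" where
  "lin_iso V W = {f \<in> lin_hom V W. bij_betw f (carrier V) (carrier W)}"

definition mutually_inverse_isos ::
    "(complex, 'a) module \<Rightarrow> (complex, 'b) module \<Rightarrow> ('a \<Rightarrow> 'b) \<Rightarrow> ('b \<Rightarrow> 'a) \<Rightarrow> bool" where
  "mutually_inverse_isos V W f g \<longleftrightarrow>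
     f \<in> lin_iso V W \<and> g \<in> lin_iso W V \<and>
     (\<forall>x\<in>carrier V. g (f x) = x) \<and> (\<forall>y\<in>carrier W. f (g y) = y)"

definition alg_hom ::
    "(complex, 'a) module \<Rightarrow> (complex, 'b) module \<Rightarrow> ('a \<Rightarrow> 'b) set" where
  "alg_hom A B = ring_hom A B \<inter> lin_hom A B"

section \<open>The enveloping algebra of gl(n)\<close>

datatype 'a free_monoid = Free_Word (letters: "'a list")

instantiation free_monoid :: (type) monoid_add
begin

definition zero_free_monoid :: "'a free_monoid" where
  "0 = Free_Word []"

definition plus_free_monoid :: "'a free_monoid \<Rightarrow> 'a free_monoid \<Rightarrow> 'a free_monoid" where
  "v + w = Free_Word (letters v @ letters w)"

instance
  by standard (simp_all add: zero_free_monoid_def plus_free_monoid_def)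

end

text \<open>
  The multiplication of \<^typ>\<open>'m \<Rightarrow>\<^sub>0 complex\<close> is convolution over the additively written monoid
  \<^typ>\<open>'m\<close>, so this is the free associative algebra on letters \<open>e\<^sub>i\<^sub>j\<close>.  Since the \<open>e\<^sub>i\<^sub>j\<close> form a basis
  of gl(n), the part with \<open>1 \<le> i, j \<le> n\<close> is the tensor algebra of gl(n).
\<close>
type_synonym tens = "(nat \<times> nat) free_monoid \<Rightarrow>\<^sub>0 complex"

definition tens_e :: "nat \<Rightarrow> nat \<Rightarrow> tens" where
  "tens_e i j = Poly_Mapping.single (Free_Word [(i, j)]) 1"

definition tens_const :: "complex \<Rightarrow> tens" where
  "tens_const c = Poly_Mapping.single 0 c"

definition tensor_alg :: "nat \<Rightarrow> tens ring" where
  "tensor_alg n =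
     \<lparr>carrier = {a. \<forall>w\<in>Poly_Mapping.keys a. set (letters w) \<subseteq> {1..n} \<times> {1..n}},
      mult = (*), one = 1, zero = 0, add = (+)\<rparr>"

definition gl_relations :: "nat \<Rightarrow> tens set" where
  "gl_relations n =
     {tens_e i j * tens_e k l - tens_e k l * tens_e i j
        - ((if j = k then tens_e i l else 0) - (if l = i then tens_e k j else 0)) | i j k l.
      {i, j, k, l} \<subseteq> {1..n}}"

definition gl_ideal :: "nat \<Rightarrow> tens set" where
  "gl_ideal n = genideal (tensor_alg n) (gl_relations n)"

definition U_proj :: "nat \<Rightarrow> tens \<Rightarrow> tens set" where
  "U_proj n a = gl_ideal n +>\<^bsub>tensor_alg n\<^esub> a"

definition U_gl :: "nat \<Rightarrow> (complex, tens set) module" where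
  "U_gl n = ring.extend (tensor_alg n Quot gl_ideal n)
     \<lparr>smult = (\<lambda>c A. U_proj n (tens_const c) \<otimes>\<^bsub>tensor_alg n Quot gl_ideal n\<^esub> A)\<rparr>"

definition U_e :: "nat \<Rightarrow> nat \<Rightarrow> nat \<Rightarrow> tens set" where
  "U_e n i j = U_proj n (tens_e i j)"

definition U_filt :: "nat \<Rightarrow> nat \<Rightarrow> tens set set" where
  "U_filt n m =
     U_proj n ` {a \<in> carrier (tensor_alg n). \<forall>w\<in>Poly_Mapping.keys a. length (letters w) \<le> m}"

section \<open>The center and the Capelli elements\<close>

definition zeta :: "nat \<Rightarrow> (complex, tens set) module" where
  "zeta n = (U_gl n)
     \<lparr>carrier := {z \<in> carrier (U_gl n). \<forall>a\<in>carrier (U_gl n). z \<otimes>\<^bsub>U_gl n\<^esub> a = a \<otimes>\<^bsub>U_gl n\<^esub> z}\<rparr>"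

definition zeta_filt :: "nat \<Rightarrow> nat \<Rightarrow> (complex, tens set) module" where
  "zeta_filt n m = (zeta n)\<lparr>carrier := carrier (zeta n) \<inter> U_filt n m\<rparr>"

definition cdet :: "nat \<Rightarrow> (nat \<Rightarrow> nat \<Rightarrow> 'a::ring_1) \<Rightarrow> 'a" where
  "cdet k a = (\<Sum>\<sigma> | \<sigma> permutes {1..k}. of_int (sign \<sigma>) * (\<Prod>j\<leftarrow>[1..<k+1]. a (\<sigma> j) j))"

text \<open>List positions start at 0, so the entry \<open>i\<^sub>r\<close> of \<open>is\<close> is \<open>is ! (r - 1)\<close>.\<close>
definition incr_seqs :: "nat \<Rightarrow> nat \<Rightarrow> nat list set" where
  "incr_seqs n k = {is. length is = k \<and> sorted_wrt (<) is \<and> set is \<subseteq> {1..n}}"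

text \<open>
  The defining expression of \<open>H\<^sub>k(n)\<close> is evaluated in the tensor algebra and then projected to the
  enveloping algebra, which is the same as evaluating it there.
\<close>
definition Capelli_H :: "nat \<Rightarrow> nat \<Rightarrow> tens set" where
  "Capelli_H n k = U_proj n (\<Sum>is\<in>incr_seqs n k.
     cdet k (\<lambda>r s. tens_e (is ! (r - 1)) (is ! (s - 1))
                   + (if r = s then tens_const (of_nat (k - s)) else 0)))"

text \<open>
  The homomorphisms are pinned down by their values on the generators \<open>H\<^sub>k\<close>; \<^const>\<open>extensional\<close>
  only fixes the irrelevant values outside the domain.
\<close>
definition incl_zeta :: "nat \<Rightarrow> tens set \<Rightarrow> tens set" where
  "incl_zeta n = (THE f. f \<in> alg_hom (zeta n) (zeta (n + 1)) \<and> f \<in> extensional (carrier (zeta n)) \<and>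
     inj_on f (carrier (zeta n)) \<and>
     (\<forall>k\<in>{1..n}. f (Capelli_H n k) = Capelli_H (n + 1) k))"

definition proj_zeta :: "nat \<Rightarrow> tens set \<Rightarrow> tens set" where
  "proj_zeta n = (THE f. f \<in> alg_hom (zeta (n + 1)) (zeta n) \<and>
     f \<in> extensional (carrier (zeta (n + 1))) \<and>
     f ` carrier (zeta (n + 1)) = carrier (zeta n) \<and>
     (\<forall>k\<in>{1..n}. f (Capelli_H (n + 1) k) = Capelli_H n k) \<and>
     f (Capelli_H (n + 1) (n + 1)) = \<zero>\<^bsub>zeta n\<^esub>)"

section \<open>Shifted symmetric polynomials\<close>

text \<open>A monomial is a finitely supported exponent function.\<close>
type_synonym mpoly = "(nat \<Rightarrow>\<^sub>0 nat) \<Rightarrow>\<^sub>0 complex"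

definition mvar :: "nat \<Rightarrow> mpoly" where
  "mvar i = Poly_Mapping.single (Poly_Mapping.single i 1) 1"

definition mconst :: "complex \<Rightarrow> mpoly" where
  "mconst c = Poly_Mapping.single 0 c"

definition meval :: "mpoly \<Rightarrow> (nat \<Rightarrow> complex) \<Rightarrow> complex" where
  "meval p x = (\<Sum>t\<in>Poly_Mapping.keys p. Poly_Mapping.lookup p t *
     (\<Prod>i\<in>Poly_Mapping.keys t. x i ^ Poly_Mapping.lookup t i))"

definition Lambda_star :: "nat \<Rightarrow> (complex, mpoly) module" where
  "Lambda_star n =
     \<lparr>carrier = {p. (\<forall>t\<in>Poly_Mapping.keys p. Poly_Mapping.keys t \<subseteq> {1..n}) \<and>
        (\<forall>i\<in>{1..<n}. \<forall>x. meval p x = meval p (x(i := x (i + 1) - 1, i + 1 := x i + 1)))},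
      mult = (*), one = 1, zero = 0, add = (+), smult = (\<lambda>c p. mconst c * p)\<rparr>"

definition Lambda_star_filt :: "nat \<Rightarrow> nat \<Rightarrow> (complex, mpoly) module" where
  "Lambda_star_filt n m = (Lambda_star n)
     \<lparr>carrier := {p \<in> carrier (Lambda_star n).
        \<forall>t\<in>Poly_Mapping.keys p. (\<Sum>i\<in>Poly_Mapping.keys t. Poly_Mapping.lookup t i) \<le> m}\<rparr>"

definition e_star :: "nat \<Rightarrow> nat \<Rightarrow> mpoly" where
  "e_star n k = (\<Sum>is\<in>incr_seqs n k. \<Prod>r=1..k. mvar (is ! (r - 1)) + mconst (of_nat (k - r)))"

definition incl_Lambda :: "nat \<Rightarrow> mpoly \<Rightarrow> mpoly" where
  "incl_Lambda n = (THE f. f \<in> alg_hom (Lambda_star n) (Lambda_star (n + 1)) \<and>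
     f \<in> extensional (carrier (Lambda_star n)) \<and>
     inj_on f (carrier (Lambda_star n)) \<and>
     (\<forall>k\<in>{1..n}. f (e_star n k) = e_star (n + 1) k))"

definition proj_Lambda :: "nat \<Rightarrow> mpoly \<Rightarrow> mpoly" where
  "proj_Lambda n = (THE f. f \<in> alg_hom (Lambda_star (n + 1)) (Lambda_star n) \<and>
     f \<in> extensional (carrier (Lambda_star (n + 1))) \<and>
     f ` carrier (Lambda_star (n + 1)) = carrier (Lambda_star n) \<and>
     (\<forall>k\<in>{1..n}. f (e_star (n + 1) k) = e_star n k) \<and>
     f (e_star (n + 1) (n + 1)) = 0)"

section \<open>Highest weight modules and the Harish-Chandra isomorphism\<close>

definition U_module ::
    "nat \<Rightarrow> (complex, 'v) module \<Rightarrow> (tens set \<Rightarrow> 'v \<Rightarrow> 'v) \<Rightarrow> bool" where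
  "U_module n V \<rho> \<longleftrightarrow>
     module complex_ring V \<and>
     (\<forall>a\<in>carrier (U_gl n). \<rho> a \<in> lin_hom V V) \<and>
     (\<forall>v\<in>carrier V. \<rho> \<one>\<^bsub>U_gl n\<^esub> v = v) \<and>
     (\<forall>a\<in>carrier (U_gl n). \<forall>b\<in>carrier (U_gl n). \<forall>v\<in>carrier V.
        \<rho> (a \<otimes>\<^bsub>U_gl n\<^esub> b) v = \<rho> a (\<rho> b v) \<and>
        \<rho> (a \<oplus>\<^bsub>U_gl n\<^esub> b) v = \<rho> a v \<oplus>\<^bsub>V\<^esub> \<rho> b v) \<and>
     (\<forall>c. \<forall>a\<in>carrier (U_gl n). \<forall>v\<in>carrier V. \<rho> (c \<odot>\<^bsub>U_gl n\<^esub> a) v = c \<odot>\<^bsub>V\<^esub> \<rho> a v)"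

definition irreducible_U_module ::
    "nat \<Rightarrow> (complex, 'v) module \<Rightarrow> (tens set \<Rightarrow> 'v \<Rightarrow> 'v) \<Rightarrow> bool" where
  "irreducible_U_module n V \<rho> \<longleftrightarrow>
     U_module n V \<rho> \<and> carrier V \<noteq> {\<zero>\<^bsub>V\<^esub>} \<and>
     (\<forall>N. submodule N complex_ring V \<and> (\<forall>a\<in>carrier (U_gl n). \<forall>v\<in>N. \<rho> a v \<in> N)
        \<longrightarrow> N = {\<zero>\<^bsub>V\<^esub>} \<or> N = carrier V)"

definition highest_weight_vector ::
    "nat \<Rightarrow> (nat \<Rightarrow> complex) \<Rightarrow> (complex, 'v) module \<Rightarrow> (tens set \<Rightarrow> 'v \<Rightarrow> 'v) \<Rightarrow> 'v \<Rightarrow> bool" where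
  "highest_weight_vector n \<mu> V \<rho> v \<longleftrightarrow>
     v \<in> carrier V \<and> v \<noteq> \<zero>\<^bsub>V\<^esub> \<and>
     (\<forall>i\<in>{1..n}. \<forall>j\<in>{1..n}. i < j \<longrightarrow> \<rho> (U_e n i j) v = \<zero>\<^bsub>V\<^esub>) \<and>
     (\<forall>i\<in>{1..n}. \<rho> (U_e n i i) v = \<mu> i \<odot>\<^bsub>V\<^esub> v)"

text \<open>
  The module \<open>V\<^sub>\<mu>\<close>, determined up to isomorphism.  The highest weight vector generates it by
  irreducibility.
\<close>
definition highest_weight_module ::
    "nat \<Rightarrow> (nat \<Rightarrow> complex) \<Rightarrow> (complex, 'v) module \<Rightarrow> (tens set \<Rightarrow> 'v \<Rightarrow> 'v) \<Rightarrow> bool" where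
  "highest_weight_module n \<mu> V \<rho> \<longleftrightarrow>
     irreducible_U_module n V \<rho> \<and> (\<exists>v. highest_weight_vector n \<mu> V \<rho> v)"

text \<open>
  The weight \<open>\<mu>\<close> ranges over all complex weights; the dominant integral ones, being Zariski dense,
  already determine the polynomial.  The modules in the next definition live on the type \<^typ>\<open>tens set\<close>.  This is no restriction: an
  irreducible module is cyclic, hence isomorphic to a quotient of the tensor algebra by a left
  ideal, whose elements are cosets.
\<close>
definition HC :: "nat \<Rightarrow> tens set \<Rightarrow> mpoly" where
  "HC n A = (THE p. p \<in> carrier (Lambda_star n) \<and>
     (\<forall>\<mu> (V :: (complex, tens set) module) \<rho>. highest_weight_module n \<mu> V \<rho> \<longrightarrow>
        (\<forall>v\<in>carrier V. \<rho> A v = meval p \<mu> \<odot>\<^bsub>V\<^esub> v)))"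

end

theory Submission
  imports
    Defs
    "HOL-Computational_Algebra.Fundamental_Theorem_Algebra"
    "HOL-Combinatorics.Multiset_Permutations"
begin

text \<open>
  Everything rests on the Harish-Chandra isomorphism, obtained through leading terms.  Letting \<open>e\<^sub>i\<^sub>j\<close>
  act on polynomial functions of a matrix by a left invariant vector field, and evaluating words on
  powers of a linear form at the identity matrix, one sees that the top degree part of an element of
  the ideal of commutation relations vanishes as a commutative polynomial (the part of the
  Poincare-Birkhoff-Witt theorem that is needed).  So a central element has a symbol, which is an
  \<open>ad\<close>-invariant polynomial on matrices; conjugating by elementary matrices shows that its restriction
  to diagonal matrices is symmetric, and comparing off-diagonal degrees shows that it vanishes if
  this restriction does.  Since the symbol of \<open>H\<^sub>k\<close> restricts to the \<open>k\<close>-th elementary symmetric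
  polynomial, subtracting a polynomial in the \<open>H\<^sub>k\<close> lowers the degree of a central element.  Hence the
  center is generated by the \<open>H\<^sub>k\<close> compatibly with filtrations, and \<open>H\<^sub>k\<close> acts on highest weight
  modules by \<open>e\<^sup>*\<^sub>k\<close>.

  On the polynomial side, \<open>\<pi>\<^sup>*\<close> is the substitution \<open>x\<^sub>n\<^sub>+\<^sub>1 = 0\<close>.  A shifted symmetric polynomial of
  degree at most \<open>m \<le> n\<close> is a polynomial in \<open>e\<^sup>*\<^sub>1, \<dots>, e\<^sup>*\<^sub>m\<close> alone, so \<open>e\<^sup>*\<^sub>n\<^sub>+\<^sub>1\<close>, the only generator killed by
  \<open>\<pi>\<^sup>*\<close>, does not occur.
\<close>

section \<open>Polynomial functions\<close>

text \<open>The maps and \<open>HC\<close> are specified by \<open>THE\<close>, so each needs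
  existence and uniqueness. Uniqueness of a homomorphism follows from generation; existence of
  \<open>incl_Lambda\<close> amounts to the algebraic independence of the first n generators in n +
  1 variables, and the value of \<open>HC\<close> is unique because nonzero highest weight modules
  exist for a Zariski dense set of weights. These come from products of powers of leading principal
  minors, whose annihilators are enlarged to maximal left ideals.

  Formal polynomials in the generators are avoided: the relations \<open>HC_rel\<close> and
  \<open>incl_rel\<close> derive an element together with its image and a bound for the weighted
  degree, and well-definedness is proved afterwards. Calculations in the enveloping algebra take
  place on lifts in the free algebra modulo \<open>J n\<close>, where word length is available.
  Polynomials are handled as functions with a degree bound (\<open>polyfn\<close>), so that
  restriction, substitution and differentiation act on functions and identities may be checked on
  dense sets.\<close>

inductive polyfn :: "'v set \<Rightarrow> nat \<Rightarrow> (('v \<Rightarrow> complex) \<Rightarrow> complex) \<Rightarrow> bool" for V where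
  const: "polyfn V m (\<lambda>x. c)"
| var: "i \<in> V \<Longrightarrow> polyfn V (Suc m) (\<lambda>x. x i)"
| add: "polyfn V m f \<Longrightarrow> polyfn V m g \<Longrightarrow> polyfn V m (\<lambda>x. f x + g x)"
| mult: "polyfn V i f \<Longrightarrow> polyfn V j g \<Longrightarrow> i + j \<le> m \<Longrightarrow> polyfn V m (\<lambda>x. f x * g x)"

lemma polyfn_mono: "polyfn V m f \<Longrightarrow> m \<le> m' \<Longrightarrow> polyfn V m' f"
  using polyfn.mult[OF polyfn.const[of V 0 1], of m f m'] by simp

lemma polyfn_cmult: "polyfn V m f \<Longrightarrow> polyfn V m (\<lambda>x. c * f x)"
  using polyfn.mult[OF polyfn.const[of V 0 c], of m f m] by simp

lemma polyfn_diff: "polyfn V m f \<Longrightarrow> polyfn V m g \<Longrightarrow> polyfn V m (\<lambda>x. f x - g x)"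
  using polyfn.add[of V m f "\<lambda>x. (-1) * g x"] polyfn_cmult[of V m g "-1"] by simp

lemma polyfn_sum: "(\<And>i. i \<in> S \<Longrightarrow> polyfn V m (f i)) \<Longrightarrow> polyfn V m (\<lambda>x. \<Sum>i\<in>S. f i x)"
  by (induction S rule: infinite_finite_induct) (auto intro: polyfn.intros)

lemma polyfn_prod:
  "finite S \<Longrightarrow> (\<And>i. i \<in> S \<Longrightarrow> polyfn V (d i) (f i)) \<Longrightarrow> polyfn V (\<Sum>i\<in>S. d i) (\<lambda>x. \<Prod>i\<in>S. f i x)"
  by (induction S rule: finite_induct) (auto intro!: polyfn.const polyfn.mult)

lemma polyfn_prod_list:
  "(\<And>i. i \<in> set is \<Longrightarrow> polyfn V 1 (f i)) \<Longrightarrow> polyfn V (length is) (\<lambda>x. \<Prod>i\<leftarrow>is. f i x)"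
  by (induction "is") (auto intro!: polyfn.const polyfn.mult[where i=1])

lemma polyfn_power: "polyfn V d f \<Longrightarrow> polyfn V (k * d) (\<lambda>x. f x ^ k)"
  by (induction k) (auto intro: polyfn.const polyfn.mult)

lemma polyfn_var: "i \<in> V \<Longrightarrow> 1 \<le> m \<Longrightarrow> polyfn V m (\<lambda>x. x i)"
  using polyfn.var[of i V "m - 1"] by simp

lemma polyfn_subst:
  assumes "polyfn V m f" "\<And>i. i \<in> V \<Longrightarrow> polyfn W 1 (g i)"
  shows "polyfn W m (\<lambda>x. f (\<lambda>i. g i x))"
  using assms
proof induction
  case (var i m)
  show ?case using polyfn_mono[OF var(2)[OF var(1)], of "Suc m"] by simp
qed (auto intro: polyfn.intros)

lemma polyfn_cong_arg: "polyfn V m f \<Longrightarrow> (\<And>i. i \<in> V \<Longrightarrow> x i = y i) \<Longrightarrow> f x = f y"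
  by (induction rule: polyfn.induct) auto

section \<open>Zeros of polynomial functions: curves, grids, linear factors\<close>

lemma polyfn_along_curve:
  assumes "polyfn V m f" "\<And>i. i \<in> V \<Longrightarrow> \<exists>q. \<forall>s. g i s = poly q s"
  shows "\<exists>q. \<forall>s. f (\<lambda>i. g i s) = poly q s"
  using assms(1)
proof induction
  case (const m c)
  show ?case by (rule exI[of _ "[:c:]"]) simp
next
  case (var i m)
  then show ?case using assms(2) by blast
next
  case (add m f g)
  then show ?case by (metis poly_add)
next
  case (mult i f j g m)
  then show ?case by (metis poly_mult)
qed

lemma poly_fun_zero:
  fixes q :: "complex poly"
  assumes "\<And>s. s \<in> S \<Longrightarrow> poly q s = 0" "infinite S"
  shows "q = 0"
  using assms poly_roots_finite[of q] by (metis (mono_tags, lifting) mem_Collect_eq rev_finite_subset subsetI)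

text \<open>Along a polynomial curve the function becomes a polynomial in the parameter, so
  infinitely many zeros kill it on the whole curve. The density arguments below choose such a curve
  through the given point.\<close>

lemma polyfn_curve_zero:
  assumes "polyfn V m f" "\<And>i. i \<in> V \<Longrightarrow> \<exists>q. \<forall>s. g i s = poly q s"
    and "\<And>s. s \<in> S \<Longrightarrow> f (\<lambda>i. g i s) = 0" "infinite S"
  shows "f (\<lambda>i. g i s) = 0"
proof -
  obtain q where q: "\<And>s. f (\<lambda>i. g i s) = poly q s"
    using polyfn_along_curve[of V m f g, OF assms(1,2)] by blast
  then have "q = 0" using poly_fun_zero[of S q] assms(3,4) by metis
  then show ?thesis using q by simp
qed

lemma polyfn_upd_zero:
  assumes "polyfn V m f" and "\<And>s. s \<in> S \<Longrightarrow> f (x(i := s)) = 0" "infinite S"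
  shows "f (x(i := s)) = 0"
proof -
  have "\<exists>q. \<forall>s. (x(i := s)) j = poly q s" for j
    by (cases "j = i") (auto intro: exI[of _ "[:0, 1:]"] exI[of _ "[:x j:]"])
  then show ?thesis
    using polyfn_curve_zero[OF assms(1), of "\<lambda>j s. (x(i := s)) j" S s] assms(2,3)
    by (simp del: fun_upd_apply)
qed

text \<open>Licenses division by \<open>x i - c\<close>: what holds off the hyperplane holds on it
  as well.\<close>

lemma polyfn_upd_zero_cofinite:
  assumes "polyfn V m f" and "\<And>s. s \<noteq> c \<Longrightarrow> f (x(i := s)) = 0"
  shows "f x = 0"
proof -
  have "infinite (- {c} :: complex set)"
    by (metis Compl_eq_Diff_UNIV finite.emptyI finite.insertI finite_Diff2 infinite_UNIV_char_0)
  then have "f (x(i := x i)) = 0"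
    using polyfn_upd_zero[OF assms(1), of "- {c}" x i "x i"] assms(2) by blast
  then show ?thesis by simp
qed

text \<open>Coordinates are released one at a time: with the others natural or already free, the
  function of one coordinate has infinitely many zeros.\<close>

lemma polyfn_zero_on_grid:
  assumes "polyfn V m f" "finite V" and 0: "\<And>x. (\<And>i. i \<in> V \<Longrightarrow> x i \<in> \<nat>) \<Longrightarrow> f x = 0"
  shows "f x = 0"
proof -
  have "\<forall>x. (\<forall>i\<in>V - S. x i \<in> \<nat>) \<longrightarrow> f x = 0" if "finite S" for S
    using that
  proof induction
    case empty
    then show ?case using 0 by simp
  next
    case (insert i S)
    show ?case
    proof (intro allI impI)
      fix x :: "'a \<Rightarrow> complex" assume x: "\<forall>j\<in>V - insert i S. x j \<in> \<nat>"
      have "f (x(i := s)) = 0" if "s \<in> \<nat>" for s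
        by (rule insert(3)[rule_format]) (use x that in auto)
      moreover have "infinite (\<nat> :: complex set)"
        by (simp add: Nats_def inj_of_nat finite_image_iff)
      ultimately have "f (x(i := x i)) = 0"
        using polyfn_upd_zero[OF assms(1), of \<nat> x i "x i"] by blast
      then show "f x = 0" by simp
    qed
  qed
  from this[OF assms(2)] show ?thesis by simp
qed

text \<open>Division with remainder by \<open>x i - c\<close>, the remainder being the restriction
  to the hyperplane \<open>x i = c\<close>. Since \<open>m - 1\<close> is truncated subtraction, the
  clause for \<open>m = 0\<close> records that a constant has quotient zero; this keeps the degree
  bound correct for products with a constant factor.\<close>

lemma polyfn_divide_linear:
  assumes "polyfn V m f"
  shows "\<exists>q. polyfn V (m - 1) q \<and> (m = 0 \<longrightarrow> q = (\<lambda>x. 0)) \<and>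
    (\<forall>x. f x = (x i - c) * q x + f (x(i := c)))"
  using assms
proof induction
  case (const m d)
  show ?case by (rule exI[of _ "\<lambda>x. 0"]) (auto intro: polyfn.const)
next
  case (var j m)
  show ?case
  proof (cases "j = i")
    case True
    then show ?thesis by (intro exI[of _ "\<lambda>x. 1"]) (auto intro: polyfn.const)
  next
    case False
    then show ?thesis by (intro exI[of _ "\<lambda>x. 0"]) (auto intro: polyfn.const)
  qed
next
  case (add m f g)
  then obtain q r where qr: "polyfn V (m - 1) q" "m = 0 \<longrightarrow> q = (\<lambda>x. 0)"
      "\<And>x. f x = (x i - c) * q x + f (x(i := c))"
      "polyfn V (m - 1) r" "m = 0 \<longrightarrow> r = (\<lambda>x. 0)"
      "\<And>x. g x = (x i - c) * r x + g (x(i := c))" by blast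
  have eq: "f x + g x = (x i - c) * (q x + r x) + (f (x(i := c)) + g (x(i := c)))" for x
    using qr(3)[of x] qr(6)[of x] by (simp add: algebra_simps)
  have "m = 0 \<longrightarrow> (\<lambda>x. q x + r x) = (\<lambda>x. 0)" using qr(2,5) by auto
  then show ?case
    using polyfn.add[OF qr(1,4)] eq by (intro exI[of _ "\<lambda>x. q x + r x"]) blast
next
  case (mult a f b g m)
  then obtain q r where qr: "polyfn V (a - 1) q" "a = 0 \<longrightarrow> q = (\<lambda>x. 0)"
      "\<And>x. f x = (x i - c) * q x + f (x(i := c))"
      "polyfn V (b - 1) r" "b = 0 \<longrightarrow> r = (\<lambda>x. 0)"
      "\<And>x. g x = (x i - c) * r x + g (x(i := c))" by blast
  define h where "h = (\<lambda>x. q x * g x + f (x(i := c)) * r x)"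
  have const_i: "polyfn V d (\<lambda>x. f (x(i := c)))" if "polyfn V d f" for d f
  proof -
    have "polyfn V d (\<lambda>x. f (\<lambda>j. if j = i then c else x j))"
    proof (rule polyfn_subst[OF that])
      fix j assume "j \<in> V"
      then show "polyfn V 1 (\<lambda>x. if j = i then c else x j)"
        by (cases "j = i") (auto intro: polyfn.const polyfn_var)
    qed
    then show ?thesis by (simp add: fun_upd_def)
  qed
  have eq: "f x * g x = (x i - c) * h x + f (x(i := c)) * g (x(i := c))" for x
  proof -
    have "f x * g x = ((x i - c) * q x + f (x(i := c))) * g x" using qr(3)[of x] by simp
    also have "\<dots> = (x i - c) * (q x * g x) + f (x(i := c)) * g x" by (simp add: algebra_simps)
    also have "\<dots> = (x i - c) * (q x * g x) + f (x(i := c)) * ((x i - c) * r x + g (x(i := c)))"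
      using qr(6)[of x] by simp
    finally show ?thesis by (simp add: h_def algebra_simps)
  qed
  have 1: "polyfn V (m - 1) (\<lambda>x. q x * g x)"
  proof (cases "a = 0")
    case True then show ?thesis using qr(2) by (simp add: polyfn.const)
  next
    case False
    then show ?thesis using mult by (intro polyfn.mult[OF qr(1) mult(2)]) auto
  qed
  have 2: "polyfn V (m - 1) (\<lambda>x. f (x(i := c)) * r x)"
  proof (cases "b = 0")
    case True then show ?thesis using qr(5) by (simp add: polyfn.const)
  next
    case False
    then show ?thesis using mult by (intro polyfn.mult[OF const_i[OF mult(1)] qr(4)]) auto
  qed
  have "polyfn V (m - 1) h" unfolding h_def by (rule polyfn.add[OF 1 2])
  moreover have "m = 0 \<longrightarrow> h = (\<lambda>x. 0)" using qr(2,5) mult(3) by (auto simp: h_def)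
  ultimately show ?case using eq by (intro exI[of _ h]) blast
qed

text \<open>The factors are split off one at a time. The quotient by \<open>x i - c i\<close> still
  vanishes on the other hyperplanes, because it does so where \<open>x i\<close> differs from
  \<open>c i\<close>, hence everywhere on them.\<close>

lemma polyfn_divide_linear_prod:
  assumes "polyfn V m f" "finite S" "\<And>i x. i \<in> S \<Longrightarrow> x i = c i \<Longrightarrow> f x = 0"
  shows "\<exists>q. polyfn V (m - card S) q \<and> (m < card S \<longrightarrow> q = (\<lambda>x. 0)) \<and>
    (\<forall>x. f x = (\<Prod>i\<in>S. x i - c i) * q x)"
  using assms(2,1,3)
proof (induction S arbitrary: f m rule: finite_induct)
  case empty
  then show ?case by auto
next
  case (insert i S)
  obtain q where q: "polyfn V (m - 1) q" "m = 0 \<longrightarrow> q = (\<lambda>x. 0)"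
      "\<And>x. f x = (x i - c i) * q x + f (x(i := c i))"
    using polyfn_divide_linear[OF insert(4), of i "c i"] by blast
  have f: "f x = (x i - c i) * q x" for x
    using q(3)[of x] insert(5)[of i "x(i := c i)"] by simp
  have "q x = 0" if j: "j \<in> S" "x j = c j" for j x
  proof (rule polyfn_upd_zero_cofinite[OF q(1)])
    fix s assume s: "s \<noteq> c i"
    have "j \<noteq> i" using j insert by auto
    then have "(x(i := s)) j = c j" using j by simp
    then have "f (x(i := s)) = 0" using insert(5)[of j "x(i := s)"] j(1) by blast
    then show "q (x(i := s)) = 0" using f[of "x(i := s)"] s by simp
  qed
  then obtain r where r: "polyfn V (m - 1 - card S) r" "m - 1 < card S \<longrightarrow> r = (\<lambda>x. 0)"
    "\<And>x. q x = (\<Prod>i\<in>S. x i - c i) * r x" using insert.IH[OF q(1)] by blast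
  have "f x = (\<Prod>i\<in>insert i S. x i - c i) * r x" for x
    using insert f[of x] r(3)[of x] by simp
  moreover have "polyfn V (m - card (insert i S)) r" using r(1) insert by simp
  moreover have "\<exists>q. polyfn V (m - card (insert i S)) q \<and> (m < card (insert i S) \<longrightarrow> q = (\<lambda>x. 0)) \<and>
    (\<forall>x. f x = (\<Prod>i\<in>insert i S. x i - c i) * q x)"
  proof (cases "m = 0")
    case True
    then have "f x = 0" for x using f q(2) by simp
    then show ?thesis by (intro exI[of _ "\<lambda>x. 0"]) (auto intro: polyfn.const)
  next
    case False
    then have "m < card (insert i S) \<longrightarrow> r = (\<lambda>x. 0)" using r(2) insert by auto
    then show ?thesis using calculation by blast
  qed
  ultimately show ?case by blast
qed

text \<open>Induction on the variables: sorting the monomials by their exponent of one variable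
  gives a one-variable polynomial that vanishes identically, hence has zero coefficients. The
  abstract index set serves both exponent functions and multisets of letters.\<close>

lemma monomials_independent:
  fixes c :: "'b \<Rightarrow> complex" and e :: "'b \<Rightarrow> 'v \<Rightarrow> nat"
  assumes "finite V" "finite K" "\<And>s t. s \<in> K \<Longrightarrow> t \<in> K \<Longrightarrow> (\<And>i. i \<in> V \<Longrightarrow> e s i = e t i) \<Longrightarrow> s = t"
    and "\<And>x. (\<Sum>t\<in>K. c t * (\<Prod>i\<in>V. x i ^ e t i)) = 0" and "t \<in> K"
  shows "c t = 0"
  using assms
proof (induction V arbitrary: K t rule: finite_induct)
  case empty
  then have "K = {t}" by auto
  then show ?case using empty(3)[of "\<lambda>_. 0"] by simp
next
  case (insert i V)
  define N where "N = Suc (Max ((\<lambda>t. e t i) ` K))"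
  have N: "e t i < N" if "t \<in> K" for t
    using that insert by (auto simp: N_def less_Suc_eq_le)
  let ?K = "\<lambda>k. {t \<in> K. e t i = k}"
  have inner: "(\<Sum>t\<in>?K k. c t * (\<Prod>i\<in>V. x i ^ e t i)) = 0" for k x
  proof -
    define q where "q = (\<Sum>k<N. monom (\<Sum>t\<in>?K k. c t * (\<Prod>i\<in>V. x i ^ e t i)) k)"
    have "poly q s = 0" for s
    proof -
      have "poly q s = (\<Sum>k<N. \<Sum>t\<in>?K k. c t * (\<Prod>i\<in>V. x i ^ e t i) * s ^ e t i)"
        by (simp add: q_def poly_sum poly_monom sum_distrib_right)
      also have "\<dots> = (\<Sum>t\<in>K. c t * (\<Prod>i\<in>V. x i ^ e t i) * s ^ e t i)"
        using insert.prems(1) N sum.group[of K "{..<N}" "\<lambda>t. e t i" "\<lambda>t. c t * (\<Prod>i\<in>V. x i ^ e t i) * s ^ e t i"]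
        by auto
      also have "\<dots> = (\<Sum>t\<in>K. c t * (\<Prod>j\<in>insert i V. (x(i := s)) j ^ e t j))"
      proof (intro sum.cong refl)
        fix t
        have "(\<Prod>j\<in>V. (x(i := s)) j ^ e t j) = (\<Prod>i\<in>V. x i ^ e t i)"
          using insert(2) by (intro prod.cong) auto
        then show "c t * (\<Prod>i\<in>V. x i ^ e t i) * s ^ e t i = c t * (\<Prod>j\<in>insert i V. (x(i := s)) j ^ e t j)"
          using insert by (simp add: mult_ac)
      qed
      finally show ?thesis using insert.prems(3) by simp
    qed
    then have "q = 0" using poly_all_0_iff_0 by blast
    then have "coeff q k = 0" by simp
    then have *: "(\<Sum>j<N. if j = k then (\<Sum>t\<in>?K j. c t * (\<Prod>i\<in>V. x i ^ e t i)) else 0) = 0"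
      by (simp add: q_def coeff_sum)
    show ?thesis
    proof (cases "k < N")
      case True
      then show ?thesis using * by (simp add: sum.delta)
    next
      case False
      then have "?K k = {}" using N by auto
      then show ?thesis by (simp only: sum.empty)
    qed
  qed
  show ?case
  proof (rule insert.IH[of "?K (e t i)" t])
    fix u v assume uv: "u \<in> ?K (e t i)" "v \<in> ?K (e t i)" "\<And>j. j \<in> V \<Longrightarrow> e u j = e v j"
    then have "e u j = e v j" if "j \<in> insert i V" for j using that by auto
    then show "u = v" using insert.prems(2) uv(1,2) by blast
  qed (use insert.prems inner in auto)
qed

section \<open>Linear extension and multivariate polynomials\<close>

text \<open>Common shape of \<open>meval\<close>, \<open>act\<close>, \<open>symb\<close> and the
  graded and differentiated variants of \<open>symb\<close>: a function on words or monomials,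
  extended linearly.\<close>

definition lin_ext :: "('w \<Rightarrow> complex) \<Rightarrow> ('w \<Rightarrow>\<^sub>0 complex) \<Rightarrow> complex" where
  "lin_ext \<psi> a = (\<Sum>w\<in>Poly_Mapping.keys a. Poly_Mapping.lookup a w * \<psi> w)"

lemma lin_ext_superset:
  "finite S \<Longrightarrow> Poly_Mapping.keys a \<subseteq> S \<Longrightarrow> lin_ext \<psi> a = (\<Sum>w\<in>S. Poly_Mapping.lookup a w * \<psi> w)"
  unfolding lin_ext_def by (intro sum.mono_neutral_left) (auto simp: in_keys_iff)

lemma lin_ext_0 [simp]: "lin_ext \<psi> 0 = 0"
  by (simp add: lin_ext_def)

lemma lin_ext_add [simp]: "lin_ext \<psi> (a + b) = lin_ext \<psi> a + lin_ext \<psi> b"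
proof -
  let ?S = "Poly_Mapping.keys a \<union> Poly_Mapping.keys b"
  have "Poly_Mapping.keys (a + b) \<subseteq> ?S" by (rule keys_add)
  then show ?thesis
    using lin_ext_superset[of ?S "a + b" \<psi>] lin_ext_superset[of ?S a \<psi>] lin_ext_superset[of ?S b \<psi>]
    by (simp add: lookup_add algebra_simps sum.distrib)
qed

lemma lin_ext_uminus [simp]: "lin_ext \<psi> (- a) = - lin_ext \<psi> a"
  using lin_ext_add[of \<psi> a "- a"] by (simp add: eq_neg_iff_add_eq_0 add.commute)

lemma lin_ext_diff [simp]: "lin_ext \<psi> (a - b) = lin_ext \<psi> a - lin_ext \<psi> b"
  using lin_ext_add[of \<psi> a "- b"] by simp

lemma lin_ext_sum: "lin_ext \<psi> (sum f S) = (\<Sum>i\<in>S. lin_ext \<psi> (f i))"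
  by (induction S rule: infinite_finite_induct) auto

lemma lin_ext_single [simp]: "lin_ext \<psi> (Poly_Mapping.single w c) = c * \<psi> w"
  by (cases "c = 0") (auto simp: lin_ext_def)

lemma poly_mapping_sum_single:
  "a = (\<Sum>w\<in>Poly_Mapping.keys a. Poly_Mapping.single w (Poly_Mapping.lookup a w))"
proof (rule poly_mapping_eqI)
  fix k
  have "Poly_Mapping.lookup (\<Sum>w\<in>Poly_Mapping.keys a. Poly_Mapping.single w (Poly_Mapping.lookup a w)) k
    = (\<Sum>w\<in>Poly_Mapping.keys a. if w = k then Poly_Mapping.lookup a w else 0)"
    by (simp add: lookup_sum lookup_single when_def)
  also have "\<dots> = Poly_Mapping.lookup a k" by (simp add: in_keys_iff)
  finally show "Poly_Mapping.lookup a k =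
    Poly_Mapping.lookup (\<Sum>w\<in>Poly_Mapping.keys a. Poly_Mapping.single w (Poly_Mapping.lookup a w)) k" ..
qed

lemma lin_ext_mult_sum:
  fixes a b :: "'w::monoid_add \<Rightarrow>\<^sub>0 complex"
  shows "lin_ext \<psi> (a * b) = (\<Sum>u\<in>Poly_Mapping.keys a. \<Sum>v\<in>Poly_Mapping.keys b.
    Poly_Mapping.lookup a u * Poly_Mapping.lookup b v * \<psi> (u + v))"
proof -
  have "a * b = (\<Sum>u\<in>Poly_Mapping.keys a. Poly_Mapping.single u (Poly_Mapping.lookup a u)) *
      (\<Sum>v\<in>Poly_Mapping.keys b. Poly_Mapping.single v (Poly_Mapping.lookup b v))"
    by (simp flip: poly_mapping_sum_single)
  also have "\<dots> = (\<Sum>u\<in>Poly_Mapping.keys a. \<Sum>v\<in>Poly_Mapping.keys b.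
      Poly_Mapping.single (u + v) (Poly_Mapping.lookup a u * Poly_Mapping.lookup b v))"
    by (simp add: sum_product mult_single)
  finally show ?thesis by (simp add: lin_ext_sum)
qed

text \<open>Multiplicativity is asked only on the words that occur in \<open>a\<close> and
  \<open>b\<close>; this lets a function that cuts off at a given length count as multiplicative on
  suitable filtration steps.\<close>

lemma lin_ext_mult:
  fixes a b :: "'w::monoid_add \<Rightarrow>\<^sub>0 complex"
  assumes "\<And>u v. u \<in> Poly_Mapping.keys a \<Longrightarrow> v \<in> Poly_Mapping.keys b \<Longrightarrow> \<psi> (u + v) = \<phi> u * \<eta> v"
  shows "lin_ext \<psi> (a * b) = lin_ext \<phi> a * lin_ext \<eta> b"
proof -
  have "lin_ext \<psi> (a * b) = (\<Sum>u\<in>Poly_Mapping.keys a. \<Sum>v\<in>Poly_Mapping.keys b.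
      Poly_Mapping.lookup a u * Poly_Mapping.lookup b v * (\<phi> u * \<eta> v))"
    unfolding lin_ext_mult_sum by (simp add: assms)
  also have "\<dots> = lin_ext \<phi> a * lin_ext \<eta> b"
    unfolding lin_ext_def sum_product by (intro sum.cong refl) simp
  finally show ?thesis .
qed

lemma lin_ext_cong: "(\<And>w. w \<in> Poly_Mapping.keys a \<Longrightarrow> \<phi> w = \<psi> w) \<Longrightarrow> lin_ext \<phi> a = lin_ext \<psi> a"
  by (simp add: lin_ext_def)

definition mono_eval :: "('v \<Rightarrow> complex) \<Rightarrow> ('v \<Rightarrow>\<^sub>0 nat) \<Rightarrow> complex" where
  "mono_eval x t = (\<Prod>i\<in>Poly_Mapping.keys t. x i ^ Poly_Mapping.lookup t i)"

lemma mono_eval_superset: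
  "finite V \<Longrightarrow> Poly_Mapping.keys t \<subseteq> V \<Longrightarrow> mono_eval x t = (\<Prod>i\<in>V. x i ^ Poly_Mapping.lookup t i)"
  unfolding mono_eval_def by (intro prod.mono_neutral_left) (auto simp: in_keys_iff)

lemma mono_eval_add: "mono_eval x (s + t) = mono_eval x s * mono_eval x t"
proof -
  let ?S = "Poly_Mapping.keys s \<union> Poly_Mapping.keys t"
  have "Poly_Mapping.keys (s + t) \<subseteq> ?S" by (rule keys_add)
  then show ?thesis
    by (simp add: mono_eval_superset[of ?S] lookup_add power_add prod.distrib)
qed

lemma meval_lin_ext: "meval p x = lin_ext (mono_eval x) p"
  by (simp add: meval_def lin_ext_def mono_eval_def)

lemma meval_simps [simp]:
  "meval 0 x = 0" "meval 1 x = 1" "meval (p + q) x = meval p x + meval q x"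
  "meval (p - q) x = meval p x - meval q x" "meval (p * q) x = meval p x * meval q x"
  "meval (mconst c) x = c" "meval (mvar i) x = x i"
proof -
  have "meval (Poly_Mapping.single 0 1) x = 1"
    unfolding meval_lin_ext by (simp only: lin_ext_single) (simp add: mono_eval_def)
  then show "meval 1 x = 1" by simp
  show "meval (p * q) x = meval p x * meval q x"
    unfolding meval_lin_ext by (rule lin_ext_mult) (simp add: mono_eval_add)
qed (simp_all add: meval_lin_ext mconst_def mvar_def mono_eval_def)

lemma meval_sum [simp]: "meval (sum f S) x = (\<Sum>i\<in>S. meval (f i) x)"
  by (induction S rule: infinite_finite_induct) auto

lemma meval_prod [simp]: "meval (prod f S) x = (\<Prod>i\<in>S. meval (f i) x)"
  by (induction S rule: infinite_finite_induct) auto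

text \<open>Monomials are linearly independent as functions, so from here on a formal polynomial may
  be replaced by its evaluation function.\<close>

lemma meval_eq_0_imp:
  assumes "\<And>x. meval p x = 0"
  shows "p = 0"
proof -
  define V where "V = (\<Union>t\<in>Poly_Mapping.keys p. Poly_Mapping.keys t)"
  have V: "finite V" "\<And>t. t \<in> Poly_Mapping.keys p \<Longrightarrow> Poly_Mapping.keys t \<subseteq> V" by (auto simp: V_def)
  have "Poly_Mapping.lookup p t = 0" if "t \<in> Poly_Mapping.keys p" for t
  proof (rule monomials_independent[where V=V and K="Poly_Mapping.keys p" and e=Poly_Mapping.lookup and t=t])
    fix s t assume st: "s \<in> Poly_Mapping.keys p" "t \<in> Poly_Mapping.keys p"
      "\<And>i. i \<in> V \<Longrightarrow> Poly_Mapping.lookup s i = Poly_Mapping.lookup t i"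
    have "Poly_Mapping.lookup s i = Poly_Mapping.lookup t i" for i
      using st(3)[of i] V(2)[OF st(1)] V(2)[OF st(2)] by (metis in_keys_iff subsetD)
    then show "s = t" by (simp add: poly_mapping_eqI)
  next
    fix x
    have "meval p x = (\<Sum>t\<in>Poly_Mapping.keys p. Poly_Mapping.lookup p t * (\<Prod>i\<in>V. x i ^ Poly_Mapping.lookup t i))"
      unfolding meval_lin_ext lin_ext_def using V by (intro sum.cong) (auto simp: mono_eval_superset)
    then show "(\<Sum>t\<in>Poly_Mapping.keys p. Poly_Mapping.lookup p t * (\<Prod>i\<in>V. x i ^ Poly_Mapping.lookup t i)) = 0"
      using assms by simp
  qed (use V that in auto)
  then show ?thesis by (metis in_keys_iff lookup_zero poly_mapping_eqI)
qed

lemma meval_inject: "(\<And>x. meval p x = meval q x) \<Longrightarrow> p = q"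
  using meval_eq_0_imp[of "p - q"] by simp

definition mpolys :: "nat set \<Rightarrow> nat \<Rightarrow> mpoly set" where
  "mpolys V m = {p. \<forall>t\<in>Poly_Mapping.keys p. Poly_Mapping.keys t \<subseteq> V \<and>
     (\<Sum>i\<in>Poly_Mapping.keys t. Poly_Mapping.lookup t i) \<le> m}"

lemma mpolys_polyfn:
  assumes "p \<in> mpolys V m"
  shows "polyfn V m (meval p)"
  unfolding meval_lin_ext[abs_def] lin_ext_def
proof (intro polyfn_sum polyfn_cmult)
  fix t assume t: "t \<in> Poly_Mapping.keys p"
  have "polyfn V (\<Sum>i\<in>Poly_Mapping.keys t. Poly_Mapping.lookup t i * 1) (\<lambda>x. mono_eval x t)"
    unfolding mono_eval_def using assms t
    by (intro polyfn_prod polyfn_power polyfn_var) (auto simp: mpolys_def)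
  then show "polyfn V m (\<lambda>x. mono_eval x t)"
    by (rule polyfn_mono) (use assms t in \<open>auto simp: mpolys_def\<close>)
qed

lemma degree_sum_add:
  fixes s t :: "'v \<Rightarrow>\<^sub>0 nat"
  shows "(\<Sum>i\<in>Poly_Mapping.keys (s + t). Poly_Mapping.lookup (s + t) i) =
    (\<Sum>i\<in>Poly_Mapping.keys s. Poly_Mapping.lookup s i) + (\<Sum>i\<in>Poly_Mapping.keys t. Poly_Mapping.lookup t i)"
proof -
  let ?S = "Poly_Mapping.keys s \<union> Poly_Mapping.keys t"
  have *: "(\<Sum>i\<in>Poly_Mapping.keys u. Poly_Mapping.lookup u i) = (\<Sum>i\<in>?S. Poly_Mapping.lookup u i)"
    if "Poly_Mapping.keys u \<subseteq> ?S" for u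
    using that by (intro sum.mono_neutral_left) (auto simp: in_keys_iff)
  have "Poly_Mapping.keys (s + t) \<subseteq> ?S" by (rule keys_add)
  then show ?thesis
    unfolding *[of "s + t", OF \<open>Poly_Mapping.keys (s + t) \<subseteq> ?S\<close>] *[of s, OF Un_upper1] *[of t, OF Un_upper2]
    by (simp add: lookup_add sum.distrib)
qed

lemma mpolys_add: "p \<in> mpolys V m \<Longrightarrow> q \<in> mpolys V m \<Longrightarrow> p + q \<in> mpolys V m"
  using keys_add[of p q] by (fastforce simp: mpolys_def)

lemma mpolys_mult:
  assumes "p \<in> mpolys V i" "q \<in> mpolys V j" "i + j \<le> m"
  shows "p * q \<in> mpolys V m"
  unfolding mpolys_def
proof (intro CollectI ballI)
  fix t assume "t \<in> Poly_Mapping.keys (p * q)"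
  then obtain u v where uv: "u \<in> Poly_Mapping.keys p" "v \<in> Poly_Mapping.keys q" "t = u + v"
    using keys_mult[of p q] by blast
  have "Poly_Mapping.keys u \<subseteq> V" "Poly_Mapping.keys v \<subseteq> V"
    "(\<Sum>i\<in>Poly_Mapping.keys u. Poly_Mapping.lookup u i) \<le> i"
    "(\<Sum>i\<in>Poly_Mapping.keys v. Poly_Mapping.lookup v i) \<le> j"
    using assms uv(1,2) by (auto simp: mpolys_def)
  then show "Poly_Mapping.keys t \<subseteq> V \<and> (\<Sum>i\<in>Poly_Mapping.keys t. Poly_Mapping.lookup t i) \<le> m"
    using keys_add[of u v] assms(3) unfolding uv(3) degree_sum_add by auto
qed

lemma mpolys_const [simp]: "mconst c \<in> mpolys V m"
  by (cases "c = 0") (auto simp: mpolys_def mconst_def)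

lemma mpolys_var [simp]: "i \<in> V \<Longrightarrow> 1 \<le> m \<Longrightarrow> mvar i \<in> mpolys V m"
  by (auto simp: mpolys_def mvar_def)

lemma polyfn_mpolys:
  assumes "polyfn V m f"
  shows "\<exists>p\<in>mpolys V m. \<forall>x. meval p x = f x"
  using assms
proof induction
  case (const m c)
  show ?case by (rule bexI[of _ "mconst c"]) auto
next
  case (var i m)
  then show ?case by (intro bexI[of _ "mvar i"]) auto
next
  case (add m f g)
  then show ?case by (metis meval_simps(3) mpolys_add)
next
  case (mult i f j g m)
  then show ?case by (metis meval_simps(5) mpolys_mult)
qed

text \<open>Some formal polynomial with the required variables and degree realises the function, and
  by \<open>meval_inject\<close> it is the given one; degree and variables can thus be read off the
  function.\<close>

lemma mpolys_iff_polyfn: "p \<in> mpolys V m \<longleftrightarrow> polyfn V m (meval p)"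
proof
  assume "polyfn V m (meval p)"
  then obtain q where "q \<in> mpolys V m" "\<forall>x. meval q x = meval p x" using polyfn_mpolys by blast
  then show "p \<in> mpolys V m" using meval_inject[of q p] by auto
qed (rule mpolys_polyfn)

section \<open>Shifted elementary symmetric functions\<close>

text \<open>The parameter \<open>h\<close> interpolates between the elementary symmetric functions (\<open>h = 0\<close>), which
  describe leading terms, and the functions \<open>e\<^sup>*\<^sub>k\<close> (\<open>h = 1\<close>).\<close>

definition shift_sym :: "complex \<Rightarrow> nat \<Rightarrow> ((nat \<Rightarrow> complex) \<Rightarrow> complex) \<Rightarrow> bool" where
  "shift_sym h n f \<longleftrightarrow> (\<forall>i\<in>{1..<n}. \<forall>x. f x = f (x(i := x (i + 1) - h, i + 1 := x i + h)))"

definition e_fun :: "complex \<Rightarrow> nat \<Rightarrow> nat \<Rightarrow> (nat \<Rightarrow> complex) \<Rightarrow> complex" where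
  "e_fun h n k x = (\<Sum>is\<in>incr_seqs n k. \<Prod>r=1..k. x (is ! (r - 1)) + h * of_nat (k - r))"

text \<open>The rising factorial with step \<open>h\<close>, a power of \<open>u\<close> for
  \<open>h = 0\<close>. It replaces the powers of \<open>u\<close> in the generating function of
  \<open>e_fun\<close>.\<close>

definition poch :: "complex \<Rightarrow> complex \<Rightarrow> nat \<Rightarrow> complex" where
  "poch h u j = (\<Prod>l<j. u + h * of_nat l)"

lemma finite_incr_seqs [simp]: "finite (incr_seqs n k)"
  by (rule finite_subset[OF _ finite_lists_length_eq[of "{1..n}" k]]) (auto simp: incr_seqs_def)

lemma incr_seqs_0: "incr_seqs n 0 = {[]}"
  by (auto simp: incr_seqs_def)

lemma incr_seqs_empty: "n < k \<Longrightarrow> incr_seqs n k = {}"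
proof -
  assume "n < k"
  have False if "is \<in> incr_seqs n k" for "is"
  proof -
    have "distinct is" using that by (auto simp: incr_seqs_def strict_sorted_iff)
    then have "k = card (set is)" using that by (simp add: distinct_card incr_seqs_def)
    also have "\<dots> \<le> card {1..n}" using that by (intro card_mono) (auto simp: incr_seqs_def)
    finally show False using \<open>n < k\<close> by simp
  qed
  then show ?thesis by blast
qed

lemma incr_seqs_Suc:
  "incr_seqs (Suc n) (Suc k) = incr_seqs n (Suc k) \<union> (\<lambda>is. is @ [Suc n]) ` incr_seqs n k"
proof (rule subset_antisym; rule subsetI)
  fix "is" assume a: "is \<in> incr_seqs (Suc n) (Suc k)"
  then obtain js j where js: "is = js @ [j]"
    by (cases "is" rule: rev_cases) (auto simp: incr_seqs_def)
  show "is \<in> incr_seqs n (Suc k) \<union> (\<lambda>is. is @ [Suc n]) ` incr_seqs n k"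
  proof (cases "j = Suc n")
    case True
    then have "js \<in> incr_seqs n k"
      using a js by (force simp: incr_seqs_def sorted_wrt_append)
    then show ?thesis using True js by blast
  next
    case False
    then have "is \<in> incr_seqs n (Suc k)"
      using a js by (force simp: incr_seqs_def sorted_wrt_append)
    then show ?thesis by blast
  qed
next
  fix "is" assume "is \<in> incr_seqs n (Suc k) \<union> (\<lambda>is. is @ [Suc n]) ` incr_seqs n k"
  then show "is \<in> incr_seqs (Suc n) (Suc k)"
    by (force simp: incr_seqs_def sorted_wrt_append)
qed

lemma e_fun_0 [simp]: "e_fun h n 0 x = 1"
  by (simp add: e_fun_def incr_seqs_0)

lemma e_fun_eq_0: "n < k \<Longrightarrow> e_fun h n k x = 0"
  by (simp add: e_fun_def incr_seqs_empty)

text \<open>Index lists are split by whether they end in \<open>Suc n\<close>. If they do, the last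
  factor carries shift zero, and each of the other factors has one more position behind it, whence
  \<open>x i + h\<close>.\<close>

lemma e_fun_Suc:
  "e_fun h (Suc n) (Suc k) x = e_fun h n (Suc k) x + x (Suc n) * e_fun h n k (\<lambda>i. x i + h)"
proof -
  have disj: "incr_seqs n (Suc k) \<inter> (\<lambda>is. is @ [Suc n]) ` incr_seqs n k = {}"
    by (auto simp: incr_seqs_def)
  have inj: "inj_on (\<lambda>is. is @ [Suc n]) (incr_seqs n k)" by (auto simp: inj_on_def)
  have *: "(\<Prod>r=1..Suc k. x ((is @ [Suc n]) ! (r - 1)) + h * of_nat (Suc k - r)) =
     x (Suc n) * (\<Prod>r=1..k. x (is ! (r - 1)) + h + h * of_nat (k - r))" if "is \<in> incr_seqs n k" for "is"
  proof -
    have len: "length is = k" using that by (simp add: incr_seqs_def)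
    have "(\<Prod>r=1..k. x ((is @ [Suc n]) ! (r - 1)) + h * of_nat (Suc k - r)) =
      (\<Prod>r=1..k. x (is ! (r - 1)) + h + h * of_nat (k - r))"
      using len by (intro prod.cong) (auto simp: nth_append Suc_diff_le algebra_simps)
    then show ?thesis using len by (simp add: nth_append)
  qed
  have "(\<Sum>is\<in>(\<lambda>is. is @ [Suc n]) ` incr_seqs n k. \<Prod>r=1..Suc k. x (is ! (r - 1)) + h * of_nat (Suc k - r)) =
    x (Suc n) * e_fun h n k (\<lambda>i. x i + h)"
    unfolding sum.reindex[OF inj] o_def e_fun_def sum_distrib_left by (intro sum.cong refl *)
  moreover have "finite ((\<lambda>is. is @ [Suc n]) ` incr_seqs n k)" by simp
  ultimately show ?thesis
    by (simp only: e_fun_def[of h "Suc n" "Suc k"] e_fun_def[of h n "Suc k"] incr_seqs_Suc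
        sum.union_disjoint[OF finite_incr_seqs _ disj])
qed

lemma poch_Suc: "poch h u (Suc j) = u * poch h (u + h) j"
  unfolding poch_def by (subst prod.lessThan_Suc_shift) (simp add: algebra_simps)

text \<open>Deforms the expansion of the product of all \<open>u + x i\<close>. The right side makes
  the shift symmetry visible, the left side isolates the single \<open>e_fun h n k\<close>.\<close>

lemma e_fun_generating:
  "(\<Sum>k\<le>n. e_fun h n k x * poch h u (n - k)) = (\<Prod>i=1..n. u + x i + h * of_nat (n - i))"
proof (induction n arbitrary: x u)
  case 0
  then show ?case by (simp add: poch_def)
next
  case (Suc n)
  have "(\<Sum>k\<le>n. e_fun h n k x * poch h u (Suc n - k)) = (\<Sum>k\<le>Suc n. e_fun h n k x * poch h u (Suc n - k))"
    by (simp add: e_fun_eq_0)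
  also have "\<dots> = poch h u (Suc n) + (\<Sum>k\<le>n. e_fun h n (Suc k) x * poch h u (n - k))"
    by (simp only: sum.atMost_Suc_shift e_fun_0) simp
  finally have 1: "poch h u (Suc n) + (\<Sum>k\<le>n. e_fun h n (Suc k) x * poch h u (n - k)) =
    (\<Sum>k\<le>n. e_fun h n k x * poch h u (Suc n - k))" ..
  have "(\<Sum>k\<le>n. e_fun h n k x * poch h u (Suc n - k)) = u * (\<Sum>k\<le>n. e_fun h n k x * poch h (u + h) (n - k))"
    by (simp add: sum_distrib_left Suc_diff_le poch_Suc mult_ac)
  also have "\<dots> = u * (\<Prod>i=1..n. u + x i + h * of_nat (Suc n - i))"
    unfolding Suc.IH by (intro arg_cong2[where f="(*)"] prod.cong) (auto simp: Suc_diff_le algebra_simps)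
  finally have 2: "(\<Sum>k\<le>n. e_fun h n k x * poch h u (Suc n - k)) =
    u * (\<Prod>i=1..n. u + x i + h * of_nat (Suc n - i))" .
  have "(\<Sum>k\<le>n. e_fun h n k (\<lambda>i. x i + h) * poch h u (n - k)) = (\<Prod>i=1..n. u + x i + h * of_nat (Suc n - i))"
    unfolding Suc.IH by (intro prod.cong) (auto simp: Suc_diff_le algebra_simps)
  then have 3: "(\<Sum>k\<le>n. x (Suc n) * e_fun h n k (\<lambda>i. x i + h) * poch h u (n - k)) =
    x (Suc n) * (\<Prod>i=1..n. u + x i + h * of_nat (Suc n - i))"
    by (simp add: mult.assoc flip: sum_distrib_left)
  have "(\<Sum>k\<le>Suc n. e_fun h (Suc n) k x * poch h u (Suc n - k)) =
    poch h u (Suc n) + (\<Sum>k\<le>n. e_fun h (Suc n) (Suc k) x * poch h u (n - k))"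
    by (simp only: sum.atMost_Suc_shift e_fun_0) simp
  also have "\<dots> = (poch h u (Suc n) + (\<Sum>k\<le>n. e_fun h n (Suc k) x * poch h u (n - k))) +
     (\<Sum>k\<le>n. x (Suc n) * e_fun h n k (\<lambda>i. x i + h) * poch h u (n - k))"
    by (simp add: e_fun_Suc distrib_right sum.distrib)
  also have "\<dots> = (u + x (Suc n)) * (\<Prod>i=1..n. u + x i + h * of_nat (Suc n - i))"
    unfolding 1 2 3 by (simp add: algebra_simps)
  also have "\<dots> = (\<Prod>i=1..Suc n. u + x i + h * of_nat (Suc n - i))"
    by (simp add: mult.commute)
  finally show ?case .
qed

section \<open>Comparing coefficients of rising factorials\<close>

definition poch_poly :: "complex \<Rightarrow> nat \<Rightarrow> complex poly" where
  "poch_poly h j = (\<Prod>l<j. [:h * of_nat l, 1:])"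

lemma poly_poch_poly [simp]: "poly (poch_poly h j) u = poch h u j"
  by (simp add: poch_poly_def poch_def poly_prod add.commute)

lemma lead_coeff_poch_poly: "lead_coeff (poch_poly h j) = 1"
  by (simp only: poch_poly_def lead_coeff_prod) simp

lemma degree_poch_poly [simp]: "degree (poch_poly h j) = j"
proof (induction j)
  case (Suc j)
  have "poch_poly h j \<noteq> 0" using lead_coeff_poch_poly[of h j] by auto
  moreover have "poch_poly h (Suc j) = poch_poly h j * [:h * of_nat j, 1:]"
    by (simp only: poch_poly_def prod.lessThan_Suc)
  ultimately have "degree (poch_poly h (Suc j)) = degree (poch_poly h j) + degree [:h * of_nat j, 1:]"
    by (metis degree_mult_eq pCons_eq_0_iff one_neq_zero)
  then show ?case using Suc by simp
qed (simp add: poch_poly_def)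

lemma coeff_poch_poly [simp]: "coeff (poch_poly h j) j = 1"
  using lead_coeff_poch_poly[of h j] by simp

text \<open>\<open>poch h u j\<close> is monic of degree \<open>j\<close> in \<open>u\<close>, so
  the top coefficient of a vanishing combination is zero and the top term can be removed.\<close>

lemma poch_independent:
  assumes "\<And>u. (\<Sum>j\<le>n. c j * poch h u j) = 0" "j \<le> n"
  shows "c j = 0"
  using assms
proof (induction n)
  case 0
  then show ?case by (simp add: poch_def)
next
  case (Suc n)
  define p where "p = (\<Sum>j\<le>Suc n. smult (c j) (poch_poly h j))"
  have "poly p u = 0" for u using Suc(2) by (simp add: p_def poly_sum)
  then have "coeff p (Suc n) = 0" using poly_all_0_iff_0[of p] by simp
  moreover have "coeff p (Suc n) = c (Suc n)"
    by (simp add: p_def coeff_sum coeff_eq_0)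
  ultimately have "c (Suc n) = 0" by simp
  then show ?case using Suc by (cases "j = Suc n") auto
qed

lemma poch_coeffs_eq:
  assumes "\<And>u. (\<Sum>k\<le>n. a k * poch h u (n - k)) = (\<Sum>k\<le>n. b k * poch h u (n - k))" "k \<le> n"
  shows "a k = b k"
proof -
  have "(\<Sum>j\<le>n. (a (n - j) - b (n - j)) * poch h u j) = 0" for u
  proof -
    have "(\<Sum>j\<le>n. (a (n - j) - b (n - j)) * poch h u j) = (\<Sum>k\<le>n. (a k - b k) * poch h u (n - k))"
      by (rule sum.reindex_bij_witness[where i="\<lambda>j. n - j" and j="\<lambda>j. n - j"]) auto
    then show ?thesis using assms(1)[of u] by (simp add: left_diff_distrib sum_subtractf)
  qed
  from poch_independent[where n=n and c="\<lambda>j. a (n - j) - b (n - j)" and j="n - k", OF this] assms(2)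
  show ?thesis by simp
qed

lemma polyfn_e_fun: "polyfn {1..n} k (e_fun h n k)"
  unfolding e_fun_def[abs_def]
proof (intro polyfn_sum)
  fix "is" assume a: "is \<in> incr_seqs n k"
  have "polyfn {1..n} (\<Sum>r\<in>{1..k}. 1) (\<lambda>x. \<Prod>r\<in>{1..k}. x (is ! (r - 1)) + h * of_nat (k - r))"
  proof (intro polyfn_prod polyfn.add polyfn.const polyfn_var)
    fix r assume "r \<in> {1..k}"
    then have "is ! (r - 1) \<in> set is" using a by (intro nth_mem) (auto simp: incr_seqs_def)
    then show "is ! (r - 1) \<in> {1..n}" using a by (auto simp: incr_seqs_def)
  qed auto
  then show "polyfn {1..n} k (\<lambda>x. \<Prod>r\<in>{1..k}. x (is ! (r - 1)) + h * of_nat (k - r))" by simp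
qed

text \<open>The substitution exchanges the factors numbered \<open>i\<close> and
  \<open>i + 1\<close>: their shifts \<open>h * of_nat (n - i)\<close> and
  \<open>h * of_nat (n - i - 1)\<close> differ by exactly \<open>h\<close>.\<close>

lemma shift_sym_linear_factors:
  "shift_sym h n (\<lambda>x. \<Prod>i=1..n. u + x i + h * of_nat (n - i))"
  unfolding shift_sym_def
proof (intro ballI allI)
  fix i and x :: "nat \<Rightarrow> complex" assume i: "i \<in> {1..<n}"
  let ?y = "x(i := x (i + 1) - h, i + 1 := x i + h)"
  let ?g = "\<lambda>j. u + x j + h * of_nat (n - j)"
  let ?t = "transpose i (i + 1)"
  have "?t permutes {1..n}" using i by (intro permutes_swap_id) auto
  then have "(\<Prod>j=1..n. ?g j) = (\<Prod>j=1..n. ?g (?t j))" by (subst prod.permute) (auto simp: o_def)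
  also have "\<dots> = (\<Prod>j=1..n. u + ?y j + h * of_nat (n - j))"
  proof (intro prod.cong refl)
    fix j
    have n: "n - i = Suc (n - Suc i)" using i by auto
    show "?g (?t j) = u + ?y j + h * of_nat (n - j)"
      using n by (cases "j = i"; cases "j = i + 1") (auto simp: transpose_def algebra_simps)
  qed
  finally show "(\<Prod>j=1..n. u + x j + h * of_nat (n - j)) = (\<Prod>j=1..n. u + ?y j + h * of_nat (n - j))" .
qed

lemma shift_sym_e_fun: "shift_sym h n (e_fun h n k)"
  unfolding shift_sym_def
proof (intro ballI allI)
  fix i and x :: "nat \<Rightarrow> complex" assume i: "i \<in> {1..<n}"
  let ?y = "x(i := x (i + 1) - h, i + 1 := x i + h)"
  show "e_fun h n k x = e_fun h n k ?y"
  proof (cases "k \<le> n")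
    case True
    show ?thesis
    proof (rule poch_coeffs_eq[where h=h, OF _ True])
      fix u
      show "(\<Sum>k\<le>n. e_fun h n k x * poch h u (n - k)) = (\<Sum>k\<le>n. e_fun h n k ?y * poch h u (n - k))"
        unfolding e_fun_generating using shift_sym_linear_factors[of h n u] i unfolding shift_sym_def by blast
    qed
  next
    case False
    then show ?thesis by (simp add: e_fun_eq_0)
  qed
qed

text \<open>Because the last chosen index has shift zero, every list ending in \<open>Suc n\<close>
  contributes a factor \<open>x (Suc n)\<close>. Hence setting this variable to zero is compatible
  with all generators at once, which gives the projection.\<close>

lemma e_fun_last_0: "e_fun h (Suc n) k (x(Suc n := 0)) = e_fun h n k x"
proof (cases k)
  case (Suc j)
  have "e_fun h n k (x(Suc n := 0)) = e_fun h n k x"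
    by (rule polyfn_cong_arg[OF polyfn_e_fun]) auto
  then show ?thesis using Suc by (simp add: e_fun_Suc)
qed simp

text \<open>The generating identity is evaluated at \<open>u = 0\<close>, where every rising
  factorial of positive length vanishes.\<close>

lemma e_fun_top: "e_fun h n n x = (\<Prod>i=1..n. x i + h * of_nat (n - i))"
proof -
  have "(\<Sum>k\<le>n. e_fun h n k x * poch h 0 (n - k)) = (\<Sum>k\<le>n. if k = n then e_fun h n n x else 0)"
  proof (intro sum.cong refl)
    fix k assume "k \<in> {..n}"
    show "e_fun h n k x * poch h 0 (n - k) = (if k = n then e_fun h n n x else 0)"
    proof (cases "k = n")
      case False
      then obtain j where "n - k = Suc j" using \<open>k \<in> {..n}\<close> by (metis Suc_diff_Suc atMost_iff le_neq_implies_less)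
      then show ?thesis using False by (simp add: poch_Suc)
    qed (simp add: poch_def)
  qed
  then show ?thesis using e_fun_generating[of h n x 0] by simp
qed

text \<open>The bound \<open>m\<close> refers to the weighted degree in which
  \<open>e_fun h n k\<close> has weight \<open>k\<close>. It bounds every intermediate expression,
  not only the final function, so no high terms can cancel unseen.\<close>

inductive e_gen :: "complex \<Rightarrow> nat \<Rightarrow> nat \<Rightarrow> ((nat \<Rightarrow> complex) \<Rightarrow> complex) \<Rightarrow> bool" for h n where
  const: "e_gen h n m (\<lambda>x. c)"
| gen: "k \<in> {1..n} \<Longrightarrow> k \<le> m \<Longrightarrow> e_gen h n m (e_fun h n k)"
| add: "e_gen h n m f \<Longrightarrow> e_gen h n m g \<Longrightarrow> e_gen h n m (\<lambda>x. f x + g x)"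
| mult: "e_gen h n i f \<Longrightarrow> e_gen h n j g \<Longrightarrow> i + j \<le> m \<Longrightarrow> e_gen h n m (\<lambda>x. f x * g x)"

lemma e_gen_shift_sym: "e_gen h n m f \<Longrightarrow> shift_sym h n f"
proof (induction rule: e_gen.induct)
  case (gen k m)
  then show ?case using shift_sym_e_fun by blast
next
  case (add m f g)
  then show ?case unfolding shift_sym_def by metis
next
  case (mult i f j g m)
  then show ?case unfolding shift_sym_def by metis
qed (simp add: shift_sym_def)

lemma e_gen_polyfn: "e_gen h n m f \<Longrightarrow> polyfn {1..n} m f"
proof (induction rule: e_gen.induct)
  case (gen k m)
  show ?case by (rule polyfn_mono[OF polyfn_e_fun gen(2)])
qed (auto intro: polyfn.intros)

lemma e_gen_extend:
  "e_gen h n m f \<Longrightarrow> \<exists>g. e_gen h (Suc n) m g \<and> (\<forall>x. g (x(Suc n := 0)) = f x)"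
proof (induction rule: e_gen.induct)
  case (const m c)
  then show ?case by (intro exI[of _ "\<lambda>x. c"]) (auto intro: e_gen.const)
next
  case (gen k m)
  then show ?case
    by (intro exI[of _ "e_fun h (Suc n) k"]) (auto intro: e_gen.gen simp: e_fun_last_0 simp del: fun_upd_apply)
next
  case (add m f g)
  then obtain f' g' where "e_gen h (Suc n) m f'" "\<forall>x. f' (x(Suc n := 0)) = f x"
    "e_gen h (Suc n) m g'" "\<forall>x. g' (x(Suc n := 0)) = g x" by blast
  then show ?case by (intro exI[of _ "\<lambda>x. f' x + g' x"]) (auto intro: e_gen.add simp del: fun_upd_apply)
next
  case (mult i f j g m)
  then obtain f' g' where "e_gen h (Suc n) i f'" "\<forall>x. f' (x(Suc n := 0)) = f x"
    "e_gen h (Suc n) j g'" "\<forall>x. g' (x(Suc n := 0)) = g x" by blast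
  then show ?case using mult(3) by (intro exI[of _ "\<lambda>x. f' x * g' x"]) (auto intro: e_gen.mult simp del: fun_upd_apply)
qed

lemma polyfn_upd_const:
  assumes "polyfn V m f"
  shows "polyfn (V - {i}) m (\<lambda>x. f (x(i := c)))"
proof -
  have "polyfn (V - {i}) m (\<lambda>x. f (\<lambda>j. (x(i := c)) j))"
  proof (rule polyfn_subst[OF assms])
    fix j assume "j \<in> V"
    then show "polyfn (V - {i}) 1 (\<lambda>x. (x(i := c)) j)"
      by (cases "j = i") (auto intro: polyfn.const polyfn_var)
  qed
  then show ?thesis .
qed

lemma polyfn_shift_sym_swap:
  fixes f :: "(nat \<Rightarrow> complex) \<Rightarrow> complex"
  assumes "polyfn {1..n} m f" "i \<in> {1..<n}"
  shows "polyfn {1..n} m (\<lambda>x. f (x(i := x (i + 1) - h, i + 1 := x i + h)))"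
proof -
  have "polyfn {1..n} m (\<lambda>x. f (\<lambda>j. (x(i := x (i + 1) - h, i + 1 := x i + h)) j))"
  proof (rule polyfn_subst[OF assms(1)])
    fix j assume "j \<in> {1..n}"
    show "polyfn {1..n} 1 (\<lambda>x. (x(i := x (i + 1) - h, i + 1 := x i + h)) j)"
    proof -
      have i: "i \<in> {1..n}" "i + 1 \<in> {1..n}" using assms(2) by auto
      consider "j = i" | "j = i + 1" | "j \<noteq> i" "j \<noteq> i + 1" by blast
      then show ?thesis
      proof cases
        case 1
        then show ?thesis
          using polyfn_diff[OF polyfn_var[OF i(2)] polyfn.const, of 1 h] by simp
      next
        case 2
        then show ?thesis
          using polyfn.add[OF polyfn_var[OF i(1)] polyfn.const, of 1 h] by simp
      next
        case 3
        then show ?thesis using polyfn_var[OF \<open>j \<in> {1..n}\<close>, of 1] by simp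
      qed
    qed
  qed
  then show ?thesis .
qed

text \<open>Along the translates \<open>x i + s\<close> the product is nonzero for all but finitely
  many \<open>s\<close>; the curve lemma then reaches \<open>s = 0\<close>.\<close>

lemma polyfn_cancel_linear_prod:
  assumes "polyfn V m f" "finite S" "\<And>x. (\<Prod>i\<in>S. x i - c i) * f x = 0"
  shows "f x = 0"
proof -
  let ?B = "(\<lambda>i. c i - x i) ` S"
  have "infinite (- ?B :: complex set)"
    using assms(2) by (metis Compl_eq_Diff_UNIV finite_Diff2 finite_imageI infinite_UNIV_char_0)
  moreover have "f (\<lambda>i. x i + s) = 0" if "s \<in> - ?B" for s
  proof -
    have "x i + s - c i \<noteq> 0" if "i \<in> S" for i
      using \<open>s \<in> - ?B\<close> that by (auto simp: algebra_simps)
    then have "(\<Prod>i\<in>S. (x i + s) - c i) \<noteq> 0" using assms(2) by simp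
    then show ?thesis using assms(3)[of "\<lambda>i. x i + s"] by simp
  qed
  moreover have "\<exists>q. \<forall>s. x i + s = poly q s" for i by (rule exI[of _ "[:x i, 1:]"]) simp
  ultimately have "f (\<lambda>i. x i + 0) = 0"
    using polyfn_curve_zero[OF assms(1), of "\<lambda>i s. x i + s" "- ?B" 0] by blast
  then show ?thesis by simp
qed

lemma shift_sym_restrict_last:
  assumes "shift_sym h (Suc n) f"
  shows "shift_sym h n (\<lambda>x. f (x(Suc n := 0)))"
  unfolding shift_sym_def
proof (intro ballI allI)
  fix i and x :: "nat \<Rightarrow> complex" assume i: "i \<in> {1..<n}"
  let ?x = "x(Suc n := 0)"
  have "f ?x = f (?x(i := ?x (i + 1) - h, i + 1 := ?x i + h))"
    using assms i unfolding shift_sym_def by fastforce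
  also have "?x(i := ?x (i + 1) - h, i + 1 := ?x i + h) = x(i := x (i + 1) - h, i + 1 := x i + h, Suc n := 0)"
    using i by (auto simp: fun_eq_iff)
  finally show "f ?x = f (x(i := x (i + 1) - h, i + 1 := x i + h, Suc n := 0))" .
qed

lemma polyfn_restrict_last:
  assumes "polyfn {1..Suc n} m f"
  shows "polyfn {1..n} m (\<lambda>x. f (x(Suc n := 0)))"
proof -
  have "{1..Suc n} - {Suc n} = {1..n}" by auto
  then show ?thesis using polyfn_upd_const[OF assms, of "Suc n" 0] by (simp only:)
qed

text \<open>Double induction on \<open>n\<close> and \<open>m\<close>. The restriction to
  \<open>x (Suc n) = 0\<close> is generated by the case \<open>n\<close>; lifting that expression
  and subtracting it leaves a shift symmetric function divisible by
  \<open>e_fun h (Suc n) (Suc n)\<close>, whose quotient has smaller degree. The case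
  \<open>h = 0\<close> serves symbols, the case \<open>h = 1\<close> shifted symmetric
  polynomials.\<close>

theorem shift_sym_generated:
  assumes "polyfn {1..n} m f" "shift_sym h n f"
  shows "e_gen h n m f"
  using assms
proof (induction n arbitrary: m f)
  case 0
  have "f = (\<lambda>x. f (\<lambda>_. 0))"
    using polyfn_cong_arg[OF 0(1)] by fastforce
  then show ?case by (metis e_gen.const)
next
  case (Suc n)
  from Suc.prems show ?case
  proof (induction m arbitrary: f rule: less_induct)
    case (less m f)
    define f0 where "f0 = (\<lambda>x. f (x(Suc n := 0)))"
    have f0: "polyfn {1..n} m f0" unfolding f0_def by (rule polyfn_restrict_last[OF less.prems(1)])
    have "shift_sym h n f0" unfolding f0_def by (rule shift_sym_restrict_last[OF less.prems(2)])
    then have "e_gen h n m f0" using Suc.IH f0 by blast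
    then obtain g where g: "e_gen h (Suc n) m g" "\<And>x. g (x(Suc n := 0)) = f0 x"
      using e_gen_extend by blast
    define d where "d = (\<lambda>x. f x - g x)"
    have d: "polyfn {1..Suc n} m d" unfolding d_def
      by (intro polyfn_diff less.prems(1) e_gen_polyfn[OF g(1)])
    have dh: "d x = d (x(i := x (i + 1) - h, i + 1 := x i + h))" if "i \<in> {1..<Suc n}" for i x
      using less.prems(2) e_gen_shift_sym[OF g(1)] that unfolding shift_sym_def d_def by metis
    \<comment> \<open>Shift symmetry moves the zero at the last coordinate leftwards, adding
      \<open>- h\<close> for each place.\<close>
    have vanish: "d x = 0" if "j \<le> n" "x (Suc n - j) = - (h * of_nat j)" for j x
      using that
    proof (induction j arbitrary: x)
      case 0
      then have "x = x(Suc n := 0)" by auto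
      then show ?case using g(2)[of x] by (metis d_def f0_def right_minus_eq)
    next
      case (Suc j)
      let ?i = "Suc n - Suc j"
      have i: "?i \<in> {1..<Suc n}" "?i + 1 = Suc n - j" using Suc by auto
      have "x ?i + h = - (h * of_nat j)" 
        by (simp only: Suc.prems(2)) (simp add: algebra_simps)
      then have "d (x(?i := x (?i + 1) - h, ?i + 1 := x ?i + h)) = 0"
        using Suc.prems i(2) by (intro Suc.IH) (auto simp del: diff_Suc_Suc)
      then show ?case using dh[OF i(1)] by simp
    qed
    let ?c = "\<lambda>i. - (h * of_nat (Suc n - i))"
    have "d x = 0" if "i \<in> {1..Suc n}" "x i = ?c i" for i x
      using vanish[of "Suc n - i" x] that by auto
    then obtain q where q: "polyfn {1..Suc n} (m - Suc n) q" "m < Suc n \<longrightarrow> q = (\<lambda>x. 0)"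
      "\<And>x. d x = (\<Prod>i=1..Suc n. x i - ?c i) * q x"
      using polyfn_divide_linear_prod[OF d, of "{1..Suc n}" ?c] by auto
    have E: "e_fun h (Suc n) (Suc n) x = (\<Prod>i=1..Suc n. x i - ?c i)" for x
      unfolding e_fun_top by simp
    \<comment> \<open>Both \<open>d\<close> and the product are shift symmetric; the product is
      cancelled from the resulting identity, although it vanishes at some points.\<close>
    have "shift_sym h (Suc n) q" unfolding shift_sym_def
    proof (intro ballI allI)
      fix i and x :: "nat \<Rightarrow> complex" assume i: "i \<in> {1..<Suc n}"
      let ?s = "\<lambda>x :: nat \<Rightarrow> complex. x(i := x (i + 1) - h, i + 1 := x i + h)"
      have "(\<Prod>i=1..Suc n. x i - ?c i) * (q x - q (?s x)) = 0" for x
      proof -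
        have "e_fun h (Suc n) (Suc n) x = e_fun h (Suc n) (Suc n) (?s x)"
          using shift_sym_e_fun[of h "Suc n" "Suc n"] i unfolding shift_sym_def by blast
        then show ?thesis using dh[OF i, of x] unfolding q(3) E by (simp add: algebra_simps)
      qed
      moreover have "polyfn {1..Suc n} (m - Suc n) (\<lambda>x. q x - q (?s x))"
        by (intro polyfn_diff q(1) polyfn_shift_sym_swap i)
      ultimately have "q x - q (?s x) = 0"
        using polyfn_cancel_linear_prod[of "{1..Suc n}" "m - Suc n" "\<lambda>x. q x - q (?s x)" "{1..Suc n}" ?c] by blast
      then show "q x = q (?s x)" by simp
    qed
    have f: "f = (\<lambda>x. g x + e_fun h (Suc n) (Suc n) x * q x)"
      using q(3) unfolding E d_def by (auto simp: fun_eq_iff algebra_simps)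
    show ?case
    proof (cases "m < Suc n")
      case True
      then show ?thesis using g(1) f q(2) by simp
    next
      case False
      then have "e_gen h (Suc n) (m - Suc n) q" using less.IH[OF _ q(1)] \<open>shift_sym h (Suc n) q\<close> by simp
      then show ?thesis unfolding f using False
        by (intro e_gen.add g(1) e_gen.mult[OF e_gen.gen[of "Suc n" _ "Suc n"]]) auto
    qed
  qed
qed

section \<open>Prescribing the values of the generators\<close>

lemma monic_poly_splits:
  fixes p :: "complex poly"
  assumes "degree p = n" "lead_coeff p = 1"
  shows "\<exists>r. \<forall>u. poly p u = (\<Prod>i=1..n. u - r i)"
  using assms
proof (induction n arbitrary: p)
  case 0
  then obtain c where "p = [:c:]" using degree_eq_zeroE by blast
  then show ?case using 0 by simp
next
  case (Suc n)
  have "\<not> constant (poly p)" using Suc(2) by (simp add: constant_degree)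
  then obtain z where "poly p z = 0" using fundamental_theorem_of_algebra by blast
  then obtain q where q: "p = [:- z, 1:] * q" by (metis dvdE poly_eq_0_iff_dvd)
  have "q \<noteq> 0" using Suc(2) q by auto
  then have "degree p = Suc (degree q)" unfolding q by (subst degree_mult_eq) auto
  moreover have "lead_coeff p = lead_coeff q" unfolding q lead_coeff_mult by simp
  ultimately obtain r where r: "\<And>u. poly q u = (\<Prod>i=1..n. u - r i)"
    using Suc.IH[of q] Suc.prems by auto
  have "poly p u = (\<Prod>i=1..Suc n. u - (r(Suc n := z)) i)" for u
  proof -
    have "(\<Prod>i=1..n. u - (r(Suc n := z)) i) = poly q u" unfolding r by (intro prod.cong) auto
    then show ?thesis by (simp add: q algebra_simps)
  qed
  then show ?case by blast
qed

text \<open>The wanted values are the coefficients of a monic polynomial in \<open>u\<close> with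
  respect to the rising factorials; it splits into linear factors over the complex numbers, and the
  point is read off its roots. This surjectivity later gives the algebraic independence of the
  generators.\<close>

lemma e_fun_surjective: "\<exists>x. \<forall>k\<in>{1..n}. e_fun h n k x = c k"
proof -
  \<comment> \<open>The coefficient of the longest rising factorial is set to 1, the value of
    \<open>e_fun h n 0\<close>, so that the polynomial is monic.\<close>
  define c' where "c' = c(0 := 1)"
  define p where "p = (\<Sum>k\<le>n. smult (c' k) (poch_poly h (n - k)))"
  have p: "p = poch_poly h n + (\<Sum>k=1..n. smult (c' k) (poch_poly h (n - k)))"
    unfolding p_def by (simp add: atMost_atLeast0 sum.atLeast_Suc_atMost c'_def)
  have coeff: "coeff p n = 1"
    unfolding p by (simp add: coeff_sum coeff_eq_0)
  have "degree p \<le> n" unfolding p_def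
    by (intro degree_sum_le) (auto intro: order_trans[OF degree_smult_le])
  then have "degree p = n" using coeff le_degree[of p n] by auto
  then obtain r where r: "\<And>u. poly p u = (\<Prod>i=1..n. u - r i)"
    using monic_poly_splits[of p n] coeff by auto
  \<comment> \<open>Solves \<open>u - r i = u + x i + h * of_nat (n - i)\<close>, matching the
    factors of the generating identity.\<close>
  define x where "x = (\<lambda>i. - r i - h * of_nat (n - i))"
  have "e_fun h n k x = c' k" if "k \<le> n" for k
  proof (rule poch_coeffs_eq[where h=h, OF _ that])
    fix u
    have "(\<Sum>k\<le>n. e_fun h n k x * poch h u (n - k)) = poly p u"
      unfolding e_fun_generating r by (simp add: x_def)
    then show "(\<Sum>k\<le>n. e_fun h n k x * poch h u (n - k)) = (\<Sum>k\<le>n. c' k * poch h u (n - k))"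
      by (simp add: p_def poly_sum)
  qed
  then show ?thesis by (intro exI[of _ x]) (auto simp: c'_def)
qed

section \<open>The tensor algebra and the ideal of commutation relations\<close>

lemma letters_0 [simp]: "letters 0 = []"
  by (simp add: zero_free_monoid_def)

lemma letters_plus [simp]: "letters (v + w) = letters v @ letters w"
  by (simp add: plus_free_monoid_def)

abbreviation T :: "nat \<Rightarrow> tens set" where
  "T n \<equiv> carrier (tensor_alg n)"

definition T_filt :: "nat \<Rightarrow> nat \<Rightarrow> tens set" where
  "T_filt n m = {a \<in> T n. \<forall>w\<in>Poly_Mapping.keys a. length (letters w) \<le> m}"

definition word :: "(nat \<times> nat) list \<Rightarrow> tens" where
  "word ls = Poly_Mapping.single (Free_Word ls) 1"

lemma T_iff: "a \<in> T n \<longleftrightarrow> (\<forall>w\<in>Poly_Mapping.keys a. set (letters w) \<subseteq> {1..n} \<times> {1..n})"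
  by (simp add: tensor_alg_def)

lemma tensor_alg_simps [simp]:
  "mult (tensor_alg n) = (*)" "add (tensor_alg n) = (+)" "zero (tensor_alg n) = 0" "one (tensor_alg n) = 1"
  by (simp_all add: tensor_alg_def)

lemma T_filt_T: "a \<in> T_filt n m \<Longrightarrow> a \<in> T n"
  by (simp add: T_filt_def)

lemma T_filt_keys: "a \<in> T_filt n m \<Longrightarrow> w \<in> Poly_Mapping.keys a \<Longrightarrow> length (letters w) \<le> m"
  by (simp add: T_filt_def)

lemma T_in_T_filt: "a \<in> T n \<Longrightarrow> \<exists>m. a \<in> T_filt n m"
  by (auto simp: T_filt_def intro!: exI[of _ "Max ((\<lambda>w. length (letters w)) ` Poly_Mapping.keys a)"])

lemma T_filt_mono: "a \<in> T_filt n m \<Longrightarrow> m \<le> m' \<Longrightarrow> a \<in> T_filt n m'"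
  by (force simp: T_filt_def)

lemma T_filt_0 [simp]: "0 \<in> T_filt n m"
  by (simp add: T_filt_def T_iff)

lemma T_filt_const [simp]: "tens_const c \<in> T_filt n m"
  by (cases "c = 0") (auto simp: T_filt_def T_iff tens_const_def)

lemma T_filt_e: "i \<in> {1..n} \<Longrightarrow> j \<in> {1..n} \<Longrightarrow> 1 \<le> m \<Longrightarrow> tens_e i j \<in> T_filt n m"
  by (auto simp: T_filt_def T_iff tens_e_def)

lemma T_filt_add: "a \<in> T_filt n m \<Longrightarrow> b \<in> T_filt n m \<Longrightarrow> a + b \<in> T_filt n m"
  using keys_add[of a b] by (fastforce simp: T_filt_def T_iff)

lemma T_filt_mult: "a \<in> T_filt n i \<Longrightarrow> b \<in> T_filt n j \<Longrightarrow> i + j \<le> m \<Longrightarrow> a * b \<in> T_filt n m"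
  unfolding T_filt_def T_iff mem_Collect_eq
proof (intro conjI ballI)
  fix w assume a: "(\<forall>w\<in>Poly_Mapping.keys a. set (letters w) \<subseteq> {1..n} \<times> {1..n}) \<and>
       (\<forall>w\<in>Poly_Mapping.keys a. length (letters w) \<le> i)"
    "(\<forall>w\<in>Poly_Mapping.keys b. set (letters w) \<subseteq> {1..n} \<times> {1..n}) \<and>
       (\<forall>w\<in>Poly_Mapping.keys b. length (letters w) \<le> j)"
    and ij: "i + j \<le> m" and "w \<in> Poly_Mapping.keys (a * b)"
  then obtain u v where uv: "u \<in> Poly_Mapping.keys a" "v \<in> Poly_Mapping.keys b" "w = u + v"
    using keys_mult[of a b] by blast
  have "set (letters u) \<subseteq> {1..n} \<times> {1..n}" "set (letters v) \<subseteq> {1..n} \<times> {1..n}"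
    "length (letters u) \<le> i" "length (letters v) \<le> j" using a uv by auto
  then show "set (letters w) \<subseteq> {1..n} \<times> {1..n}" "length (letters w) \<le> m"
    using ij by (auto simp: uv(3))
qed

lemma T_0 [simp]: "0 \<in> T n" and T_const [simp]: "tens_const c \<in> T n"
  using T_filt_T[OF T_filt_0] T_filt_T[OF T_filt_const] by auto

lemma tens_const_1 [simp]: "tens_const 1 = 1" and tens_const_0 [simp]: "tens_const 0 = 0"
  by (simp_all add: tens_const_def)

lemma tens_const_add: "tens_const (c + d) = tens_const c + tens_const d"
  by (simp add: tens_const_def single_add)

lemma tens_const_diff: "tens_const (c - d) = tens_const c - tens_const d"
  by (simp add: tens_const_def single_diff)

lemma tens_const_mult: "tens_const (c * d) = tens_const c * tens_const d"
  by (simp add: tens_const_def mult_single)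

lemma tens_const_uminus: "tens_const (- c) = - tens_const c"
  using tens_const_diff[of 0 c] by simp

lemma tens_const_of_nat: "tens_const (of_nat k) = of_nat k"
  by (simp add: tens_const_def)

lemma tens_const_of_int: "tens_const (of_int k) = of_int k"
  by (simp add: tens_const_def)

lemma T_1 [simp]: "1 \<in> T n"
  using T_const[of 1 n] by simp

lemma T_e: "i \<in> {1..n} \<Longrightarrow> j \<in> {1..n} \<Longrightarrow> tens_e i j \<in> T n"
  using T_filt_T[OF T_filt_e[of i n j 1]] by simp

lemma T_add: "a \<in> T n \<Longrightarrow> b \<in> T n \<Longrightarrow> a + b \<in> T n"
  using keys_add[of a b] by (fastforce simp: T_iff)

lemma T_mult: "a \<in> T n \<Longrightarrow> b \<in> T n \<Longrightarrow> a * b \<in> T n"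
  using T_in_T_filt[of a n] T_in_T_filt[of b n] T_filt_mult[of a n _ b] T_filt_T by blast

lemma T_uminus: "a \<in> T n \<Longrightarrow> - a \<in> T n"
  using T_mult[OF T_const[of "- 1"], of a n] by (simp add: tens_const_uminus)

lemma T_diff: "a \<in> T n \<Longrightarrow> b \<in> T n \<Longrightarrow> a - b \<in> T n"
  using T_add[of a n "- b"] T_uminus[of b n] by simp

lemma T_sum: "(\<And>i. i \<in> S \<Longrightarrow> f i \<in> T n) \<Longrightarrow> sum f S \<in> T n"
  by (induction S rule: infinite_finite_induct) (auto intro: T_add)

lemma T_prod_list: "(\<And>i. i \<in> set is \<Longrightarrow> f i \<in> T n) \<Longrightarrow> (\<Prod>i\<leftarrow>is. f i) \<in> T n"
  by (induction "is") (auto intro: T_mult)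

lemma T_filt_uminus: "a \<in> T_filt n m \<Longrightarrow> - a \<in> T_filt n m"
  using T_filt_mult[OF T_filt_const[of "- 1" n 0], of a m m] by (simp add: tens_const_uminus)

lemma T_filt_diff: "a \<in> T_filt n m \<Longrightarrow> b \<in> T_filt n m \<Longrightarrow> a - b \<in> T_filt n m"
  using T_filt_add[of a n m "- b"] T_filt_uminus[of b n m] by simp

lemma T_filt_cmult: "a \<in> T_filt n m \<Longrightarrow> tens_const c * a \<in> T_filt n m"
  using T_filt_mult[OF T_filt_const[of c n 0], of a m m] by simp

lemma T_filt_sum: "(\<And>i. i \<in> S \<Longrightarrow> f i \<in> T_filt n m) \<Longrightarrow> sum f S \<in> T_filt n m"
  by (induction S rule: infinite_finite_induct) (auto intro: T_filt_add)

lemma T_filt_prod_list: "(\<And>i. i \<in> set is \<Longrightarrow> f i \<in> T_filt n 1) \<Longrightarrow> (\<Prod>i\<leftarrow>is. f i) \<in> T_filt n (length is)"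
proof (induction "is")
  case Nil
  then show ?case using T_filt_const[of 1 n 0] by simp
next
  case (Cons i "is")
  then show ?case by (auto intro!: T_filt_mult[where i=1])
qed

lemma word_Nil [simp]: "word [] = 1"
  by (simp add: word_def flip: zero_free_monoid_def)

lemma word_append: "word (us @ vs) = word us * word vs"
  by (simp add: word_def mult_single plus_free_monoid_def)

lemma word_Cons: "word (l # ls) = tens_e (fst l) (snd l) * word ls"
  using word_append[of "[l]" ls] by (simp add: word_def tens_e_def)

lemma single_eq_word: "Poly_Mapping.single w c = tens_const c * word (letters w)"
  by (simp add: tens_const_def word_def mult_single zero_free_monoid_def plus_free_monoid_def)

lemma tens_expand: "a = (\<Sum>w\<in>Poly_Mapping.keys a. tens_const (Poly_Mapping.lookup a w) * word (letters w))"
  using poly_mapping_sum_single[of a] by (simp only: single_eq_word)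

lemma T_filt_word: "set ls \<subseteq> {1..n} \<times> {1..n} \<Longrightarrow> length ls \<le> m \<Longrightarrow> word ls \<in> T_filt n m"
  by (auto simp: T_filt_def T_iff word_def)

lemma T_word: "set ls \<subseteq> {1..n} \<times> {1..n} \<Longrightarrow> word ls \<in> T n"
  using T_filt_T[OF T_filt_word] by blast

lemma T_keys: "a \<in> T n \<Longrightarrow> w \<in> Poly_Mapping.keys a \<Longrightarrow> set (letters w) \<subseteq> {1..n} \<times> {1..n}"
  by (simp add: T_iff)

lemma tens_const_commute: "tens_const c * a = a * (tens_const c :: tens)"
proof -
  have *: "tens_const c * (tens_const d * word ls) = tens_const d * word ls * tens_const c" for d ls
    by (simp add: tens_const_def word_def mult_single mult.commute)
  show ?thesis
    by (subst (1 2) tens_expand[of a]) (simp add: sum_distrib_left sum_distrib_right *)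
qed

lemma tens_const_left_commute: "a * (tens_const c * b) = tens_const c * (a * (b :: tens))"
  by (metis mult.assoc tens_const_commute)

lemma tensor_alg_ring: "ring (tensor_alg n)"
proof (intro ringI abelian_groupI monoidI)
  fix x assume "x \<in> T n"
  then show "\<exists>y\<in>T n. y \<oplus>\<^bsub>tensor_alg n\<^esub> x = \<zero>\<^bsub>tensor_alg n\<^esub>"
    by (intro bexI[of _ "- x"]) (auto intro: T_uminus)
qed (auto intro: T_add T_mult simp: algebra_simps)

lemma gl_relations_T: "gl_relations n \<subseteq> T n"
proof
  fix x assume "x \<in> gl_relations n"
  then obtain i j k l where x: "x = tens_e i j * tens_e k l - tens_e k l * tens_e i j
        - ((if j = k then tens_e i l else 0) - (if l = i then tens_e k j else 0))"
    and "{i, j, k, l} \<subseteq> {1..n}" unfolding gl_relations_def by blast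
  then show "x \<in> T n" unfolding x by (intro T_diff T_mult T_e) (auto intro: T_e)
qed

lemma gl_ideal_ideal: "ideal (gl_ideal n) (tensor_alg n)"
  unfolding gl_ideal_def by (rule ring.genideal_ideal[OF tensor_alg_ring gl_relations_T])

text \<open>Stated once for \<open>J n\<close>, for annihilators of vectors and for the maximal left
  ideals used later. Closure under negation comes from multiplication by the constant
  \<open>- 1\<close>.\<close>

definition left_ideal :: "nat \<Rightarrow> tens set \<Rightarrow> bool" where
  "left_ideal n L \<longleftrightarrow> L \<subseteq> T n \<and> 0 \<in> L \<and> (\<forall>a\<in>L. \<forall>b\<in>L. a + b \<in> L) \<and> (\<forall>a\<in>T n. \<forall>b\<in>L. a * b \<in> L)"

lemma left_idealD:
  assumes "left_ideal n L"
  shows "a \<in> L \<Longrightarrow> a \<in> T n" "0 \<in> L" "a \<in> L \<Longrightarrow> b \<in> L \<Longrightarrow> a + b \<in> L" "c \<in> T n \<Longrightarrow> b \<in> L \<Longrightarrow> c * b \<in> L"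
    "a \<in> L \<Longrightarrow> - a \<in> L" "a \<in> L \<Longrightarrow> b \<in> L \<Longrightarrow> a - b \<in> L" "a \<in> L \<Longrightarrow> tens_const d * a \<in> L"
proof -
  have L: "\<And>a. a \<in> L \<Longrightarrow> a \<in> T n" "0 \<in> L" "\<And>a b. a \<in> L \<Longrightarrow> b \<in> L \<Longrightarrow> a + b \<in> L"
    "\<And>c b. c \<in> T n \<Longrightarrow> b \<in> L \<Longrightarrow> c * b \<in> L" using assms unfolding left_ideal_def by blast+
  have u: "- a \<in> L" if "a \<in> L" for a
    using L(4)[OF T_const[of "- 1"] that] by (simp add: tens_const_uminus)
  show "a \<in> L \<Longrightarrow> a \<in> T n" "0 \<in> L" "a \<in> L \<Longrightarrow> b \<in> L \<Longrightarrow> a + b \<in> L" "c \<in> T n \<Longrightarrow> b \<in> L \<Longrightarrow> c * b \<in> L"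
    "a \<in> L \<Longrightarrow> - a \<in> L" "a \<in> L \<Longrightarrow> tens_const d * a \<in> L"
    using L u by auto
  show "a \<in> L \<Longrightarrow> b \<in> L \<Longrightarrow> a - b \<in> L" using L(3)[of a "- b"] u[of b] by simp
qed

lemma left_ideal_sum: "left_ideal n L \<Longrightarrow> (\<And>i. i \<in> S \<Longrightarrow> f i \<in> L) \<Longrightarrow> sum f S \<in> L"
  by (induction S rule: infinite_finite_induct) (auto intro: left_idealD)

abbreviation J :: "nat \<Rightarrow> tens set" where
  "J n \<equiv> gl_ideal n"

lemma J_left_ideal: "left_ideal n (J n)"
proof -
  interpret ideal "J n" "tensor_alg n" by (rule gl_ideal_ideal)
  show ?thesis unfolding left_ideal_def
    using a_subset I_l_closed additive_subgroup.zero_closed[OF is_additive_subgroup]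
      additive_subgroup.a_closed[OF is_additive_subgroup] by auto
qed

lemmas J = left_idealD[OF J_left_ideal] left_ideal_sum[OF J_left_ideal]

lemma J_rmult: "a \<in> J n \<Longrightarrow> b \<in> T n \<Longrightarrow> a * b \<in> J n"
  using ideal.I_r_closed[OF gl_ideal_ideal, of a n b] by simp

lemma J_trans: "a - b \<in> J n \<Longrightarrow> b - c \<in> J n \<Longrightarrow> a - c \<in> J n"
  using J(3)[of "a - b" n "b - c"] by simp

lemma J_sym: "a - b \<in> J n \<Longrightarrow> b - a \<in> J n"
  using J(5)[of "a - b" n] by simp

lemma J_add_cong: "a - b \<in> J n \<Longrightarrow> c - d \<in> J n \<Longrightarrow> (a + c) - (b + d) \<in> J n"
  using J(3)[of "a - b" n "c - d"] by (simp add: algebra_simps)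

lemma gl_relation_J:
  assumes "i \<in> {1..n}" "j \<in> {1..n}" "k \<in> {1..n}" "l \<in> {1..n}"
  shows "tens_e i j * tens_e k l - tens_e k l * tens_e i j
        - ((if j = k then tens_e i l else 0) - (if l = i then tens_e k j else 0)) \<in> J n"
proof -
  have "gl_relations n \<subseteq> J n"
    unfolding gl_ideal_def by (rule ring.genideal_self[OF tensor_alg_ring gl_relations_T])
  then show ?thesis using assms unfolding gl_relations_def by blast
qed

text \<open>An induction principle for \<open>J n\<close>: a property of tensors follows once the
  tensors having it form a two-sided ideal that contains the relations.\<close>

lemma J_minimal:
  assumes "K \<subseteq> T n" "0 \<in> K" "\<And>a b. a \<in> K \<Longrightarrow> b \<in> K \<Longrightarrow> a + b \<in> K"
    "\<And>a b. a \<in> T n \<Longrightarrow> b \<in> K \<Longrightarrow> a * b \<in> K" "\<And>a b. a \<in> T n \<Longrightarrow> b \<in> K \<Longrightarrow> b * a \<in> K"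
    and "gl_relations n \<subseteq> K"
  shows "J n \<subseteq> K"
  unfolding gl_ideal_def
proof (rule ring.genideal_minimal[OF tensor_alg_ring _ assms(6)])
  have um: "- a \<in> K" if "a \<in> K" for a
    using assms(4)[OF T_const[of "- 1"] that] by (simp add: tens_const_uminus)
  have inv: "inv\<^bsub>add_monoid (tensor_alg n)\<^esub> a = - a" if "a \<in> T n" for a
  proof -
    interpret ring "tensor_alg n" by (rule tensor_alg_ring)
    have "\<ominus>\<^bsub>tensor_alg n\<^esub> a = - a"
      using that T_uminus[OF that] by (intro minus_equality) auto
    then show ?thesis by (simp add: a_inv_def)
  qed
  have "subgroup K (add_monoid (tensor_alg n))"
    by (rule subgroup.intro) (use assms um inv in \<open>auto simp: subset_iff\<close>)
  then show "ideal K (tensor_alg n)"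
    by (rule idealI[OF tensor_alg_ring]) (use assms(4,5) in auto)
qed

section \<open>The enveloping algebra as a quotient\<close>

lemma U_proj_eq_iff:
  assumes "a \<in> T n" "b \<in> T n"
  shows "U_proj n a = U_proj n b \<longleftrightarrow> a - b \<in> J n"
proof -
  have eq: "U_proj n a = {h + a |h. h \<in> J n}" for a
    by (auto simp: U_proj_def a_r_coset_def r_coset_def)
  show ?thesis
  proof
    assume "U_proj n a = U_proj n b"
    moreover have "a \<in> U_proj n a" unfolding eq using J(2) by force
    ultimately show "a - b \<in> J n" unfolding eq by auto
  next
    assume *: "a - b \<in> J n"
    have "\<exists>h'. h + a = h' + b \<and> h' \<in> J n" if "h \<in> J n" for h
      using J(3)[OF that *] by (intro exI[of _ "h + (a - b)"]) simp
    moreover have "\<exists>h'. h + b = h' + a \<and> h' \<in> J n" if "h \<in> J n" for h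
      using J(6)[OF that *] by (intro exI[of _ "h - (a - b)"]) simp
    ultimately show "U_proj n a = U_proj n b" unfolding eq by auto
  qed
qed

lemma U_gl_carrier: "carrier (U_gl n) = U_proj n ` T n"
  by (auto simp: U_gl_def ring.defs FactRing_def A_RCOSETS_def' U_proj_def)

lemma U_gl_mult: "a \<in> T n \<Longrightarrow> b \<in> T n \<Longrightarrow> U_proj n a \<otimes>\<^bsub>U_gl n\<^esub> U_proj n b = U_proj n (a * b)"
  using ideal.rcoset_mult_add[OF gl_ideal_ideal, of a n b]
  by (simp add: U_gl_def ring.defs FactRing_def U_proj_def)

lemma U_gl_add: "a \<in> T n \<Longrightarrow> b \<in> T n \<Longrightarrow> U_proj n a \<oplus>\<^bsub>U_gl n\<^esub> U_proj n b = U_proj n (a + b)"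
proof -
  assume ab: "a \<in> T n" "b \<in> T n"
  interpret ideal "J n" "tensor_alg n" by (rule gl_ideal_ideal)
  show ?thesis
    using a_rcos_sum[of a b] ab
    by (simp add: U_gl_def ring.defs FactRing_def U_proj_def)
qed

lemma U_gl_one: "\<one>\<^bsub>U_gl n\<^esub> = U_proj n 1"
  by (simp add: U_gl_def ring.defs FactRing_def U_proj_def)

lemma U_gl_zero: "\<zero>\<^bsub>U_gl n\<^esub> = U_proj n 0"
proof -
  interpret ideal "J n" "tensor_alg n" by (rule gl_ideal_ideal)
  show ?thesis
    using a_coset_add_zero[OF a_subset] by (simp add: U_gl_def ring.defs FactRing_def U_proj_def)
qed

lemma U_gl_smult: "a \<in> T n \<Longrightarrow> c \<odot>\<^bsub>U_gl n\<^esub> U_proj n a = U_proj n (tens_const c * a)"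
  using U_gl_mult[OF T_const, of a n c] by (simp add: U_gl_def ring.defs)

lemma U_filt_eq: "U_filt n m = U_proj n ` T_filt n m"
  by (simp add: U_filt_def T_filt_def)

text \<open>Centrality of the class of \<open>a\<close>, stated on the lift: a class has no words,
  whereas a lift has a length and a symbol.\<close>

definition central_mod :: "nat \<Rightarrow> tens \<Rightarrow> bool" where
  "central_mod n a \<longleftrightarrow> a \<in> T n \<and> (\<forall>b\<in>T n. a * b - b * a \<in> J n)"

lemma zeta_simps [simp]:
  "mult (zeta n) = mult (U_gl n)" "add (zeta n) = add (U_gl n)" "zero (zeta n) = zero (U_gl n)"
  "one (zeta n) = one (U_gl n)" "module.smult (zeta n) = module.smult (U_gl n)"
  by (simp_all add: zeta_def)

lemma zeta_filt_simps [simp]: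
  "mult (zeta_filt n m) = mult (U_gl n)" "add (zeta_filt n m) = add (U_gl n)" "zero (zeta_filt n m) = zero (U_gl n)"
  "one (zeta_filt n m) = one (U_gl n)" "module.smult (zeta_filt n m) = module.smult (U_gl n)"
  by (simp_all add: zeta_filt_def)

lemma U_proj_in_zeta_iff: "a \<in> T n \<Longrightarrow> U_proj n a \<in> carrier (zeta n) \<longleftrightarrow> central_mod n a"
  by (auto simp: zeta_def U_gl_carrier U_gl_mult central_mod_def U_proj_eq_iff T_mult)

lemma zeta_carrier: "carrier (zeta n) = U_proj n ` {a. central_mod n a}"
proof -
  have "carrier (zeta n) \<subseteq> U_proj n ` T n" by (auto simp: zeta_def U_gl_carrier)
  moreover have "{a. central_mod n a} \<subseteq> T n" by (auto simp: central_mod_def)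
  ultimately show ?thesis using U_proj_in_zeta_iff[of _ n] by (auto 4 3)
qed

text \<open>One lift witnesses both the filtration and the centrality, since centrality depends only
  on the class.\<close>

lemma zeta_filt_carrier: "carrier (zeta_filt n m) = U_proj n ` {a \<in> T_filt n m. central_mod n a}"
proof -
  have "carrier (zeta_filt n m) = carrier (zeta n) \<inter> U_proj n ` T_filt n m"
    by (simp add: zeta_filt_def U_filt_eq)
  also have "\<dots> = U_proj n ` {a \<in> T_filt n m. central_mod n a}"
  proof (rule subset_antisym; rule subsetI)
    fix z assume "z \<in> carrier (zeta n) \<inter> U_proj n ` T_filt n m"
    then obtain a where "a \<in> T_filt n m" "z = U_proj n a" "U_proj n a \<in> carrier (zeta n)" by blast
    then show "z \<in> U_proj n ` {a \<in> T_filt n m. central_mod n a}"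
      using U_proj_in_zeta_iff[OF T_filt_T, of a n m] by blast
  next
    fix z assume "z \<in> U_proj n ` {a \<in> T_filt n m. central_mod n a}"
    then obtain a where "a \<in> T_filt n m" "z = U_proj n a" "central_mod n a" by blast
    then show "z \<in> carrier (zeta n) \<inter> U_proj n ` T_filt n m"
      using U_proj_in_zeta_iff[OF T_filt_T, of a n m] by blast
  qed
  finally show ?thesis .
qed

text \<open>Commuting with \<open>a\<close> modulo \<open>J n\<close> passes from letters to words
  by the Leibniz rule and to tensors by linearity.\<close>

lemma central_modI:
  assumes "a \<in> T n" "\<And>i j. i \<in> {1..n} \<Longrightarrow> j \<in> {1..n} \<Longrightarrow> a * tens_e i j - tens_e i j * a \<in> J n"
  shows "central_mod n a"
proof -
  have w: "a * word ls - word ls * a \<in> J n" if "set ls \<subseteq> {1..n} \<times> {1..n}" for ls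
    using that
  proof (induction ls)
    case Nil
    then show ?case using J(2) by simp
  next
    case (Cons l ls)
    let ?e = "tens_e (fst l) (snd l)"
    have l: "fst l \<in> {1..n}" "snd l \<in> {1..n}" using Cons(2) by auto
    have "(a * ?e - ?e * a) * word ls + ?e * (a * word ls - word ls * a) \<in> J n"
      using Cons l by (intro J(3) J_rmult J(4) assms(2) T_e T_word) auto
    then show ?case by (simp add: word_Cons algebra_simps)
  qed
  have "a * b - b * a \<in> J n" if b: "b \<in> T n" for b
  proof -
    have "a * b - b * a = (\<Sum>w\<in>Poly_Mapping.keys b. tens_const (Poly_Mapping.lookup b w) *
       (a * word (letters w) - word (letters w) * a))"
      by (subst (1 2) tens_expand[of b])
        (simp add: sum_distrib_left sum_distrib_right right_diff_distrib sum_subtractf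
          tens_const_left_commute mult.assoc)
    also have "\<dots> \<in> J n" by (intro J(8) J(7) w T_keys[OF b])
    finally show ?thesis .
  qed
  then show ?thesis using assms(1) by (simp add: central_mod_def)
qed

lemma central_mod_const: "central_mod n (tens_const c)"
  by (simp add: central_mod_def tens_const_commute J(2))

lemma central_mod_add: "central_mod n a \<Longrightarrow> central_mod n b \<Longrightarrow> central_mod n (a + b)"
  using J_add_cong[of "a * c" "c * a" n "b * c" "c * b" for c] T_add[of a n b]
  by (simp add: central_mod_def distrib_left distrib_right)

lemma central_mod_mult:
  assumes "central_mod n a" "central_mod n b"
  shows "central_mod n (a * b)"
proof -
  have T: "a \<in> T n" "b \<in> T n" using assms by (auto simp: central_mod_def)
  have "a * b * c - c * (a * b) \<in> J n" if c: "c \<in> T n" for c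
  proof -
    have "a * (b * c - c * b) + (a * c - c * a) * b \<in> J n"
      using assms T c by (intro J(3) J(4) J_rmult) (auto simp: central_mod_def)
    then show ?thesis by (simp add: algebra_simps)
  qed
  then show ?thesis using T by (simp add: central_mod_def T_mult)
qed

lemma central_mod_cong: "central_mod n a \<Longrightarrow> b \<in> T n \<Longrightarrow> a - b \<in> J n \<Longrightarrow> central_mod n b"
  using U_proj_in_zeta_iff[of a n] U_proj_in_zeta_iff[of b n] U_proj_eq_iff[of a n b]
  by (auto simp: central_mod_def)

lemma central_mod_diff: "central_mod n a \<Longrightarrow> central_mod n b \<Longrightarrow> central_mod n (a - b)"
  using central_mod_add[of n a "tens_const (- 1) * b"] central_mod_mult[OF central_mod_const[of n "- 1"], of b]
  by (simp add: tens_const_uminus)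

section \<open>The action on polynomial functions of matrices\<close>

text \<open>The letter \<open>e\<^sub>i\<^sub>j\<close> acts as the vector field \<open>\<Sum>\<^sub>l x\<^sub>i\<^sub>l \<partial>/\<partial>x\<^sub>j\<^sub>l\<close>.\<close>

definition row_op :: "nat \<Rightarrow> nat \<Rightarrow> complex \<Rightarrow> (nat \<times> nat \<Rightarrow> complex) \<Rightarrow> nat \<times> nat \<Rightarrow> complex" where
  "row_op i j s x = (\<lambda>p. x p + (if fst p = j then s * x (i, snd p) else 0))"

text \<open>With the derivative at \<open>s = 0\<close> along \<open>row_op\<close>, linearity and
  the product rule are inherited from calculus. For polynomial functions the value exists by
  \<open>vf_has_derivative\<close>.\<close>

definition vf :: "nat \<Rightarrow> nat \<Rightarrow> ((nat \<times> nat \<Rightarrow> complex) \<Rightarrow> complex) \<Rightarrow> (nat \<times> nat \<Rightarrow> complex) \<Rightarrow> complex" where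
  "vf i j f x = (THE D. ((\<lambda>s. f (row_op i j s x)) has_field_derivative D) (at 0))"

definition poly_fun :: "(('v \<Rightarrow> complex) \<Rightarrow> complex) \<Rightarrow> bool" where
  "poly_fun f \<longleftrightarrow> (\<exists>m. polyfn UNIV m f)"

lemma poly_fun_const: "poly_fun (\<lambda>x. c)" and poly_fun_var: "poly_fun (\<lambda>x. x i)"
  unfolding poly_fun_def by (auto intro: polyfn.const polyfn_var)

lemma poly_fun_add: "poly_fun f \<Longrightarrow> poly_fun g \<Longrightarrow> poly_fun (\<lambda>x. f x + g x)"
proof -
  assume "poly_fun f" "poly_fun g"
  then obtain i j where "polyfn UNIV i f" "polyfn UNIV j g" unfolding poly_fun_def by blast
  then have "polyfn UNIV (max i j) (\<lambda>x. f x + g x)" by (intro polyfn.add) (auto elim: polyfn_mono)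
  then show ?thesis unfolding poly_fun_def by blast
qed

lemma poly_fun_mult: "poly_fun f \<Longrightarrow> poly_fun g \<Longrightarrow> poly_fun (\<lambda>x. f x * g x)"
proof -
  assume "poly_fun f" "poly_fun g"
  then obtain i j where "polyfn UNIV i f" "polyfn UNIV j g" unfolding poly_fun_def by blast
  then have "polyfn UNIV (i + j) (\<lambda>x. f x * g x)" by (rule polyfn.mult) simp
  then show ?thesis unfolding poly_fun_def by blast
qed

lemma poly_fun_induct [consumes 1, case_names const var add mult]:
  assumes "poly_fun f" "\<And>c. P (\<lambda>x. c)" "\<And>i. P (\<lambda>x. x i)"
    "\<And>f g. poly_fun f \<Longrightarrow> P f \<Longrightarrow> poly_fun g \<Longrightarrow> P g \<Longrightarrow> P (\<lambda>x. f x + g x)"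
    "\<And>f g. poly_fun f \<Longrightarrow> P f \<Longrightarrow> poly_fun g \<Longrightarrow> P g \<Longrightarrow> P (\<lambda>x. f x * g x)"
  shows "P f"
proof -
  obtain m where "polyfn UNIV m f" using assms(1) unfolding poly_fun_def by blast
  then show ?thesis
  proof (induction rule: polyfn.induct)
    case (add m f g)
    then show ?case using assms(4)[of f g] unfolding poly_fun_def by blast
  next
    case (mult i f j g m)
    then show ?case using assms(5)[of f g] unfolding poly_fun_def by blast
  qed (rule assms)+
qed

lemma poly_fun_sum: "(\<And>i. i \<in> S \<Longrightarrow> poly_fun (f i)) \<Longrightarrow> poly_fun (\<lambda>x. \<Sum>i\<in>S. f i x)"
  by (induction S rule: infinite_finite_induct) (auto intro: poly_fun_const poly_fun_add)

lemma poly_fun_power: "poly_fun f \<Longrightarrow> poly_fun (\<lambda>x. f x ^ k)"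
  by (induction k) (auto intro: poly_fun_const poly_fun_mult)

lemma poly_fun_prod_list: "(\<And>i. i \<in> set is \<Longrightarrow> poly_fun (f i)) \<Longrightarrow> poly_fun (\<lambda>x. \<Prod>i\<leftarrow>is. f i x)"
  by (induction "is") (auto intro: poly_fun_const poly_fun_mult)

lemma row_op_0 [simp]: "row_op i j 0 x = x"
  by (simp add: row_op_def fun_eq_iff)

lemma vf_eqI:
  "((\<lambda>s. f (row_op i j s x)) has_field_derivative c) (at 0) \<Longrightarrow> vf i j f x = c"
  unfolding vf_def by (rule the_equality) (auto intro: DERIV_unique)

lemma vf_has_derivative:
  assumes "poly_fun f"
  shows "((\<lambda>s. f (row_op i j s x)) has_field_derivative vf i j f x) (at 0)"
proof -
  obtain m where f: "polyfn UNIV m f" using assms by (auto simp: poly_fun_def)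
  have "\<exists>q. \<forall>s. row_op i j s x p = poly q s" for p
    by (rule exI[of _ "[:x p, if fst p = j then x (i, snd p) else 0:]"]) (simp add: row_op_def)
  then obtain q where q: "\<And>s. f (\<lambda>p. row_op i j s x p) = poly q s"
    using polyfn_along_curve[OF f, of "\<lambda>p s. row_op i j s x p"] by blast
  then have "(\<lambda>s. f (row_op i j s x)) = poly q" by simp
  then have "((\<lambda>s. f (row_op i j s x)) has_field_derivative poly (pderiv q) 0) (at 0)"
    by (simp add: poly_DERIV)
  then show ?thesis using vf_eqI[of f i j x] by simp
qed

lemma vf_const [simp]: "vf i j (\<lambda>x. c) = (\<lambda>x. 0)"
  by (rule ext, rule vf_eqI) simp

lemma vf_var: "vf i j (\<lambda>x. x p) = (\<lambda>x. if fst p = j then x (i, snd p) else 0)"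
proof (rule ext, rule vf_eqI)
  fix x
  show "((\<lambda>s. row_op i j s x p) has_field_derivative (if fst p = j then x (i, snd p) else 0)) (at 0)"
    unfolding row_op_def by (auto intro!: derivative_eq_intros)
qed

lemma vf_add: "poly_fun f \<Longrightarrow> poly_fun g \<Longrightarrow> vf i j (\<lambda>x. f x + g x) = (\<lambda>x. vf i j f x + vf i j g x)"
  by (rule ext, rule vf_eqI) (auto intro!: derivative_eq_intros vf_has_derivative)

lemma vf_mult: "poly_fun f \<Longrightarrow> poly_fun g \<Longrightarrow> vf i j (\<lambda>x. f x * g x) = (\<lambda>x. vf i j f x * g x + f x * vf i j g x)"
proof (rule ext, rule vf_eqI)
  fix x assume "poly_fun f" "poly_fun g"
  from DERIV_mult[OF vf_has_derivative[OF this(1), of i j x] vf_has_derivative[OF this(2), of i j x]]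
  show "((\<lambda>s. f (row_op i j s x) * g (row_op i j s x)) has_field_derivative
      vf i j f x * g x + f x * vf i j g x) (at 0)" by (simp add: mult.commute add.commute)
qed

lemma vf_cmult: "poly_fun f \<Longrightarrow> vf i j (\<lambda>x. c * f x) = (\<lambda>x. c * vf i j f x)"
  using vf_mult[OF poly_fun_const, of f i j c] by simp

lemma vf_sum: "(\<And>k. k \<in> S \<Longrightarrow> poly_fun (f k)) \<Longrightarrow> vf i j (\<lambda>x. \<Sum>k\<in>S. f k x) = (\<lambda>x. \<Sum>k\<in>S. vf i j (f k) x)"
  by (induction S rule: infinite_finite_induct) (auto simp: vf_add poly_fun_sum)

lemma poly_fun_vf: "poly_fun f \<Longrightarrow> poly_fun (vf i j f)"
proof (induction rule: poly_fun_induct)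
  case (var p)
  show ?case unfolding vf_var by (cases "fst p = j") (auto intro: poly_fun_const poly_fun_var)
qed (auto simp: vf_add vf_mult intro: poly_fun_const poly_fun_add poly_fun_mult)

text \<open>A commutator of two derivations is a derivation, so both sides obey the same sum and
  product rules and agree once they agree on coordinates.\<close>

lemma vf_commutator:
  "poly_fun f \<Longrightarrow> vf i j (vf k l f) x - vf k l (vf i j f) x =
    (if j = k then vf i l f x else 0) - (if l = i then vf k j f x else 0)"
proof (induction rule: poly_fun_induct)
  case (const c)
  then show ?case by simp
next
  case (var p)
  have "vf a b (\<lambda>x. if fst p = c then x (d, snd p) else 0) x =
      (if fst p = c \<and> d = b then x (a, snd p) else 0)" for a b c d
    by (cases "fst p = c") (auto simp: vf_var)
  then show ?case by (simp add: vf_var)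
next
  case (add f g)
  have "vf i j (vf k l (\<lambda>x. f x + g x)) x - vf k l (vf i j (\<lambda>x. f x + g x)) x =
    (vf i j (vf k l f) x - vf k l (vf i j f) x) + (vf i j (vf k l g) x - vf k l (vf i j g) x)"
    using add by (simp add: vf_add poly_fun_vf algebra_simps)
  also have "\<dots> = (if j = k then vf i l (\<lambda>x. f x + g x) x else 0) - (if l = i then vf k j (\<lambda>x. f x + g x) x else 0)"
    unfolding add(3,4) vf_add[OF add(1,2)] by (auto simp: algebra_simps)
  finally show ?case .
next
  case (mult f g)
  have "vf i j (vf k l (\<lambda>x. f x * g x)) x - vf k l (vf i j (\<lambda>x. f x * g x)) x =
    (vf i j (vf k l f) x - vf k l (vf i j f) x) * g x + f x * (vf i j (vf k l g) x - vf k l (vf i j g) x)"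
    using mult by (simp add: vf_add vf_mult poly_fun_vf poly_fun_mult algebra_simps)
  also have "\<dots> = (if j = k then vf i l (\<lambda>x. f x * g x) x else 0) - (if l = i then vf k j (\<lambda>x. f x * g x) x else 0)"
    unfolding mult(3,4) vf_mult[OF mult(1,2)] by (auto simp: algebra_simps)
  finally show ?case .
qed

primrec act_word :: "(nat \<times> nat) list \<Rightarrow> ((nat \<times> nat \<Rightarrow> complex) \<Rightarrow> complex) \<Rightarrow> (nat \<times> nat \<Rightarrow> complex) \<Rightarrow> complex" where
  "act_word [] f = f"
| "act_word (l # ls) f = vf (fst l) (snd l) (act_word ls f)"

definition act :: "tens \<Rightarrow> ((nat \<times> nat \<Rightarrow> complex) \<Rightarrow> complex) \<Rightarrow> (nat \<times> nat \<Rightarrow> complex) \<Rightarrow> complex" where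
  "act a f x = lin_ext (\<lambda>w. act_word (letters w) f x) a"

lemma poly_fun_act_word: "poly_fun f \<Longrightarrow> poly_fun (act_word ls f)"
  by (induction ls) (auto intro: poly_fun_vf)

lemma act_word_append: "act_word (us @ vs) f = act_word us (act_word vs f)"
  by (induction us) auto

lemma act_word_lincomb:
  "(\<And>k. k \<in> S \<Longrightarrow> poly_fun (f k)) \<Longrightarrow>
    act_word ls (\<lambda>x. \<Sum>k\<in>S. c k * f k x) = (\<lambda>x. \<Sum>k\<in>S. c k * act_word ls (f k) x)"
proof (induction ls)
  case (Cons l ls)
  then show ?case
    by (simp add: vf_sum vf_cmult poly_fun_act_word poly_fun_mult[OF poly_fun_const])
qed simp

lemma poly_fun_act: "poly_fun f \<Longrightarrow> poly_fun (act a f)"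
  unfolding act_def[abs_def] lin_ext_def
  by (intro poly_fun_sum poly_fun_mult[OF poly_fun_const] poly_fun_act_word)

lemma act_add: "act (a + b) f x = act a f x + act b f x"
  and act_diff: "act (a - b) f x = act a f x - act b f x"
  and act_0 [simp]: "act 0 f x = 0"
  by (simp_all add: act_def)

lemma act_1 [simp]: "act 1 f = f"
proof
  fix x
  have "act (Poly_Mapping.single 0 1) f x = f x" unfolding act_def by (simp only: lin_ext_single) simp
  then show "act 1 f x = f x" by simp
qed

lemma act_const: "act (tens_const c) f x = c * f x"
  by (simp add: act_def tens_const_def)

lemma act_e: "act (tens_e i j) f x = vf i j f x"
  by (simp add: act_def tens_e_def)

lemma act_mult:
  assumes "poly_fun f"
  shows "act (a * b) f = act a (act b f)"
proof
  fix x
  have *: "act_word ls (act b f) x =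
    (\<Sum>v\<in>Poly_Mapping.keys b. Poly_Mapping.lookup b v * act_word (ls @ letters v) f x)" for ls
    unfolding act_def[abs_def] lin_ext_def
    by (subst act_word_lincomb) (auto intro: poly_fun_act_word assms simp: act_word_append)
  have "act (a * b) f x = (\<Sum>u\<in>Poly_Mapping.keys a. \<Sum>v\<in>Poly_Mapping.keys b.
    Poly_Mapping.lookup a u * Poly_Mapping.lookup b v * act_word (letters u @ letters v) f x)"
    unfolding act_def lin_ext_mult_sum by simp
  also have "\<dots> = (\<Sum>u\<in>Poly_Mapping.keys a. Poly_Mapping.lookup a u * act_word (letters u) (act b f) x)"
    unfolding * by (simp add: sum_distrib_left mult.assoc)
  finally show "act (a * b) f x = act a (act b f) x"
    unfolding act_def[of a "act b f"] lin_ext_def .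
qed

lemma act_zero_fun: "act a (\<lambda>x. 0) x = 0"
  using act_word_lincomb[of "{}" undefined _ undefined] by (simp add: act_def lin_ext_def)

text \<open>The tensors that kill every polynomial function form a two-sided ideal. Closure under
  right factors is the reason for testing all functions at once, since \<open>act a f\<close> is
  again one of them.\<close>

lemma J_acts_zero:
  assumes "a \<in> J n" "poly_fun f"
  shows "act a f x = 0"
proof -
  define K where "K = {a \<in> T n. \<forall>f. poly_fun f \<longrightarrow> (\<forall>x. act a f x = 0)}"
  have "J n \<subseteq> K"
  proof (rule J_minimal)
    show "gl_relations n \<subseteq> K"
    proof
      fix r assume r: "r \<in> gl_relations n"
      then obtain i j k l where r': "r = tens_e i j * tens_e k l - tens_e k l * tens_e i j
        - ((if j = k then tens_e i l else 0) - (if l = i then tens_e k j else 0))"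
        unfolding gl_relations_def by blast
      have "act r f x = 0" if "poly_fun f" for f x
      proof -
        have e: "act (tens_e a b) f = vf a b f" for a b f using act_e by blast
        have *: "act (if j = k then tens_e i l else 0) f x = (if j = k then vf i l f x else 0)"
          "act (if l = i then tens_e k j else 0) f x = (if l = i then vf k j f x else 0)" by (auto simp: e)
        show ?thesis
          unfolding r' act_diff act_mult[OF that] e * using vf_commutator[OF that, of i j k l x] by simp
      qed
      then show "r \<in> K" using r gl_relations_T by (auto simp: K_def)
    qed
  next
    fix a b assume ab: "a \<in> T n" "b \<in> K"
    have z: "act b f = (\<lambda>x. 0)" if "poly_fun f" for f using ab(2) that by (auto simp: K_def)
    show "a * b \<in> K" using ab T_mult by (auto simp: K_def act_mult z act_zero_fun)
    show "b * a \<in> K" using ab T_mult by (auto simp: K_def act_mult poly_fun_act)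
  qed (auto simp: K_def act_add T_add)
  then show ?thesis using assms by (auto simp: K_def)
qed

section \<open>Symbols\<close>

text \<open>The degree \<open>m\<close> component of a tensor read commutatively, with the letter
  \<open>(i, j)\<close> as the coordinate \<open>A (i, j)\<close>: its image in the symmetric
  algebra, as a polynomial function on matrices.\<close>

definition symb :: "nat \<Rightarrow> (nat \<times> nat \<Rightarrow> complex) \<Rightarrow> tens \<Rightarrow> complex" where
  "symb m A = lin_ext (\<lambda>w. if length (letters w) = m then \<Prod>l\<leftarrow>letters w. A l else 0)"

lemma symb_add: "symb m A (a + b) = symb m A a + symb m A b"
  and symb_diff: "symb m A (a - b) = symb m A a - symb m A b"
  and symb_0 [simp]: "symb m A 0 = 0"
  by (simp_all add: symb_def)

lemma symb_sum: "symb m A (sum f S) = (\<Sum>i\<in>S. symb m A (f i))"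
  by (simp add: symb_def lin_ext_sum)

lemma symb_zero_if_low:
  assumes "a \<in> T_filt n k" "k < m"
  shows "symb m A a = 0"
proof -
  have "symb m A a = lin_ext (\<lambda>w. 0) a"
    unfolding symb_def using T_filt_keys[OF assms(1)] assms(2) by (intro lin_ext_cong) force
  then show ?thesis by (simp add: lin_ext_def)
qed

text \<open>Under the two length bounds a word of length \<open>i + j\<close> in the product can
  only come from words of full lengths \<open>i\<close> and \<open>j\<close>.\<close>

lemma symb_mult:
  assumes "a \<in> T_filt n i" "b \<in> T_filt n j"
  shows "symb (i + j) A (a * b) = symb i A a * symb j A b"
  unfolding symb_def
proof (rule lin_ext_mult)
  fix u v assume "u \<in> Poly_Mapping.keys a" "v \<in> Poly_Mapping.keys b"
  then have "length (letters u) \<le> i" "length (letters v) \<le> j"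
    using assms T_filt_keys by blast+
  then show "(if length (letters (u + v)) = i + j then \<Prod>l\<leftarrow>letters (u + v). A l else 0) =
    (if length (letters u) = i then \<Prod>l\<leftarrow>letters u. A l else 0) *
    (if length (letters v) = j then \<Prod>l\<leftarrow>letters v. A l else 0)" by auto
qed

lemma symb_const: "symb m A (tens_const c) = (if m = 0 then c else 0)"
  by (simp add: symb_def tens_const_def)

lemma symb_e: "symb m A (tens_e i j) = (if m = 1 then A (i, j) else 0)"
  by (simp add: symb_def tens_e_def)

lemma symb_word: "symb m A (word ls) = (if length ls = m then \<Prod>l\<leftarrow>ls. A l else 0)"
  by (simp add: symb_def word_def)

lemma symb_cmult: "symb m A (tens_const c * a) = c * symb m A a"
proof -
  have "symb m A (tens_const c * a) = lin_ext (\<lambda>w. 1) (tens_const c) * symb m A a"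
    unfolding symb_def
  proof (rule lin_ext_mult)
    fix u v assume "u \<in> Poly_Mapping.keys (tens_const c)"
    then have "u = 0" by (auto simp: tens_const_def split: if_splits)
    then show "(if length (letters (u + v)) = m then \<Prod>l\<leftarrow>letters (u + v). A l else 0) =
      1 * (if length (letters v) = m then \<Prod>l\<leftarrow>letters v. A l else 0)" by simp
  qed
  then show ?thesis by (simp add: tens_const_def)
qed

text \<open>Powers of the linear form with matrix \<open>B\<close>, centred at the identity matrix: a word of length
  \<open>m\<close> has to hit every factor of the \<open>m\<close>-th power to survive evaluation at the identity.\<close>

definition lin_form :: "nat \<Rightarrow> (nat \<times> nat \<Rightarrow> complex) \<Rightarrow> (nat \<times> nat \<Rightarrow> complex) \<Rightarrow> complex" where
  "lin_form n B x = (\<Sum>p\<in>{1..n}\<times>{1..n}. B p * (x p - (if fst p = snd p then 1 else 0)))"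

definition id_mat :: "nat \<times> nat \<Rightarrow> complex" where
  "id_mat p = (if fst p = snd p then 1 else 0)"

lemma poly_fun_lin_form: "poly_fun (lin_form n B)"
proof -
  have "poly_fun (\<lambda>x. \<Sum>p\<in>{1..n}\<times>{1..n}. B p * (x p + - (if fst p = snd p then 1 else 0)))"
    by (intro poly_fun_sum poly_fun_mult[OF poly_fun_const] poly_fun_add poly_fun_const poly_fun_var)
  then show ?thesis by (simp add: lin_form_def[abs_def])
qed

lemma lin_form_id [simp]: "lin_form n B id_mat = 0"
  by (simp add: lin_form_def id_mat_def)

lemma vf_lin_form_id:
  assumes "i \<in> {1..n}" "j \<in> {1..n}"
  shows "vf i j (lin_form n B) id_mat = B (j, i)"
proof -
  have "lin_form n B = (\<lambda>x. \<Sum>p\<in>{1..n}\<times>{1..n}. B p * (x p + - (if fst p = snd p then 1 else 0)))"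
    by (simp add: lin_form_def[abs_def])
  then have "vf i j (lin_form n B) id_mat = (\<Sum>p\<in>{1..n}\<times>{1..n}. B p * vf i j (\<lambda>x. x p) id_mat)"
    by (simp only: vf_sum vf_cmult vf_add poly_fun_mult[OF poly_fun_const] poly_fun_add poly_fun_const poly_fun_var vf_const) simp
  also have "\<dots> = (\<Sum>p\<in>{1..n}\<times>{1..n}. if p = (j, i) then B p else 0)"
    by (intro sum.cong refl) (auto simp: vf_var id_mat_def)
  also have "\<dots> = B (j, i)" using assms by (simp add: sum.delta)
  finally show ?thesis .
qed

text \<open>The divided power absorbs the factorials: a derivation sends the power
  \<open>Suc r\<close> to the power \<open>r\<close> times the derivative of
  \<open>lin_form\<close>.\<close>

definition divpow :: "nat \<Rightarrow> (nat \<times> nat \<Rightarrow> complex) \<Rightarrow> nat \<Rightarrow> (nat \<times> nat \<Rightarrow> complex) \<Rightarrow> complex" where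
  "divpow n B r x = lin_form n B x ^ r / fact r"

lemma poly_fun_divpow: "poly_fun (divpow n B r)"
  using poly_fun_mult[OF poly_fun_const poly_fun_power[OF poly_fun_lin_form], of "1 / fact r" n B r]
  by (simp add: divpow_def[abs_def])

lemma divpow_Suc: "divpow n B (Suc r) = (\<lambda>x. (1 / of_nat (Suc r)) * (lin_form n B x * divpow n B r x))"
  by (simp add: divpow_def fun_eq_iff field_simps)

lemma vf_divpow_Suc: "vf i j (divpow n B (Suc r)) = (\<lambda>x. divpow n B r x * vf i j (lin_form n B) x)"
proof (induction r)
  case 0
  have "divpow n B (Suc 0) = lin_form n B" by (simp add: divpow_def fun_eq_iff)
  moreover have "divpow n B 0 = (\<lambda>x. 1)" by (simp add: divpow_def fun_eq_iff)
  ultimately show ?case by simp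
next
  case (Suc r)
  have "vf i j (divpow n B (Suc (Suc r))) =
    (\<lambda>x. (1 / of_nat (Suc (Suc r))) * (vf i j (lin_form n B) x * divpow n B (Suc r) x +
       lin_form n B x * vf i j (divpow n B (Suc r)) x))"
    by (subst divpow_Suc) (simp only: vf_cmult poly_fun_mult poly_fun_lin_form poly_fun_divpow vf_mult)
  also have "\<dots> = (\<lambda>x. (1 / of_nat (Suc (Suc r))) * (vf i j (lin_form n B) x * divpow n B (Suc r) x +
       lin_form n B x * (divpow n B r x * vf i j (lin_form n B) x)))" unfolding Suc ..
  also have "\<dots> = (\<lambda>x. divpow n B (Suc r) x * vf i j (lin_form n B) x)"
  proof
    fix x
    have 1: "lin_form n B x * divpow n B r x = of_nat (Suc r) * divpow n B (Suc r) x"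
      unfolding divpow_Suc by (simp del: of_nat_Suc)
    have "(1 / of_nat (Suc (Suc r))) * (vf i j (lin_form n B) x * divpow n B (Suc r) x +
       lin_form n B x * (divpow n B r x * vf i j (lin_form n B) x)) =
       (1 / of_nat (Suc (Suc r))) * (vf i j (lin_form n B) x * (divpow n B (Suc r) x + lin_form n B x * divpow n B r x))"
      by (simp add: algebra_simps)
    also have "\<dots> = (1 / of_nat (Suc (Suc r))) * (vf i j (lin_form n B) x * (of_nat (Suc (Suc r)) * divpow n B (Suc r) x))"
      unfolding 1 by (simp add: algebra_simps)
    also have "\<dots> = divpow n B (Suc r) x * vf i j (lin_form n B) x" by (simp del: of_nat_Suc)
    finally show "(1 / of_nat (Suc (Suc r))) * (vf i j (lin_form n B) x * divpow n B (Suc r) x +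
       lin_form n B x * (divpow n B r x * vf i j (lin_form n B) x)) = divpow n B (Suc r) x * vf i j (lin_form n B) x" .
  qed
  finally show ?case .
qed

text \<open>Each letter lowers the exponent by one and contributes its derivative of
  \<open>lin_form\<close>. When it differentiates a factor produced earlier instead, the power stays
  higher by one; such terms carry an extra \<open>lin_form\<close> and are gathered in
  \<open>p\<close>.\<close>

lemma act_word_divpow:
  assumes "length ls \<le> m"
  shows "\<exists>p. poly_fun p \<and> act_word ls (divpow n B m) =
    (\<lambda>x. divpow n B (m - length ls) x * ((\<Prod>l\<leftarrow>ls. vf (fst l) (snd l) (lin_form n B) x) + lin_form n B x * p x))"
  using assms
proof (induction ls)
  case Nil
  show ?case by (rule exI[of _ "\<lambda>x. 0"]) (auto intro: poly_fun_const)
next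
  case (Cons l ls)
  define c where "c = (\<lambda>x. \<Prod>l\<leftarrow>ls. vf (fst l) (snd l) (lin_form n B) x)"
  have c: "poly_fun c" unfolding c_def by (intro poly_fun_prod_list poly_fun_vf poly_fun_lin_form)
  obtain r where r: "m - length ls = Suc r" "m - length (l # ls) = r"
    using Cons(2) by (metis Suc_diff_Suc Suc_le_eq length_Cons)
  obtain p where p: "poly_fun p" "act_word ls (divpow n B m) =
      (\<lambda>x. divpow n B (Suc r) x * (c x + lin_form n B x * p x))"
    using Cons r(1) by (auto simp: c_def)
  let ?L = "lin_form n B" let ?v = "vf (fst l) (snd l)"
  define q where "q = (\<lambda>x. ?v ?L x * p x + (1 / of_nat (Suc r)) * (?v c x + (?v ?L x * p x + ?L x * ?v p x)))"
  have "poly_fun q" unfolding q_def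
    by (intro poly_fun_add poly_fun_mult poly_fun_const poly_fun_vf poly_fun_lin_form c p(1))
  moreover have "act_word (l # ls) (divpow n B m) =
    (\<lambda>x. divpow n B r x * ((\<Prod>l\<leftarrow>l # ls. vf (fst l) (snd l) (lin_form n B) x) + ?L x * q x))"
  proof
    fix x
    have "act_word (l # ls) (divpow n B m) x = ?v (\<lambda>x. divpow n B (Suc r) x * (c x + ?L x * p x)) x"
      by (simp add: p(2))
    also have "\<dots> = divpow n B r x * ?v ?L x * (c x + ?L x * p x) +
        divpow n B (Suc r) x * (?v c x + (?v ?L x * p x + ?L x * ?v p x))"
      by (simp only: vf_mult vf_add poly_fun_add poly_fun_mult poly_fun_divpow poly_fun_lin_form c p(1) vf_divpow_Suc)
    also have "\<dots> = divpow n B r x * (?v ?L x * c x + ?L x * q x)"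
      unfolding q_def divpow_Suc by (simp add: algebra_simps)
    finally show "act_word (l # ls) (divpow n B m) x =
      divpow n B r x * ((\<Prod>l\<leftarrow>l # ls. vf (fst l) (snd l) (lin_form n B) x) + ?L x * q x)" by (simp add: c_def)
  qed
  ultimately show ?case unfolding r(2) by blast
qed

text \<open>\<open>lin_form\<close> vanishes at the identity, which kills the error term and every
  positive power left over. The indices come out transposed because at the identity
  \<open>vf i j\<close> is the partial derivative by the entry \<open>(j, i)\<close>.\<close>

lemma act_word_divpow_id:
  assumes "length ls \<le> m" "set ls \<subseteq> {1..n} \<times> {1..n}"
  shows "act_word ls (divpow n B m) id_mat =
    (if length ls = m then \<Prod>l\<leftarrow>ls. B (snd l, fst l) else 0)"
proof -
  obtain p where "act_word ls (divpow n B m) =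
    (\<lambda>x. divpow n B (m - length ls) x * ((\<Prod>l\<leftarrow>ls. vf (fst l) (snd l) (lin_form n B) x) + lin_form n B x * p x))"
    using act_word_divpow[OF assms(1)] by blast
  moreover have "(\<Prod>l\<leftarrow>ls. vf (fst l) (snd l) (lin_form n B) id_mat) = (\<Prod>l\<leftarrow>ls. B (snd l, fst l))"
  proof (intro arg_cong[where f=prod_list] map_cong refl)
    fix l assume "l \<in> set ls"
    then have "fst l \<in> {1..n}" "snd l \<in> {1..n}" using assms(2) by auto
    then show "vf (fst l) (snd l) (lin_form n B) id_mat = B (snd l, fst l)" by (rule vf_lin_form_id)
  qed
  ultimately show ?thesis using assms(1) by (auto simp: divpow_def)
qed

theorem symb_J:
  assumes "a \<in> J n" "a \<in> T_filt n m"
  shows "symb m A a = 0"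
proof -
  \<comment> \<open>Transposing here undoes the exchange of indices, so that the letter
    \<open>(i, j)\<close> contributes \<open>A (i, j)\<close>.\<close>
  define B where "B = (\<lambda>p :: nat \<times> nat. A (snd p, fst p))"
  have "symb m A a = act a (divpow n B m) id_mat"
    unfolding symb_def act_def
  proof (intro lin_ext_cong)
    fix w assume "w \<in> Poly_Mapping.keys a"
    then have "length (letters w) \<le> m" "set (letters w) \<subseteq> {1..n} \<times> {1..n}"
      using T_filt_keys[OF assms(2)] T_keys[OF T_filt_T[OF assms(2)]] by blast+
    then show "(if length (letters w) = m then \<Prod>l\<leftarrow>letters w. A l else 0) =
      act_word (letters w) (divpow n B m) id_mat"
      by (subst act_word_divpow_id) (auto simp: B_def)
  qed
  then show ?thesis using J_acts_zero[OF assms(1) poly_fun_divpow] by simp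
qed

text \<open>The head of the left list is moved past the letters that precede it in the right list,
  and the argument recurs behind a fixed prefix. Swaps are required only for lists with multiset
  \<open>M\<close>, which lets their proof rely on the length and the entries.\<close>

lemma mset_eq_adjacent_swaps:
  assumes refl: "\<And>xs. R xs xs" and trans: "\<And>xs ys zs. R xs ys \<Longrightarrow> R ys zs \<Longrightarrow> R xs zs"
    and swap: "\<And>xs a b ys. mset (xs @ a # b # ys) = M \<Longrightarrow> R (xs @ a # b # ys) (xs @ b # a # ys)"
    and "mset us = M" "mset vs = M"
  shows "R us vs"
proof -
  have move: "R (pre @ a # v1 @ v2) (pre @ v1 @ a # v2)" if "mset (pre @ a # v1 @ v2) = M" for pre a v1 v2
    using that
  proof (induction v1 arbitrary: pre)
    case Nil
    then show ?case using refl by simp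
  next
    case (Cons b v1)
    have "R (pre @ a # b # v1 @ v2) (pre @ b # a # v1 @ v2)" using Cons(2) by (intro swap) simp
    moreover have "R ((pre @ [b]) @ a # v1 @ v2) ((pre @ [b]) @ v1 @ a # v2)"
      using Cons(2) by (intro Cons.IH) (simp add: add_mset_commute)
    ultimately show ?case using trans by fastforce
  qed
  have "R (pre @ us) (pre @ vs)" if "mset (pre @ us) = M" "mset us = mset vs" for pre
    using that
  proof (induction us arbitrary: pre vs)
    case Nil
    then show ?case using refl by simp
  next
    case (Cons a us)
    have "a \<in> set vs" using Cons(3) by (metis list.set_intros(1) set_mset_mset)
    then obtain v1 v2 where vs: "vs = v1 @ a # v2" by (meson split_list)
    have eq: "mset us = mset (v1 @ v2)" using Cons(3) vs by simp
    have "R ((pre @ [a]) @ us) ((pre @ [a]) @ v1 @ v2)"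
      by (rule Cons.IH[OF _ eq]) (use Cons(2) in simp)
    moreover have "mset (pre @ a # v1 @ v2) = M" using Cons(2) eq by simp
    ultimately show ?case using move[of pre a v1 v2] trans vs by fastforce
  qed
  from this[of "[]"] show ?thesis using assms(4,5) by simp
qed

section \<open>Lowering tensors with vanishing symbol modulo the ideal\<close>

definition lowers :: "nat \<Rightarrow> nat \<Rightarrow> tens \<Rightarrow> bool" where
  "lowers n m a \<longleftrightarrow> (\<exists>b\<in>T_filt n m. a - b \<in> J n)"

lemma lowers_0: "lowers n m 0"
  unfolding lowers_def by (rule bexI[of _ 0]) (auto simp: J(2))

lemma lowers_add: "lowers n m a \<Longrightarrow> lowers n m b \<Longrightarrow> lowers n m (a + b)"
  unfolding lowers_def using J_add_cong T_filt_add by meson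

lemma lowers_cmult: "lowers n m a \<Longrightarrow> lowers n m (tens_const c * a)"
  unfolding lowers_def using J(7) T_filt_cmult by (metis right_diff_distrib)

lemma lowers_sum: "(\<And>i. i \<in> S \<Longrightarrow> lowers n m (f i)) \<Longrightarrow> lowers n m (sum f S)"
  by (induction S rule: infinite_finite_induct) (auto intro: lowers_0 lowers_add)

lemma lowers_filt: "a \<in> T_filt n m \<Longrightarrow> lowers n m a"
  unfolding lowers_def by (rule bexI[of _ a]) (auto simp: J(2))

text \<open>Modulo \<open>J n\<close> the commutator of two letters is a combination of single
  letters, so the difference is one letter shorter.\<close>

lemma lowers_word_swap:
  assumes "set (xs @ p # q # ys) \<subseteq> {1..n} \<times> {1..n}" "length (xs @ p # q # ys) \<le> Suc m"
  shows "lowers n m (word (xs @ p # q # ys) - word (xs @ q # p # ys))"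
proof -
  obtain i j k l where pq: "p = (i, j)" "q = (k, l)" by (metis surj_pair)
  have ijkl: "i \<in> {1..n}" "j \<in> {1..n}" "k \<in> {1..n}" "l \<in> {1..n}" using assms(1) pq by auto
  let ?b = "(if j = k then tens_e i l else 0) - (if l = i then tens_e k j else 0)"
  have "word xs * (tens_e i j * tens_e k l - tens_e k l * tens_e i j - ?b) * word ys \<in> J n"
    using gl_relation_J[OF ijkl] assms(1) by (intro J_rmult J(4) T_word) auto
  then have "(word (xs @ p # q # ys) - word (xs @ q # p # ys)) - word xs * ?b * word ys \<in> J n"
    by (simp only: word_append word_Cons pq fst_conv snd_conv) (simp only: algebra_simps)
  moreover have "word xs * ?b * word ys \<in> T_filt n m"
  proof (rule T_filt_mult[OF T_filt_mult])
    show "?b \<in> T_filt n 1" by (intro T_filt_diff) (auto intro: T_filt_e[OF ijkl(1,4)] T_filt_e[OF ijkl(3,2)])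
    have "set xs \<subseteq> {1..n} \<times> {1..n}" "set ys \<subseteq> {1..n} \<times> {1..n}" using assms(1) by simp_all
    then show "word xs \<in> T_filt n (length xs)" "word ys \<in> T_filt n (length ys)"
      by (simp_all only: T_filt_word order_refl)
    show "length xs + 1 \<le> length xs + 1" "length xs + 1 + length ys \<le> m" using assms(2) by auto
  qed
  ultimately show ?thesis unfolding lowers_def by blast
qed

lemma lowers_word_mset:
  assumes "mset us = mset vs" "set us \<subseteq> {1..n} \<times> {1..n}" "length us \<le> Suc m"
  shows "lowers n m (word us - word vs)"
proof (rule mset_eq_adjacent_swaps[where M="mset us" and R="\<lambda>us vs. lowers n m (word us - word vs)"])
  fix xs a b ys assume "mset (xs @ a # b # ys) = mset us"
  then have "set (xs @ a # b # ys) = set us" "length (xs @ a # b # ys) = length us"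
    by (metis set_mset_mset, metis size_mset)
  then show "lowers n m (word (xs @ a # b # ys) - word (xs @ b # a # ys))"
    using assms by (intro lowers_word_swap) auto
next
  fix xs ys zs assume "lowers n m (word xs - word ys)" "lowers n m (word ys - word zs)"
  then show "lowers n m (word xs - word zs)" using lowers_add by fastforce
qed (use assms lowers_0 in auto)

text \<open>Words of full length are grouped by their multiset of letters. A vanishing symbol means
  that the coefficients in each group add up to zero; the words of a group are replaced by one
  common ordering at the cost of shorter words, after which they cancel.\<close>

theorem symb_zero_lowers:
  assumes a: "a \<in> T_filt n (Suc m)" and "\<And>A. symb (Suc m) A a = 0"
  shows "lowers n m a"
proof -
  let ?K = "Poly_Mapping.keys a"
  define top where "top = {w \<in> ?K. length (letters w) = Suc m}"
  have fin: "finite top" "finite (?K - top)" by (auto simp: top_def)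
  define rep :: "(nat \<times> nat) multiset \<Rightarrow> (nat \<times> nat) list" where "rep M = (SOME ls. mset ls = M)" for M
  have rep: "mset (rep M) = M" for M unfolding rep_def by (rule someI_ex) (rule ex_mset)
  let ?c = "Poly_Mapping.lookup a"
  let ?ms = "\<lambda>w. mset (letters w)"
  have V: "set (letters w) \<subseteq> {1..n} \<times> {1..n}" if "w \<in> top" for w
    using that T_keys[OF T_filt_T[OF a]] by (auto simp: top_def)
  have "(\<Sum>w | w \<in> top \<and> ?ms w = M. ?c w) = 0" if "M \<in> ?ms ` top" for M
  proof (rule monomials_independent[where V="{1..n} \<times> {1..n}" and K="?ms ` top" and e=count and
        c="\<lambda>M. \<Sum>w | w \<in> top \<and> ?ms w = M. ?c w"])
    fix s t :: "(nat \<times> nat) multiset"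
    assume st: "s \<in> ?ms ` top" "t \<in> ?ms ` top" and *: "\<And>i. i \<in> {1..n} \<times> {1..n} \<Longrightarrow> count s i = count t i"
    have sub: "set_mset M \<subseteq> {1..n} \<times> {1..n}" if M: "M \<in> ?ms ` top" for M
    proof -
      obtain w where "M = ?ms w" "w \<in> top" using M by (rule imageE)
      then show ?thesis using V[of w] by (simp only: set_mset_mset)
    qed
    show "s = t"
    proof (rule multiset_eqI)
      fix i
      show "count s i = count t i"
      proof (cases "i \<in> {1..n} \<times> {1..n}")
        case False
        then have "i \<notin># s" "i \<notin># t" using sub[OF st(1)] sub[OF st(2)] by blast+
        then show ?thesis by (simp add: not_in_iff)
      qed (rule *)
    qed
  next
    fix A :: "nat \<times> nat \<Rightarrow> complex"
    have "(\<Sum>M\<in>?ms ` top. (\<Sum>w | w \<in> top \<and> ?ms w = M. ?c w) * (\<Prod>i\<in>{1..n} \<times> {1..n}. A i ^ count M i)) =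
      (\<Sum>M\<in>?ms ` top. \<Sum>w | w \<in> top \<and> ?ms w = M. ?c w * (\<Prod>i\<in>{1..n} \<times> {1..n}. A i ^ count (?ms w) i))"
      by (simp add: sum_distrib_right)
    also have "\<dots> = (\<Sum>w\<in>top. ?c w * (\<Prod>i\<in>{1..n} \<times> {1..n}. A i ^ count (?ms w) i))"
      using fin(1) by (intro sum.group) auto
    also have "\<dots> = (\<Sum>w\<in>top. ?c w * (\<Prod>l\<leftarrow>letters w. A l))"
    proof (intro sum.cong refl arg_cong2[where f="(*)"])
      fix w assume "w \<in> top"
      have "(\<Prod>l\<leftarrow>letters w. A l) = prod_mset (image_mset A (?ms w))"
        by (metis mset_map prod_mset_prod_list)
      also have "\<dots> = (\<Prod>i\<in>set (letters w). A i ^ count (?ms w) i)"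
        by (simp add: image_prod_mset_multiplicity)
      also have "\<dots> = (\<Prod>i\<in>{1..n} \<times> {1..n}. A i ^ count (?ms w) i)"
      proof (intro prod.mono_neutral_left ballI)
        fix i assume "i \<in> {1..n} \<times> {1..n} - set (letters w)"
        then have "count (?ms w) i = 0" by (simp add: count_eq_zero_iff)
        then show "A i ^ count (?ms w) i = 1" by (simp only: power_0)
      qed (use V[OF \<open>w \<in> top\<close>] in auto)
      finally show "(\<Prod>i\<in>{1..n} \<times> {1..n}. A i ^ count (?ms w) i) = (\<Prod>l\<leftarrow>letters w. A l)" ..
    qed
    also have "\<dots> = symb (Suc m) A a"
      unfolding symb_def lin_ext_def top_def
      by (intro sum.mono_neutral_cong_left) auto
    finally show "(\<Sum>M\<in>?ms ` top. (\<Sum>w | w \<in> top \<and> ?ms w = M. ?c w) *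
        (\<Prod>i\<in>{1..n} \<times> {1..n}. A i ^ count M i)) = 0" using assms(2) by simp
  qed (use fin that in auto)
  then have "(\<Sum>M\<in>?ms ` top. tens_const (\<Sum>w | w \<in> top \<and> ?ms w = M. ?c w) * word (rep M)) = 0"
    by (intro sum.neutral) auto
  moreover have "(\<Sum>M\<in>?ms ` top. tens_const (\<Sum>w | w \<in> top \<and> ?ms w = M. ?c w) * word (rep M)) =
     (\<Sum>M\<in>?ms ` top. \<Sum>w | w \<in> top \<and> ?ms w = M. tens_const (?c w) * word (rep (?ms w)))"
  proof (intro sum.cong refl)
    fix M
    have "tens_const (sum ?c S) = (\<Sum>w\<in>S. tens_const (?c w))" for S
      by (induction S rule: infinite_finite_induct) (auto simp: tens_const_add)
    then show "tens_const (\<Sum>w | w \<in> top \<and> ?ms w = M. ?c w) * word (rep M) =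
      (\<Sum>w | w \<in> top \<and> ?ms w = M. tens_const (?c w) * word (rep (?ms w)))"
      by (simp add: sum_distrib_right)
  qed
  moreover have "\<dots> = (\<Sum>w\<in>top. tens_const (?c w) * word (rep (?ms w)))"
    using fin(1) by (intro sum.group) auto
  ultimately have 0: "(\<Sum>w\<in>top. tens_const (?c w) * word (rep (?ms w))) = 0" by simp
  have "a = (\<Sum>w\<in>top. tens_const (?c w) * word (letters w)) + (\<Sum>w\<in>?K - top. tens_const (?c w) * word (letters w))"
    using tens_expand[of a] by (subst (asm) sum.subset_diff[of top]) (auto simp: top_def add.commute)
  also have "(\<Sum>w\<in>top. tens_const (?c w) * word (letters w)) =
    (\<Sum>w\<in>top. tens_const (?c w) * (word (letters w) - word (rep (?ms w))))"
    using 0 by (simp add: right_diff_distrib sum_subtractf)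
  finally have eq: "a = (\<Sum>w\<in>top. tens_const (?c w) * (word (letters w) - word (rep (?ms w)))) +
    (\<Sum>w\<in>?K - top. tens_const (?c w) * word (letters w))" .
  have "lowers n m (\<Sum>w\<in>top. tens_const (?c w) * (word (letters w) - word (rep (?ms w))))"
    by (intro lowers_sum lowers_cmult lowers_word_mset V) (auto simp: rep top_def)
  moreover have "word (letters w) \<in> T_filt n m" if "w \<in> ?K - top" for w
    using that T_keys[OF T_filt_T[OF a], of w] T_filt_keys[OF a, of w]
    by (intro T_filt_word) (auto simp: top_def)
  then have "lowers n m (\<Sum>w\<in>?K - top. tens_const (?c w) * word (letters w))"
    by (intro lowers_filt T_filt_sum T_filt_cmult)
  ultimately have "lowers n m ((\<Sum>w\<in>top. tens_const (?c w) * (word (letters w) - word (rep (?ms w)))) +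
    (\<Sum>w\<in>?K - top. tens_const (?c w) * word (letters w)))" by (rule lowers_add)
  then show ?thesis by (simp only: eq[symmetric])
qed

text \<open>Only the empty word has length zero, so the tensor is the scalar
  \<open>symb 0 A a\<close>. This ends the descents on the degree.\<close>

lemma symb_zero_filt_0:
  assumes "a \<in> T_filt n 0" "\<And>A. symb 0 A a = 0"
  shows "a = 0"
proof -
  have "Poly_Mapping.keys a \<subseteq> {0}"
    using T_filt_keys[OF assms(1)] by (auto simp: zero_free_monoid_def intro: free_monoid.expand)
  then have "symb 0 A a = Poly_Mapping.lookup a 0" for A
    unfolding symb_def by (subst lin_ext_superset[of "{0}"]) auto
  then have "Poly_Mapping.lookup a 0 = 0" using assms(2) by metis
  then have "Poly_Mapping.lookup a k = 0" for k
    using \<open>Poly_Mapping.keys a \<subseteq> {0}\<close> by (cases "k = 0") (auto simp: in_keys_iff)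
  then show ?thesis by (intro poly_mapping_eqI) simp
qed

section \<open>Symbols of central elements\<close>

text \<open>The Lie bracket of the letter \<open>(i, j)\<close> with the letter \<open>l\<close>, as
  prescribed by \<open>gl_relations\<close>.\<close>

definition br :: "nat \<Rightarrow> nat \<Rightarrow> nat \<times> nat \<Rightarrow> tens" where
  "br i j l = (if j = fst l then tens_e i (snd l) else 0) - (if snd l = i then tens_e (fst l) j else 0)"

text \<open>The symbol of \<open>br\<close>, regarded as a vector field on matrices; for
  \<open>i \<noteq> j\<close> it is the velocity of the conjugations
  \<open>elem_conj\<close>.\<close>

definition adv :: "nat \<Rightarrow> nat \<Rightarrow> (nat \<times> nat \<Rightarrow> complex) \<Rightarrow> nat \<times> nat \<Rightarrow> complex" where
  "adv i j A l = (if j = fst l then A (i, snd l) else 0) - (if snd l = i then A (fst l, j) else 0)"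

primrec ad_word :: "nat \<Rightarrow> nat \<Rightarrow> (nat \<times> nat) list \<Rightarrow> tens" where
  "ad_word i j [] = 0"
| "ad_word i j (l # ls) = br i j l * word ls + tens_e (fst l) (snd l) * ad_word i j ls"

text \<open>The derivative of \<open>A \<mapsto> \<Prod>l\<leftarrow>ls. A l\<close> at \<open>A\<close> in direction \<open>V\<close>.\<close>
primrec dword :: "('l \<Rightarrow> complex) \<Rightarrow> ('l \<Rightarrow> complex) \<Rightarrow> 'l list \<Rightarrow> complex" where
  "dword V A [] = 0"
| "dword V A (l # ls) = V l * (\<Prod>l\<leftarrow>ls. A l) + A l * dword V A ls"

definition dsymb :: "nat \<Rightarrow> (nat \<times> nat \<Rightarrow> complex) \<Rightarrow> (nat \<times> nat \<Rightarrow> complex) \<Rightarrow> tens \<Rightarrow> complex" where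
  "dsymb m V A = lin_ext (\<lambda>w. if length (letters w) = m then dword V A (letters w) else 0)"

text \<open>A representative, modulo \<open>J n\<close>, of the commutator of the letter
  \<open>(i, j)\<close> with \<open>a\<close> whose words are no longer than those of
  \<open>a\<close>. The literal commutator is one letter longer, and its top symbol vanishes for
  trivial reasons, so \<open>symb_J\<close> would yield nothing.\<close>

definition ad_tens :: "nat \<Rightarrow> nat \<Rightarrow> tens \<Rightarrow> tens" where
  "ad_tens i j a = (\<Sum>w\<in>Poly_Mapping.keys a. tens_const (Poly_Mapping.lookup a w) * ad_word i j (letters w))"

lemma br_T_filt:
  assumes "i \<in> {1..n}" "j \<in> {1..n}" "l \<in> {1..n} \<times> {1..n}"
  shows "br i j l \<in> T_filt n 1"
proof -
  have "fst l \<in> {1..n}" "snd l \<in> {1..n}" using assms(3) by auto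
  then show ?thesis
    using T_filt_e[OF assms(1), of "snd l" 1] T_filt_e[OF _ assms(2), of "fst l" 1]
    unfolding br_def by (intro T_filt_diff) auto
qed

lemma ad_word_T_filt:
  assumes "i \<in> {1..n}" "j \<in> {1..n}" "set ls \<subseteq> {1..n} \<times> {1..n}"
  shows "ad_word i j ls \<in> T_filt n (length ls)"
  using assms(3)
proof (induction ls)
  case (Cons l ls)
  then have "fst l \<in> {1..n}" "snd l \<in> {1..n}" "set ls \<subseteq> {1..n} \<times> {1..n}" by auto
  then have "br i j l * word ls \<in> T_filt n (length (l # ls))"
    "tens_e (fst l) (snd l) * ad_word i j ls \<in> T_filt n (length (l # ls))"
    using Cons assms(1,2)
    by (auto intro!: T_filt_mult[OF br_T_filt T_filt_word[OF _ order_refl]] T_filt_mult[OF T_filt_e[where m=1] Cons.IH])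
  then show ?case by (simp only: ad_word.simps T_filt_add)
qed simp

lemma ad_word_J:
  assumes "i \<in> {1..n}" "j \<in> {1..n}" "set ls \<subseteq> {1..n} \<times> {1..n}"
  shows "tens_e i j * word ls - word ls * tens_e i j - ad_word i j ls \<in> J n"
  using assms(3)
proof (induction ls)
  case Nil
  then show ?case using J(2) by simp
next
  case (Cons l ls)
  let ?l = "tens_e (fst l) (snd l)"
  have l: "fst l \<in> {1..n}" "snd l \<in> {1..n}" "set ls \<subseteq> {1..n} \<times> {1..n}" using Cons by auto
  have "tens_e i j * ?l - ?l * tens_e i j - br i j l \<in> J n"
    using gl_relation_J[OF assms(1,2) l(1,2)] by (simp add: br_def)
  then have "(tens_e i j * ?l - ?l * tens_e i j - br i j l) * word ls +
    ?l * (tens_e i j * word ls - word ls * tens_e i j - ad_word i j ls) \<in> J n"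
    using Cons.IH[OF l(3)] l by (intro J(3) J_rmult J(4) T_e T_word)
  then show ?case by (simp add: word_Cons algebra_simps)
qed

lemma ad_tens_T_filt:
  assumes "i \<in> {1..n}" "j \<in> {1..n}" "a \<in> T_filt n m"
  shows "ad_tens i j a \<in> T_filt n m"
  unfolding ad_tens_def
proof (intro T_filt_sum T_filt_cmult)
  fix w assume "w \<in> Poly_Mapping.keys a"
  then show "ad_word i j (letters w) \<in> T_filt n m"
    using T_filt_keys[OF assms(3)] T_keys[OF T_filt_T[OF assms(3)]]
    by (intro T_filt_mono[OF ad_word_T_filt[OF assms(1,2)]]) auto
qed

lemma ad_tens_J:
  assumes "i \<in> {1..n}" "j \<in> {1..n}" "a \<in> T n"
  shows "tens_e i j * a - a * tens_e i j - ad_tens i j a \<in> J n"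
proof -
  have "tens_e i j * a - a * tens_e i j - ad_tens i j a = (\<Sum>w\<in>Poly_Mapping.keys a.
     tens_const (Poly_Mapping.lookup a w) *
       (tens_e i j * word (letters w) - word (letters w) * tens_e i j - ad_word i j (letters w)))"
    unfolding ad_tens_def
    by (subst (1 2) tens_expand[of a])
      (simp add: sum_distrib_left sum_distrib_right right_diff_distrib sum_subtractf
        tens_const_left_commute mult.assoc)
  also have "\<dots> \<in> J n" by (intro J(8) J(7) ad_word_J assms T_keys[OF assms(3)])
  finally show ?thesis .
qed

lemma symb_br: "symb (Suc 0) A (br i j l) = adv i j A l"
  by (simp add: br_def adv_def symb_diff symb_e)

lemma symb_ad_word:
  assumes "i \<in> {1..n}" "j \<in> {1..n}" "set ls \<subseteq> {1..n} \<times> {1..n}"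
  shows "symb (length ls) A (ad_word i j ls) = dword (adv i j A) A ls"
  using assms(3)
proof (induction ls)
  case (Cons l ls)
  then have l: "fst l \<in> {1..n}" "snd l \<in> {1..n}" "set ls \<subseteq> {1..n} \<times> {1..n}" "l \<in> {1..n} \<times> {1..n}" by auto
  have "symb (1 + length ls) A (br i j l * word ls) = adv i j A l * (\<Prod>l\<leftarrow>ls. A l)"
    by (subst symb_mult[OF br_T_filt[OF assms(1,2) l(4)] T_filt_word[OF l(3) order_refl]])
      (simp add: symb_br symb_word)
  moreover have "symb (1 + length ls) A (tens_e (fst l) (snd l) * ad_word i j ls) = A l * dword (adv i j A) A ls"
    by (subst symb_mult[OF T_filt_e[OF l(1,2) order_refl] ad_word_T_filt[OF assms(1,2) l(3)]])
      (simp add: symb_e Cons.IH[OF l(3)])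
  ultimately show ?case by (simp add: symb_add)
qed simp

lemma symb_ad_tens:
  assumes "i \<in> {1..n}" "j \<in> {1..n}" "a \<in> T_filt n m"
  shows "symb m A (ad_tens i j a) = dsymb m (adv i j A) A a"
  unfolding ad_tens_def symb_sum dsymb_def lin_ext_def symb_cmult
proof (intro sum.cong refl arg_cong2[where f="(*)"])
  fix w assume w: "w \<in> Poly_Mapping.keys a"
  have l: "set (letters w) \<subseteq> {1..n} \<times> {1..n}" "length (letters w) \<le> m"
    using w T_filt_keys[OF assms(3)] T_keys[OF T_filt_T[OF assms(3)]] by auto
  show "symb m A (ad_word i j (letters w)) = (if length (letters w) = m then dword (adv i j A) A (letters w) else 0)"
  proof (cases "length (letters w) = m")
    case True
    then show ?thesis using symb_ad_word[OF assms(1,2) l(1)] by auto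
  next
    case False
    then show ?thesis using symb_zero_if_low[OF ad_word_T_filt[OF assms(1,2) l(1)]] l(2) by auto
  qed
qed

text \<open>Centrality puts \<open>ad_tens i j a\<close> into \<open>J n\<close>, and its words are
  no longer than \<open>m\<close>; \<open>symb_J\<close> then says that the derivative of the symbol
  along \<open>adv i j\<close> vanishes.\<close>

lemma central_dsymb:
  assumes "central_mod n a" "a \<in> T_filt n m" "i \<in> {1..n}" "j \<in> {1..n}"
  shows "dsymb m (adv i j A) A a = 0"
proof -
  have a: "a \<in> T n" using assms(1) by (simp add: central_mod_def)
  have "tens_e i j * a - a * tens_e i j \<in> J n"
    using assms T_e[OF assms(3,4)] J_sym unfolding central_mod_def by blast
  from J(6)[OF this ad_tens_J[OF assms(3,4) a]] have "ad_tens i j a \<in> J n" by simp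
  then show ?thesis
    using symb_J[OF _ ad_tens_T_filt[OF assms(3,4,2)]] symb_ad_tens[OF assms(3,4,2)] by metis
qed

section \<open>Invariance of the symbol under conjugation\<close>

lemma dword_has_derivative:
  assumes "\<And>p. ((\<lambda>s. A s p) has_field_derivative V p) (at s)"
  shows "((\<lambda>s. \<Prod>l\<leftarrow>ls. A s l) has_field_derivative dword V (A s) ls) (at s)"
proof (induction ls)
  case (Cons l ls)
  from DERIV_mult[OF assms[of l] Cons] show ?case by (simp add: algebra_simps)
qed simp

lemma polyfn_symb:
  assumes "a \<in> T_filt n m"
  shows "polyfn ({1..n} \<times> {1..n}) m (\<lambda>A. symb m A a)"
  unfolding symb_def lin_ext_def
proof (intro polyfn_sum polyfn_cmult)
  fix w assume "w \<in> Poly_Mapping.keys a"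
  then have "set (letters w) \<subseteq> {1..n} \<times> {1..n}" using T_keys[OF T_filt_T[OF assms]] by blast
  then have "polyfn ({1..n} \<times> {1..n}) (length (letters w)) (\<lambda>A. \<Prod>l\<leftarrow>letters w. A l)"
    by (intro polyfn_prod_list polyfn_var) auto
  then show "polyfn ({1..n} \<times> {1..n}) m (\<lambda>A. if length (letters w) = m then \<Prod>l\<leftarrow>letters w. A l else 0)"
    by (cases "length (letters w) = m") (auto intro: polyfn.const)
qed

definition diag :: "(nat \<Rightarrow> complex) \<Rightarrow> nat \<times> nat \<Rightarrow> complex" where
  "diag d p = (if fst p = snd p then d (fst p) else 0)"

text \<open>Conjugation of the matrix \<open>A\<close> by the elementary matrix \<open>1 + s E\<^sub>j\<^sub>i\<close>.\<close>
definition elem_conj :: "nat \<Rightarrow> nat \<Rightarrow> complex \<Rightarrow> (nat \<times> nat \<Rightarrow> complex) \<Rightarrow> nat \<times> nat \<Rightarrow> complex" where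
  "elem_conj i j s A l = A l + (if fst l = j then s * A (i, snd l) else 0)
     - (if snd l = i then s * A (fst l, j) else 0) - (if fst l = j \<and> snd l = i then s\<^sup>2 * A (i, j) else 0)"

text \<open>As \<open>s\<close> moves, the matrix flows along \<open>adv i j\<close>, so the symbol
  has derivative zero by \<open>central_dsymb\<close>. For \<open>i \<noteq> j\<close> the matrix
  unit squares to zero, hence the flow is polynomial in \<open>s\<close> and the symbol along it is
  a constant polynomial.\<close>

lemma symb_elem_conj:
  assumes "central_mod n a" "a \<in> T_filt n m" "i \<in> {1..n}" "j \<in> {1..n}" "i \<noteq> j"
  shows "symb m (elem_conj i j s A) a = symb m A a"
proof -
  have D: "((\<lambda>s. elem_conj i j s A p) has_field_derivative adv i j (elem_conj i j s A) p) (at s)" for p s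
    using assms(5) unfolding elem_conj_def adv_def
    by (auto intro!: derivative_eq_intros simp: algebra_simps)
  have der: "((\<lambda>s. symb m (elem_conj i j s A) a) has_field_derivative 0) (at s)" for s
  proof -
    have "((\<lambda>s. symb m (elem_conj i j s A) a) has_field_derivative
        dsymb m (adv i j (elem_conj i j s A)) (elem_conj i j s A) a) (at s)"
      unfolding symb_def dsymb_def lin_ext_def
    proof (intro DERIV_sum DERIV_cmult)
      fix w
      show "((\<lambda>s. if length (letters w) = m then prod_list (map (elem_conj i j s A) (letters w)) else 0)
        has_field_derivative (if length (letters w) = m
          then dword (adv i j (elem_conj i j s A)) (elem_conj i j s A) (letters w) else 0)) (at s)"
        using dword_has_derivative[of "\<lambda>s. elem_conj i j s A", OF D] by auto
    qed
    then show ?thesis using central_dsymb[OF assms(1-4)] by simp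
  qed
  have "\<exists>q. \<forall>s. elem_conj i j s A p = poly q s" for p
    by (rule exI[of _ "[:A p, (if fst p = j then A (i, snd p) else 0) - (if snd p = i then A (fst p, j) else 0),
       - (if fst p = j \<and> snd p = i then A (i, j) else 0):]"])
      (simp add: elem_conj_def algebra_simps power2_eq_square)
  then obtain q where q: "\<And>s. symb m (elem_conj i j s A) a = poly q s"
    using polyfn_along_curve[OF polyfn_symb[OF assms(2)], of "\<lambda>p s. elem_conj i j s A p"] by auto
  have "poly (pderiv q) s = 0" for s
    using der[of s] poly_DERIV[of q s] unfolding q by (rule DERIV_unique[rotated])
  then have "pderiv q = 0" using poly_all_0_iff_0 by blast
  then have "degree q = 0" by (simp add: pderiv_eq_0_iff)
  then obtain c where "q = [:c:]" by (rule degree_eq_zeroE)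
  then have "symb m (elem_conj i j s A) a = symb m (elem_conj i j 0 A) a" unfolding q by simp
  also have "elem_conj i j 0 A = A" by (simp add: elem_conj_def fun_eq_iff)
  finally show ?thesis .
qed

text \<open>The product of the three elementary matrices exchanges \<open>p\<close> and
  \<open>q\<close> up to a sign, like the Weyl group element of SL(2); the sign disappears when a
  diagonal matrix is conjugated.\<close>

lemma elem_conj_swap:
  assumes "p \<noteq> q"
  shows "elem_conj q p 1 (elem_conj p q (- 1) (elem_conj q p 1 (diag d))) = diag (d(p := d q, q := d p))"
  using assms by (auto simp: fun_eq_iff elem_conj_def diag_def)

lemma central_symb_diag_shift_sym:
  assumes "central_mod n a" "a \<in> T_filt n m"
  shows "shift_sym 0 n (\<lambda>d. symb m (diag d) a)"
  unfolding shift_sym_def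
proof (intro ballI allI)
  fix i and d :: "nat \<Rightarrow> complex" assume i: "i \<in> {1..<n}"
  have "symb m (diag (d(i := d (i + 1), i + 1 := d i))) a = symb m (diag d) a"
  proof -
    have "diag (d(i := d (i + 1), i + 1 := d i)) =
      elem_conj (i + 1) i 1 (elem_conj i (i + 1) (- 1) (elem_conj (i + 1) i 1 (diag d)))"
      by (rule elem_conj_swap[symmetric]) simp
    then show ?thesis using i by (simp only:) (simp add: symb_elem_conj[OF assms])
  qed
  then show "symb m (diag d) a = symb m (diag (d(i := d (i + 1) - 0, i + 1 := d i + 0))) a" by simp
qed

lemma polyfn_symb_diag:
  assumes "a \<in> T_filt n m"
  shows "polyfn {1..n} m (\<lambda>d. symb m (diag d) a)"
proof -
  have "polyfn {1..n} m (\<lambda>d. symb m (\<lambda>p. diag d p) a)"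
  proof (rule polyfn_subst[OF polyfn_symb[OF assms]])
    fix p :: "nat \<times> nat" assume "p \<in> {1..n} \<times> {1..n}"
    then show "polyfn {1..n} 1 (\<lambda>d. diag d p)"
      by (cases "fst p = snd p") (auto simp: diag_def intro: polyfn.const polyfn_var)
  qed
  then show ?thesis .
qed

section \<open>Grading the symbol by off-diagonal degree\<close>

definition off :: "(nat \<times> nat) list \<Rightarrow> nat" where
  "off ls = length (filter (\<lambda>l. fst l \<noteq> snd l) ls)"

lemma off_simps [simp]: "off [] = 0" "off (l # ls) = (if fst l = snd l then off ls else Suc (off ls))"
  by (simp_all add: off_def)

lemma off_le: "off ls \<le> length ls"
  by (simp add: off_def)

definition gsymb :: "nat \<Rightarrow> nat \<Rightarrow> (nat \<times> nat \<Rightarrow> complex) \<Rightarrow> tens \<Rightarrow> complex" where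
  "gsymb m k A = lin_ext (\<lambda>w. if length (letters w) = m \<and> off (letters w) = k
     then \<Prod>l\<leftarrow>letters w. A l else 0)"

definition dgsymb :: "nat \<Rightarrow> nat \<Rightarrow> (nat \<times> nat \<Rightarrow> complex) \<Rightarrow> (nat \<times> nat \<Rightarrow> complex) \<Rightarrow> tens \<Rightarrow> complex" where
  "dgsymb m k V A = lin_ext (\<lambda>w. if length (letters w) = m \<and> off (letters w) = k
     then dword V A (letters w) else 0)"

text \<open>The parameter \<open>s\<close> records the off-diagonal degree as an exponent.\<close>

definition scale_off :: "complex \<Rightarrow> (nat \<times> nat \<Rightarrow> complex) \<Rightarrow> nat \<times> nat \<Rightarrow> complex" where
  "scale_off s A p = (if fst p = snd p then A p else s * A p)"

lemma prod_scale_off: "(\<Prod>l\<leftarrow>ls. scale_off s A l) = s ^ off ls * (\<Prod>l\<leftarrow>ls. A l)"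
  by (induction ls) (auto simp: scale_off_def)

lemma dword_scale_off_diag:
  "(\<And>p. fst p \<noteq> snd p \<Longrightarrow> V p = 0) \<Longrightarrow> dword V (scale_off s A) ls = s ^ off ls * dword V A ls"
  by (induction ls) (auto simp: prod_scale_off, auto simp: scale_off_def algebra_simps)

text \<open>Differentiating in an off-diagonal direction removes one scaled letter; the factor
  \<open>s\<close> on the left makes up for it and avoids a negative power.\<close>

lemma dword_scale_off_off:
  "(\<And>p. fst p = snd p \<Longrightarrow> V p = 0) \<Longrightarrow> s * dword V (scale_off s A) ls = s ^ off ls * dword V A ls"
proof (induction ls)
  case (Cons l ls)
  have "s * dword V (scale_off s A) (l # ls) =
    s * V l * (s ^ off ls * (\<Prod>l\<leftarrow>ls. A l)) + scale_off s A l * (s * dword V (scale_off s A) ls)"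
    by (simp add: prod_scale_off algebra_simps)
  also have "\<dots> = s * V l * (s ^ off ls * (\<Prod>l\<leftarrow>ls. A l)) + scale_off s A l * (s ^ off ls * dword V A ls)"
    using Cons by simp
  also have "scale_off s A l = (if fst l = snd l then A l else s * A l)" by (simp add: scale_off_def)
  finally have "s * dword V (scale_off s A) (l # ls) = s * V l * (s ^ off ls * (\<Prod>l\<leftarrow>ls. A l)) +
    (if fst l = snd l then A l else s * A l) * (s ^ off ls * dword V A ls)" .
  then show ?case using Cons(2)[of l] by (simp only: dword.simps off_simps) (auto simp: algebra_simps)
qed simp

lemma dword_add: "dword (\<lambda>p. V p + W p) A ls = dword V A ls + dword W A ls"
  by (induction ls) (auto simp: algebra_simps)

lemma dword_cmult: "dword (\<lambda>p. c * V p) A ls = c * dword V A ls"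
  by (induction ls) (auto simp: algebra_simps)

lemma dword_sum: "dword (\<lambda>p. \<Sum>i\<in>S. V i p) A ls = (\<Sum>i\<in>S. dword (V i) A ls)"
proof (induction S rule: infinite_finite_induct)
  case empty
  show ?case by (induction ls) auto
next
  case (infinite S)
  then show ?case by (induction ls) auto
qed (simp add: dword_add)

lemma dword_cong: "(\<And>p. p \<in> set ls \<Longrightarrow> V p = W p) \<Longrightarrow> dword V A ls = dword W A ls"
  by (induction ls) auto

lemma dword_euler: "dword (\<lambda>p. if fst p = snd p then 0 else A p) A ls = of_nat (off ls) * (\<Prod>l\<leftarrow>ls. A l)"
  by (induction ls) (auto simp: algebra_simps)

lemma gsymb_zero_imp_dgsymb_zero:
  assumes "\<And>A. gsymb m k A a = 0"
  shows "dgsymb m k V A a = 0"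
proof -
  have D: "((\<lambda>s. A p + s * V p) has_field_derivative V p) (at 0)" for p
    by (auto intro!: derivative_eq_intros)
  have "((\<lambda>s. gsymb m k (\<lambda>p. A p + s * V p) a) has_field_derivative dgsymb m k V (\<lambda>p. A p + 0 * V p) a) (at 0)"
    unfolding gsymb_def dgsymb_def lin_ext_def
  proof (intro DERIV_sum DERIV_cmult)
    fix w
    show "((\<lambda>s. if length (letters w) = m \<and> off (letters w) = k then \<Prod>l\<leftarrow>letters w. A l + s * V l else 0)
      has_field_derivative (if length (letters w) = m \<and> off (letters w) = k
        then dword V (\<lambda>p. A p + 0 * V p) (letters w) else 0)) (at 0)"
      using dword_has_derivative[of "\<lambda>s p. A p + s * V p", OF D] by auto
  qed
  moreover have "((\<lambda>s. gsymb m k (\<lambda>p. A p + s * V p) a) has_field_derivative 0) (at 0)"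
    using assms by simp
  ultimately show ?thesis using DERIV_unique by force
qed

lemma sum_gsymb: "(\<Sum>k\<le>m. gsymb m k A a) = symb m A a"
proof -
  have "(\<Sum>k\<le>m. gsymb m k A a) = (\<Sum>w\<in>Poly_Mapping.keys a. \<Sum>k\<le>m. Poly_Mapping.lookup a w *
      (if length (letters w) = m \<and> off (letters w) = k then \<Prod>l\<leftarrow>letters w. A l else 0))"
    unfolding gsymb_def lin_ext_def by (rule sum.swap)
  also have "\<dots> = symb m A a"
    unfolding symb_def lin_ext_def
  proof (intro sum.cong refl)
    fix w
    show "(\<Sum>k\<le>m. Poly_Mapping.lookup a w *
      (if length (letters w) = m \<and> off (letters w) = k then \<Prod>l\<leftarrow>letters w. A l else 0)) =
      Poly_Mapping.lookup a w * (if length (letters w) = m then \<Prod>l\<leftarrow>letters w. A l else 0)"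
      using off_le[of "letters w"] by (cases "length (letters w) = m") (auto simp flip: sum_distrib_left)
  qed
  finally show ?thesis .
qed

lemma polyfn_gsymb:
  assumes "a \<in> T_filt n m"
  shows "polyfn ({1..n} \<times> {1..n}) m (\<lambda>A. gsymb m k A a)"
  unfolding gsymb_def lin_ext_def
proof (intro polyfn_sum polyfn_cmult)
  fix w assume "w \<in> Poly_Mapping.keys a"
  then have "set (letters w) \<subseteq> {1..n} \<times> {1..n}" using T_keys[OF T_filt_T[OF assms]] by blast
  then have "polyfn ({1..n} \<times> {1..n}) (length (letters w)) (\<lambda>A. \<Prod>l\<leftarrow>letters w. A l)"
    by (intro polyfn_prod_list polyfn_var) auto
  then show "polyfn ({1..n} \<times> {1..n}) m (\<lambda>A. if length (letters w) = m \<and> off (letters w) = k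
      then \<Prod>l\<leftarrow>letters w. A l else 0)"
    by (cases "length (letters w) = m \<and> off (letters w) = k") (auto intro: polyfn.const)
qed

text \<open>\<open>C\<close> is an off-diagonal direction with diagonal coefficient,
  \<open>R\<^sub>o\<close> an off-diagonal direction with off-diagonal coefficients,
  \<open>R\<^sub>d\<close> a diagonal direction with off-diagonal coefficients. They lower the
  off-diagonal degree by one, preserve it and raise it by one; the factor \<open>s\<close> on the
  left turns this into the extra exponents 0, 1 and 2.\<close>

lemma dsymb_scale_off_adv:
  fixes A :: "nat \<times> nat \<Rightarrow> complex"
  assumes "i \<noteq> j"
  defines "C \<equiv> \<lambda>p. if p = (j, i) then A (i, i) - A (j, j) else 0"
    and "R\<^sub>o \<equiv> \<lambda>p. if p = (j, i) \<or> fst p = snd p then 0 else adv i j A p"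
    and "R\<^sub>d \<equiv> \<lambda>p. if fst p = snd p then adv i j A p else 0"
  shows "s * dsymb m (adv i j (scale_off s A)) (scale_off s A) a =
    (\<Sum>k\<le>m. s ^ k * (dgsymb m k C A a + s * dgsymb m k R\<^sub>o A a + s\<^sup>2 * dgsymb m k R\<^sub>d A a))"
proof -
  let ?A = "scale_off s A"
  have adv: "adv i j ?A = (\<lambda>p. C p + (s * R\<^sub>o p + s * R\<^sub>d p))"
    using assms(1) by (auto simp: fun_eq_iff adv_def scale_off_def C_def R\<^sub>o_def R\<^sub>d_def algebra_simps)
  have "s * dword (adv i j ?A) ?A ls =
     s ^ off ls * (dword C A ls + s * dword R\<^sub>o A ls + s\<^sup>2 * dword R\<^sub>d A ls)" for ls
  proof -
    have 1: "s * dword C ?A ls = s ^ off ls * dword C A ls"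
      by (rule dword_scale_off_off) (use assms(1) in \<open>auto simp: C_def\<close>)
    have 2: "s * dword R\<^sub>o ?A ls = s ^ off ls * dword R\<^sub>o A ls"
      by (rule dword_scale_off_off) (auto simp: R\<^sub>o_def)
    have 3: "dword R\<^sub>d ?A ls = s ^ off ls * dword R\<^sub>d A ls"
      by (rule dword_scale_off_diag) (auto simp: R\<^sub>d_def)
    have "s * dword (adv i j ?A) ?A ls =
      s * dword C ?A ls + s * (s * dword R\<^sub>o ?A ls) + s * s * dword R\<^sub>d ?A ls"
      unfolding adv dword_add dword_cmult by (simp add: algebra_simps)
    then show ?thesis unfolding 1 2 3 by (simp add: algebra_simps power2_eq_square)
  qed
  note dw = this
  have "s * dsymb m (adv i j ?A) ?A a = (\<Sum>w\<in>Poly_Mapping.keys a. Poly_Mapping.lookup a w *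
    (if length (letters w) = m then s * dword (adv i j ?A) ?A (letters w) else 0))"
    unfolding dsymb_def lin_ext_def sum_distrib_left by (intro sum.cong) auto
  also have "\<dots> = (\<Sum>w\<in>Poly_Mapping.keys a. \<Sum>k\<le>m. Poly_Mapping.lookup a w *
    (if length (letters w) = m \<and> off (letters w) = k then s ^ k *
      (dword C A (letters w) + s * dword R\<^sub>o A (letters w) + s\<^sup>2 * dword R\<^sub>d A (letters w)) else 0))"
  proof (intro sum.cong refl)
    fix w
    show "Poly_Mapping.lookup a w * (if length (letters w) = m then s * dword (adv i j ?A) ?A (letters w) else 0) =
      (\<Sum>k\<le>m. Poly_Mapping.lookup a w * (if length (letters w) = m \<and> off (letters w) = k then s ^ k *
      (dword C A (letters w) + s * dword R\<^sub>o A (letters w) + s\<^sup>2 * dword R\<^sub>d A (letters w)) else 0))"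
      using off_le[of "letters w"] by (cases "length (letters w) = m") (auto simp: dw simp flip: sum_distrib_left)
  qed
  also have "\<dots> = (\<Sum>k\<le>m. \<Sum>w\<in>Poly_Mapping.keys a. Poly_Mapping.lookup a w *
    (if length (letters w) = m \<and> off (letters w) = k then s ^ k *
      (dword C A (letters w) + s * dword R\<^sub>o A (letters w) + s\<^sup>2 * dword R\<^sub>d A (letters w)) else 0))"
    by (rule sum.swap)
  also have "\<dots> = (\<Sum>k\<le>m. s ^ k * (dgsymb m k C A a + s * dgsymb m k R\<^sub>o A a + s\<^sup>2 * dgsymb m k R\<^sub>d A a))"
    unfolding dgsymb_def lin_ext_def sum_distrib_left distrib_left sum.distrib[symmetric]
    by (intro sum.cong) (auto simp: algebra_simps)
  finally show ?thesis .
qed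

text \<open>In the lowest off-diagonal degree \<open>k\<close>, only the component \<open>(A\<^sub>i\<^sub>i - A\<^sub>j\<^sub>j) \<partial>/\<partial>A\<^sub>j\<^sub>i\<close> of
  \<open>ad e\<^sub>i\<^sub>j\<close> lowers the off-diagonal degree.\<close>

lemma dgsymb_lowest:
  assumes "central_mod n a" "a \<in> T_filt n m" "i \<in> {1..n}" "j \<in> {1..n}" "i \<noteq> j" "k \<le> m"
    and low: "\<And>k' A. k' < k \<Longrightarrow> gsymb m k' A a = 0"
  shows "(A (i, i) - A (j, j)) * dgsymb m k (\<lambda>p. if p = (j, i) then 1 else 0) A a = 0"
proof -
  define C where "C = (\<lambda>p. if p = (j, i) then A (i, i) - A (j, j) else 0)"
  define Ro where "Ro = (\<lambda>p. if p = (j, i) \<or> fst p = snd p then 0 else adv i j A p)"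
  define Rd where "Rd = (\<lambda>p. if fst p = snd p then adv i j A p else 0)"
  define q where "q = (\<Sum>k'\<le>m. monom (dgsymb m k' C A a) k' + monom (dgsymb m k' Ro A a) (Suc k') +
      monom (dgsymb m k' Rd A a) (Suc (Suc k')))"
  have "poly q s = 0" for s
  proof -
    have "poly q s = (\<Sum>k\<le>m. s ^ k * (dgsymb m k C A a + s * dgsymb m k Ro A a + s\<^sup>2 * dgsymb m k Rd A a))"
      by (simp add: q_def poly_sum poly_monom algebra_simps power2_eq_square)
    also have "\<dots> = 0"
      using dsymb_scale_off_adv[OF assms(5), of s m A a] central_dsymb[OF assms(1-4)]
      by (simp add: C_def Ro_def Rd_def)
    finally show ?thesis .
  qed
  \<comment> \<open>In the coefficient of \<open>s ^ k\<close> the terms with \<open>Ro\<close> and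
    \<open>Rd\<close> come from degrees below \<open>k\<close>, where the component vanishes by
    assumption; only \<open>C\<close> in degree \<open>k\<close> is left.\<close>
  then have "coeff q k = 0" using poly_all_0_iff_0[of q] by simp
  moreover have "coeff q k = (\<Sum>k'\<le>m. if k' = k then dgsymb m k C A a else 0)"
    unfolding q_def coeff_sum
  proof (intro sum.cong refl)
    fix k'
    have "dgsymb m k' V A a = 0" if "k' < k" for V
      using gsymb_zero_imp_dgsymb_zero[OF low[OF that]] .
    then show "coeff (monom (dgsymb m k' C A a) k' + monom (dgsymb m k' Ro A a) (Suc k') +
      monom (dgsymb m k' Rd A a) (Suc (Suc k'))) k = (if k' = k then dgsymb m k C A a else 0)"
      by (cases "k' < k") auto
  qed
  ultimately have "dgsymb m k C A a = 0" using assms(6) by simp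
  moreover have "C = (\<lambda>p. (A (i, i) - A (j, j)) * (if p = (j, i) then 1 else 0))" by (auto simp: C_def)
  then have "dgsymb m k C A a = (A (i, i) - A (j, j)) * dgsymb m k (\<lambda>p. if p = (j, i) then 1 else 0) A a"
    by (simp only: dgsymb_def lin_ext_def dword_cmult sum_distrib_left) (auto intro!: sum.cong)
  ultimately show ?thesis by simp
qed

text \<open>Euler's identity in the off-diagonal variables: for \<open>k > 0\<close> the component
  of degree \<open>k\<close> is recovered from its off-diagonal partial derivatives.\<close>

lemma gsymb_euler:
  assumes "a \<in> T_filt n m"
  shows "of_nat k * gsymb m k A a =
    (\<Sum>p\<in>{1..n}\<times>{1..n}. (if fst p = snd p then 0 else A p) * dgsymb m k (\<lambda>l. if l = p then 1 else 0) A a)"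
proof -
  have dw: "of_nat (off ls) * (\<Prod>l\<leftarrow>ls. A l) =
      (\<Sum>p\<in>{1..n}\<times>{1..n}. (if fst p = snd p then 0 else A p) * dword (\<lambda>l. if l = p then 1 else 0) A ls)"
    if "set ls \<subseteq> {1..n} \<times> {1..n}" for ls
  proof -
    have "of_nat (off ls) * (\<Prod>l\<leftarrow>ls. A l) = dword (\<lambda>p. if fst p = snd p then 0 else A p) A ls"
      by (rule dword_euler[symmetric])
    also have "\<dots> = dword (\<lambda>l. \<Sum>p\<in>{1..n}\<times>{1..n}. (if fst p = snd p then 0 else A p) * (if l = p then 1 else 0)) A ls"
    proof (rule dword_cong)
      fix l assume "l \<in> set ls"
      then have "l \<in> {1..n} \<times> {1..n}" using that by blast
      then have "(\<Sum>p\<in>{1..n}\<times>{1..n}. if l = p then (if fst p = snd p then 0 else A p) else 0) =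
        (if fst l = snd l then 0 else A l)" by (simp only: sum.delta' finite_cartesian_product finite_atLeastAtMost if_True)
      moreover have "(\<Sum>p\<in>{1..n}\<times>{1..n}. (if fst p = snd p then 0 else A p) * (if l = p then 1 else 0)) =
        (\<Sum>p\<in>{1..n}\<times>{1..n}. if l = p then (if fst p = snd p then 0 else A p) else 0)"
        by (intro sum.cong) auto
      ultimately show "(if fst l = snd l then 0 else A l) =
        (\<Sum>p\<in>{1..n}\<times>{1..n}. (if fst p = snd p then 0 else A p) * (if l = p then 1 else 0))" by simp
    qed
    finally show ?thesis by (simp only: dword_sum dword_cmult)
  qed
  have "of_nat k * gsymb m k A a = (\<Sum>w\<in>Poly_Mapping.keys a. Poly_Mapping.lookup a w *
    (if length (letters w) = m \<and> off (letters w) = k then of_nat (off (letters w)) * (\<Prod>l\<leftarrow>letters w. A l) else 0))"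
    unfolding gsymb_def lin_ext_def sum_distrib_left by (intro sum.cong) auto
  also have "\<dots> = (\<Sum>w\<in>Poly_Mapping.keys a. \<Sum>p\<in>{1..n}\<times>{1..n}. (if fst p = snd p then 0 else A p) *
     (Poly_Mapping.lookup a w * (if length (letters w) = m \<and> off (letters w) = k
       then dword (\<lambda>l. if l = p then 1 else 0) A (letters w) else 0)))"
  proof (intro sum.cong refl)
    fix w assume "w \<in> Poly_Mapping.keys a"
    then have l: "set (letters w) \<subseteq> {1..n} \<times> {1..n}" using T_keys[OF T_filt_T[OF assms]] by blast
    show "Poly_Mapping.lookup a w * (if length (letters w) = m \<and> off (letters w) = k
        then of_nat (off (letters w)) * (\<Prod>l\<leftarrow>letters w. A l) else 0) =
      (\<Sum>p\<in>{1..n}\<times>{1..n}. (if fst p = snd p then 0 else A p) *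
     (Poly_Mapping.lookup a w * (if length (letters w) = m \<and> off (letters w) = k
       then dword (\<lambda>l. if l = p then 1 else 0) A (letters w) else 0)))"
      unfolding dw[OF l] by (auto simp: sum_distrib_left mult_ac intro!: sum.cong)
  qed
  also have "\<dots> = (\<Sum>p\<in>{1..n}\<times>{1..n}. (if fst p = snd p then 0 else A p) * dgsymb m k (\<lambda>l. if l = p then 1 else 0) A a)"
    unfolding dgsymb_def lin_ext_def sum_distrib_left by (rule sum.swap)
  finally show ?thesis .
qed

text \<open>Induction on the off-diagonal degree. When the diagonal entries are distinct, the factor
  \<open>A (i, i) - A (j, j)\<close> cancels from \<open>dgsymb_lowest\<close>, so all off-diagonal
  partial derivatives of the lowest component vanish and Euler's identity kills it; general matrices
  follow by density.\<close>

theorem central_symb_zero: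
  assumes c: "central_mod n a" and a: "a \<in> T_filt n m" and diag0: "\<And>d. symb m (diag d) a = 0"
  shows "symb m A a = 0"
proof -
  have g: "gsymb m k A a = 0" if "k \<le> m" for k A
    using that
  proof (induction k arbitrary: A rule: less_induct)
    case (less k)
    show ?case
    proof (cases "k = 0")
      case True
      \<comment> \<open>In off-diagonal degree zero the component is the symbol of the diagonal
        part, which vanishes by hypothesis.\<close>
      let ?d = "diag (\<lambda>i. A (i, i))"
      have prod: "(\<Prod>l\<leftarrow>ls. ?d l) = (if off ls = 0 then \<Prod>l\<leftarrow>ls. A l else 0)" for ls
        by (induction ls) (auto simp: diag_def)
      have "gsymb m 0 A a = symb m ?d a"
        unfolding gsymb_def symb_def lin_ext_def by (intro sum.cong refl) (auto simp: prod)
      then show ?thesis using diag0 True by simp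
    next
      case False
      have reg: "gsymb m k A a = 0"
        if reg_A: "\<And>i j. i \<in> {1..n} \<Longrightarrow> j \<in> {1..n} \<Longrightarrow> i \<noteq> j \<Longrightarrow> A (i, i) \<noteq> A (j, j)" for A
      proof -
        have "dgsymb m k (\<lambda>l. if l = (j, i) then 1 else 0) A a = 0"
          if ij: "i \<in> {1..n}" "j \<in> {1..n}" "i \<noteq> j" for i j
          using dgsymb_lowest[OF c a ij less.prems, of A] less reg_A[OF ij] by auto
        then have "of_nat k * gsymb m k A a = 0"
          unfolding gsymb_euler[OF a] by (intro sum.neutral) auto
        then show ?thesis using False by simp
      qed
      \<comment> \<open>Adding \<open>s\<close> times the diagonal matrix with entries 1 to
        \<open>n\<close> makes the diagonal entries distinct unless \<open>s\<close> is one of these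
        finitely many values.\<close>
      define bad where "bad = (\<lambda>(i, j). (A (j, j) - A (i, i)) / (of_nat i - of_nat j)) ` ({1..n} \<times> {1..n})"
      have "finite bad" unfolding bad_def by (intro finite_imageI finite_cartesian_product) auto
      then have inf: "infinite (- bad)" by (simp add: finite_compl infinite_UNIV_char_0)
      define A' where "A' = (\<lambda>p s. A p + s * (if fst p = snd p then of_nat (fst p) else 0 :: complex))"
      have "gsymb m k (\<lambda>p. A' p s) a = 0" if s: "s \<in> - bad" for s
      proof (rule reg)
        fix i j assume ij: "i \<in> {1..n}" "j \<in> {1..n}" "i \<noteq> j"
        show "A' (i, i) s \<noteq> A' (j, j) s"
        proof
          assume "A' (i, i) s = A' (j, j) s"
          then have "s * (of_nat i - of_nat j) = A (j, j) - A (i, i)" by (simp add: A'_def algebra_simps)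
          then have "s = (A (j, j) - A (i, i)) / (of_nat i - of_nat j)" using ij(3) by (simp add: field_simps)
          then have "s \<in> bad" using ij unfolding bad_def by force
          then show False using s by simp
        qed
      qed
      moreover have "\<exists>q. \<forall>s. A' p s = poly q s" for p
        by (rule exI[of _ "[:A p, if fst p = snd p then of_nat (fst p) else 0:]"]) (simp add: A'_def)
      ultimately have "gsymb m k (\<lambda>p. A' p 0) a = 0"
        by (intro polyfn_curve_zero[OF polyfn_gsymb[OF a], of A' "- bad" k 0] inf) auto
      then show ?thesis by (simp add: A'_def)
    qed
  qed
  have "symb m A a = (\<Sum>k\<le>m. gsymb m k A a)" by (rule sum_gsymb[symmetric])
  also have "\<dots> = 0" by (intro sum.neutral) (use g in auto)
  finally show ?thesis .
qed

corollary central_lowers: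
  assumes "central_mod n a" "a \<in> T_filt n (Suc m)" "\<And>d. symb (Suc m) (diag d) a = 0"
  shows "lowers n m a"
  by (rule symb_zero_lowers[OF assms(2) central_symb_zero[OF assms]])

section \<open>The Capelli elements\<close>

definition cols :: "nat \<Rightarrow> nat list" where
  "cols k = [1..<k+1]"

lemma set_cols [simp]: "set (cols k) = {1..k}"
  by (auto simp: cols_def)

lemma length_cols [simp]: "length (cols k) = k"
  by (simp add: cols_def)

lemma distinct_cols [simp]: "distinct (cols k)"
  by (simp add: cols_def)

lemma cols_split: "p \<in> {1..k} \<Longrightarrow> cols k = [1..<p] @ p # [p+1..<k+1]"
  using upt_add_eq_append[of 1 p "k + 1 - p"] upt_conv_Cons[of p "k + 1"] by (simp add: cols_def)

lemma cols_split_adjacent: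
  assumes "p \<in> {1..k}" "p + 1 \<in> {1..k}"
  shows "cols k = [1..<p] @ p # (p + 1) # [p+2..<k+1]"
  using cols_split[OF assms(1)] assms(2) upt_conv_Cons[of "p + 1" "k + 1"] by simp

text \<open>The diagonal shift depends on equality of the indices instead of equality of positions.
  For distinct indices the two agree, see \<open>Hlift_eq\<close>; for arbitrary lists this form is
  stable under commutators, see \<open>X_commutator_J\<close>.\<close>

definition X :: "nat \<Rightarrow> nat \<Rightarrow> nat \<Rightarrow> tens" where
  "X c i j = tens_e i j + (if i = j then tens_const (of_nat c) else 0)"

text \<open>Arbitrary index lists are allowed, because the sum over all lists (instead of the increasing
  ones) is invariant under the adjoint action for trivial reasons.\<close>
definition Xprod :: "nat \<Rightarrow> nat list \<Rightarrow> nat list \<Rightarrow> (nat \<Rightarrow> nat) \<Rightarrow> tens" where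
  "Xprod k is js \<sigma> = (\<Prod>s\<leftarrow>cols k. X (k - s) (is ! (\<sigma> s - 1)) (js ! (s - 1)))"

definition Xdet :: "nat \<Rightarrow> nat list \<Rightarrow> nat list \<Rightarrow> tens" where
  "Xdet k is js = (\<Sum>\<sigma> | \<sigma> permutes {1..k}. of_int (sign \<sigma>) * Xprod k is js \<sigma>)"

definition index_lists :: "nat \<Rightarrow> nat \<Rightarrow> nat list set" where
  "index_lists n k = {is. set is \<subseteq> {1..n} \<and> length is = k}"

definition Hlift :: "nat \<Rightarrow> nat \<Rightarrow> tens" where
  "Hlift n k = (\<Sum>is\<in>incr_seqs n k.
     cdet k (\<lambda>r s. tens_e (is ! (r - 1)) (is ! (s - 1))
                   + (if r = s then tens_const (of_nat (k - s)) else 0)))"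

lemma Capelli_H_eq: "Capelli_H n k = U_proj n (Hlift n k)"
  by (simp add: Capelli_H_def Hlift_def)

lemma X_T_filt: "i \<in> {1..n} \<Longrightarrow> j \<in> {1..n} \<Longrightarrow> X c i j \<in> T_filt n 1"
  unfolding X_def by (intro T_filt_add) (auto intro: T_filt_e)

lemma X_T: "i \<in> {1..n} \<Longrightarrow> j \<in> {1..n} \<Longrightarrow> X c i j \<in> T n"
  by (rule T_filt_T[OF X_T_filt])

lemma finite_index_lists [simp]: "finite (index_lists n k)"
  unfolding index_lists_def by (rule finite_lists_length_eq) simp

lemma index_lists_nth:
  assumes "is \<in> index_lists n k" "r \<in> {1..k}"
  shows "is ! (r - 1) \<in> {1..n}"
proof -
  have "is ! (r - 1) \<in> set is" using assms by (intro nth_mem) (auto simp: index_lists_def)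
  then show ?thesis using assms(1) by (auto simp: index_lists_def)
qed

lemma Xprod_T_filt:
  assumes "is \<in> index_lists n k" "js \<in> index_lists n k" "\<sigma> permutes {1..k}"
  shows "Xprod k is js \<sigma> \<in> T_filt n k"
proof -
  have "Xprod k is js \<sigma> \<in> T_filt n (length (cols k))"
    unfolding Xprod_def
  proof (rule T_filt_prod_list)
    fix s assume "s \<in> set (cols k)"
    then have "s \<in> {1..k}" "\<sigma> s \<in> {1..k}" using permutes_in_image[OF assms(3), of s] by auto
    then show "X (k - s) (is ! (\<sigma> s - 1)) (js ! (s - 1)) \<in> T_filt n 1"
      by (intro X_T_filt index_lists_nth[OF assms(1)] index_lists_nth[OF assms(2)])
  qed
  then show ?thesis by simp
qed

lemma Xdet_T_filt:
  assumes "is \<in> index_lists n k" "js \<in> index_lists n k"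
  shows "Xdet k is js \<in> T_filt n k"
  unfolding Xdet_def tens_const_of_int[symmetric]
  using Xprod_T_filt[OF assms] by (intro T_filt_sum T_filt_cmult) auto

lemma incr_seqs_index_lists: "is \<in> incr_seqs n k \<Longrightarrow> is \<in> index_lists n k"
  by (auto simp: incr_seqs_def index_lists_def)

lemma incr_seqs_distinct: "is \<in> incr_seqs n k \<Longrightarrow> distinct is"
  by (auto simp: incr_seqs_def strict_sorted_iff)

lemma Hlift_eq: "Hlift n k = (\<Sum>is\<in>incr_seqs n k. Xdet k is is)"
  unfolding Hlift_def cdet_def Xdet_def Xprod_def cols_def[symmetric]
proof (intro sum.cong refl arg_cong2[where f="(*)"] arg_cong[where f=prod_list] map_cong)
  fix "is" \<sigma> s assume a: "is \<in> incr_seqs n k" "\<sigma> \<in> {\<sigma>. \<sigma> permutes {1..k}}" "s \<in> set (cols k)"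
  then have "s \<in> {1..k}" "\<sigma> s \<in> {1..k}" using permutes_in_image[of \<sigma> "{1..k}" s] by auto
  then have "(is ! (\<sigma> s - 1) = is ! (s - 1)) = (\<sigma> s = s)"
    using incr_seqs_distinct[OF a(1)] a(1)
    by (subst nth_eq_iff_index_eq) (auto simp: incr_seqs_def)
  then show "tens_e (is ! (\<sigma> s - 1)) (is ! (s - 1)) + (if \<sigma> s = s then tens_const (of_nat (k - s)) else 0) =
    X (k - s) (is ! (\<sigma> s - 1)) (is ! (s - 1))" by (simp add: X_def)
qed

lemma Hlift_T_filt: "Hlift n k \<in> T_filt n k"
  unfolding Hlift_eq by (intro T_filt_sum Xdet_T_filt incr_seqs_index_lists)

lemma Hlift_T: "Hlift n k \<in> T n"
  by (rule T_filt_T[OF Hlift_T_filt])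

section \<open>Exchanging rows and columns of the determinants\<close>

lemma tens_double_eq_0:
  assumes "a + a = (0 :: tens)"
  shows "a = 0"
proof -
  have "a = tens_const (1 / 2) * (a + a)"
    by (simp add: distrib_left flip: distrib_right tens_const_add)
  then show ?thesis using assms by simp
qed

lemma half_in_J: "a + a \<in> J n \<Longrightarrow> a \<in> J n"
proof -
  assume "a + a \<in> J n"
  then have "tens_const (1 / 2) * (a + a) \<in> J n" by (rule J(7))
  then show "a \<in> J n" by (simp add: distrib_left flip: distrib_right tens_const_add)
qed

lemma signed_sum_compose_left:
  fixes G :: "(nat \<Rightarrow> nat) \<Rightarrow> 'a :: ring_1"
  assumes "p \<in> {1..k}" "q \<in> {1..k}" "p \<noteq> q"
  shows "(\<Sum>\<sigma> | \<sigma> permutes {1..k}. of_int (sign \<sigma>) * G (transpose p q \<circ> \<sigma>)) =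
    - (\<Sum>\<sigma> | \<sigma> permutes {1..k}. of_int (sign \<sigma>) * G \<sigma>)"
proof -
  let ?t = "transpose p q"
  have t: "?t permutes {1..k}" using assms by (intro permutes_swap_id)
  have "(\<Sum>\<sigma> | \<sigma> permutes {1..k}. of_int (sign \<sigma>) * G \<sigma>) =
    (\<Sum>\<sigma> | \<sigma> permutes {1..k}. of_int (sign (?t \<circ> \<sigma>)) * G (?t \<circ> \<sigma>))"
    by (rule setum_permutations_compose_left[OF t])
  also have "\<dots> = (\<Sum>\<sigma> | \<sigma> permutes {1..k}. - (of_int (sign \<sigma>) * G (?t \<circ> \<sigma>)))"
  proof (intro sum.cong refl)
    fix \<sigma> assume "\<sigma> \<in> {\<sigma>. \<sigma> permutes {1..k}}"
    then have "sign (?t \<circ> \<sigma>) = - sign \<sigma>"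
      using assms(3) t by (subst sign_compose) (auto simp: sign_swap_id intro: permutation_permutes[THEN iffD2])
    then show "of_int (sign (?t \<circ> \<sigma>)) * G (?t \<circ> \<sigma>) = - (of_int (sign \<sigma>) * G (?t \<circ> \<sigma>))" by simp
  qed
  finally show ?thesis by (simp add: sum_negf)
qed

lemma signed_sum_compose_right:
  fixes G :: "(nat \<Rightarrow> nat) \<Rightarrow> 'a :: ring_1"
  assumes "p \<in> {1..k}" "q \<in> {1..k}" "p \<noteq> q"
  shows "(\<Sum>\<sigma> | \<sigma> permutes {1..k}. of_int (sign \<sigma>) * G (\<sigma> \<circ> transpose p q)) =
    - (\<Sum>\<sigma> | \<sigma> permutes {1..k}. of_int (sign \<sigma>) * G \<sigma>)"
proof -
  let ?t = "transpose p q"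
  have t: "?t permutes {1..k}" using assms by (intro permutes_swap_id)
  have "(\<Sum>\<sigma> | \<sigma> permutes {1..k}. of_int (sign \<sigma>) * G \<sigma>) =
    (\<Sum>\<sigma> | \<sigma> permutes {1..k}. of_int (sign (\<sigma> \<circ> ?t)) * G (\<sigma> \<circ> ?t))"
    by (rule sum_permutations_compose_right[OF t])
  also have "\<dots> = (\<Sum>\<sigma> | \<sigma> permutes {1..k}. - (of_int (sign \<sigma>) * G (\<sigma> \<circ> ?t)))"
  proof (intro sum.cong refl)
    fix \<sigma> assume "\<sigma> \<in> {\<sigma>. \<sigma> permutes {1..k}}"
    then have "sign (\<sigma> \<circ> ?t) = - sign \<sigma>"
      using assms(3) t by (subst sign_compose) (auto simp: sign_swap_id intro: permutation_permutes[THEN iffD2])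
    then show "of_int (sign (\<sigma> \<circ> ?t)) * G (\<sigma> \<circ> ?t) = - (of_int (sign \<sigma>) * G (\<sigma> \<circ> ?t))" by simp
  qed
  finally show ?thesis by (simp add: sum_negf)
qed

lemma nth_swap_adjacent:
  "(xs @ b # a # ys) ! (r - 1) = (xs @ a # b # ys) ! (transpose (length xs + 1) (length xs + 2) r - 1)"
  if "1 \<le> r"
proof -
  consider "r = length xs + 1" | "r = length xs + 2" | "r \<noteq> length xs + 1" "r \<noteq> length xs + 2" by blast
  then show ?thesis
  proof cases
    case 3
    then have t: "transpose (length xs + 1) (length xs + 2) r = r" by (simp add: transpose_apply_other)
    show ?thesis
    proof (cases "r - 1 < length xs")
      case False
      then have "r - 1 = length xs + Suc (Suc (r - length xs - 3))" using 3 that by auto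
      then show ?thesis using t by (simp add: nth_append)
    qed (simp add: t nth_append)
  qed (auto simp: nth_append)
qed

text \<open>An exact identity in the free algebra: the exchange of two row indices is absorbed by
  \<sigma>, while the factors keep their column order and their shifts.\<close>

lemma Xdet_swap_rows:
  assumes "length (xs @ a # b # ys) = k"
  shows "Xdet k (xs @ b # a # ys) js = - Xdet k (xs @ a # b # ys) js"
proof -
  let ?t = "transpose (length xs + 1) (length xs + 2)"
  have "Xprod k (xs @ b # a # ys) js \<sigma> = Xprod k (xs @ a # b # ys) js (?t \<circ> \<sigma>)" if "\<sigma> permutes {1..k}" for \<sigma>
    unfolding Xprod_def
  proof (intro arg_cong[where f=prod_list] map_cong refl)
    fix s assume "s \<in> set (cols k)"
    then have "1 \<le> \<sigma> s" using permutes_in_image[OF that, of s] by auto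
    then show "X (k - s) ((xs @ b # a # ys) ! (\<sigma> s - 1)) (js ! (s - 1)) =
      X (k - s) ((xs @ a # b # ys) ! ((?t \<circ> \<sigma>) s - 1)) (js ! (s - 1))"
      using nth_swap_adjacent[of "\<sigma> s" xs b a ys] by simp
  qed
  then have "Xdet k (xs @ b # a # ys) js =
    (\<Sum>\<sigma> | \<sigma> permutes {1..k}. of_int (sign \<sigma>) * Xprod k (xs @ a # b # ys) js (?t \<circ> \<sigma>))"
    unfolding Xdet_def by (intro sum.cong refl) simp
  also have "\<dots> = - Xdet k (xs @ a # b # ys) js"
    unfolding Xdet_def using assms by (intro signed_sum_compose_left) auto
  finally show ?thesis .
qed

lemma Xdet_eq_0:
  assumes "length is = k" "\<not> distinct is"
  shows "Xdet k is js = 0"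
proof -
  obtain p q where pq: "p < k" "q < k" "p \<noteq> q" "is ! p = is ! q"
    using assms by (auto simp: distinct_conv_nth)
  let ?t = "transpose (p + 1) (q + 1)"
  have "is ! (?t r - 1) = is ! (r - 1)" for r
    using pq by (cases "r = p + 1"; cases "r = q + 1") (auto simp: transpose_apply_other)
  then have "Xprod k is js (?t \<circ> \<sigma>) = Xprod k is js \<sigma>" for \<sigma>
    by (simp add: Xprod_def)
  then have "Xdet k is js = (\<Sum>\<sigma> | \<sigma> permutes {1..k}. of_int (sign \<sigma>) * Xprod k is js (?t \<circ> \<sigma>))"
    by (simp add: Xdet_def)
  also have "\<dots> = - Xdet k is js"
    unfolding Xdet_def using pq by (intro signed_sum_compose_left) auto
  finally have eq: "Xdet k is js = - Xdet k is js" .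
  have "Xdet k is js + Xdet k is js = 0" by (subst (2) eq) simp
  then show ?thesis by (rule tens_double_eq_0)
qed

text \<open>With \<open>E1\<close>, \<open>E2\<close>, \<open>E3\<close>, \<open>E4\<close> for the
  letters at (a, p), (b, q), (a, q), (b, p) and \<open>d1\<close> to \<open>d4\<close> for the
  matching Kronecker symbols, the right side is the sum of two defining relations. The terms
  quadratic in the \<open>d\<close> cancel.\<close>

lemma shifted_columns_identity:
  fixes E1 E2 E3 E4 :: "'a :: ring_1" and c d1 d2 d3 d4 :: nat
  shows "(E1 + of_nat (Suc c * d1)) * (E2 + of_nat (c * d2)) - (E4 + of_nat (Suc c * d4)) * (E3 + of_nat (c * d3))
    + ((E3 + of_nat (Suc c * d3)) * (E4 + of_nat (c * d4)) - (E2 + of_nat (Suc c * d2)) * (E1 + of_nat (c * d1)))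
    = (E1 * E2 - E2 * E1 - (of_nat d4 * E3 - of_nat d3 * E4)) + (E3 * E4 - E4 * E3 - (of_nat d2 * E1 - of_nat d1 * E2))"
proof -
  have comm: "E * of_nat m = of_nat m * E" for E :: 'a and m by (rule mult_of_nat_commute[symmetric])
  have S: "of_nat (Suc c * d) = of_nat (c * d) + (of_nat d :: 'a)" for d by simp
  have nn: "of_nat d * of_nat (c * e) = (of_nat e * of_nat (c * d) :: 'a)" for d e
    by (simp only: of_nat_mult[symmetric]) (simp add: ac_simps)
  have nn': "of_nat (c * d) * of_nat (c * e) = (of_nat (c * e) * of_nat (c * d) :: 'a)" for d e
    by (simp only: of_nat_mult[symmetric]) (simp add: ac_simps)
  show ?thesis
    unfolding S
    using nn[of d1 d2] nn[of d4 d3] nn'[of d1 d2] nn'[of d4 d3]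
    by (simp add: algebra_simps comm[of E1] comm[of E2] comm[of E3] comm[of E4] del: of_nat_mult)
qed

text \<open>Here the shift by \<open>1\<close> between neighbouring columns compensates the commutators.\<close>
lemma X_columns_J:
  assumes "a \<in> {1..n}" "b \<in> {1..n}" "p \<in> {1..n}" "q \<in> {1..n}"
  shows "X (Suc c) a p * X c b q - X (Suc c) b p * X c a q + (X (Suc c) a q * X c b p - X (Suc c) b q * X c a p) \<in> J n"
proof -
  let ?d = "\<lambda>i j :: nat. if i = j then 1 else 0 :: nat"
  have X: "X c i j = tens_e i j + of_nat (c * ?d i j)" for c i j
    by (simp add: X_def tens_const_of_nat)
  have r1: "tens_e a p * tens_e b q - tens_e b q * tens_e a p -
      (of_nat (?d b p) * tens_e a q - of_nat (?d a q) * tens_e b p) \<in> J n"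
    using gl_relation_J[OF assms(1,3,2,4)] by (cases "p = b"; cases "q = a") simp_all
  have r2: "tens_e a q * tens_e b p - tens_e b p * tens_e a q -
      (of_nat (?d b q) * tens_e a p - of_nat (?d a p) * tens_e b q) \<in> J n"
    using gl_relation_J[OF assms(1,4,2,3)] by (cases "q = b"; cases "p = a") simp_all
  show ?thesis unfolding X shifted_columns_identity by (rule J(3)[OF r1 r2])
qed

text \<open>Each \<sigma> is paired with its composition with the transposition of the two columns.
  These stand next to each other with shifts differing by one, so \<open>X_columns_J\<close> applies
  between the untouched outer factors; the result holds modulo \<open>J n\<close>.\<close>

lemma Xdet_swap_columns:
  assumes "is \<in> index_lists n k" "xs @ a # b # ys \<in> index_lists n k"
  shows "Xdet k is (xs @ a # b # ys) + Xdet k is (xs @ b # a # ys) \<in> J n"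
proof (rule half_in_J)
  let ?js = "xs @ a # b # ys" and ?js' = "xs @ b # a # ys"
  define p where "p = length xs + 1"
  let ?t = "transpose p (p + 1)"
  have p: "p \<in> {1..k}" "p + 1 \<in> {1..k}" using assms(2) by (auto simp: p_def index_lists_def)
  have js': "?js' \<in> index_lists n k" using assms(2) by (auto simp: index_lists_def)
  have ab: "?js ! (p - 1) = a" "?js ! p = b" "?js' ! (p - 1) = b" "?js' ! p = a"
    by (auto simp: p_def nth_append)
  have cols_J: "Xprod k is ?js \<sigma> - Xprod k is ?js (\<sigma> \<circ> ?t) + (Xprod k is ?js' \<sigma> - Xprod k is ?js' (\<sigma> \<circ> ?t)) \<in> J n"
    if \<sigma>: "\<sigma> permutes {1..k}" for \<sigma>
  proof -
    let ?f = "\<lambda>s. X (k - s) (is ! (\<sigma> s - 1)) (?js ! (s - 1))"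
    define pre where "pre = (\<Prod>s\<leftarrow>[1..<p]. ?f s)"
    define post where "post = (\<Prod>s\<leftarrow>[p+2..<k+1]. ?f s)"
    let ?i = "is ! (\<sigma> p - 1)" and ?j = "is ! (\<sigma> (p + 1) - 1)"
    let ?c = "k - (p + 1)"
    have c: "k - p = Suc ?c" using p by auto
    have other: "?js ! (s - 1) = ?js' ! (s - 1)" if "s \<noteq> p" "s \<noteq> p + 1" "1 \<le> s" for s
      using nth_swap_adjacent[OF that(3), of xs b a ys] that by (simp add: p_def transpose_apply_other)
    have split: "Xprod k is js \<tau> = pre * (X (Suc ?c) (is ! (\<tau> p - 1)) (js ! (p - 1)) *
        X ?c (is ! (\<tau> (p + 1) - 1)) (js ! p)) * post"
      if "js = ?js \<or> js = ?js'" "\<tau> = \<sigma> \<or> \<tau> = \<sigma> \<circ> ?t" for js \<tau>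
    proof -
      have same: "X (k - s) (is ! (\<tau> s - 1)) (js ! (s - 1)) = ?f s" if "s \<noteq> p" "s \<noteq> p + 1" "1 \<le> s" for s
        using \<open>js = ?js \<or> js = ?js'\<close> \<open>\<tau> = \<sigma> \<or> \<tau> = \<sigma> \<circ> ?t\<close> other[OF that] that
        by (auto simp: transpose_apply_other)
      have "(\<Prod>s\<leftarrow>[1..<p]. X (k - s) (is ! (\<tau> s - 1)) (js ! (s - 1))) = pre"
        unfolding pre_def by (intro arg_cong[where f=prod_list] map_cong refl same) auto
      moreover have "(\<Prod>s\<leftarrow>[p+2..<k+1]. X (k - s) (is ! (\<tau> s - 1)) (js ! (s - 1))) = post"
        unfolding post_def by (intro arg_cong[where f=prod_list] map_cong refl same) auto
      ultimately show ?thesis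
        unfolding Xprod_def cols_split_adjacent[OF p]
        using c by (simp add: mult.assoc)
    qed
    have idx: "is ! (\<sigma> s - 1) \<in> {1..n}" "?js ! (s - 1) \<in> {1..n}" if "s \<in> {1..k}" for s
      using that permutes_in_image[OF \<sigma>, of s] index_lists_nth[OF assms(1), of "\<sigma> s"]
        index_lists_nth[OF assms(2), of s] by blast+
    have T: "pre \<in> T n" "post \<in> T n"
    proof -
      have fT: "?f s \<in> T n" if "s \<in> {1..k}" for s by (intro X_T idx that)
      show "pre \<in> T n" unfolding pre_def by (rule T_prod_list, rule fT) (use p in auto)
      show "post \<in> T n" unfolding post_def by (rule T_prod_list, rule fT) (use p in auto)
    qed
    have abn: "a \<in> {1..n}" "b \<in> {1..n}" using assms(2) by (auto simp: index_lists_def)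
    have "pre * (X (Suc ?c) ?i a * X ?c ?j b - X (Suc ?c) ?j a * X ?c ?i b +
      (X (Suc ?c) ?i b * X ?c ?j a - X (Suc ?c) ?j b * X ?c ?i a)) * post \<in> J n"
      by (intro J_rmult J(4) X_columns_J T idx p abn)
    then show ?thesis
      by (simp add: split ab ab[unfolded One_nat_def] algebra_simps)
  qed
  \<comment> \<open>The pairing counts every permutation twice, which is why the double is treated
    and \<open>half_in_J\<close> is applied.\<close>
  have s: "Xdet k is js + Xdet k is js = (\<Sum>\<sigma> | \<sigma> permutes {1..k}. of_int (sign \<sigma>) *
      (Xprod k is js \<sigma> - Xprod k is js (\<sigma> \<circ> ?t)))" for js
    using signed_sum_compose_right[OF p, of "Xprod k is js"]
    by (simp add: Xdet_def right_diff_distrib sum_subtractf)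
  have "Xdet k is ?js + Xdet k is ?js' + (Xdet k is ?js + Xdet k is ?js') =
    (Xdet k is ?js + Xdet k is ?js) + (Xdet k is ?js' + Xdet k is ?js')" by (simp add: algebra_simps)
  also have "\<dots> = (\<Sum>\<sigma> | \<sigma> permutes {1..k}. tens_const (of_int (sign \<sigma>)) *
     (Xprod k is ?js \<sigma> - Xprod k is ?js (\<sigma> \<circ> ?t) + (Xprod k is ?js' \<sigma> - Xprod k is ?js' (\<sigma> \<circ> ?t))))"
    unfolding s tens_const_of_int by (simp add: sum.distrib distrib_left)
  also have "\<dots> \<in> J n" using cols_J by (intro J(8) J(7)) auto
  finally show "Xdet k is ?js + Xdet k is ?js' + (Xdet k is ?js + Xdet k is ?js') \<in> J n" .
qed

text \<open>A simultaneous exchange in rows and columns produces two signs, which cancel modulo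
  \<open>J n\<close>.\<close>

lemma Xdet_sort:
  assumes "is \<in> index_lists n k"
  shows "Xdet k is is - Xdet k (sort is) (sort is) \<in> J n"
proof (rule mset_eq_adjacent_swaps[where M="mset is" and R="\<lambda>is js. Xdet k is is - Xdet k js js \<in> J n"])
  fix xs a b ys assume "mset (xs @ a # b # ys) = mset is"
  then have "set (xs @ a # b # ys) = set is" "length (xs @ a # b # ys) = length is"
    by (metis set_mset_mset, metis size_mset)
  then have i: "xs @ a # b # ys \<in> index_lists n k"
    using assms unfolding index_lists_def by (metis (no_types, lifting) mem_Collect_eq)
  have "Xdet k (xs @ a # b # ys) (xs @ a # b # ys) + Xdet k (xs @ a # b # ys) (xs @ b # a # ys) \<in> J n"
    by (rule Xdet_swap_columns[OF i i])
  moreover have "Xdet k (xs @ b # a # ys) (xs @ b # a # ys) = - Xdet k (xs @ a # b # ys) (xs @ b # a # ys)"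
    using i by (intro Xdet_swap_rows) (simp add: index_lists_def)
  ultimately show "Xdet k (xs @ a # b # ys) (xs @ a # b # ys) - Xdet k (xs @ b # a # ys) (xs @ b # a # ys) \<in> J n"
    by simp
qed (auto simp: J(2) intro: J_trans)

text \<open>Lists with a repeated entry have determinant zero, and each set of \<open>k\<close>
  indices has \<open>fact k\<close> orderings with congruent determinants.\<close>

lemma sum_Xdet_Hlift:
  "(\<Sum>is\<in>index_lists n k. Xdet k is is) - tens_const (fact k) * Hlift n k \<in> J n"
proof -
  let ?D = "{is \<in> index_lists n k. distinct is}"
  have "(\<Sum>is\<in>index_lists n k. Xdet k is is) = (\<Sum>is\<in>?D. Xdet k is is)"
    by (rule sum.mono_neutral_right[OF finite_index_lists]) (auto simp: index_lists_def intro: Xdet_eq_0)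
  then have 1: "(\<Sum>is\<in>index_lists n k. Xdet k is is) - (\<Sum>is\<in>?D. Xdet k (sort is) (sort is)) \<in> J n"
    using J(8)[of ?D "\<lambda>is. Xdet k is is - Xdet k (sort is) (sort is)" n] Xdet_sort
    by (simp add: sum_subtractf)
  have fin: "finite ?D" by (rule finite_subset[OF _ finite_index_lists[of n k]]) auto
  have img: "sort ` ?D \<subseteq> incr_seqs n k"
    by (auto simp: incr_seqs_def index_lists_def strict_sorted_iff)
  have "(\<Sum>is\<in>?D. Xdet k (sort is) (sort is)) =
    (\<Sum>I\<in>incr_seqs n k. \<Sum>is | is \<in> ?D \<and> sort is = I. Xdet k (sort is) (sort is))"
    by (rule sum.group[OF fin finite_incr_seqs img, symmetric])
  also have "\<dots> = (\<Sum>I\<in>incr_seqs n k. tens_const (fact k) * Xdet k I I)"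
  proof (intro sum.cong refl)
    fix I assume I: "I \<in> incr_seqs n k"
    have "{is. is \<in> ?D \<and> sort is = I} = permutations_of_set (set I)"
    proof (rule subset_antisym; rule subsetI)
      fix "is" assume "is \<in> {is. is \<in> ?D \<and> sort is = I}"
      then show "is \<in> permutations_of_set (set I)" by (auto simp: permutations_of_set_def)
    next
      fix "is" assume "is \<in> permutations_of_set (set I)"
      then have a: "set is = set I" "distinct is" by (auto simp: permutations_of_set_def)
      then have "sort is = I"
        using I by (intro sorted_distinct_set_unique) (auto simp: incr_seqs_def strict_sorted_iff)
      moreover have "length is = k"
        using a distinct_card[of "is"] distinct_card[OF incr_seqs_distinct[OF I]] I by (simp add: incr_seqs_def)
      ultimately show "is \<in> {is. is \<in> ?D \<and> sort is = I}"
        using a I by (auto simp: index_lists_def incr_seqs_def)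
    qed
    moreover have "card (set I) = k" using I incr_seqs_distinct[OF I] by (simp add: distinct_card incr_seqs_def)
    ultimately have "card {is. is \<in> ?D \<and> sort is = I} = fact k" by simp
    moreover have "(\<Sum>is | is \<in> ?D \<and> sort is = I. Xdet k (sort is) (sort is)) =
      (\<Sum>is | is \<in> ?D \<and> sort is = I. Xdet k I I)" by (intro sum.cong) auto
    ultimately show "(\<Sum>is | is \<in> ?D \<and> sort is = I. Xdet k (sort is) (sort is)) = tens_const (fact k) * Xdet k I I"
      using tens_const_of_nat[of "fact k"] by simp
  qed
  also have "\<dots> = tens_const (fact k) * Hlift n k" by (simp add: Hlift_eq sum_distrib_left)
  finally show ?thesis using 1 by simp
qed

section \<open>Commutators with products and centrality\<close>

lemma prod_list_upd_diff:
  fixes f :: "'b \<Rightarrow> 'a :: ring_1"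
  assumes "distinct ss" "s \<in> set ss"
  shows "(\<Prod>t\<leftarrow>ss. (f(s := u - v)) t) = (\<Prod>t\<leftarrow>ss. (f(s := u)) t) - (\<Prod>t\<leftarrow>ss. (f(s := v)) t)"
proof -
  obtain us vs where ss: "ss = us @ s # vs" using assms(2) by (meson split_list)
  then have "s \<notin> set us" "s \<notin> set vs" using assms(1) by auto
  then have *: "map (f(s := x)) us = map f us" "map (f(s := x)) vs = map f vs" for x by auto
  show ?thesis unfolding ss by (simp only: map_append list.map * prod_list.append prod_list.Cons fun_upd_same)
      (simp add: algebra_simps)
qed

lemma prod_list_upd_0:
  fixes f :: "'b \<Rightarrow> 'a :: ring_1"
  assumes "distinct ss" "s \<in> set ss"
  shows "(\<Prod>t\<leftarrow>ss. (f(s := 0)) t) = 0"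
  using prod_list_upd_diff[OF assms, of f 0 0] by simp

text \<open>The Leibniz rule modulo \<open>J n\<close>. The terms are written as products with the
  entry at \<open>s\<close> replaced, so that they match \<open>Xprod\<close> with one index
  changed; distinctness lets \<open>s\<close> mark a single position.\<close>

lemma J_prod_list_derivation:
  assumes "e \<in> T n" "\<And>s. s \<in> set ss \<Longrightarrow> f s \<in> T n" "\<And>s. s \<in> set ss \<Longrightarrow> d s \<in> T n"
    and "\<And>s. s \<in> set ss \<Longrightarrow> e * f s - f s * e - d s \<in> J n" "distinct ss"
  shows "e * (\<Prod>s\<leftarrow>ss. f s) - (\<Prod>s\<leftarrow>ss. f s) * e - (\<Sum>s\<in>set ss. \<Prod>t\<leftarrow>ss. (f(s := d s)) t) \<in> J n"
  using assms(2-5)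
proof (induction ss)
  case Nil
  then show ?case using J(2) by simp
next
  case (Cons r ss)
  let ?P = "\<Prod>s\<leftarrow>ss. f s"
  let ?S = "\<Sum>s\<in>set ss. \<Prod>t\<leftarrow>ss. (f(s := d s)) t"
  have r: "r \<notin> set ss" using Cons by auto
  have "map (f(r := d r)) ss = map f ss" using r by auto
  then have 1: "(\<Prod>t\<leftarrow>r # ss. (f(r := d r)) t) = d r * ?P"
    by (simp only: list.map prod_list.Cons fun_upd_same)
  have 2: "(\<Sum>s\<in>set ss. \<Prod>t\<leftarrow>r # ss. (f(s := d s)) t) = f r * ?S"
    unfolding sum_distrib_left
  proof (intro sum.cong refl)
    fix x assume "x \<in> set ss"
    then have "r \<noteq> x" using r by auto
    show "(\<Prod>t\<leftarrow>r # ss. (f(x := d x)) t) = f r * (\<Prod>t\<leftarrow>ss. (f(x := d x)) t)"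
      by (simp only: list.map prod_list.Cons fun_upd_other[OF \<open>r \<noteq> x\<close>])
  qed
  have "(e * f r - f r * e - d r) * ?P + f r * (e * ?P - ?P * e - ?S) \<in> J n"
    using Cons by (intro J(3) J_rmult J(4) T_prod_list) auto
  moreover have "(\<Sum>s\<in>set (r # ss). \<Prod>t\<leftarrow>r # ss. (f(s := d s)) t) = d r * ?P + f r * ?S"
    using r 1 2 by (simp del: fun_upd_apply)
  ultimately show ?case by (simp add: algebra_simps del: fun_upd_apply)
qed

text \<open>The scalar shift commutes with everything, and on the right the shifts of both terms
  appear exactly when \<open>b = i\<close> and \<open>j = a\<close> hold together, where they
  cancel.\<close>

lemma X_commutator_J:
  assumes "a \<in> {1..n}" "b \<in> {1..n}" "i \<in> {1..n}" "j \<in> {1..n}"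
  shows "tens_e a b * X c i j - X c i j * tens_e a b -
    ((if b = i then X c a j else 0) - (if j = a then X c i b else 0)) \<in> J n"
proof -
  have "tens_e a b * X c i j - X c i j * tens_e a b - ((if b = i then X c a j else 0) - (if j = a then X c i b else 0))
    = tens_e a b * tens_e i j - tens_e i j * tens_e a b - ((if b = i then tens_e a j else 0) - (if j = a then tens_e i b else 0))"
    by (cases "i = j"; cases "b = i"; cases "j = a")
      (simp_all add: X_def algebra_simps tens_const_commute[of "of_nat c"])
  then show ?thesis using gl_relation_J[OF assms] by simp
qed

lemma Xprod_commutator_J:
  assumes "a \<in> {1..n}" "b \<in> {1..n}" "is \<in> index_lists n k" "js \<in> index_lists n k" "\<sigma> permutes {1..k}"
  shows "tens_e a b * Xprod k is js \<sigma> - Xprod k is js \<sigma> * tens_e a b -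
    ((\<Sum>r\<in>{1..k}. if is ! (r - 1) = b then Xprod k (is[r - 1 := a]) js \<sigma> else 0) -
     (\<Sum>r\<in>{1..k}. if js ! (r - 1) = a then Xprod k is (js[r - 1 := b]) \<sigma> else 0)) \<in> J n"
proof -
  let ?f = "\<lambda>s. X (k - s) (is ! (\<sigma> s - 1)) (js ! (s - 1))"
  let ?u = "\<lambda>s. if b = is ! (\<sigma> s - 1) then X (k - s) a (js ! (s - 1)) else 0"
  let ?v = "\<lambda>s. if js ! (s - 1) = a then X (k - s) (is ! (\<sigma> s - 1)) b else 0"
  let ?ss = "cols k"
  have ss: "set ?ss = {1..k}" by simp
  have len: "length is = k" "length js = k" using assms by (auto simp: index_lists_def)
  have idx: "is ! (\<sigma> s - 1) \<in> {1..n}" "js ! (s - 1) \<in> {1..n}" "\<sigma> s \<in> {1..k}" if "s \<in> {1..k}" for s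
    using that permutes_in_image[OF assms(5), of s] index_lists_nth[OF assms(3), of "\<sigma> s"]
      index_lists_nth[OF assms(4), of s] by auto
  have 1: "tens_e a b * Xprod k is js \<sigma> - Xprod k is js \<sigma> * tens_e a b -
    (\<Sum>s\<in>set ?ss. \<Prod>t\<leftarrow>?ss. (?f(s := ?u s - ?v s)) t) \<in> J n"
    unfolding Xprod_def
  proof (rule J_prod_list_derivation)
    fix s assume "s \<in> set ?ss"
    then have s: "s \<in> {1..k}" by auto
    show "?f s \<in> T n" using idx[OF s] by (intro X_T)
    show "?u s - ?v s \<in> T n"
      using X_T[OF assms(1) idx(2)[OF s]] X_T[OF idx(1)[OF s] assms(2)] by (intro T_diff) auto
    show "tens_e a b * ?f s - ?f s * tens_e a b - (?u s - ?v s) \<in> J n"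
      by (rule X_commutator_J[OF assms(1,2) idx(1,2)[OF s]])
  qed (use assms in \<open>auto intro: T_e\<close>)
  have u: "(\<Prod>t\<leftarrow>?ss. (?f(s := ?u s)) t) = (if is ! (\<sigma> s - 1) = b then Xprod k (is[\<sigma> s - 1 := a]) js \<sigma> else 0)"
    if s: "s \<in> {1..k}" for s
  proof (cases "is ! (\<sigma> s - 1) = b")
    case True
    have "(\<Prod>t\<leftarrow>?ss. (?f(s := ?u s)) t) = Xprod k (is[\<sigma> s - 1 := a]) js \<sigma>"
      unfolding Xprod_def
    proof (intro arg_cong[where f=prod_list] map_cong refl)
      fix t assume "t \<in> set ?ss"
      then have t: "t \<in> {1..k}" by auto
      have "\<sigma> t - 1 = \<sigma> s - 1 \<longleftrightarrow> \<sigma> t = \<sigma> s" using idx(3)[OF t] idx(3)[OF s] by auto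
      also have "\<dots> \<longleftrightarrow> t = s" by (rule inj_eq[OF permutes_inj[OF assms(5)]])
      finally have "\<sigma> t - 1 = \<sigma> s - 1 \<longleftrightarrow> t = s" .
      then show "(?f(s := ?u s)) t = X (k - t) (is[\<sigma> s - 1 := a] ! (\<sigma> t - 1)) (js ! (t - 1))"
        using True idx(3)[OF s] len by (auto simp: nth_list_update)
    qed
    then show ?thesis by (subst if_P[OF True])
  next
    case False
    then have "?u s = 0" by auto
    then show ?thesis using prod_list_upd_0[of ?ss s ?f] s False by simp
  qed
  have v: "(\<Prod>t\<leftarrow>?ss. (?f(s := ?v s)) t) = (if js ! (s - 1) = a then Xprod k is (js[s - 1 := b]) \<sigma> else 0)"
    if s: "s \<in> {1..k}" for s
  proof (cases "js ! (s - 1) = a")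
    case True
    have "(\<Prod>t\<leftarrow>?ss. (?f(s := ?v s)) t) = Xprod k is (js[s - 1 := b]) \<sigma>"
      unfolding Xprod_def
    proof (intro arg_cong[where f=prod_list] map_cong refl)
      fix t assume "t \<in> set ?ss"
      then have t: "t \<in> {1..k}" by auto
      have "t - 1 = s - 1 \<longleftrightarrow> t = s" using t s by auto
      then show "(?f(s := ?v s)) t = X (k - t) (is ! (\<sigma> t - 1)) (js[s - 1 := b] ! (t - 1))"
        using True s len by (auto simp: nth_list_update)
    qed
    then show ?thesis by (subst (2) if_P[OF True])
  next
    case False
    then have "?v s = 0" by auto
    then show ?thesis using prod_list_upd_0[of ?ss s ?f] s False by simp
  qed
  have "(\<Sum>s\<in>set ?ss. \<Prod>t\<leftarrow>?ss. (?f(s := ?u s - ?v s)) t) =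
    (\<Sum>s\<in>{1..k}. (\<Prod>t\<leftarrow>?ss. (?f(s := ?u s)) t) - (\<Prod>t\<leftarrow>?ss. (?f(s := ?v s)) t))"
    unfolding ss by (intro sum.cong refl prod_list_upd_diff) auto
  also have "\<dots> = (\<Sum>s\<in>{1..k}. if is ! (\<sigma> s - 1) = b then Xprod k (is[\<sigma> s - 1 := a]) js \<sigma> else 0) -
     (\<Sum>s\<in>{1..k}. if js ! (s - 1) = a then Xprod k is (js[s - 1 := b]) \<sigma> else 0)"
    unfolding sum_subtractf using u v by (intro arg_cong2[where f="(-)"] sum.cong refl) blast+
  \<comment> \<open>Row changes are found in column order; reindexing by \<sigma> lists them by row
    position.\<close>
  also have "(\<Sum>s\<in>{1..k}. if is ! (\<sigma> s - 1) = b then Xprod k (is[\<sigma> s - 1 := a]) js \<sigma> else 0) =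
    (\<Sum>r\<in>{1..k}. if is ! (r - 1) = b then Xprod k (is[r - 1 := a]) js \<sigma> else 0)"
    by (subst (2) sum.permute[OF assms(5)]) (simp add: o_def)
  finally show ?thesis using 1 by simp
qed

text \<open>Commuting with the letter \<open>(a, b)\<close> turns one row index \<open>b\<close>
  into \<open>a\<close> and, with a minus sign, one column index \<open>a\<close> into
  \<open>b\<close>. Over all lists, replacing the entry at position \<open>r\<close> is a bijection
  between the two kinds of terms, so the sums cancel exactly for each \<sigma>.\<close>

lemma sum_Xdet_central: "central_mod n (\<Sum>is\<in>index_lists n k. Xdet k is is)"
proof (rule central_modI)
  show "(\<Sum>is\<in>index_lists n k. Xdet k is is) \<in> T n"
    using Xdet_T_filt by (intro T_sum T_filt_T) blast
next
  fix a b assume ab: "a \<in> {1..n}" "b \<in> {1..n}"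
  let ?L = "index_lists n k" and ?S = "{\<sigma>. \<sigma> permutes {1..k}}"
  let ?e = "tens_e a b"
  let ?c = "\<lambda>\<sigma> :: nat \<Rightarrow> nat. tens_const (of_int (sign \<sigma>))"
  let ?R = "\<lambda>is \<sigma>. \<Sum>r\<in>{1..k}. if is ! (r - 1) = b then Xprod k (is[r - 1 := a]) is \<sigma> else 0"
  let ?C = "\<lambda>is \<sigma>. \<Sum>r\<in>{1..k}. if is ! (r - 1) = a then Xprod k is (is[r - 1 := b]) \<sigma> else 0"
  let ?Z = "\<Sum>is\<in>?L. Xdet k is is"
  have Z: "?Z = (\<Sum>\<sigma>\<in>?S. \<Sum>is\<in>?L. ?c \<sigma> * Xprod k is is \<sigma>)"
    unfolding Xdet_def tens_const_of_int by (rule sum.swap)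
  have "(\<Sum>\<sigma>\<in>?S. \<Sum>is\<in>?L. ?c \<sigma> * (?e * Xprod k is is \<sigma> - Xprod k is is \<sigma> * ?e - (?R is \<sigma> - ?C is \<sigma>))) \<in> J n"
    by (intro J(8) J(7) Xprod_commutator_J ab) auto
  also have "(\<Sum>\<sigma>\<in>?S. \<Sum>is\<in>?L. ?c \<sigma> * (?e * Xprod k is is \<sigma> - Xprod k is is \<sigma> * ?e - (?R is \<sigma> - ?C is \<sigma>))) =
    ?e * ?Z - ?Z * ?e - (\<Sum>\<sigma>\<in>?S. ?c \<sigma> * ((\<Sum>is\<in>?L. ?R is \<sigma>) - (\<Sum>is\<in>?L. ?C is \<sigma>)))"
    unfolding Z sum_distrib_left sum_distrib_right right_diff_distrib sum_subtractf
    by (simp add: tens_const_left_commute mult.assoc)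
  also have "(\<Sum>\<sigma>\<in>?S. ?c \<sigma> * ((\<Sum>is\<in>?L. ?R is \<sigma>) - (\<Sum>is\<in>?L. ?C is \<sigma>))) = 0"
  proof (rule sum.neutral, rule ballI)
    fix \<sigma>
    have eq_r: "(\<Sum>is\<in>?L. if is ! (r - 1) = b then Xprod k (is[r - 1 := a]) is \<sigma> else 0) =
      (\<Sum>is\<in>?L. if is ! (r - 1) = a then Xprod k is (is[r - 1 := b]) \<sigma> else 0)" if r: "r \<in> {1..k}" for r
    proof -
      have "(\<Sum>is | is \<in> ?L \<and> is ! (r - 1) = b. Xprod k (is[r - 1 := a]) is \<sigma>) =
        (\<Sum>is | is \<in> ?L \<and> is ! (r - 1) = a. Xprod k is (is[r - 1 := b]) \<sigma>)"
      proof (rule sum.reindex_bij_witness[where i="\<lambda>is. is[r - 1 := b]" and j="\<lambda>is. is[r - 1 := a]"])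
        fix "is" assume i: "is \<in> {is. is \<in> ?L \<and> is ! (r - 1) = b}"
        then show "is[r - 1 := a] \<in> {is. is \<in> ?L \<and> is ! (r - 1) = a}"
          using ab r set_update_subset_insert[of "is" "r - 1" a] by (auto simp: index_lists_def)
        show "is[r - 1 := a, r - 1 := b] = is" using i by auto
        then show "Xprod k (is[r - 1 := a]) (is[r - 1 := a, r - 1 := b]) \<sigma> = Xprod k (is[r - 1 := a]) is \<sigma>" by simp
      next
        fix "is" assume i: "is \<in> {is. is \<in> ?L \<and> is ! (r - 1) = a}"
        then show "is[r - 1 := b] \<in> {is. is \<in> ?L \<and> is ! (r - 1) = b}"
          using ab r set_update_subset_insert[of "is" "r - 1" b] by (auto simp: index_lists_def)
        show "is[r - 1 := b, r - 1 := a] = is" using i by auto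
      qed
      then show ?thesis by (simp only: sum.inter_filter[OF finite_index_lists])
    qed
    have "(\<Sum>is\<in>?L. ?R is \<sigma>) = (\<Sum>is\<in>?L. ?C is \<sigma>)"
      by (subst (1 2) sum.swap) (rule sum.cong[OF refl], rule eq_r)
    then show "?c \<sigma> * ((\<Sum>is\<in>?L. ?R is \<sigma>) - (\<Sum>is\<in>?L. ?C is \<sigma>)) = 0" by simp
  qed
  finally have "?e * ?Z - ?Z * ?e \<in> J n" by simp
  then show "?Z * ?e - ?e * ?Z \<in> J n" by (rule J_sym)
qed

theorem Hlift_central: "central_mod n (Hlift n k)"
proof -
  let ?Z = "\<Sum>is\<in>index_lists n k. Xdet k is is"
  have "tens_const (1 / fact k) * (?Z - tens_const (fact k) * Hlift n k) \<in> J n"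
    by (intro J(7) sum_Xdet_Hlift)
  then have "tens_const (1 / fact k) * ?Z - Hlift n k \<in> J n"
    by (simp add: right_diff_distrib mult.assoc[symmetric] flip: tens_const_mult)
  then show ?thesis
    using central_mod_cong[OF central_mod_mult[OF central_mod_const sum_Xdet_central] Hlift_T] by blast
qed

section \<open>Symbols of the Capelli elements on diagonal matrices\<close>

lemma symb_prod_list:
  "(\<And>s. s \<in> set ss \<Longrightarrow> f s \<in> T_filt n 1) \<Longrightarrow>
    symb (length ss) A (\<Prod>s\<leftarrow>ss. f s) = (\<Prod>s\<leftarrow>ss. symb 1 A (f s))"
proof (induction ss)
  case Nil
  then show ?case using symb_word[of 0 A "[]"] by simp
next
  case (Cons s ss)
  have "symb (1 + length ss) A (f s * (\<Prod>s\<leftarrow>ss. f s)) = symb 1 A (f s) * symb (length ss) A (\<Prod>s\<leftarrow>ss. f s)"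
    by (rule symb_mult[OF _ T_filt_prod_list]) (use Cons in auto)
  then show ?case using Cons by simp
qed

lemma prod_list_upt: "(\<Prod>s\<leftarrow>cols k. f s) = (\<Prod>s=1..k. f s :: 'a :: comm_monoid_mult)"
proof -
  have "(\<Prod>s\<leftarrow>cols k. f s) = prod f (set (cols k))"
    by (rule prod.distinct_set_conv_list[symmetric]) simp
  then show ?thesis by simp
qed

text \<open>The shifts have degree zero and drop out of the symbol, and a permutation other than the
  identity meets an off-diagonal entry of \<open>diag d\<close>.\<close>

lemma symb_diag_Hlift: "symb k (diag d) (Hlift n k) = e_fun 0 n k d"
  unfolding Hlift_eq symb_sum e_fun_def
proof (intro sum.cong refl)
  fix "is" assume i: "is \<in> incr_seqs n k"
  have il: "is \<in> index_lists n k" by (rule incr_seqs_index_lists[OF i])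
  have S: "symb k (diag d) (Xprod k is is \<sigma>) = (\<Prod>s=1..k. diag d (is ! (\<sigma> s - 1), is ! (s - 1)))"
    if \<sigma>: "\<sigma> permutes {1..k}" for \<sigma>
  proof -
    have "symb (length (cols k)) (diag d) (Xprod k is is \<sigma>) =
      (\<Prod>s\<leftarrow>cols k. symb 1 (diag d) (X (k - s) (is ! (\<sigma> s - 1)) (is ! (s - 1))))"
      unfolding Xprod_def
    proof (rule symb_prod_list)
      fix s assume "s \<in> set (cols k)"
      then have "s \<in> {1..k}" "\<sigma> s \<in> {1..k}" using permutes_in_image[OF \<sigma>, of s] by auto
      then show "X (k - s) (is ! (\<sigma> s - 1)) (is ! (s - 1)) \<in> T_filt n 1"
        by (intro X_T_filt index_lists_nth[OF il])
    qed
    moreover have "symb 1 (diag d) (X c p q) = diag d (p, q)" for c p q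
      by (simp add: X_def symb_add symb_e symb_const)
    ultimately show ?thesis by (simp only: prod_list_upt) simp
  qed
  have nid: "(\<Prod>s=1..k. diag d (is ! (\<sigma> s - 1), is ! (s - 1))) = 0" if \<sigma>: "\<sigma> permutes {1..k}" "\<sigma> \<noteq> id" for \<sigma>
  proof -
    obtain s where s: "\<sigma> s \<noteq> s" using \<sigma>(2) by (auto simp: fun_eq_iff)
    then have sk: "s \<in> {1..k}" using \<sigma>(1) by (meson permutes_not_in)
    then have "\<sigma> s \<in> {1..k}" using permutes_in_image[OF \<sigma>(1)] by blast
    then have "is ! (\<sigma> s - 1) \<noteq> is ! (s - 1)"
      using sk s incr_seqs_distinct[OF i] i by (subst nth_eq_iff_index_eq) (auto simp: incr_seqs_def)
    then have "diag d (is ! (\<sigma> s - 1), is ! (s - 1)) = 0" by (simp add: diag_def)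
    then show ?thesis using sk by (intro prod_zero) auto
  qed
  have "symb k (diag d) (Xdet k is is) = (\<Sum>\<sigma> | \<sigma> permutes {1..k}. of_int (sign \<sigma>) *
      (\<Prod>s=1..k. diag d (is ! (\<sigma> s - 1), is ! (s - 1))))"
    unfolding Xdet_def symb_sum tens_const_of_int[symmetric] symb_cmult
    by (intro sum.cong refl) (simp add: S)
  also have "\<dots> = (\<Sum>\<sigma>\<in>{id}. of_int (sign \<sigma>) * (\<Prod>s=1..k. diag d (is ! (\<sigma> s - 1), is ! (s - 1))))"
  proof (rule sum.mono_neutral_right)
    show "\<forall>\<sigma>\<in>{\<sigma>. \<sigma> permutes {1..k}} - {id}. of_int (sign \<sigma>) *
      (\<Prod>s=1..k. diag d (is ! (\<sigma> s - 1), is ! (s - 1))) = 0"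
    proof
      fix \<sigma> assume "\<sigma> \<in> {\<sigma>. \<sigma> permutes {1..k}} - {id}"
      then have "(\<Prod>s=1..k. diag d (is ! (\<sigma> s - 1), is ! (s - 1))) = 0" by (intro nid) auto
      then show "of_int (sign \<sigma>) * (\<Prod>s=1..k. diag d (is ! (\<sigma> s - 1), is ! (s - 1))) = 0"
        by (simp only: mult_zero_right)
    qed
  qed (auto simp: permutes_id finite_permutations)
  also have "\<dots> = (\<Prod>r=1..k. d (is ! (r - 1)) + 0 * of_nat (k - r))"
    by (simp add: diag_def)
  finally show "symb k (diag d) (Xdet k is is) = (\<Prod>r=1..k. d (is ! (r - 1)) + 0 * of_nat (k - r))" .
qed

section \<open>The eigenvalues of the Capelli elements on highest weight vectors\<close>

text \<open>Axiomatises the annihilator of a vector of highest weight \<mu>: congruence to a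
  constant modulo \<open>L\<close> stands for acting on that vector by the constant. Abstract
  modules and explicit functions are covered alike; properness, \<open>1 \<notin> L\<close>, is
  stated separately.\<close>

definition hw_ideal :: "nat \<Rightarrow> (nat \<Rightarrow> complex) \<Rightarrow> tens set \<Rightarrow> bool" where
  "hw_ideal n \<mu> L \<longleftrightarrow> left_ideal n L \<and> J n \<subseteq> L \<and>
    (\<forall>i\<in>{1..n}. \<forall>j\<in>{1..n}. i < j \<longrightarrow> tens_e i j \<in> L) \<and>
    (\<forall>i\<in>{1..n}. tens_e i i - tens_const (\<mu> i) \<in> L)"

lemma hw_ideal_diag_prod:
  assumes "hw_ideal n \<mu> L" "\<And>s. s \<in> set ss \<Longrightarrow> g s \<in> {1..n}"
  shows "(\<Prod>s\<leftarrow>ss. X (c s) (g s) (g s)) - tens_const (\<Prod>s\<leftarrow>ss. \<mu> (g s) + of_nat (c s)) \<in> L"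
  using assms(2)
proof (induction ss)
  case Nil
  then show ?case using assms(1) left_idealD(2) by (auto simp: hw_ideal_def)
next
  case (Cons s ss)
  have L: "left_ideal n L" using assms(1) by (simp add: hw_ideal_def)
  let ?P = "\<Prod>s\<leftarrow>ss. X (c s) (g s) (g s)" and ?q = "\<Prod>s\<leftarrow>ss. \<mu> (g s) + of_nat (c s)"
  let ?X = "X (c s) (g s) (g s)"
  have g: "g s \<in> {1..n}" using Cons by simp
  have "?X * (?P - tens_const ?q) \<in> L" using Cons g by (intro left_idealD(4)[OF L] X_T) auto
  moreover have "tens_e (g s) (g s) - tens_const (\<mu> (g s)) \<in> L" using assms(1) g by (auto simp: hw_ideal_def)
  then have "tens_const ?q * (tens_e (g s) (g s) - tens_const (\<mu> (g s))) \<in> L" by (rule left_idealD(7)[OF L])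
  ultimately have "?X * (?P - tens_const ?q) + tens_const ?q * (tens_e (g s) (g s) - tens_const (\<mu> (g s))) \<in> L"
    by (rule left_idealD(3)[OF L])
  also have "?X * (?P - tens_const ?q) + tens_const ?q * (tens_e (g s) (g s) - tens_const (\<mu> (g s))) =
    ?X * ?P - tens_const ((\<mu> (g s) + of_nat (c s)) * ?q)"
    unfolding X_def
    by (simp add: algebra_simps tens_const_add tens_const_mult tens_const_commute[of "prod_list _"])
  finally show ?case by simp
qed

text \<open>For \<sigma> other than the identity let \<open>s\<close> be the largest moved column.
  The columns behind it are diagonal and act by scalars, and \<open>\<sigma> s < s\<close> makes the
  factor in column \<open>s\<close> a raising operator, which lies in \<open>L\<close>. The identity
  remains, with the shifts \<open>k - r\<close>.\<close>

lemma hw_ideal_Hlift: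
  assumes "hw_ideal n \<mu> L"
  shows "Hlift n k - tens_const (e_fun 1 n k \<mu>) \<in> L"
proof -
  have L: "left_ideal n L" using assms by (simp add: hw_ideal_def)
  have "Xdet k is is - tens_const (\<Prod>r=1..k. \<mu> (is ! (r - 1)) + 1 * of_nat (k - r)) \<in> L"
    if i: "is \<in> incr_seqs n k" for "is"
  proof -
    have il: "is \<in> index_lists n k" by (rule incr_seqs_index_lists[OF i])
    have id_term: "Xprod k is is id - tens_const (\<Prod>r=1..k. \<mu> (is ! (r - 1)) + 1 * of_nat (k - r)) \<in> L"
    proof -
      have "Xprod k is is id - tens_const (\<Prod>s\<leftarrow>cols k. \<mu> (is ! (s - 1)) + of_nat (k - s)) \<in> L"
        unfolding Xprod_def id_apply
        by (rule hw_ideal_diag_prod[OF assms, where c="\<lambda>s. k - s" and g="\<lambda>s. is ! (s - 1)"])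
          (use index_lists_nth[OF il] in simp)
      then show ?thesis by (simp only: prod_list_upt) simp
    qed
    have other: "Xprod k is is \<sigma> \<in> L" if \<sigma>: "\<sigma> permutes {1..k}" "\<sigma> \<noteq> id" for \<sigma>
    proof -
      define s where "s = Max {s. \<sigma> s \<noteq> s}"
      have sub: "{s. \<sigma> s \<noteq> s} \<subseteq> {1..k}" using \<sigma>(1) by (auto simp: permutes_not_in dest: permutes_not_in)
      then have fin: "finite {s. \<sigma> s \<noteq> s}" by (rule finite_subset) simp
      have ne: "{s. \<sigma> s \<noteq> s} \<noteq> {}" using \<sigma>(2) by (auto simp: fun_eq_iff)
      have s: "\<sigma> s \<noteq> s" using Max_in[OF fin ne] by (simp add: s_def)
      then have sk: "s \<in> {1..k}" using sub by blast
      have fix_above: "\<sigma> t = t" if "t > s" for t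
        using Max_ge[OF fin, of t] that by (auto simp: s_def)
      have "\<sigma> s < s"
      proof (rule ccontr)
        assume "\<not> \<sigma> s < s"
        then have "\<sigma> (\<sigma> s) = \<sigma> s" using fix_above[of "\<sigma> s"] s by simp
        then show False using s by (simp add: inj_eq[OF permutes_inj[OF \<sigma>(1)]])
      qed
      have \<sigma>k: "\<sigma> t \<in> {1..k}" if "t \<in> {1..k}" for t using that permutes_in_image[OF \<sigma>(1)] by blast
      let ?f = "\<lambda>t. X (k - t) (is ! (\<sigma> t - 1)) (is ! (t - 1))"
      have upt: "cols k = [1..<s] @ s # [s+1..<k+1]"
        by (rule cols_split[OF sk])
      define pre where "pre = (\<Prod>t\<leftarrow>[1..<s]. ?f t)"
      define post where "post = (\<Prod>t\<leftarrow>[s+1..<k+1]. ?f t)"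
      define q where "q = (\<Prod>t\<leftarrow>[s+1..<k+1]. \<mu> (is ! (t - 1)) + of_nat (k - t))"
      have "post = (\<Prod>t\<leftarrow>[s+1..<k+1]. X (k - t) (is ! (t - 1)) (is ! (t - 1)))"
        unfolding post_def using fix_above by (intro arg_cong[where f=prod_list] map_cong refl) auto
      then have post: "post - tens_const q \<in> L"
        unfolding q_def
      proof (simp only:, intro hw_ideal_diag_prod[OF assms, where c="\<lambda>t. k - t" and g="\<lambda>t. is ! (t - 1)"])
        fix t assume "t \<in> set [s+1..<k+1]"
        then show "is ! (t - 1) \<in> {1..n}" using sk by (intro index_lists_nth[OF il]) auto
      qed
      have preT: "pre \<in> T n"
        unfolding pre_def
      proof (intro T_prod_list X_T)
        fix t assume "t \<in> set [1..<s]"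
        then have "t \<in> {1..k}" using sk by auto
        then show "is ! (\<sigma> t - 1) \<in> {1..n}" "is ! (t - 1) \<in> {1..n}"
          using index_lists_nth[OF il] \<sigma>k by blast+
      qed
      have "\<sigma> s - 1 < s - 1" "s - 1 < k" using \<open>\<sigma> s < s\<close> sk \<sigma>k[OF sk] by auto
      then have lt: "is ! (\<sigma> s - 1) < is ! (s - 1)"
        using i by (simp add: incr_seqs_def sorted_wrt_iff_nth_less)
      have "tens_e (is ! (\<sigma> s - 1)) (is ! (s - 1)) \<in> L"
        using assms lt index_lists_nth[OF il sk] index_lists_nth[OF il \<sigma>k[OF sk]]
        unfolding hw_ideal_def by blast
      then have fs: "?f s \<in> L" using lt by (simp add: X_def)
      \<comment> \<open>The trailing factors are replaced by their scalar \<open>q\<close>, which is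
        pulled to the left of the raising factor; everything is then a left multiple of an element
        of \<open>L\<close>.\<close>
      have "pre * (?f s * (post - tens_const q) + tens_const q * ?f s) \<in> L"
        using left_idealD(1)[OF L fs]
        by (intro left_idealD(4)[OF L preT] left_idealD(3)[OF L] left_idealD(4)[OF L _ post] left_idealD(7)[OF L fs])
      also have "pre * (?f s * (post - tens_const q) + tens_const q * ?f s) = Xprod k is is \<sigma>"
        unfolding Xprod_def upt by (simp add: pre_def post_def tens_const_commute[of q] algebra_simps)
      finally show ?thesis .
    qed
    let ?S = "{\<sigma>. \<sigma> permutes {1..k}}"
    have "Xdet k is is = of_int (sign (id :: nat \<Rightarrow> nat)) * Xprod k is is id +
      (\<Sum>\<sigma>\<in>?S - {id}. of_int (sign \<sigma>) * Xprod k is is \<sigma>)"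
      unfolding Xdet_def by (rule sum.remove) (auto simp: permutes_id finite_permutations)
    then have "Xdet k is is - tens_const (\<Prod>r=1..k. \<mu> (is ! (r - 1)) + 1 * of_nat (k - r)) =
      (Xprod k is is id - tens_const (\<Prod>r=1..k. \<mu> (is ! (r - 1)) + 1 * of_nat (k - r))) +
      (\<Sum>\<sigma>\<in>?S - {id}. tens_const (of_int (sign \<sigma>)) * Xprod k is is \<sigma>)"
      by (simp add: sign_id tens_const_of_int)
    also have "\<dots> \<in> L"
      using other by (intro left_idealD(3)[OF L] id_term left_ideal_sum[OF L] left_idealD(7)[OF L]) auto
    finally show ?thesis .
  qed
  then have "(\<Sum>is\<in>incr_seqs n k. Xdet k is is - tens_const (\<Prod>r=1..k. \<mu> (is ! (r - 1)) + 1 * of_nat (k - r))) \<in> L"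
    by (rule left_ideal_sum[OF L])
  moreover have "tens_const (sum f S) = (\<Sum>x\<in>S. tens_const (f x))" for f :: "nat list \<Rightarrow> complex" and S
    by (induction S rule: infinite_finite_induct) (auto simp: tens_const_add)
  ultimately show ?thesis by (simp add: Hlift_eq e_fun_def sum_subtractf)
qed

section \<open>Highest weight vectors among polynomial functions of matrices\<close>

text \<open>The leading principal minor of size \<open>k\<close>, a highest weight vector for the
  \<open>k\<close>-th fundamental weight.\<close>

definition minor :: "nat \<Rightarrow> (nat \<times> nat \<Rightarrow> complex) \<Rightarrow> complex" where
  "minor k x = (\<Sum>\<sigma> | \<sigma> permutes {1..k}. of_int (sign \<sigma>) * (\<Prod>s\<in>{1..k}. x (\<sigma> s, s)))"

lemma poly_fun_prod: "(\<And>s. s \<in> S \<Longrightarrow> poly_fun (f s)) \<Longrightarrow> poly_fun (\<lambda>x. \<Prod>s\<in>S. f s x)"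
  by (induction S rule: infinite_finite_induct) (auto intro: poly_fun_const poly_fun_mult)

lemma poly_fun_minor: "poly_fun (minor k)"
  unfolding minor_def[abs_def] by (intro poly_fun_sum poly_fun_mult[OF poly_fun_const] poly_fun_prod poly_fun_var)

lemma vf_prod:
  assumes "finite S" "\<And>s. s \<in> S \<Longrightarrow> poly_fun (f s)"
  shows "vf i j (\<lambda>x. \<Prod>s\<in>S. f s x) = (\<lambda>x. \<Sum>s\<in>S. vf i j (f s) x * (\<Prod>t\<in>S - {s}. f t x))"
  using assms
proof (induction S rule: finite_induct)
  case (insert r S)
  have "vf i j (\<lambda>x. \<Prod>s\<in>insert r S. f s x) = vf i j (\<lambda>x. f r x * (\<Prod>s\<in>S. f s x))"
    using insert by simp
  also have "\<dots> = (\<lambda>x. vf i j (f r) x * (\<Prod>s\<in>S. f s x) + f r x * vf i j (\<lambda>x. \<Prod>s\<in>S. f s x) x)"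
    using insert by (intro vf_mult poly_fun_prod) auto
  also have "\<dots> = (\<lambda>x. \<Sum>s\<in>insert r S. vf i j (f s) x * (\<Prod>t\<in>insert r S - {s}. f t x))"
  proof
    fix x
    have "(\<Sum>s\<in>S. vf i j (f s) x * (\<Prod>t\<in>insert r S - {s}. f t x)) =
      (\<Sum>s\<in>S. f r x * (vf i j (f s) x * (\<Prod>t\<in>S - {s}. f t x)))"
    proof (intro sum.cong refl)
      fix s assume "s \<in> S"
      then have "insert r S - {s} = insert r (S - {s})" using insert by auto
      then show "vf i j (f s) x * (\<Prod>t\<in>insert r S - {s}. f t x) = f r x * (vf i j (f s) x * (\<Prod>t\<in>S - {s}. f t x))"
        using insert by simp
    qed
    moreover have "insert r S - {r} = S" using insert by auto
    ultimately show "vf i j (f r) x * (\<Prod>s\<in>S. f s x) + f r x * vf i j (\<lambda>x. \<Prod>s\<in>S. f s x) x =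
      (\<Sum>s\<in>insert r S. vf i j (f s) x * (\<Prod>t\<in>insert r S - {s}. f t x))"
      using insert by (simp add: sum_distrib_left)
  qed
  finally show ?case .
qed simp

text \<open>Every term contains exactly one entry of row \<open>j\<close>, so the derivation
  replaces row \<open>j\<close> by row \<open>i\<close>.\<close>

lemma vf_minor:
  assumes "j \<in> {1..k}"
  shows "vf i j (minor k) x = (\<Sum>\<sigma> | \<sigma> permutes {1..k}. of_int (sign \<sigma>) *
    (\<Prod>s\<in>{1..k}. x (if \<sigma> s = j then i else \<sigma> s, s)))"
proof -
  let ?S = "{\<sigma>. \<sigma> permutes {1..k}}"
  have "vf i j (minor k) x = (\<Sum>\<sigma>\<in>?S. of_int (sign \<sigma>) * vf i j (\<lambda>x. \<Prod>s\<in>{1..k}. x (\<sigma> s, s)) x)"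
    unfolding minor_def[abs_def]
    by (simp only: vf_sum vf_cmult poly_fun_mult[OF poly_fun_const] poly_fun_prod poly_fun_var)
  also have "\<dots> = (\<Sum>\<sigma>\<in>?S. of_int (sign \<sigma>) * (\<Prod>s\<in>{1..k}. x (if \<sigma> s = j then i else \<sigma> s, s)))"
  proof (intro sum.cong refl arg_cong2[where f="(*)"])
    fix \<sigma> assume "\<sigma> \<in> ?S"
    then have \<sigma>: "\<sigma> permutes {1..k}" by simp
    obtain r where r: "\<sigma> r = j" using permutes_surj[OF \<sigma>] by (metis surjD)
    have rk: "r \<in> {1..k}" using assms r permutes_in_image[OF \<sigma>, of r] by simp
    have un: "\<sigma> s = j \<longleftrightarrow> s = r" for s using r inj_eq[OF permutes_inj[OF \<sigma>], of s r] by simp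
    have "vf i j (\<lambda>x. \<Prod>s\<in>{1..k}. x (\<sigma> s, s)) x =
      (\<Sum>s\<in>{1..k}. vf i j (\<lambda>x. x (\<sigma> s, s)) x * (\<Prod>t\<in>{1..k} - {s}. x (\<sigma> t, t)))"
      by (subst vf_prod) (auto intro: poly_fun_var)
    also have "\<dots> = (\<Sum>s\<in>{1..k}. if s = r then x (i, s) * (\<Prod>t\<in>{1..k} - {s}. x (\<sigma> t, t)) else 0)"
      by (intro sum.cong) (auto simp: vf_var un)
    also have "\<dots> = x (i, r) * (\<Prod>t\<in>{1..k} - {r}. x (\<sigma> t, t))" using rk by (simp add: sum.delta)
    also have "\<dots> = (\<Prod>s\<in>{1..k}. x (if \<sigma> s = j then i else \<sigma> s, s))"
      using rk by (subst prod.remove[of "{1..k}" r]) (auto simp: un intro!: prod.cong)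
    finally show "vf i j (\<lambda>x. \<Prod>s\<in>{1..k}. x (\<sigma> s, s)) x = (\<Prod>s\<in>{1..k}. x (if \<sigma> s = j then i else \<sigma> s, s))" .
  qed
  finally show ?thesis .
qed

lemma vf_minor_large:
  assumes "k < j"
  shows "vf i j (minor k) x = 0"
proof -
  have "vf i j (minor k) x = (\<Sum>\<sigma> | \<sigma> permutes {1..k}. of_int (sign \<sigma>) * vf i j (\<lambda>x. \<Prod>s\<in>{1..k}. x (\<sigma> s, s)) x)"
    unfolding minor_def[abs_def]
    by (simp only: vf_sum vf_cmult poly_fun_mult[OF poly_fun_const] poly_fun_prod poly_fun_var)
  also have "\<dots> = 0"
  proof (rule sum.neutral, rule ballI)
    fix \<sigma> assume "\<sigma> \<in> {\<sigma>. \<sigma> permutes {1..k}}"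
    then have "\<sigma> s \<noteq> j" if "s \<in> {1..k}" for s
      using permutes_in_image[of \<sigma> "{1..k}" s] assms that by auto
    then have "vf i j (\<lambda>x. \<Prod>s\<in>{1..k}. x (\<sigma> s, s)) x = 0"
      by (subst vf_prod) (auto intro: poly_fun_var intro!: sum.neutral simp: vf_var)
    then show "of_int (sign \<sigma>) * vf i j (\<lambda>x. \<Prod>s\<in>{1..k}. x (\<sigma> s, s)) x = 0" by simp
  qed
  finally show ?thesis .
qed

definition vf_eigen :: "nat \<Rightarrow> nat \<Rightarrow> complex \<Rightarrow> ((nat \<times> nat \<Rightarrow> complex) \<Rightarrow> complex) \<Rightarrow> bool" where
  "vf_eigen i j c f \<longleftrightarrow> poly_fun f \<and> vf i j f = (\<lambda>x. c * f x)"

lemma vf_eigen_const: "vf_eigen i j 0 (\<lambda>x. d)"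
  by (simp add: vf_eigen_def poly_fun_const)

lemma vf_eigen_mult: "vf_eigen i j c f \<Longrightarrow> vf_eigen i j d g \<Longrightarrow> vf_eigen i j (c + d) (\<lambda>x. f x * g x)"
  by (auto simp: vf_eigen_def vf_mult poly_fun_mult algebra_simps)

lemma vf_eigen_power: "vf_eigen i j c f \<Longrightarrow> vf_eigen i j (of_nat k * c) (\<lambda>x. f x ^ k)"
proof (induction k)
  case 0
  then show ?case using vf_eigen_const[of i j 1] by simp
next
  case (Suc k)
  from vf_eigen_mult[OF Suc(2) Suc(1)[OF Suc(2)]] show ?case by (simp add: algebra_simps)
qed

lemma vf_eigen_prod:
  "finite S \<Longrightarrow> (\<And>s. s \<in> S \<Longrightarrow> vf_eigen i j (c s) (f s)) \<Longrightarrow> vf_eigen i j (\<Sum>s\<in>S. c s) (\<lambda>x. \<Prod>s\<in>S. f s x)"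
proof (induction S rule: finite_induct)
  case empty
  then show ?case using vf_eigen_const[of i j 1] by simp
next
  case (insert s S)
  then have "vf_eigen i j (c s + (\<Sum>s\<in>S. c s)) (\<lambda>x. f s x * (\<Prod>s\<in>S. f s x))"
    by (intro vf_eigen_mult) auto
  then show ?case using insert by simp
qed

text \<open>Replacing row \<open>j\<close> by row \<open>i\<close> changes nothing for
  \<open>i = j \<le> k\<close> and produces two equal rows for \<open>i < j \<le> k\<close>; for
  \<open>j > k\<close> no entry of row \<open>j\<close> occurs.\<close>

lemma vf_eigen_minor:
  assumes "1 \<le> i" "i \<le> j"
  shows "vf_eigen i j (if i = j \<and> i \<le> k then 1 else 0) (minor k)"
proof (cases "j \<le> k")
  case False
  then show ?thesis using vf_minor_large[of k j i] poly_fun_minor by (auto simp: vf_eigen_def)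
next
  case True
  then have j: "j \<in> {1..k}" "i \<in> {1..k}" using assms by auto
  show ?thesis
  proof (cases "i = j")
    case True
    have "vf i j (minor k) x = minor k x" for x
    proof -
      have "(if \<sigma> s = j then i else \<sigma> s) = \<sigma> s" for \<sigma> :: "nat \<Rightarrow> nat" and s using True by auto
      then show ?thesis unfolding vf_minor[OF j(1)] minor_def by (simp only:)
    qed
    then show ?thesis using True j poly_fun_minor by (auto simp: vf_eigen_def)
  next
    case False
    have "vf i j (minor k) x = 0" for x
    proof -
      let ?g = "\<lambda>r. if r = j then i else r"
      let ?G = "\<lambda>\<sigma>. \<Prod>s\<in>{1..k}. x (?g (\<sigma> s), s)"
      have g: "?g (transpose i j r) = ?g r" for r
        by (cases "r = i"; cases "r = j") (auto simp: transpose_apply_other)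
      have "?G (transpose i j \<circ> \<sigma>) = ?G \<sigma>" for \<sigma> :: "nat \<Rightarrow> nat" by (simp only: o_apply g)
      then have "(\<Sum>\<sigma> | \<sigma> permutes {1..k}. of_int (sign \<sigma>) * ?G \<sigma>) =
        - (\<Sum>\<sigma> | \<sigma> permutes {1..k}. of_int (sign \<sigma>) * ?G \<sigma>)"
        using signed_sum_compose_left[OF j(2,1) False, of ?G] by simp
      then show ?thesis unfolding vf_minor[OF j(1)] by simp
    qed
    then show ?thesis using False poly_fun_minor by (auto simp: vf_eigen_def)
  qed
qed

lemma minor_id [simp]: "minor k id_mat = 1"
proof -
  have "(\<Prod>s\<in>{1..k}. id_mat (\<sigma> s, s)) = 0" if \<sigma>: "\<sigma> permutes {1..k}" "\<sigma> \<noteq> id" for \<sigma>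
  proof -
    obtain s where "\<sigma> s \<noteq> s" using \<sigma>(2) by (auto simp: fun_eq_iff)
    then have "id_mat (\<sigma> s, s) = 0" by (simp add: id_mat_def)
    moreover have "s \<in> {1..k}" using \<open>\<sigma> s \<noteq> s\<close> \<sigma>(1) by (meson permutes_not_in)
    ultimately show ?thesis by (intro prod_zero) auto
  qed
  then have "minor k id_mat = (\<Sum>\<sigma>\<in>{id}. of_int (sign \<sigma>) * (\<Prod>s\<in>{1..k}. id_mat (\<sigma> s, s)))"
    unfolding minor_def by (intro sum.mono_neutral_right) (auto simp: permutes_id finite_permutations simp del: prod_zero_iff One_nat_def)
  then show ?thesis by (simp add: sign_id id_mat_def)
qed

text \<open>\<open>a k\<close> is the coefficient of the \<open>k\<close>-th fundamental weight, so
  the parts are partial sums from the right.\<close>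

definition dominant :: "nat \<Rightarrow> (nat \<Rightarrow> nat) \<Rightarrow> nat \<Rightarrow> complex" where
  "dominant n a i = (\<Sum>k\<in>{i..n}. of_nat (a k))"

text \<open>The annihilator of a product of powers of minors, whose weights add. It is proper
  because the product takes the value 1 at the identity matrix.\<close>

lemma hw_ideal_exists:
  "\<exists>L. hw_ideal n (dominant n a) L \<and> 1 \<notin> L"
proof -
  define F where "F = (\<lambda>x. \<Prod>k\<in>{1..n}. minor k x ^ a k)"
  have F: "vf_eigen i j (\<Sum>k\<in>{1..n}. of_nat (a k) * (if i = j \<and> i \<le> k then 1 else 0)) F" if "1 \<le> i" "i \<le> j" for i j
    unfolding F_def by (intro vf_eigen_prod vf_eigen_power vf_eigen_minor that) simp
  define L where "L = {b \<in> T n. \<forall>x. act b F x = 0}"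
  have poly_fun: "poly_fun F" using F[of 1 1] by (simp add: vf_eigen_def)
  have "left_ideal n L"
    unfolding left_ideal_def
  proof (intro conjI ballI)
    fix b c assume "b \<in> T n" "c \<in> L"
    then have "act c F = (\<lambda>x. 0)" by (auto simp: L_def)
    then have "act (b * c) F x = 0" for x using act_zero_fun by (simp add: act_mult[OF poly_fun])
    then show "b * c \<in> L" using \<open>b \<in> T n\<close> \<open>c \<in> L\<close> by (auto simp: L_def T_mult)
  qed (auto simp: L_def act_add T_add)
  moreover have "J n \<subseteq> L" using J_acts_zero[OF _ poly_fun] J(1) by (auto simp: L_def)
  moreover have "tens_e i j \<in> L" if "i \<in> {1..n}" "j \<in> {1..n}" "i < j" for i j
    using F[of i j] that T_e[OF that(1,2)] by (simp add: L_def act_e vf_eigen_def)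
  moreover have "tens_e i i - tens_const (dominant n a i) \<in> L" if i: "i \<in> {1..n}" for i
  proof -
    have "(\<Sum>k\<in>{1..n}. of_nat (a k) * (if i = i \<and> i \<le> k then 1 else 0)) = (dominant n a i :: complex)"
      unfolding dominant_def using i by (intro sum.mono_neutral_cong_right) auto
    then show ?thesis
      using F[of i i] i T_diff[OF T_e[OF i i] T_const] by (simp add: L_def act_diff act_e act_const vf_eigen_def)
  qed
  moreover have "1 \<notin> L"
  proof
    assume "1 \<in> L"
    then have "F id_mat = 0" by (simp add: L_def)
    moreover have "F id_mat = 1" by (simp add: F_def)
    ultimately show False by simp
  qed
  ultimately show ?thesis unfolding hw_ideal_def by blast
qed

lemma maximal_left_ideal_exists:
  assumes "left_ideal n L0" "1 \<notin> L0"
  shows "\<exists>L. left_ideal n L \<and> 1 \<notin> L \<and> L0 \<subseteq> L \<and> (\<forall>M. left_ideal n M \<longrightarrow> L \<subseteq> M \<longrightarrow> 1 \<notin> M \<longrightarrow> M = L)"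
proof -
  define S where "S = {L. left_ideal n L \<and> 1 \<notin> L \<and> L0 \<subseteq> L}"
  have "\<exists>M\<in>S. \<forall>X\<in>S. M \<subseteq> X \<longrightarrow> X = M"
  proof (rule subset_Zorn_nonempty)
    show "S \<noteq> {}" using assms by (auto simp: S_def)
    fix C assume C: "C \<noteq> {}" "subset.chain S C"
    have CS: "C \<subseteq> S" and ch: "\<And>A B. A \<in> C \<Longrightarrow> B \<in> C \<Longrightarrow> A \<subseteq> B \<or> B \<subseteq> A"
      using C(2) by (auto simp: subset.chain_def subset_chain_def)
    have li: "left_ideal n A" if "A \<in> C" for A using CS that by (auto simp: S_def)
    obtain A0 where A0: "A0 \<in> C" using C(1) by blast
    have "left_ideal n (\<Union>C)"
      unfolding left_ideal_def
    proof (intro conjI ballI)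
      show "\<Union>C \<subseteq> T n" using left_idealD(1)[OF li] by blast
      show "0 \<in> \<Union>C" using left_idealD(2)[OF li[OF A0]] A0 by blast
      show "a + b \<in> \<Union>C" if ab: "a \<in> \<Union>C" "b \<in> \<Union>C" for a b
      proof -
        obtain A B where AB: "A \<in> C" "B \<in> C" "a \<in> A" "b \<in> B" using ab by blast
        from ch[OF AB(1,2)] show ?thesis
          using AB left_idealD(3)[OF li[OF AB(1)], of a b] left_idealD(3)[OF li[OF AB(2)], of a b] by blast
      qed
      show "a * b \<in> \<Union>C" if "a \<in> T n" "b \<in> \<Union>C" for a b
        using that left_idealD(4)[OF li] by blast
    qed
    then show "\<Union>C \<in> S" using CS A0 by (auto simp: S_def)
  qed
  then obtain L where L: "L \<in> S" "\<And>X. X \<in> S \<Longrightarrow> L \<subseteq> X \<Longrightarrow> X = L" by blast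
  then show ?thesis by (intro exI[of _ L]) (auto simp: S_def)
qed

section \<open>Quotients of the tensor algebra by left ideals\<close>

definition coset :: "tens set \<Rightarrow> tens \<Rightarrow> tens set" where
  "coset L a = {l + a | l. l \<in> L}"

definition coset_rep :: "nat \<Rightarrow> tens set \<Rightarrow> tens set \<Rightarrow> tens" where
  "coset_rep n L C = (SOME a. a \<in> T n \<and> coset L a = C)"

text \<open>Cosets of \<open>L\<close> are sets of tensors, so the quotient lives on the type that
  \<open>HC\<close> quantifies over. Operations go through chosen representatives;
  \<open>quot_mod_add\<close> and \<open>quot_mod_smult\<close> show independence of the
  choice.\<close>

definition quot_mod :: "nat \<Rightarrow> tens set \<Rightarrow> (complex, tens set) module" where
  "quot_mod n L = \<lparr>carrier = coset L ` T n, mult = (\<lambda>A B. A), one = coset L 1, zero = coset L 0,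
     add = (\<lambda>A B. coset L (coset_rep n L A + coset_rep n L B)),
     module.smult = (\<lambda>c A. coset L (tens_const c * coset_rep n L A))\<rparr>"

definition quot_act :: "nat \<Rightarrow> tens set \<Rightarrow> tens set \<Rightarrow> tens set \<Rightarrow> tens set" where
  "quot_act n L A C = coset L (coset_rep n (J n) A * coset_rep n L C)"

lemma U_proj_eq_coset: "U_proj n a = coset (J n) a"
  by (auto simp: U_proj_def a_r_coset_def r_coset_def coset_def)

lemma complex_ring_cring: "cring complex_ring"
proof (intro cringI abelian_groupI comm_monoidI)
  fix x assume "x \<in> carrier complex_ring"
  show "\<exists>y\<in>carrier complex_ring. y \<oplus>\<^bsub>complex_ring\<^esub> x = \<zero>\<^bsub>complex_ring\<^esub>"
    by (rule bexI[of _ "- x"]) (auto simp: complex_ring_def)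
qed (auto simp: complex_ring_def algebra_simps)

lemma quot_mod_carrier: "carrier (quot_mod n L) = coset L ` T n"
  and quot_mod_zero: "\<zero>\<^bsub>quot_mod n L\<^esub> = coset L 0"
  by (simp_all add: quot_mod_def)

context
  fixes n :: nat and L :: "tens set"
  assumes L: "left_ideal n L"
begin

lemma coset_eq_iff: "coset L a = coset L b \<longleftrightarrow> a - b \<in> L"
proof
  assume "coset L a = coset L b"
  moreover have "a \<in> coset L a" unfolding coset_def using left_idealD(2)[OF L] by force
  ultimately show "a - b \<in> L" unfolding coset_def by auto
next
  assume *: "a - b \<in> L"
  have "\<exists>h'. h + a = h' + b \<and> h' \<in> L" if "h \<in> L" for h
    using left_idealD(3)[OF L that *] by (intro exI[of _ "h + (a - b)"]) simp
  moreover have "\<exists>h'. h + b = h' + a \<and> h' \<in> L" if "h \<in> L" for h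
    using left_idealD(6)[OF L that *] by (intro exI[of _ "h - (a - b)"]) simp
  ultimately show "coset L a = coset L b" unfolding coset_def by auto
qed

lemma coset_rep:
  assumes "a \<in> T n"
  shows "coset_rep n L (coset L a) \<in> T n" "coset_rep n L (coset L a) - a \<in> L"
proof -
  have "coset_rep n L (coset L a) \<in> T n \<and> coset L (coset_rep n L (coset L a)) = coset L a"
    unfolding coset_rep_def by (rule someI[of _ a]) (use assms in simp)
  then show "coset_rep n L (coset L a) \<in> T n" "coset_rep n L (coset L a) - a \<in> L"
    using coset_eq_iff by auto
qed

lemma quot_mod_add: "a \<in> T n \<Longrightarrow> b \<in> T n \<Longrightarrow> coset L a \<oplus>\<^bsub>quot_mod n L\<^esub> coset L b = coset L (a + b)"
  using left_idealD(3)[OF L coset_rep(2)[of a] coset_rep(2)[of b]]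
  by (simp add: quot_mod_def coset_eq_iff algebra_simps)

lemma quot_mod_smult: "a \<in> T n \<Longrightarrow> c \<odot>\<^bsub>quot_mod n L\<^esub> coset L a = coset L (tens_const c * a)"
  using left_idealD(7)[OF L coset_rep(2)[of a], of c]
  by (simp add: quot_mod_def coset_eq_iff algebra_simps)

lemma quot_act:
  assumes "J n \<subseteq> L" "a \<in> T n" "b \<in> T n"
  shows "quot_act n L (U_proj n a) (coset L b) = coset L (a * b)"
proof -
  let ?a = "coset_rep n (J n) (coset (J n) a)" and ?b = "coset_rep n L (coset L b)"
  have a: "?a \<in> T n" "?a - a \<in> J n"
  proof -
    have "?a \<in> T n \<and> coset (J n) ?a = coset (J n) a"
      unfolding coset_rep_def by (rule someI[of _ a]) (use assms in simp)
    then show "?a \<in> T n" "?a - a \<in> J n"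
      using U_proj_eq_iff[of ?a n a] assms by (auto simp: U_proj_eq_coset)
  qed
  have "?a * (?b - b) + (?a - a) * b \<in> L"
    using assms(1) by (intro left_idealD(3)[OF L] left_idealD(4)[OF L] a coset_rep assms(2,3)
        subsetD[OF assms(1) J_rmult])
  then show ?thesis by (simp add: quot_act_def U_proj_eq_coset coset_eq_iff algebra_simps)
qed

lemma quot_mod_module: "module complex_ring (quot_mod n L)"
proof (intro moduleI complex_ring_cring abelian_groupI)
  let ?V = "quot_mod n L"
  show "\<zero>\<^bsub>?V\<^esub> \<in> carrier ?V" by (simp add: quot_mod_carrier quot_mod_zero)
  fix x assume "x \<in> carrier ?V"
  then obtain a where a: "a \<in> T n" "x = coset L a" by (auto simp: quot_mod_carrier)
  show "\<zero>\<^bsub>?V\<^esub> \<oplus>\<^bsub>?V\<^esub> x = x" using a by (simp add: quot_mod_zero quot_mod_add)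
  show "\<exists>y\<in>carrier ?V. y \<oplus>\<^bsub>?V\<^esub> x = \<zero>\<^bsub>?V\<^esub>"
    using a by (intro bexI[of _ "coset L (- a)"]) (auto simp: quot_mod_zero quot_mod_add quot_mod_carrier T_uminus)
  show "\<one>\<^bsub>complex_ring\<^esub> \<odot>\<^bsub>?V\<^esub> x = x" using a by (simp add: complex_ring_def quot_mod_smult)
  fix c d
  show "c \<odot>\<^bsub>?V\<^esub> x \<in> carrier ?V" using a by (auto simp: quot_mod_smult quot_mod_carrier T_mult)
  show "(c \<oplus>\<^bsub>complex_ring\<^esub> d) \<odot>\<^bsub>?V\<^esub> x = c \<odot>\<^bsub>?V\<^esub> x \<oplus>\<^bsub>?V\<^esub> d \<odot>\<^bsub>?V\<^esub> x"
    using a by (simp add: complex_ring_def quot_mod_smult quot_mod_add T_mult tens_const_add distrib_right)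
  show "(c \<otimes>\<^bsub>complex_ring\<^esub> d) \<odot>\<^bsub>?V\<^esub> x = c \<odot>\<^bsub>?V\<^esub> (d \<odot>\<^bsub>?V\<^esub> x)"
    using a by (simp add: complex_ring_def quot_mod_smult T_mult tens_const_mult mult.assoc)
  fix y assume "y \<in> carrier ?V"
  then obtain b where b: "b \<in> T n" "y = coset L b" by (auto simp: quot_mod_carrier)
  show "x \<oplus>\<^bsub>?V\<^esub> y \<in> carrier ?V" using a b by (auto simp: quot_mod_add quot_mod_carrier T_add)
  show "x \<oplus>\<^bsub>?V\<^esub> y = y \<oplus>\<^bsub>?V\<^esub> x" using a b by (simp add: quot_mod_add add.commute)
  show "c \<odot>\<^bsub>?V\<^esub> (x \<oplus>\<^bsub>?V\<^esub> y) = c \<odot>\<^bsub>?V\<^esub> x \<oplus>\<^bsub>?V\<^esub> c \<odot>\<^bsub>?V\<^esub> y"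
    using a b by (simp add: quot_mod_smult quot_mod_add T_mult T_add distrib_left)
  fix z assume "z \<in> carrier ?V"
  then obtain d where "d \<in> T n" "z = coset L d" by (auto simp: quot_mod_carrier)
  then show "x \<oplus>\<^bsub>?V\<^esub> y \<oplus>\<^bsub>?V\<^esub> z = x \<oplus>\<^bsub>?V\<^esub> (y \<oplus>\<^bsub>?V\<^esub> z)"
    using a b by (simp add: quot_mod_add T_add add.assoc)
qed

lemma quot_mod_U_module:
  assumes JL: "J n \<subseteq> L"
  shows "U_module n (quot_mod n L) (quot_act n L)"
  unfolding U_module_def
proof (intro conjI ballI allI)
  let ?V = "quot_mod n L" and ?\<rho> = "quot_act n L"
  show "module complex_ring ?V" by (rule quot_mod_module)
  show "?\<rho> \<one>\<^bsub>U_gl n\<^esub> v = v" if "v \<in> carrier ?V" for v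
    using that by (auto simp: quot_mod_carrier U_gl_one quot_act[OF JL])
  fix A assume "A \<in> carrier (U_gl n)"
  then obtain a where a: "a \<in> T n" "A = U_proj n a" by (auto simp: U_gl_carrier)
  show "?\<rho> A \<in> lin_hom ?V ?V"
    unfolding lin_hom_def
    using a by (auto simp: quot_mod_carrier quot_act[OF JL] quot_mod_add quot_mod_smult T_mult T_add distrib_left
        tens_const_left_commute)
  fix v assume "v \<in> carrier ?V"
  then obtain b where b: "b \<in> T n" "v = coset L b" by (auto simp: quot_mod_carrier)
  show "?\<rho> (c \<odot>\<^bsub>U_gl n\<^esub> A) v = c \<odot>\<^bsub>?V\<^esub> ?\<rho> A v" for c
    using a b by (simp add: U_gl_smult quot_act[OF JL] quot_mod_smult T_mult mult.assoc)
  fix B assume "B \<in> carrier (U_gl n)"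
  then obtain d where d: "d \<in> T n" "B = U_proj n d" by (auto simp: U_gl_carrier)
  show "?\<rho> (A \<otimes>\<^bsub>U_gl n\<^esub> B) v = ?\<rho> A (?\<rho> B v)"
    using a b d by (simp add: U_gl_mult quot_act[OF JL] T_mult mult.assoc)
  show "?\<rho> (A \<oplus>\<^bsub>U_gl n\<^esub> B) v = ?\<rho> A v \<oplus>\<^bsub>?V\<^esub> ?\<rho> B v"
    using a b d by (simp add: U_gl_add quot_act[OF JL] quot_mod_add T_mult T_add distrib_right)
qed

text \<open>The tensors whose cosets lie in a stable subspace form a left ideal containing
  \<open>L\<close>; by maximality it equals \<open>L\<close> or contains 1, and the coset of 1
  generates.\<close>

lemma quot_mod_irreducible:
  assumes JL: "J n \<subseteq> L" and one: "1 \<notin> L"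
    and max: "\<And>M. left_ideal n M \<Longrightarrow> L \<subseteq> M \<Longrightarrow> 1 \<notin> M \<Longrightarrow> M = L"
  shows "irreducible_U_module n (quot_mod n L) (quot_act n L)"
  unfolding irreducible_U_module_def
proof (intro conjI allI impI quot_mod_U_module JL)
  let ?V = "quot_mod n L" and ?\<rho> = "quot_act n L"
  have "coset L 1 \<in> carrier ?V" "coset L 1 \<noteq> \<zero>\<^bsub>?V\<^esub>"
    using one by (auto simp: quot_mod_carrier quot_mod_zero coset_eq_iff)
  then show "carrier ?V \<noteq> {\<zero>\<^bsub>?V\<^esub>}" by blast
  fix N assume N: "submodule N complex_ring ?V \<and> (\<forall>a\<in>carrier (U_gl n). \<forall>v\<in>N. ?\<rho> a v \<in> N)"
  interpret submodule N complex_ring ?V using N by blast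
  have stable: "coset L (a * b) \<in> N" if "a \<in> T n" "b \<in> T n" "coset L b \<in> N" for a b
    using N that quot_act[OF JL that(1,2)] by (metis U_gl_carrier imageI)
  define M where "M = {a \<in> T n. coset L a \<in> N}"
  have NV: "N \<subseteq> coset L ` T n" using subset by (simp add: quot_mod_carrier)
  have zN: "coset L 0 \<in> N" using one_closed by (simp add: quot_mod_zero)
  have "left_ideal n M"
    unfolding left_ideal_def
  proof (intro conjI ballI)
    show "a + b \<in> M" if "a \<in> M" "b \<in> M" for a b
      using that m_closed[of "coset L a" "coset L b"] by (simp add: M_def quot_mod_add T_add)
  qed (use zN stable in \<open>auto simp: M_def T_mult\<close>)
  moreover have "L \<subseteq> M"
  proof
    fix l assume l: "l \<in> L"
    then have "coset L l = coset L 0" by (simp add: coset_eq_iff)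
    then show "l \<in> M" using l left_idealD(1)[OF L] zN by (simp add: M_def)
  qed
  ultimately have M1: "1 \<in> M \<or> M = L" using max by blast
  show "N = {\<zero>\<^bsub>?V\<^esub>} \<or> N = carrier ?V"
  proof (cases "1 \<in> M")
    case True
    then have "coset L a \<in> N" if "a \<in> T n" for a using stable[OF that, of 1] by (simp add: M_def)
    then show ?thesis using NV by (auto simp: quot_mod_carrier)
  next
    case False
    then have "M = L" using M1 by blast
    have "C = coset L 0" if "C \<in> N" for C
    proof -
      have "C \<in> coset L ` T n" using NV that ..
      then obtain a where a: "C = coset L a" "a \<in> T n" by (rule imageE)
      have "a \<in> M" using a that by (simp add: M_def)
      then have "a \<in> L" using \<open>M = L\<close> by simp
      then show ?thesis using a by (simp add: coset_eq_iff)
    qed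
    then have "N \<subseteq> {coset L 0}" by (intro subsetI) (simp only: singleton_iff)
    moreover have "{coset L 0} \<subseteq> N" using zN by (simp only: insert_subset empty_subsetI simp_thms)
    ultimately show ?thesis unfolding quot_mod_zero by (intro disjI1 subset_antisym)
  qed
qed

end

text \<open>Enlarging the annihilator from \<open>hw_ideal_exists\<close> to a maximal left ideal
  makes the cyclic module irreducible and keeps the relations of the highest weight vector.\<close>

theorem highest_weight_module_exists:
  "\<exists>(V :: (complex, tens set) module) \<rho>. highest_weight_module n (dominant n a) V \<rho>"
proof -
  obtain L0 where L0: "hw_ideal n (dominant n a) L0" "1 \<notin> L0" using hw_ideal_exists by blast
  then have "left_ideal n L0" by (simp add: hw_ideal_def)
  from maximal_left_ideal_exists[OF this L0(2)] obtain L where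
    L: "left_ideal n L" "1 \<notin> L" "L0 \<subseteq> L" "\<And>M. left_ideal n M \<Longrightarrow> L \<subseteq> M \<Longrightarrow> 1 \<notin> M \<Longrightarrow> M = L" by blast
  have JL: "J n \<subseteq> L" using L0 L(3) by (auto simp: hw_ideal_def)
  have "irreducible_U_module n (quot_mod n L) (quot_act n L)"
    by (rule quot_mod_irreducible[OF L(1) JL L(2,4)])
  moreover have "highest_weight_vector n (dominant n a) (quot_mod n L) (quot_act n L) (coset L 1)"
    unfolding highest_weight_vector_def
  proof (intro conjI ballI impI)
    show "coset L 1 \<in> carrier (quot_mod n L)" by (simp add: quot_mod_carrier)
    show "coset L 1 \<noteq> \<zero>\<^bsub>quot_mod n L\<^esub>" using L(2) by (simp add: quot_mod_zero coset_eq_iff[OF L(1)])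
    fix i assume i: "i \<in> {1..n}"
    have "tens_e i i - tens_const (dominant n a i) \<in> L" using L0(1) L(3) i by (auto simp: hw_ideal_def)
    then show "quot_act n L (U_e n i i) (coset L 1) = dominant n a i \<odot>\<^bsub>quot_mod n L\<^esub> coset L 1"
      using T_e[OF i i] by (simp add: U_e_def quot_act[OF L(1) JL] quot_mod_smult[OF L(1)] coset_eq_iff[OF L(1)])
    fix j assume j: "j \<in> {1..n}" "i < j"
    then have "tens_e i j \<in> L" using L0(1) L(3) i by (auto simp: hw_ideal_def)
    then show "quot_act n L (U_e n i j) (coset L 1) = \<zero>\<^bsub>quot_mod n L\<^esub>"
      using T_e[OF i j(1)] by (simp add: U_e_def quot_act[OF L(1) JL] quot_mod_zero coset_eq_iff[OF L(1)])
  qed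
  ultimately show ?thesis unfolding highest_weight_module_def by blast
qed

section \<open>Central elements on highest weight modules\<close>

lemma U_moduleD:
  assumes "U_module n V \<rho>" and a: "a \<in> T n" and w: "w \<in> carrier V"
  shows "module complex_ring V" "\<rho> (U_proj n a) w \<in> carrier V" "\<rho> (U_proj n 1) w = w"
    "b \<in> T n \<Longrightarrow> \<rho> (U_proj n (a + b)) w = \<rho> (U_proj n a) w \<oplus>\<^bsub>V\<^esub> \<rho> (U_proj n b) w"
    "b \<in> T n \<Longrightarrow> \<rho> (U_proj n (a * b)) w = \<rho> (U_proj n a) (\<rho> (U_proj n b) w)"
    "\<rho> (U_proj n (tens_const c * a)) w = c \<odot>\<^bsub>V\<^esub> \<rho> (U_proj n a) w"
    "u \<in> carrier V \<Longrightarrow> \<rho> (U_proj n a) (w \<oplus>\<^bsub>V\<^esub> u) = \<rho> (U_proj n a) w \<oplus>\<^bsub>V\<^esub> \<rho> (U_proj n a) u"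
    "\<rho> (U_proj n a) (c \<odot>\<^bsub>V\<^esub> w) = c \<odot>\<^bsub>V\<^esub> \<rho> (U_proj n a) w"
    "\<rho> (U_proj n a) \<zero>\<^bsub>V\<^esub> = \<zero>\<^bsub>V\<^esub>" "\<rho> (U_proj n 0) w = \<zero>\<^bsub>V\<^esub>"
proof -
  show mod: "module complex_ring V" using assms(1) by (simp add: U_module_def)
  interpret module complex_ring V by (rule mod)
  have U: "U_proj n a \<in> carrier (U_gl n)" if "a \<in> T n" for a using that by (simp add: U_gl_carrier)
  have closed: "\<rho> (U_proj n a) w \<in> carrier V" if "a \<in> T n" "w \<in> carrier V" for a w
    using assms(1) U[OF that(1)] that(2) unfolding U_module_def lin_hom_def by blast
  then show "\<rho> (U_proj n a) w \<in> carrier V" using a w by blast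
  have add: "\<rho> (U_proj n (a + b)) w = \<rho> (U_proj n a) w \<oplus>\<^bsub>V\<^esub> \<rho> (U_proj n b) w"
    if "a \<in> T n" "b \<in> T n" "w \<in> carrier V" for a b w
    using assms(1) U[OF that(1)] U[OF that(2)] that(3) unfolding U_gl_add[OF that(1,2), symmetric] U_module_def by blast
  then show "b \<in> T n \<Longrightarrow> \<rho> (U_proj n (a + b)) w = \<rho> (U_proj n a) w \<oplus>\<^bsub>V\<^esub> \<rho> (U_proj n b) w"
    using a w by blast
  show "b \<in> T n \<Longrightarrow> \<rho> (U_proj n (a * b)) w = \<rho> (U_proj n a) (\<rho> (U_proj n b) w)"
    using assms(1) U[OF a] U[of b] w U_gl_mult[OF a, of b] unfolding U_module_def by metis
  show "\<rho> (U_proj n (tens_const c * a)) w = c \<odot>\<^bsub>V\<^esub> \<rho> (U_proj n a) w"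
    using assms(1) U[OF a] w unfolding U_gl_smult[OF a, symmetric] U_module_def by blast
  show "\<rho> (U_proj n 1) w = w"
    using assms(1) w unfolding U_gl_one[symmetric] U_module_def by blast
  show "u \<in> carrier V \<Longrightarrow> \<rho> (U_proj n a) (w \<oplus>\<^bsub>V\<^esub> u) = \<rho> (U_proj n a) w \<oplus>\<^bsub>V\<^esub> \<rho> (U_proj n a) u"
    "\<rho> (U_proj n a) (c \<odot>\<^bsub>V\<^esub> w) = c \<odot>\<^bsub>V\<^esub> \<rho> (U_proj n a) w"
    using assms(1) U[OF a] w unfolding U_module_def lin_hom_def by blast+
  have "\<rho> (U_proj n a) (\<zero>\<^bsub>V\<^esub> \<oplus>\<^bsub>V\<^esub> \<zero>\<^bsub>V\<^esub>) = \<rho> (U_proj n a) \<zero>\<^bsub>V\<^esub> \<oplus>\<^bsub>V\<^esub> \<rho> (U_proj n a) \<zero>\<^bsub>V\<^esub>"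
    using assms(1) U[OF a] M.zero_closed unfolding U_module_def lin_hom_def by blast
  then show "\<rho> (U_proj n a) \<zero>\<^bsub>V\<^esub> = \<zero>\<^bsub>V\<^esub>"
    using closed[OF a M.zero_closed] by (simp add: M.add.l_cancel_one')
  show "\<rho> (U_proj n 0) w = \<zero>\<^bsub>V\<^esub>"
    using add[OF T_0 T_0 w] closed[OF T_0 w] by (simp add: M.add.l_cancel_one')
qed

text \<open>Transfers congruences modulo left ideals, proved without modules, to an arbitrary module
  with a highest weight vector.\<close>

lemma hw_ideal_of_vector:
  assumes U: "U_module n V \<rho>" and hw: "highest_weight_vector n \<mu> V \<rho> v"
  shows "hw_ideal n \<mu> {a \<in> T n. \<rho> (U_proj n a) v = \<zero>\<^bsub>V\<^esub>}"
proof -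
  let ?L = "{a \<in> T n. \<rho> (U_proj n a) v = \<zero>\<^bsub>V\<^esub>}"
  note D = U_moduleD[OF U]
  have v: "v \<in> carrier V" using hw by (simp add: highest_weight_vector_def)
  interpret module complex_ring V by (rule D(1)[OF T_0 v])
  have "left_ideal n ?L"
    unfolding left_ideal_def using v by (auto simp: T_add T_mult D(4,5,9) D(10)[OF T_0])
  moreover have "J n \<subseteq> ?L"
  proof
    fix a assume a: "a \<in> J n"
    then have "U_proj n a = U_proj n 0" using U_proj_eq_iff[OF J(1)[OF a] T_0] by simp
    then show "a \<in> ?L" using J(1)[OF a] D(10)[OF T_0 v] by simp
  qed
  moreover have "tens_e i j \<in> ?L" if "i \<in> {1..n}" "j \<in> {1..n}" "i < j" for i j
    using that hw T_e[OF that(1,2)] by (simp add: highest_weight_vector_def U_e_def)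
  moreover have "tens_e i i - tens_const (\<mu> i) \<in> ?L" if i: "i \<in> {1..n}" for i
  proof -
    have eq: "tens_e i i - tens_const (\<mu> i) = tens_e i i + tens_const (- \<mu> i) * 1" by (simp add: tens_const_uminus)
    have "\<rho> (U_proj n (tens_e i i + tens_const (- \<mu> i) * 1)) v =
      \<rho> (U_proj n (tens_e i i)) v \<oplus>\<^bsub>V\<^esub> \<rho> (U_proj n (tens_const (- \<mu> i) * 1)) v"
      by (rule D(4)[OF T_e[OF i i] v]) (intro T_mult T_const T_1)
    also have "\<dots> = \<mu> i \<odot>\<^bsub>V\<^esub> v \<oplus>\<^bsub>V\<^esub> (- \<mu> i) \<odot>\<^bsub>V\<^esub> v"
      using hw i unfolding D(6)[OF T_1 v] D(3)[OF T_1 v] by (simp add: highest_weight_vector_def U_e_def)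
    also have "\<dots> = (\<mu> i \<oplus>\<^bsub>complex_ring\<^esub> (- \<mu> i)) \<odot>\<^bsub>V\<^esub> v"
      by (rule smult_l_distr[symmetric]) (auto simp: complex_ring_def v)
    also have "\<dots> = \<zero>\<^bsub>complex_ring\<^esub> \<odot>\<^bsub>V\<^esub> v" by (simp add: complex_ring_def)
    also have "\<dots> = \<zero>\<^bsub>V\<^esub>" by (rule smult_l_null[OF v])
    finally show ?thesis using T_diff[OF T_e[OF i i] T_const] unfolding eq[symmetric] by simp
  qed
  ultimately show ?thesis unfolding hw_ideal_def by blast
qed

text \<open>Schur's argument: the kernel of a central element is a submodule.\<close>
lemma central_acts_by_scalar:
  assumes irr: "irreducible_U_module n V \<rho>" and v: "v \<in> carrier V" "v \<noteq> \<zero>\<^bsub>V\<^esub>"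
    and a: "central_mod n a" and av: "\<rho> (U_proj n (a - tens_const c)) v = \<zero>\<^bsub>V\<^esub>" and w: "w \<in> carrier V"
  shows "\<rho> (U_proj n a) w = c \<odot>\<^bsub>V\<^esub> w"
proof -
  have U: "U_module n V \<rho>" using irr by (simp add: irreducible_U_module_def)
  note D = U_moduleD[OF U]
  interpret module complex_ring V by (rule D(1)[OF T_0 w])
  define x where "x = a - tens_const c"
  have cx: "central_mod n x" unfolding x_def by (rule central_mod_diff[OF a central_mod_const])
  then have xT: "x \<in> T n" by (simp add: central_mod_def)
  define N where "N = {w \<in> carrier V. \<rho> (U_proj n x) w = \<zero>\<^bsub>V\<^esub>}"
  have smN: "d \<odot>\<^bsub>V\<^esub> u \<in> N" if "u \<in> N" for d u
    using that D(8)[OF xT] smult_closed[of d u] by (simp add: N_def complex_ring_def smult_r_null[unfolded complex_ring_def, simplified])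
  have "submodule N complex_ring V"
  proof (rule submoduleI)
    show "\<zero>\<^bsub>V\<^esub> \<in> N" using D(9)[OF xT w] by (simp add: N_def)
    show "\<ominus>\<^bsub>V\<^esub> u \<in> N" if u: "u \<in> N" for u
    proof -
      have uV: "u \<in> carrier V" using u by (simp add: N_def)
      have "(\<ominus>\<^bsub>complex_ring\<^esub> \<one>\<^bsub>complex_ring\<^esub>) \<odot>\<^bsub>V\<^esub> u = \<ominus>\<^bsub>V\<^esub> u"
        using smult_l_minus[OF R.one_closed uV] smult_one[OF uV] by simp
      then show ?thesis using smN[OF u] by metis
    qed
    show "u \<oplus>\<^bsub>V\<^esub> u' \<in> N" if "u \<in> N" "u' \<in> N" for u u'
      using that D(7)[OF xT] by (auto simp: N_def)
    show "d \<odot>\<^bsub>V\<^esub> u \<in> N" if "d \<in> carrier complex_ring" "u \<in> N" for d u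
      by (rule smN[OF that(2)])
  qed (auto simp: N_def)
  moreover have "\<rho> A u \<in> N" if A: "A \<in> carrier (U_gl n)" and u: "u \<in> N" for A u
  proof -
    obtain b where b: "b \<in> T n" "A = U_proj n b" using A by (auto simp: U_gl_carrier)
    have uV: "u \<in> carrier V" "\<rho> (U_proj n x) u = \<zero>\<^bsub>V\<^esub>" using u by (auto simp: N_def)
    have "U_proj n (x * b) = U_proj n (b * x)"
      using cx b(1) xT by (simp add: U_proj_eq_iff T_mult central_mod_def)
    then have "\<rho> (U_proj n x) (\<rho> (U_proj n b) u) = \<rho> (U_proj n b) (\<rho> (U_proj n x) u)"
      using D(5)[OF xT uV(1) b(1)] D(5)[OF b(1) uV(1) xT] by simp
    then show ?thesis using b uV D(9)[OF b(1) uV(1)] D(2)[OF b(1) uV(1)] by (simp add: N_def)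
  qed
  ultimately have "N = {\<zero>\<^bsub>V\<^esub>} \<or> N = carrier V"
    using irr unfolding irreducible_U_module_def by blast
  moreover have "v \<in> N" using v(1) av by (simp add: N_def x_def)
  ultimately have "w \<in> N" using v(2) w by blast
  then have xw: "\<rho> (U_proj n x) w = \<zero>\<^bsub>V\<^esub>" by (simp add: N_def)
  have "a = x + tens_const c * 1" by (simp add: x_def)
  then have "\<rho> (U_proj n a) w = \<rho> (U_proj n x) w \<oplus>\<^bsub>V\<^esub> \<rho> (U_proj n (tens_const c * 1)) w"
    using D(4)[OF xT w, of "tens_const c * 1"] T_const[of c n] by simp
  also have "\<dots> = c \<odot>\<^bsub>V\<^esub> w"
    unfolding xw D(6)[OF T_1 w] D(3)[OF T_1 w] using w smult_closed[of c w] by (simp add: complex_ring_def)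
  finally show ?thesis .
qed

section \<open>Leading coefficients\<close>

text \<open>For a polynomial function of degree at most \<open>m\<close>, \<open>c\<close> is the
  value at \<open>d\<close> of its homogeneous part of degree \<open>m\<close>, extracted along the
  ray through \<open>d\<close>.\<close>

definition top_coeff :: "nat \<Rightarrow> ((nat \<Rightarrow> complex) \<Rightarrow> complex) \<Rightarrow> (nat \<Rightarrow> complex) \<Rightarrow> complex \<Rightarrow> bool" where
  "top_coeff m f d c \<longleftrightarrow> (\<exists>q. degree q \<le> m \<and> (\<forall>t. poly q t = f (\<lambda>i. t * d i)) \<and> coeff q m = c)"

lemma top_coeff_unique: "top_coeff m f d a \<Longrightarrow> top_coeff m f d b \<Longrightarrow> a = b"
  unfolding top_coeff_def by (metis poly_eq_poly_eq_iff ext)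

lemma top_coeff_const: "top_coeff m (\<lambda>x. e) d (if m = 0 then e else 0)"
  unfolding top_coeff_def by (rule exI[of _ "[:e:]"]) (auto simp: coeff_pCons split: nat.split)

lemma top_coeff_linear: "top_coeff 1 (\<lambda>x. x i + e) d (d i)"
  unfolding top_coeff_def by (rule exI[of _ "[:e, d i:]"]) (auto simp: algebra_simps)

lemma top_coeff_add: "top_coeff m f d a \<Longrightarrow> top_coeff m g d b \<Longrightarrow> top_coeff m (\<lambda>x. f x + g x) d (a + b)"
  unfolding top_coeff_def by (metis coeff_add degree_add_le poly_add)

lemma top_coeff_sum:
  "(\<And>i. i \<in> S \<Longrightarrow> top_coeff m (f i) d (a i)) \<Longrightarrow> top_coeff m (\<lambda>x. \<Sum>i\<in>S. f i x) d (\<Sum>i\<in>S. a i)"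
proof (induction S rule: infinite_finite_induct)
  case (insert i S)
  then show ?case by (simp add: top_coeff_add)
qed (use top_coeff_const[of m 0 d] in simp_all)

lemma coeff_mult_top:
  fixes p q :: "complex poly"
  assumes "degree p \<le> i" "degree q \<le> j"
  shows "coeff (p * q) (i + j) = coeff p i * coeff q j"
proof -
  have "coeff (p * q) (i + j) = (\<Sum>l\<le>i + j. coeff p l * coeff q (i + j - l))" by (rule coeff_mult)
  also have "\<dots> = (\<Sum>l\<le>i + j. if l = i then coeff p i * coeff q j else 0)"
  proof (intro sum.cong refl)
    fix l assume "l \<in> {..i + j}"
    show "coeff p l * coeff q (i + j - l) = (if l = i then coeff p i * coeff q j else 0)"
    proof (cases "l = i")
      case False
      then consider "l > i" | "i + j - l > j" using \<open>l \<in> {..i + j}\<close> by fastforce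
      then show ?thesis
      proof cases
        case 1
        then have "coeff p l = 0" using assms(1) by (intro coeff_eq_0) simp
        then show ?thesis using False by simp
      next
        case 2
        then have "coeff q (i + j - l) = 0" using assms(2) by (intro coeff_eq_0) simp
        then show ?thesis using False by simp
      qed
    qed simp
  qed
  also have "\<dots> = coeff p i * coeff q j" by simp
  finally show ?thesis .
qed

lemma top_coeff_mult:
  assumes "top_coeff i f d a" "top_coeff j g d b"
  shows "top_coeff (i + j) (\<lambda>x. f x * g x) d (a * b)"
proof -
  obtain p q where "degree p \<le> i" "\<forall>t. poly p t = f (\<lambda>i. t * d i)" "coeff p i = a"
    "degree q \<le> j" "\<forall>t. poly q t = g (\<lambda>i. t * d i)" "coeff q j = b"
    using assms unfolding top_coeff_def by blast
  then show ?thesis unfolding top_coeff_def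
    by (intro exI[of _ "p * q"]) (auto simp: coeff_mult_top intro: order_trans[OF degree_mult_le])
qed

lemma top_coeff_prod:
  "finite S \<Longrightarrow> (\<And>i. i \<in> S \<Longrightarrow> top_coeff 1 (f i) d (a i)) \<Longrightarrow>
    top_coeff (card S) (\<lambda>x. \<Prod>i\<in>S. f i x) d (\<Prod>i\<in>S. a i)"
proof (induction S rule: finite_induct)
  case empty
  then show ?case using top_coeff_const[of 0 1 d] by simp
next
  case (insert i S)
  then show ?case using top_coeff_mult[of 1 "f i" d "a i" "card S" "\<lambda>x. \<Prod>i\<in>S. f i x" "\<Prod>i\<in>S. a i"] by simp
qed

lemma top_coeff_higher: "top_coeff k f d c \<Longrightarrow> k < m \<Longrightarrow> top_coeff m f d 0"
  unfolding top_coeff_def by (metis coeff_eq_0 le_less_trans less_imp_le)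

text \<open>The shifts are constants and do not affect the leading term; here the cases
  \<open>h = 1\<close> and \<open>h = 0\<close> meet.\<close>

lemma top_coeff_e_fun: "top_coeff k (e_fun h n k) d (e_fun 0 n k d)"
proof -
  have "top_coeff (card {1..k}) (\<lambda>x. \<Prod>r\<in>{1..k}. x (is ! (r - 1)) + h * of_nat (k - r)) d
    (\<Prod>r\<in>{1..k}. d (is ! (r - 1)))" for "is"
    by (intro top_coeff_prod top_coeff_linear) simp
  then show ?thesis unfolding e_fun_def[abs_def] by (intro top_coeff_sum) simp
qed

section \<open>The center is generated by the Capelli elements\<close>

text \<open>\<open>HC_rel n m a f\<close>: the tensor \<open>a\<close> is a polynomial of weighted degree at most \<open>m\<close> in the Capelli
  elements, and \<open>f\<close> is the same polynomial in the functions \<open>e\<^sup>*\<^sub>k\<close>.\<close>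
inductive HC_rel :: "nat \<Rightarrow> nat \<Rightarrow> tens \<Rightarrow> ((nat \<Rightarrow> complex) \<Rightarrow> complex) \<Rightarrow> bool" for n where
  const: "HC_rel n m (tens_const c) (\<lambda>x. c)"
| gen: "k \<in> {1..n} \<Longrightarrow> k \<le> m \<Longrightarrow> HC_rel n m (Hlift n k) (e_fun 1 n k)"
| add: "HC_rel n m a f \<Longrightarrow> HC_rel n m b g \<Longrightarrow> HC_rel n m (a + b) (\<lambda>x. f x + g x)"
| mult: "HC_rel n i a f \<Longrightarrow> HC_rel n j b g \<Longrightarrow> i + j \<le> m \<Longrightarrow> HC_rel n m (a * b) (\<lambda>x. f x * g x)"

lemma HC_rel_T_filt: "HC_rel n m a f \<Longrightarrow> a \<in> T_filt n m"
proof (induction rule: HC_rel.induct)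
  case (gen k m)
  show ?case by (rule T_filt_mono[OF Hlift_T_filt gen(2)])
qed (auto intro: T_filt_add T_filt_mult)

lemma HC_rel_T: "HC_rel n m a f \<Longrightarrow> a \<in> T n"
  by (rule T_filt_T[OF HC_rel_T_filt])

lemma HC_rel_central: "HC_rel n m a f \<Longrightarrow> central_mod n a"
  by (induction rule: HC_rel.induct)
    (auto intro: central_mod_const Hlift_central central_mod_add central_mod_mult)

lemma HC_rel_e_gen: "HC_rel n m a f \<Longrightarrow> e_gen 1 n m f"
  by (induction rule: HC_rel.induct) (auto intro: e_gen.intros)

lemma e_gen_HC_rel: "e_gen 1 n m f \<Longrightarrow> \<exists>a. HC_rel n m a f"
proof (induction rule: e_gen.induct)
  case (gen k m)
  then show ?case using HC_rel.gen by blast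
qed (auto intro: HC_rel.intros)

lemma HC_rel_mono: "HC_rel n m a f \<Longrightarrow> m \<le> m' \<Longrightarrow> HC_rel n m' a f"
  using HC_rel.mult[OF HC_rel.const[of n 0 1], of m a f m'] by simp

lemma HC_rel_cmult: "HC_rel n m a f \<Longrightarrow> HC_rel n m (tens_const c * a) (\<lambda>x. c * f x)"
  by (rule HC_rel.mult[OF HC_rel.const[of n 0]]) auto

lemma HC_rel_hw_ideal:
  assumes "HC_rel n m a f" "hw_ideal n \<mu> L"
  shows "a - tens_const (f \<mu>) \<in> L"
proof -
  have L: "left_ideal n L" using assms(2) by (simp add: hw_ideal_def)
  show ?thesis using assms(1)
  proof (induction rule: HC_rel.induct)
    case (const m c)
    then show ?case using left_idealD(2)[OF L] by simp
  next
    case (gen k m)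
    show ?case by (rule hw_ideal_Hlift[OF assms(2)])
  next
    case (add m a f b g)
    then show ?case using left_idealD(3)[OF L, of "a - tens_const (f \<mu>)" "b - tens_const (g \<mu>)"]
      by (simp add: tens_const_add algebra_simps)
  next
    case (mult i a f j b g m)
    have "a * (b - tens_const (g \<mu>)) + tens_const (g \<mu>) * (a - tens_const (f \<mu>)) \<in> L"
      using mult HC_rel_T by (intro left_idealD(3)[OF L] left_idealD(4)[OF L] left_idealD(7)[OF L])
    also have "a * (b - tens_const (g \<mu>)) + tens_const (g \<mu>) * (a - tens_const (f \<mu>)) =
      a * b - tens_const (f \<mu> * g \<mu>)"
      by (simp add: algebra_simps tens_const_commute[of "g \<mu>"] flip: tens_const_mult)
    finally show ?case .
  qed
qed

text \<open>The bridge between symbols and eigenvalues: both are multiplicative, and on the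
  generators both give the elementary symmetric polynomial. Where an expression stays below the
  bound \<open>m\<close>, both are zero.\<close>

lemma HC_rel_top_coeff: "HC_rel n m a f \<Longrightarrow> top_coeff m f d (symb m (diag d) a)"
proof (induction rule: HC_rel.induct)
  case (const m c)
  then show ?case using top_coeff_const[of m c d] by (simp add: symb_const)
next
  case (gen k m)
  show ?case
  proof (cases "k = m")
    case True
    then show ?thesis using top_coeff_e_fun[of k 1 n d] by (simp add: symb_diag_Hlift)
  next
    case False
    then have "k < m" using gen by simp
    then show ?thesis
      using top_coeff_higher[OF top_coeff_e_fun, of k m 1 n d] symb_zero_if_low[OF Hlift_T_filt] by simp
  qed
next
  case (add m a f b g)
  then show ?case by (simp add: symb_add top_coeff_add)
next
  case (mult i a f j b g m)
  have t: "top_coeff (i + j) (\<lambda>x. f x * g x) d (symb i (diag d) a * symb j (diag d) b)"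
    by (rule top_coeff_mult[OF mult.IH])
  show ?case
  proof (cases "i + j = m")
    case True
    then show ?thesis using t symb_mult[OF HC_rel_T_filt[OF mult(1)] HC_rel_T_filt[OF mult(2)]] by auto
  next
    case False
    then have "i + j < m" using mult by simp
    then show ?thesis using top_coeff_higher[OF t]
        symb_zero_if_low[OF T_filt_mult[OF HC_rel_T_filt[OF mult(1)] HC_rel_T_filt[OF mult(2)] order_refl]] by simp
  qed
qed

text \<open>Substituting \<open>Hlift n k\<close> for the elementary symmetric polynomials produces
  a central tensor whose symbol on diagonal matrices is the degree \<open>m\<close> part of the
  given symmetric function; lower terms are not controlled.\<close>

lemma e_gen_0_HC_rel:
  "e_gen 0 n m g \<Longrightarrow> \<exists>a f. HC_rel n m a f \<and> (\<forall>d. top_coeff m g d (symb m (diag d) a))"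
proof (induction rule: e_gen.induct)
  case (const m c)
  show ?case using HC_rel.const[of n m c] HC_rel_top_coeff[OF HC_rel.const[of n m c]] by blast
next
  case (gen k m)
  have "top_coeff m (e_fun 0 n k) d (symb m (diag d) (Hlift n k))" for d
  proof (cases "k = m")
    case True
    then show ?thesis using top_coeff_e_fun[of k 0 n d] by (simp add: symb_diag_Hlift)
  next
    case False
    then have "k < m" using gen by simp
    then show ?thesis
      using top_coeff_higher[OF top_coeff_e_fun, of k m 0 n d] symb_zero_if_low[OF Hlift_T_filt] by simp
  qed
  then show ?case using HC_rel.gen[OF gen] by blast
next
  case (add m f g)
  then obtain a b f' g' where "HC_rel n m a f'" "HC_rel n m b g'"
    "\<And>d. top_coeff m f d (symb m (diag d) a)" "\<And>d. top_coeff m g d (symb m (diag d) b)" by blast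
  then show ?case
    by (intro exI[of _ "a + b"] exI[of _ "\<lambda>x. f' x + g' x"]) (auto intro: HC_rel.add simp: symb_add top_coeff_add)
next
  case (mult i f j g m)
  then obtain a b f' g' where h: "HC_rel n i a f'" "HC_rel n j b g'"
    "\<And>d. top_coeff i f d (symb i (diag d) a)" "\<And>d. top_coeff j g d (symb j (diag d) b)" by blast
  have t: "top_coeff (i + j) (\<lambda>x. f x * g x) d (symb (i + j) (diag d) (a * b))" for d
    using top_coeff_mult[OF h(3,4)] symb_mult[OF HC_rel_T_filt[OF h(1)] HC_rel_T_filt[OF h(2)]] by simp
  have "top_coeff m (\<lambda>x. f x * g x) d (symb m (diag d) (a * b))" for d
  proof (cases "i + j = m")
    case False
    then have "i + j < m" using mult by simp
    then show ?thesis using top_coeff_higher[OF t]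
        symb_zero_if_low[OF T_filt_mult[OF HC_rel_T_filt[OF h(1)] HC_rel_T_filt[OF h(2)] order_refl]] by simp
  qed (use t in auto)
  then show ?case using HC_rel.mult[OF h(1,2) mult(3)] by blast
qed

lemma symb_diag_scale: "symb m (diag (\<lambda>i. t * d i)) a = t ^ m * symb m (diag d) a"
proof -
  have "diag (\<lambda>i. t * d i) p = t * diag d p" for p by (simp add: diag_def)
  then have p: "(\<Prod>l\<leftarrow>ls. diag (\<lambda>i. t * d i) l) = t ^ length ls * (\<Prod>l\<leftarrow>ls. diag d l)" for ls
    by (induction ls) (auto simp: mult_ac)
  show ?thesis unfolding symb_def lin_ext_def sum_distrib_left
    by (intro sum.cong refl) (simp add: p)
qed

theorem central_generated:
  assumes "central_mod n z" "z \<in> T_filt n m"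
  shows "\<exists>a f. HC_rel n m a f \<and> z - a \<in> J n"
  using assms
proof (induction m arbitrary: z)
  have step: "\<exists>a f. HC_rel n m a f \<and> (\<forall>d. symb m (diag d) (z - a) = 0)"
    if z: "central_mod n z" "z \<in> T_filt n m" for m z
  proof -
    let ?g = "\<lambda>d. symb m (diag d) z"
    have "e_gen 0 n m ?g"
      by (rule shift_sym_generated[OF polyfn_symb_diag[OF z(2)] central_symb_diag_shift_sym[OF z]])
    then obtain a f where a: "HC_rel n m a f" "\<And>d. top_coeff m ?g d (symb m (diag d) a)"
      using e_gen_0_HC_rel by blast
    \<comment> \<open>The symbol is homogeneous of degree \<open>m\<close>, hence equal to its own
      leading part.\<close>
    have "top_coeff m ?g d (?g d)" for d
      unfolding top_coeff_def
      by (rule exI[of _ "monom (?g d) m"]) (auto simp: degree_monom_le poly_monom symb_diag_scale)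
    then have "symb m (diag d) (z - a) = 0" for d
      using top_coeff_unique[OF _ a(2)] by (simp add: symb_diff)
    then show ?thesis using a(1) by blast
  qed
  {
    case 0
    obtain a f where a: "HC_rel n 0 a f" "\<And>d. symb 0 (diag d) (z - a) = 0" using step[OF 0] by blast
    have za: "central_mod n (z - a)" "z - a \<in> T_filt n 0"
      using central_mod_diff[OF 0(1) HC_rel_central[OF a(1)]] T_filt_diff[OF 0(2) HC_rel_T_filt[OF a(1)]] by auto
    have "z - a = 0" by (rule symb_zero_filt_0[OF za(2) central_symb_zero[OF za a(2)]])
    then show ?case using a(1) J(2) by metis
  next
    case (Suc m)
    obtain a f where a: "HC_rel n (Suc m) a f" "\<And>d. symb (Suc m) (diag d) (z - a) = 0" using step[OF Suc(2,3)] by blast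
    have za: "central_mod n (z - a)" "z - a \<in> T_filt n (Suc m)"
      using central_mod_diff[OF Suc(2) HC_rel_central[OF a(1)]] T_filt_diff[OF Suc(3) HC_rel_T_filt[OF a(1)]] by auto
    \<comment> \<open>The remainder has a shorter representative, which is again central because
      centrality depends only on the class.\<close>
    obtain b where b: "b \<in> T_filt n m" "z - a - b \<in> J n"
      using central_lowers[OF za a(2)] unfolding lowers_def by blast
    have "central_mod n b" by (rule central_mod_cong[OF za(1) T_filt_T[OF b(1)] b(2)])
    then obtain a' f' where a': "HC_rel n m a' f'" "b - a' \<in> J n" using Suc.IH b(1) by blast
    have "HC_rel n (Suc m) (a + a') (\<lambda>x. f x + f' x)"
      by (rule HC_rel.add[OF a(1) HC_rel_mono[OF a'(1)]]) simp
    moreover have "z - (a + a') \<in> J n" using J_trans[OF b(2) a'(2)] by (simp add: algebra_simps)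
    ultimately show ?case by blast
  }
qed

text \<open>In the coordinates \<open>x k - x (Suc k)\<close> the dominant weights become the grid
  of natural numbers, where \<open>polyfn_zero_on_grid\<close> applies.\<close>

lemma polyfn_zero_on_dominant:
  assumes "polyfn {1..n} m f" "\<And>a. f (dominant n a) = 0"
  shows "f x = 0"
proof -
  define l :: "(nat \<Rightarrow> complex) \<Rightarrow> nat \<Rightarrow> complex" where "l b i = (\<Sum>k\<in>{i..n}. b k)" for b i
  have pl: "polyfn {1..n} m (\<lambda>b. f (\<lambda>i. l b i))"
  proof (rule polyfn_subst[OF assms(1)])
    fix i assume "i \<in> {1..n}"
    then show "polyfn {1..n} 1 (\<lambda>b. l b i)" unfolding l_def by (intro polyfn_sum polyfn_var) auto
  qed
  have zero: "f (\<lambda>i. l b i) = 0" for b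
  proof (rule polyfn_zero_on_grid[OF pl])
    fix b :: "nat \<Rightarrow> complex" assume b: "\<And>i. i \<in> {1..n} \<Longrightarrow> b i \<in> \<nat>"
    define a where "a k = (SOME j. b k = of_nat j)" for k
    have a: "b k = of_nat (a k)" if "k \<in> {1..n}" for k
      unfolding a_def by (rule someI_ex) (use b[OF that] in \<open>auto elim: Nats_cases\<close>)
    have "f (\<lambda>i. l b i) = f (dominant n a)"
    proof (rule polyfn_cong_arg[OF assms(1)])
      fix i assume "i \<in> {1..n}"
      then show "l b i = dominant n a i" unfolding l_def dominant_def using a by (intro sum.cong) auto
    qed
    then show "f (\<lambda>i. l b i) = 0" using assms(2) by simp
  qed simp
  \<comment> \<open>Padding by zero after \<open>n\<close> makes the telescoping sum, which stops at
    \<open>n\<close> as in \<open>dominant\<close>, equal to \<open>x i\<close>.\<close>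
  define y where "y k = (if k \<le> n then x k else 0)" for k
  define b where "b k = y k - y (Suc k)" for k
  have "f (\<lambda>i. l b i) = f x"
  proof (rule polyfn_cong_arg[OF assms(1)])
    fix i assume i: "i \<in> {1..n}"
    have "l b i = - (\<Sum>k=i..n. y (Suc k) - y k)" unfolding l_def b_def by (simp add: sum_negf[symmetric])
    also have "(\<Sum>k=i..n. y (Suc k) - y k) = y (Suc n) - y i" using i by (intro sum_Suc_diff) auto
    finally show "l b i = x i" using i by (simp add: y_def)
  qed
  then show ?thesis using zero by simp
qed

text \<open>If the values differed at a dominant weight, a nonzero scalar and hence 1 would lie in a
  proper left ideal of that weight; dominant weights are dense.\<close>

lemma HC_rel_fun_unique:
  assumes "HC_rel n m a f" "HC_rel n m' b g" "a - b \<in> J n"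
  shows "f = g"
proof
  fix x
  have "polyfn {1..n} (max m m') (\<lambda>x. f x - g x)"
    by (intro polyfn_diff) (auto intro: polyfn_mono[OF e_gen_polyfn[OF HC_rel_e_gen[OF assms(1)]]]
        polyfn_mono[OF e_gen_polyfn[OF HC_rel_e_gen[OF assms(2)]]] simp del: One_nat_def)
  moreover have "f (dominant n c) - g (dominant n c) = 0" for c
  proof (rule ccontr)
    let ?\<mu> = "dominant n c"
    assume ne: "f ?\<mu> - g ?\<mu> \<noteq> 0"
    obtain L where L: "hw_ideal n ?\<mu> L" "1 \<notin> L" using hw_ideal_exists by blast
    have li: "left_ideal n L" and JL: "J n \<subseteq> L" using L(1) by (auto simp: hw_ideal_def)
    have "a - b - ((a - tens_const (f ?\<mu>)) - (b - tens_const (g ?\<mu>))) \<in> L"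
      by (rule left_idealD(6)[OF li subsetD[OF JL assms(3)]
            left_idealD(6)[OF li HC_rel_hw_ideal[OF assms(1) L(1)] HC_rel_hw_ideal[OF assms(2) L(1)]]])
    then have "tens_const (f ?\<mu> - g ?\<mu>) \<in> L" by (simp add: tens_const_diff)
    then have "tens_const (1 / (f ?\<mu> - g ?\<mu>)) * tens_const (f ?\<mu> - g ?\<mu>) \<in> L" by (rule left_idealD(7)[OF li])
    then show False using ne L(2) by (simp flip: tens_const_mult)
  qed
  ultimately have "f x - g x = 0" by (rule polyfn_zero_on_dominant)
  then show "f x = g x" by simp
qed

text \<open>A vanishing \<open>f\<close> forces the symbol to vanish on diagonal matrices, so the
  element has a shorter representative. \<open>central_generated\<close> rewrites that one with a
  smaller bound, and by \<open>HC_rel_fun_unique\<close> its function is still zero.\<close>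

lemma HC_rel_zero_imp_J: "HC_rel n m a f \<Longrightarrow> f = (\<lambda>x. 0) \<Longrightarrow> a \<in> J n"
proof (induction m arbitrary: a f)
  case 0
  have "symb 0 (diag d) a = 0" for d
    using top_coeff_unique[OF HC_rel_top_coeff[OF 0(1), of d]] top_coeff_const[of 0 0 d] 0(2) by simp
  then have "a = 0"
    using symb_zero_filt_0[OF HC_rel_T_filt[OF 0(1)] central_symb_zero[OF HC_rel_central[OF 0(1)] HC_rel_T_filt[OF 0(1)]]] by blast
  then show ?case using J(2) by simp
next
  case (Suc m)
  have "symb (Suc m) (diag d) a = 0" for d
    using top_coeff_unique[OF HC_rel_top_coeff[OF Suc(2), of d]] top_coeff_const[of "Suc m" 0 d] Suc(3) by simp
  then have "lowers n m a" by (rule central_lowers[OF HC_rel_central[OF Suc(2)] HC_rel_T_filt[OF Suc(2)]])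
  then obtain b where b: "b \<in> T_filt n m" "a - b \<in> J n" unfolding lowers_def by blast
  have "central_mod n b" by (rule central_mod_cong[OF HC_rel_central[OF Suc(2)] T_filt_T[OF b(1)] b(2)])
  then obtain a' f' where a': "HC_rel n m a' f'" "b - a' \<in> J n" using central_generated b(1) by blast
  have aa': "a - a' \<in> J n" by (rule J_trans[OF b(2) a'(2)])
  then have "f' = (\<lambda>x. 0)" using HC_rel_fun_unique[OF Suc(2) a'(1)] Suc(3) by simp
  then have "a' \<in> J n" by (rule Suc.IH[OF a'(1)])
  then show ?case using J(3)[OF aa', of a'] by simp
qed

lemma HC_rel_fun_eq_imp_J:
  assumes "HC_rel n m a f" "HC_rel n m' b f"
  shows "a - b \<in> J n"
proof -
  let ?m = "max m m'"
  have "HC_rel n ?m (a + tens_const (- 1) * b) (\<lambda>x. f x + (- 1) * f x)"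
    using HC_rel_mono[OF assms(1), of ?m] HC_rel_mono[OF assms(2), of ?m] by (intro HC_rel.add HC_rel_cmult) auto
  from HC_rel_zero_imp_J[OF this] show ?thesis by (simp add: tens_const_uminus)
qed

section \<open>The algebra of shifted symmetric polynomials\<close>

lemma Lambda_star_simps [simp]:
  "mult (Lambda_star n) = (*)" "add (Lambda_star n) = (+)" "one (Lambda_star n) = 1"
  "zero (Lambda_star n) = 0" "module.smult (Lambda_star n) = (\<lambda>c p. mconst c * p)"
  by (simp_all add: Lambda_star_def)

lemma Lambda_star_filt_simps [simp]:
  "mult (Lambda_star_filt n m) = (*)" "add (Lambda_star_filt n m) = (+)" "one (Lambda_star_filt n m) = 1"
  "zero (Lambda_star_filt n m) = 0" "module.smult (Lambda_star_filt n m) = (\<lambda>c p. mconst c * p)"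
  by (simp_all add: Lambda_star_filt_def)

text \<open>By \<open>shift_sym_generated\<close> the degree filtration coincides with the weighted
  filtration by the generators.\<close>

lemma Lambda_star_filt_iff: "p \<in> carrier (Lambda_star_filt n m) \<longleftrightarrow> e_gen 1 n m (meval p)"
proof -
  have "p \<in> carrier (Lambda_star_filt n m) \<longleftrightarrow> p \<in> mpolys {1..n} m \<and> shift_sym 1 n (meval p)"
    unfolding Lambda_star_filt_def Lambda_star_def shift_sym_def mpolys_def by auto
  also have "\<dots> \<longleftrightarrow> e_gen 1 n m (meval p)"
    unfolding mpolys_iff_polyfn using shift_sym_generated e_gen_polyfn e_gen_shift_sym by blast
  finally show ?thesis .
qed

lemma Lambda_star_iff: "p \<in> carrier (Lambda_star n) \<longleftrightarrow> (\<exists>m. p \<in> carrier (Lambda_star_filt n m))"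
proof
  assume p: "p \<in> carrier (Lambda_star n)"
  let ?D = "(\<lambda>t. \<Sum>i\<in>Poly_Mapping.keys t. Poly_Mapping.lookup t i) ` Poly_Mapping.keys p"
  have "p \<in> carrier (Lambda_star_filt n (Max ?D))"
    using p by (auto simp: Lambda_star_filt_def)
  then show "\<exists>m. p \<in> carrier (Lambda_star_filt n m)" ..
next
  assume "\<exists>m. p \<in> carrier (Lambda_star_filt n m)"
  then show "p \<in> carrier (Lambda_star n)" by (auto simp: Lambda_star_filt_def)
qed

lemma Lambda_star_e_gen: "p \<in> carrier (Lambda_star n) \<longleftrightarrow> (\<exists>m. e_gen 1 n m (meval p))"
  by (simp add: Lambda_star_iff Lambda_star_filt_iff)

lemma e_gen_meval:
  assumes "e_gen 1 n m f"
  obtains p where "p \<in> carrier (Lambda_star_filt n m)" "meval p = f"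
proof -
  obtain p where "\<forall>x. meval p x = f x" using polyfn_mpolys[OF e_gen_polyfn[OF assms]] by blast
  then have "meval p = f" by (intro ext) simp
  then show thesis using that[of p] assms by (simp add: Lambda_star_filt_iff)
qed

lemma meval_injective: "meval p = meval q \<Longrightarrow> p = q"
  by (rule meval_inject) simp

lemma meval_e_star: "meval (e_star n k) = e_fun 1 n k"
  by (rule ext) (simp add: e_star_def e_fun_def)

section \<open>Algebra homomorphisms\<close>

definition closed_alg :: "(complex, 'a) module \<Rightarrow> bool" where
  "closed_alg A \<longleftrightarrow> \<one>\<^bsub>A\<^esub> \<in> carrier A \<and>
     (\<forall>x\<in>carrier A. \<forall>y\<in>carrier A. x \<oplus>\<^bsub>A\<^esub> y \<in> carrier A \<and> x \<otimes>\<^bsub>A\<^esub> y \<in> carrier A) \<and>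
     (\<forall>c. \<forall>x\<in>carrier A. c \<odot>\<^bsub>A\<^esub> x \<in> carrier A)"

lemma alg_hom_iff:
  "f \<in> alg_hom A B \<longleftrightarrow> f \<in> carrier A \<rightarrow> carrier B \<and> f \<one>\<^bsub>A\<^esub> = \<one>\<^bsub>B\<^esub> \<and>
     (\<forall>x\<in>carrier A. \<forall>y\<in>carrier A. f (x \<oplus>\<^bsub>A\<^esub> y) = f x \<oplus>\<^bsub>B\<^esub> f y \<and> f (x \<otimes>\<^bsub>A\<^esub> y) = f x \<otimes>\<^bsub>B\<^esub> f y) \<and>
     (\<forall>c. \<forall>x\<in>carrier A. f (c \<odot>\<^bsub>A\<^esub> x) = c \<odot>\<^bsub>B\<^esub> f x)"
  unfolding alg_hom_def ring_hom_def lin_hom_def by auto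

lemma alg_hom_restrict:
  assumes "f \<in> alg_hom A B" "closed_alg A"
  shows "restrict f (carrier A) \<in> alg_hom A B"
  using assms unfolding alg_hom_iff closed_alg_def by auto

lemma alg_hom_comp:
  assumes "f \<in> alg_hom A B" "g \<in> alg_hom B C"
  shows "(\<lambda>x. g (f x)) \<in> alg_hom A C"
  using assms unfolding alg_hom_iff Pi_iff by simp

lemma alg_hom_inv_into:
  assumes f: "f \<in> alg_hom A B" and bij: "bij_betw f (carrier A) (carrier B)" and A: "closed_alg A"
  shows "inv_into (carrier A) f \<in> alg_hom B A"
proof -
  let ?g = "inv_into (carrier A) f"
  have inj: "inj_on f (carrier A)" and img: "f ` carrier A = carrier B" using bij by (auto simp: bij_betw_def)
  have g: "?g y \<in> carrier A" "f (?g y) = y" if "y \<in> carrier B" for y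
    using that img by (auto intro: inv_into_into f_inv_into_f)
  have eqI: "?g y = x" if "x \<in> carrier A" "f x = y" for x y
    using that inv_into_f_f[OF inj] by auto
  show ?thesis
    unfolding alg_hom_iff
  proof (intro conjI ballI allI)
    show "?g \<in> carrier B \<rightarrow> carrier A" using g by auto
    show "?g \<one>\<^bsub>B\<^esub> = \<one>\<^bsub>A\<^esub>" using f A by (intro eqI) (auto simp: alg_hom_iff closed_alg_def)
    fix x assume x: "x \<in> carrier B"
    show "?g (c \<odot>\<^bsub>B\<^esub> x) = c \<odot>\<^bsub>A\<^esub> ?g x" for c
      using f A g[OF x] by (intro eqI) (auto simp: alg_hom_iff closed_alg_def)
    fix y assume y: "y \<in> carrier B"
    show "?g (x \<oplus>\<^bsub>B\<^esub> y) = ?g x \<oplus>\<^bsub>A\<^esub> ?g y" "?g (x \<otimes>\<^bsub>B\<^esub> y) = ?g x \<otimes>\<^bsub>A\<^esub> ?g y"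
      using f A g[OF x] g[OF y] by (auto intro!: eqI simp: alg_hom_iff closed_alg_def)
  qed
qed

lemma Lambda_star_closed: "closed_alg (Lambda_star n)"
proof -
  have eq: "meval (p + q) = (\<lambda>x. meval p x + meval q x)" "meval (p * q) = (\<lambda>x. meval p x * meval q x)"
    "meval (mconst c) = (\<lambda>x. c)" "meval 1 = (\<lambda>x. 1)" for p q c by auto
  have mono: "e_gen 1 n m f \<Longrightarrow> m \<le> m' \<Longrightarrow> e_gen 1 n m' f" for m m' f
    using e_gen.mult[OF e_gen.const[of 1 n 0 1], of m f m'] by simp
  show ?thesis
    unfolding closed_alg_def
  proof (intro conjI ballI allI)
    show "\<one>\<^bsub>Lambda_star n\<^esub> \<in> carrier (Lambda_star n)"
      using e_gen.const[of 1 n 0 1] by (auto simp: Lambda_star_e_gen eq)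
    fix p assume "p \<in> carrier (Lambda_star n)"
    then obtain i where i: "e_gen 1 n i (meval p)" by (auto simp: Lambda_star_e_gen)
    show "c \<odot>\<^bsub>Lambda_star n\<^esub> p \<in> carrier (Lambda_star n)" for c
      using e_gen.mult[OF e_gen.const[of 1 n 0 c] i, of i] by (auto simp: Lambda_star_e_gen eq)
    fix q assume "q \<in> carrier (Lambda_star n)"
    then obtain j where j: "e_gen 1 n j (meval q)" by (auto simp: Lambda_star_e_gen)
    have "e_gen 1 n (max i j) (\<lambda>x. meval p x + meval q x)"
      by (intro e_gen.add mono[OF i] mono[OF j]) auto
    then show "p \<oplus>\<^bsub>Lambda_star n\<^esub> q \<in> carrier (Lambda_star n)" by (auto simp: Lambda_star_e_gen eq)
    show "p \<otimes>\<^bsub>Lambda_star n\<^esub> q \<in> carrier (Lambda_star n)"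
      using e_gen.mult[OF i j order_refl] by (auto simp: Lambda_star_e_gen eq)
  qed
qed

lemma e_star_carrier: "k \<in> {1..n} \<Longrightarrow> e_star n k \<in> carrier (Lambda_star n)"
  using e_gen.gen[of k n k 1] by (auto simp: Lambda_star_e_gen meval_e_star)

text \<open>Supplies the uniqueness behind \<open>THE\<close>, by induction on the expression in the
  generators. Its intermediate functions must come from elements of the carrier, which
  \<open>e_gen_meval\<close> provides.\<close>

lemma Lambda_alg_hom_unique:
  assumes F: "F \<in> alg_hom (Lambda_star n) B" and G: "G \<in> alg_hom (Lambda_star n) B"
    and gen: "\<And>k. k \<in> {1..n} \<Longrightarrow> F (e_star n k) = G (e_star n k)" and p: "p \<in> carrier (Lambda_star n)"
  shows "F p = G p"
proof -
  have D: "F (x + y) = F x \<oplus>\<^bsub>B\<^esub> F y" "F (x * y) = F x \<otimes>\<^bsub>B\<^esub> F y"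
    "G (x + y) = G x \<oplus>\<^bsub>B\<^esub> G y" "G (x * y) = G x \<otimes>\<^bsub>B\<^esub> G y"
    if "x \<in> carrier (Lambda_star n)" "y \<in> carrier (Lambda_star n)" for x y
    using F G that by (auto simp: alg_hom_iff)
  have one: "1 \<in> carrier (Lambda_star n)" using Lambda_star_closed[of n] by (simp add: closed_alg_def)
  have "F p = G p" if "e_gen 1 n m f" "meval p = f" for m f p
    using that
  proof (induction arbitrary: p rule: e_gen.induct)
    case (const m c)
    have "p = mconst c * 1" using const by (intro meval_inject) simp
    moreover have "F (mconst c * 1) = G (mconst c * 1)"
      using F G one by (simp add: alg_hom_iff del: mult_1_right)
    ultimately show ?case by simp
  next
    case (gen k m)
    then have "p = e_star n k" by (intro meval_injective) (simp add: meval_e_star)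
    then show ?case using assms(3) gen by simp
  next
    case (add m f g)
    obtain a b where ab: "a \<in> carrier (Lambda_star_filt n m)" "meval a = f"
        "b \<in> carrier (Lambda_star_filt n m)" "meval b = g"
      using e_gen_meval[OF add(1)] e_gen_meval[OF add(2)] by metis
    have "p = a + b" using add(5) ab by (intro meval_inject) simp
    moreover have "a \<in> carrier (Lambda_star n)" "b \<in> carrier (Lambda_star n)" using ab by (auto simp: Lambda_star_iff)
    ultimately show ?case using D[of a b] add(3)[OF ab(2)] add(4)[OF ab(4)] by simp
  next
    case (mult i f j g m)
    obtain a b where ab: "a \<in> carrier (Lambda_star_filt n i)" "meval a = f"
        "b \<in> carrier (Lambda_star_filt n j)" "meval b = g"
      using e_gen_meval[OF mult(1)] e_gen_meval[OF mult(2)] by metis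
    have "p = a * b" using mult(6) ab by (intro meval_inject) simp
    moreover have "a \<in> carrier (Lambda_star n)" "b \<in> carrier (Lambda_star n)" using ab by (auto simp: Lambda_star_iff)
    ultimately show ?case using D[of a b] mult.IH(1)[OF ab(2)] mult.IH(2)[OF ab(4)] by simp
  qed
  then show ?thesis using p by (auto simp: Lambda_star_e_gen)
qed

section \<open>The Harish-Chandra isomorphism\<close>

lemma smult_right_cancel:
  assumes "module complex_ring V" "v \<in> carrier V" "v \<noteq> \<zero>\<^bsub>V\<^esub>" "c \<odot>\<^bsub>V\<^esub> v = d \<odot>\<^bsub>V\<^esub> v"
  shows "c = d"
proof (rule ccontr)
  assume ne: "c \<noteq> d"
  interpret module complex_ring V by (rule assms(1))
  have cr: "x \<in> carrier complex_ring" for x by (simp add: complex_ring_def)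
  have "(c - d) \<odot>\<^bsub>V\<^esub> v = (c \<oplus>\<^bsub>complex_ring\<^esub> (- d)) \<odot>\<^bsub>V\<^esub> v" by (simp add: complex_ring_def)
  also have "\<dots> = d \<odot>\<^bsub>V\<^esub> v \<oplus>\<^bsub>V\<^esub> (- d) \<odot>\<^bsub>V\<^esub> v"
    unfolding smult_l_distr[OF cr cr assms(2)] assms(4) ..
  also have "\<dots> = (d \<oplus>\<^bsub>complex_ring\<^esub> (- d)) \<odot>\<^bsub>V\<^esub> v" by (rule smult_l_distr[OF cr cr assms(2), symmetric])
  also have "\<dots> = \<zero>\<^bsub>complex_ring\<^esub> \<odot>\<^bsub>V\<^esub> v" by (simp add: complex_ring_def)
  also have "\<dots> = \<zero>\<^bsub>V\<^esub>" by (rule smult_l_null[OF assms(2)])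
  finally have 0: "(c - d) \<odot>\<^bsub>V\<^esub> v = \<zero>\<^bsub>V\<^esub>" .
  have "v = \<one>\<^bsub>complex_ring\<^esub> \<odot>\<^bsub>V\<^esub> v" by (rule smult_one[OF assms(2), symmetric])
  also have "\<dots> = ((1 / (c - d)) \<otimes>\<^bsub>complex_ring\<^esub> (c - d)) \<odot>\<^bsub>V\<^esub> v" using ne by (simp add: complex_ring_def)
  also have "\<dots> = (1 / (c - d)) \<odot>\<^bsub>V\<^esub> ((c - d) \<odot>\<^bsub>V\<^esub> v)" by (rule smult_assoc1[OF cr cr assms(2)])
  also have "\<dots> = \<zero>\<^bsub>V\<^esub>" unfolding 0 by (rule smult_r_null[OF cr])
  finally show False using assms(3) by simp
qed

lemma HC_rel_acts:
  assumes "HC_rel n m a f" "highest_weight_module n \<mu> V \<rho>" "w \<in> carrier V"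
  shows "\<rho> (U_proj n a) w = f \<mu> \<odot>\<^bsub>V\<^esub> w"
proof -
  obtain v where v: "highest_weight_vector n \<mu> V \<rho> v" and irr: "irreducible_U_module n V \<rho>"
    using assms(2) by (auto simp: highest_weight_module_def)
  have U: "U_module n V \<rho>" using irr by (simp add: irreducible_U_module_def)
  have "\<rho> (U_proj n (a - tens_const (f \<mu>))) v = \<zero>\<^bsub>V\<^esub>"
    using HC_rel_hw_ideal[OF assms(1) hw_ideal_of_vector[OF U v]] by simp
  then show ?thesis
    using v by (intro central_acts_by_scalar[OF irr _ _ HC_rel_central[OF assms(1)] _ assms(3)])
      (auto simp: highest_weight_vector_def)
qed

text \<open>Resolves the \<open>THE\<close> in \<open>HC\<close>. Two candidates are compared on
  nonzero vectors of the modules for dominant weights; the existence of these modules keeps the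
  defining condition from being vacuous there.\<close>

lemma HC_HC_rel:
  assumes "HC_rel n m a f"
  shows "HC n (U_proj n a) \<in> carrier (Lambda_star_filt n m)" "meval (HC n (U_proj n a)) = f"
proof -
  obtain p where p: "p \<in> carrier (Lambda_star_filt n m)" "meval p = f" using e_gen_meval[OF HC_rel_e_gen[OF assms]] .
  have "HC n (U_proj n a) = p"
    unfolding HC_def
  proof (rule the_equality)
    show "p \<in> carrier (Lambda_star n) \<and> (\<forall>\<mu> (V :: (complex, tens set) module) \<rho>. highest_weight_module n \<mu> V \<rho> \<longrightarrow>
        (\<forall>v\<in>carrier V. \<rho> (U_proj n a) v = meval p \<mu> \<odot>\<^bsub>V\<^esub> v))"
    proof (intro conjI allI impI ballI)
      show "p \<in> carrier (Lambda_star n)" using p(1) Lambda_star_iff by blast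
      show "\<rho> (U_proj n a) v = meval p \<mu> \<odot>\<^bsub>V\<^esub> v"
        if "highest_weight_module n \<mu> V \<rho>" "v \<in> carrier V" for \<mu> \<rho> v and V :: "(complex, tens set) module"
        unfolding p(2) by (rule HC_rel_acts[OF assms that])
    qed
  next
    fix q assume q: "q \<in> carrier (Lambda_star n) \<and> (\<forall>\<mu> (V :: (complex, tens set) module) \<rho>. highest_weight_module n \<mu> V \<rho> \<longrightarrow>
        (\<forall>v\<in>carrier V. \<rho> (U_proj n a) v = meval q \<mu> \<odot>\<^bsub>V\<^esub> v))"
    then obtain k where k: "e_gen 1 n k (meval q)" by (auto simp: Lambda_star_e_gen)
    have "polyfn {1..n} (max k m) (\<lambda>x. meval q x - f x)"
      by (rule polyfn_diff[OF polyfn_mono[OF e_gen_polyfn[OF k]] polyfn_mono[OF e_gen_polyfn[OF HC_rel_e_gen[OF assms]]]]) auto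
    moreover have "meval q (dominant n b) - f (dominant n b) = 0" for b
    proof -
      obtain V :: "(complex, tens set) module" and \<rho> where V: "highest_weight_module n (dominant n b) V \<rho>"
        using highest_weight_module_exists by blast
      then obtain v where v: "v \<in> carrier V" "v \<noteq> \<zero>\<^bsub>V\<^esub>"
        by (auto simp: highest_weight_module_def highest_weight_vector_def)
      have "module complex_ring V"
        using V by (simp add: highest_weight_module_def irreducible_U_module_def U_module_def)
      moreover have "meval q (dominant n b) \<odot>\<^bsub>V\<^esub> v = f (dominant n b) \<odot>\<^bsub>V\<^esub> v"
        using q V v(1) HC_rel_acts[OF assms V v(1)] by metis
      ultimately show ?thesis using smult_right_cancel[OF _ v] by simp
    qed
    ultimately have "meval q x - f x = 0" for x by (rule polyfn_zero_on_dominant)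
    then show "q = p" using p(2) by (intro meval_inject) simp
  qed
  then show "HC n (U_proj n a) \<in> carrier (Lambda_star_filt n m)" "meval (HC n (U_proj n a)) = f" using p by auto
qed

text \<open>By \<open>central_generated\<close> the same bound \<open>m\<close> serves the length of
  the lift and the weighted degree in the Capelli elements.\<close>

lemma zeta_filt_HC_rel: "z \<in> carrier (zeta_filt n m) \<longleftrightarrow> (\<exists>a f. HC_rel n m a f \<and> z = U_proj n a)"
proof
  assume "z \<in> carrier (zeta_filt n m)"
  then obtain b where b: "b \<in> T_filt n m" "central_mod n b" "z = U_proj n b" by (auto simp: zeta_filt_carrier)
  then obtain a f where a: "HC_rel n m a f" "b - a \<in> J n" using central_generated by blast
  then have "z = U_proj n a" using b U_proj_eq_iff[OF T_filt_T[OF b(1)] HC_rel_T[OF a(1)]] by simp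
  then show "\<exists>a f. HC_rel n m a f \<and> z = U_proj n a" using a by blast
next
  assume "\<exists>a f. HC_rel n m a f \<and> z = U_proj n a"
  then show "z \<in> carrier (zeta_filt n m)" using HC_rel_T_filt HC_rel_central unfolding zeta_filt_carrier by blast
qed

lemma zeta_iff_filt: "z \<in> carrier (zeta n) \<longleftrightarrow> (\<exists>m. z \<in> carrier (zeta_filt n m))"
proof
  assume "z \<in> carrier (zeta n)"
  then obtain a where a: "central_mod n a" "z = U_proj n a" by (auto simp: zeta_carrier)
  then obtain m where "a \<in> T_filt n m" using T_in_T_filt[of a n] by (auto simp: central_mod_def)
  then show "\<exists>m. z \<in> carrier (zeta_filt n m)" using a by (auto simp: zeta_filt_carrier)
qed (auto simp: zeta_filt_def)

lemma zeta_HC_rel: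
  assumes "z \<in> carrier (zeta n)"
  obtains m a f where "HC_rel n m a f" "z = U_proj n a"
  using assms unfolding zeta_iff_filt zeta_filt_HC_rel by blast

lemma HC_rel_zeta: "HC_rel n m a f \<Longrightarrow> U_proj n a \<in> carrier (zeta n)"
  unfolding zeta_iff_filt zeta_filt_HC_rel by blast

lemma zeta_ops_HC_rel:
  assumes "HC_rel n i a f" "HC_rel n j b g"
  shows "HC_rel n (max i j) (a + b) (\<lambda>x. f x + g x)" "HC_rel n (i + j) (a * b) (\<lambda>x. f x * g x)"
    "U_proj n a \<oplus>\<^bsub>zeta n\<^esub> U_proj n b = U_proj n (a + b)" "U_proj n a \<otimes>\<^bsub>zeta n\<^esub> U_proj n b = U_proj n (a * b)"
    "c \<odot>\<^bsub>zeta n\<^esub> U_proj n a = U_proj n (tens_const c * a)"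
proof -
  show "HC_rel n (max i j) (a + b) (\<lambda>x. f x + g x)"
    by (rule HC_rel.add[OF HC_rel_mono[OF assms(1)] HC_rel_mono[OF assms(2)]]) auto
qed (use assms HC_rel_T[OF assms(1)] HC_rel_T[OF assms(2)] in \<open>auto simp: U_gl_add U_gl_mult U_gl_smult intro: HC_rel.mult\<close>)

lemma zeta_closed: "closed_alg (zeta n)"
  unfolding closed_alg_def
proof (intro conjI ballI allI)
  show "\<one>\<^bsub>zeta n\<^esub> \<in> carrier (zeta n)"
    using HC_rel_zeta[OF HC_rel.const[of n 0 1]] by (simp add: U_gl_one)
  fix x assume "x \<in> carrier (zeta n)"
  then obtain i a f where a: "HC_rel n i a f" "x = U_proj n a" by (rule zeta_HC_rel)
  show "c \<odot>\<^bsub>zeta n\<^esub> x \<in> carrier (zeta n)" for c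
    using HC_rel_zeta[OF HC_rel_cmult[OF a(1)]] zeta_ops_HC_rel(5)[OF a(1) a(1)] a(2) by simp
  fix y assume "y \<in> carrier (zeta n)"
  then obtain j b g where b: "HC_rel n j b g" "y = U_proj n b" by (rule zeta_HC_rel)
  show "x \<oplus>\<^bsub>zeta n\<^esub> y \<in> carrier (zeta n)" "x \<otimes>\<^bsub>zeta n\<^esub> y \<in> carrier (zeta n)"
    unfolding a(2) b(2) zeta_ops_HC_rel(3,4)[OF a(1) b(1)]
    using HC_rel_zeta[OF zeta_ops_HC_rel(1)[OF a(1) b(1)]] HC_rel_zeta[OF zeta_ops_HC_rel(2)[OF a(1) b(1)]] by auto
qed

lemma HC_alg_hom: "HC n \<in> alg_hom (zeta n) (Lambda_star n)"
  unfolding alg_hom_iff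
proof (intro conjI ballI allI)
  show "HC n \<in> carrier (zeta n) \<rightarrow> carrier (Lambda_star n)"
  proof
    fix z assume "z \<in> carrier (zeta n)"
    then obtain m a f where "HC_rel n m a f" "z = U_proj n a" by (rule zeta_HC_rel)
    then show "HC n z \<in> carrier (Lambda_star n)" using HC_HC_rel(1) Lambda_star_iff by blast
  qed
  have "meval (HC n (U_proj n (tens_const 1))) = (\<lambda>x. 1)" by (rule HC_HC_rel(2)[OF HC_rel.const[of n 0 1]])
  then have "HC n (U_proj n 1) = 1" by (intro meval_inject) simp
  then show "HC n \<one>\<^bsub>zeta n\<^esub> = \<one>\<^bsub>Lambda_star n\<^esub>" by (simp add: U_gl_one)
  fix x assume "x \<in> carrier (zeta n)"
  then obtain i a f where a: "HC_rel n i a f" "x = U_proj n a" by (rule zeta_HC_rel)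
  show "HC n (c \<odot>\<^bsub>zeta n\<^esub> x) = c \<odot>\<^bsub>Lambda_star n\<^esub> HC n x" for c
    using HC_HC_rel(2)[OF HC_rel_cmult[OF a(1), of c]] HC_HC_rel(2)[OF a(1)]
    unfolding a(2) zeta_ops_HC_rel(5)[OF a(1) a(1)] by (intro meval_inject) simp
  fix y assume "y \<in> carrier (zeta n)"
  then obtain j b g where b: "HC_rel n j b g" "y = U_proj n b" by (rule zeta_HC_rel)
  show "HC n (x \<oplus>\<^bsub>zeta n\<^esub> y) = HC n x \<oplus>\<^bsub>Lambda_star n\<^esub> HC n y"
    using HC_HC_rel(2)[OF zeta_ops_HC_rel(1)[OF a(1) b(1)]] HC_HC_rel(2)[OF a(1)] HC_HC_rel(2)[OF b(1)]
    unfolding a(2) b(2) zeta_ops_HC_rel(3)[OF a(1) b(1)] by (intro meval_inject) simp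
  show "HC n (x \<otimes>\<^bsub>zeta n\<^esub> y) = HC n x \<otimes>\<^bsub>Lambda_star n\<^esub> HC n y"
    using HC_HC_rel(2)[OF zeta_ops_HC_rel(2)[OF a(1) b(1)]] HC_HC_rel(2)[OF a(1)] HC_HC_rel(2)[OF b(1)]
    unfolding a(2) b(2) zeta_ops_HC_rel(4)[OF a(1) b(1)] by (intro meval_inject) simp
qed

lemma HC_inj: "inj_on (HC n) (carrier (zeta n))"
proof (rule inj_onI)
  fix x y assume xy: "x \<in> carrier (zeta n)" "y \<in> carrier (zeta n)" "HC n x = HC n y"
  obtain i a f where a: "HC_rel n i a f" "x = U_proj n a" using xy(1) by (rule zeta_HC_rel)
  obtain j b g where b: "HC_rel n j b g" "y = U_proj n b" using xy(2) by (rule zeta_HC_rel)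
  have "f = g" using HC_HC_rel(2)[OF a(1)] HC_HC_rel(2)[OF b(1)] xy(3) a(2) b(2) by simp
  then show "x = y"
    using HC_rel_fun_eq_imp_J[OF a(1)] b a(2) U_proj_eq_iff[OF HC_rel_T[OF a(1)] HC_rel_T[OF b(1)]] by simp
qed

text \<open>\<open>HC_rel\<close> carries one bound for both sides, so the filtrations correspond
  exactly and not just up to inclusion.\<close>

lemma HC_image_filt: "HC n ` carrier (zeta_filt n m) = carrier (Lambda_star_filt n m)"
proof (rule subset_antisym; rule subsetI)
  fix p assume "p \<in> HC n ` carrier (zeta_filt n m)"
  then obtain z where z: "p = HC n z" "z \<in> carrier (zeta_filt n m)" by (rule imageE)
  then obtain a f where "HC_rel n m a f" "z = U_proj n a" unfolding zeta_filt_HC_rel by blast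
  then show "p \<in> carrier (Lambda_star_filt n m)" using HC_HC_rel(1) z(1) by simp
next
  fix p assume "p \<in> carrier (Lambda_star_filt n m)"
  then have "e_gen 1 n m (meval p)" by (simp add: Lambda_star_filt_iff)
  then obtain a where a: "HC_rel n m a (meval p)" using e_gen_HC_rel by blast
  then have "HC n (U_proj n a) = p" using HC_HC_rel(2) meval_injective by blast
  then show "p \<in> HC n ` carrier (zeta_filt n m)" using a zeta_filt_HC_rel by blast
qed

lemma HC_bij: "bij_betw (HC n) (carrier (zeta n)) (carrier (Lambda_star n))"
proof -
  have "carrier (zeta n) = (\<Union>m. carrier (zeta_filt n m))" using zeta_iff_filt by auto
  moreover have "carrier (Lambda_star n) = (\<Union>m. carrier (Lambda_star_filt n m))" using Lambda_star_iff by auto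
  ultimately have "HC n ` carrier (zeta n) = carrier (Lambda_star n)" using HC_image_filt by (simp add: image_UN)
  then show ?thesis using HC_inj by (simp add: bij_betw_def)
qed

lemma HC_Capelli_H: "k \<in> {1..n} \<Longrightarrow> HC n (Capelli_H n k) = e_star n k"
  using HC_HC_rel(2)[OF HC_rel.gen[of k n k]] by (intro meval_injective) (simp add: Capelli_H_eq meval_e_star)

lemma Capelli_H_zeta: "Capelli_H n k \<in> carrier (zeta n)"
  unfolding Capelli_H_eq using U_proj_in_zeta_iff[OF Hlift_T] Hlift_central by blast

lemma zeta_alg_hom_unique:
  assumes F: "F \<in> alg_hom (zeta n) B" and G: "G \<in> alg_hom (zeta n) B"
    and gen: "\<And>k. k \<in> {1..n} \<Longrightarrow> F (Capelli_H n k) = G (Capelli_H n k)" and z: "z \<in> carrier (zeta n)"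
  shows "F z = G z"
proof -
  have "F (U_proj n a) = G (U_proj n a)" if "HC_rel n m a f" for m a f
    using that
  proof induction
    case (const m c)
    have "\<one>\<^bsub>zeta n\<^esub> \<in> carrier (zeta n)" using zeta_closed[of n] by (simp add: closed_alg_def)
    moreover have "U_proj n (tens_const c) = c \<odot>\<^bsub>zeta n\<^esub> \<one>\<^bsub>zeta n\<^esub>" by (simp add: U_gl_one U_gl_smult)
    ultimately show ?case using F G by (simp only: alg_hom_iff)
  next
    case (gen k m)
    then show ?case using assms(3) by (simp add: Capelli_H_eq)
  next
    case (add m a f b g)
    then show ?case using F G HC_rel_zeta[OF add(1)] HC_rel_zeta[OF add(2)]
      unfolding zeta_ops_HC_rel(3)[OF add(1,2), symmetric] alg_hom_iff by simp
  next
    case (mult i a f j b g m)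
    then show ?case using F G HC_rel_zeta[OF mult(1)] HC_rel_zeta[OF mult(2)]
      unfolding zeta_ops_HC_rel(4)[OF mult(1,2), symmetric] alg_hom_iff by simp
  qed
  then show ?thesis using z by (auto elim: zeta_HC_rel)
qed

section \<open>The maps between shifted symmetric polynomials in n and n + 1 variables\<close>

text \<open>\<open>incl_rel n m f g\<close>: \<open>f\<close> and \<open>g\<close> are the same polynomial in the functions \<open>e\<^sup>*\<^sub>1, \<dots>, e\<^sup>*\<^sub>n\<close> of \<open>n\<close>
  and of \<open>n + 1\<close> variables.\<close>
inductive incl_rel :: "nat \<Rightarrow> nat \<Rightarrow> ((nat \<Rightarrow> complex) \<Rightarrow> complex) \<Rightarrow> ((nat \<Rightarrow> complex) \<Rightarrow> complex) \<Rightarrow> bool" for n where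
  const: "incl_rel n m (\<lambda>x. c) (\<lambda>x. c)"
| gen: "k \<in> {1..n} \<Longrightarrow> k \<le> m \<Longrightarrow> incl_rel n m (e_fun 1 n k) (e_fun 1 (Suc n) k)"
| add: "incl_rel n m f f' \<Longrightarrow> incl_rel n m g g' \<Longrightarrow> incl_rel n m (\<lambda>x. f x + g x) (\<lambda>x. f' x + g' x)"
| mult: "incl_rel n i f f' \<Longrightarrow> incl_rel n j g g' \<Longrightarrow> i + j \<le> m \<Longrightarrow> incl_rel n m (\<lambda>x. f x * g x) (\<lambda>x. f' x * g' x)"

lemma e_gen_incl_rel: "e_gen 1 n m f \<Longrightarrow> \<exists>g. incl_rel n m f g"
proof (induction rule: e_gen.induct)
  case (gen k m)
  then show ?case using incl_rel.gen by blast
qed (auto intro: incl_rel.intros)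

lemma incl_rel_mono: "incl_rel n m f g \<Longrightarrow> m \<le> m' \<Longrightarrow> incl_rel n m' f g"
  using incl_rel.mult[OF incl_rel.const[of n 0 1], of m f g m'] by simp

lemma incl_rel_e_gen: "incl_rel n m f g \<Longrightarrow> e_gen 1 (Suc n) m g"
proof (induction rule: incl_rel.induct)
  case (gen k m)
  then show ?case by (intro e_gen.gen) auto
qed (auto intro: e_gen.intros)

lemma incl_rel_restrict: "incl_rel n m f g \<Longrightarrow> g (x(Suc n := 0)) = f x"
  by (induction rule: incl_rel.induct) (simp_all add: e_fun_last_0 del: fun_upd_apply)

lemma incl_rel_depends:
  "incl_rel n m f g \<Longrightarrow> (\<And>k. k \<in> {1..n} \<Longrightarrow> e_fun 1 (Suc n) k x = e_fun 1 (Suc n) k y) \<Longrightarrow> g x = g y"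
  by (induction rule: incl_rel.induct) simp_all

text \<open>The algebraic independence of \<open>e\<^sup>*\<^sub>1, \<dots>, e\<^sup>*\<^sub>n\<close> in \<open>n + 1\<close> variables: by surjectivity of
  \<open>(e\<^sup>*\<^sub>1, \<dots>, e\<^sup>*\<^sub>n)\<close> in \<open>n\<close> variables every point may be replaced by one with last coordinate \<open>0\<close>.\<close>
lemma incl_rel_unique:
  assumes "incl_rel n m f g" "incl_rel n m' f g'"
  shows "g = g'"
proof
  fix x
  obtain y where y: "\<And>k. k \<in> {1..n} \<Longrightarrow> e_fun 1 n k y = e_fun 1 (Suc n) k x"
    using e_fun_surjective[of n 1 "\<lambda>k. e_fun 1 (Suc n) k x"] by blast
  let ?y = "y(Suc n := 0)"
  have e: "e_fun 1 (Suc n) k x = e_fun 1 (Suc n) k ?y" if "k \<in> {1..n}" for k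
    using y[OF that] by (simp add: e_fun_last_0 del: fun_upd_apply)
  have "g x = g ?y" "g' x = g' ?y" using incl_rel_depends[OF assms(1) e] incl_rel_depends[OF assms(2) e] by auto
  then show "g x = g' x" using incl_rel_restrict[OF assms(1)] incl_rel_restrict[OF assms(2)] by simp
qed

text \<open>The bound \<open>m \<le> n\<close> of the theorem takes effect here: every generator in
  the expression has index \<open>k \<le> m\<close>, so \<open>e_fun 1 (Suc n) (Suc n)\<close>
  cannot occur, and the same expression in \<open>n\<close> variables is the restriction to
  \<open>x (Suc n) = 0\<close>.\<close>

lemma e_gen_low_incl_rel:
  "e_gen 1 (Suc n) m g \<Longrightarrow> m \<le> n \<Longrightarrow> incl_rel n m (\<lambda>x. g (x(Suc n := 0))) g"
proof (induction rule: e_gen.induct)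
  case (gen k m)
  then show ?case using incl_rel.gen[of k n m] by (simp add: e_fun_last_0 del: fun_upd_apply)
next
  case (mult i f j g m)
  then show ?case by (intro incl_rel.mult) auto
qed (auto intro: incl_rel.const incl_rel.add)

text \<open>A concrete candidate for \<open>incl_Lambda\<close>: an expression is read again in one
  more variable. The value is unique by \<open>incl_rel_unique\<close>, although expression and
  bound may vary.\<close>

definition inclL :: "nat \<Rightarrow> mpoly \<Rightarrow> mpoly" where
  "inclL n p = (THE q. \<exists>m. incl_rel n m (meval p) (meval q))"

definition projL :: "nat \<Rightarrow> mpoly \<Rightarrow> mpoly" where
  "projL n p = (THE q. \<forall>x. meval q x = meval p (x(Suc n := 0)))"

lemma inclL_eq: "incl_rel n m (meval p) (meval q) \<Longrightarrow> inclL n p = q"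
  unfolding inclL_def by (rule the_equality) (auto intro: meval_injective incl_rel_unique)

lemma inclL:
  assumes "p \<in> carrier (Lambda_star_filt n m)"
  shows "incl_rel n m (meval p) (meval (inclL n p))" "inclL n p \<in> carrier (Lambda_star_filt (Suc n) m)"
proof -
  obtain g where g: "incl_rel n m (meval p) g" using assms e_gen_incl_rel[of n m "meval p"] Lambda_star_filt_iff by blast
  obtain q where q: "q \<in> carrier (Lambda_star_filt (Suc n) m)" "meval q = g" using e_gen_meval[OF incl_rel_e_gen[OF g]] .
  have "inclL n p = q" using g q(2) by (intro inclL_eq) simp
  then show "incl_rel n m (meval p) (meval (inclL n p))" "inclL n p \<in> carrier (Lambda_star_filt (Suc n) m)"
    using g q by auto
qed

lemma projL_eq: "(\<And>x. meval q x = meval p (x(Suc n := 0))) \<Longrightarrow> projL n p = q"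
  unfolding projL_def by (rule the_equality) (auto intro: meval_inject)

lemma projL:
  assumes "p \<in> carrier (Lambda_star_filt (Suc n) m)"
  shows "projL n p \<in> carrier (Lambda_star_filt n m)" "meval (projL n p) x = meval p (x(Suc n := 0))"
proof -
  have p: "e_gen 1 (Suc n) m (meval p)" using assms by (simp add: Lambda_star_filt_iff)
  have "e_gen 1 n m (\<lambda>x. meval p (x(Suc n := 0)))"
    by (rule shift_sym_generated[OF polyfn_restrict_last[OF e_gen_polyfn[OF p]] shift_sym_restrict_last[OF e_gen_shift_sym[OF p]]])
  then obtain q where q: "q \<in> carrier (Lambda_star_filt n m)" "meval q = (\<lambda>x. meval p (x(Suc n := 0)))"
    by (rule e_gen_meval)
  have "projL n p = q" by (rule projL_eq) (simp add: q(2))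
  then show "projL n p \<in> carrier (Lambda_star_filt n m)" "meval (projL n p) x = meval p (x(Suc n := 0))"
    using q by auto
qed

lemma projL_inclL:
  assumes "p \<in> carrier (Lambda_star n)"
  shows "projL n (inclL n p) = p"
proof -
  obtain m where "p \<in> carrier (Lambda_star_filt n m)" using assms Lambda_star_iff by blast
  from incl_rel_restrict[OF inclL(1)[OF this]] show ?thesis by (intro projL_eq) simp
qed

lemma inclL_projL:
  assumes "q \<in> carrier (Lambda_star_filt (Suc n) m)" "m \<le> n"
  shows "inclL n (projL n q) = q"
proof (rule inclL_eq)
  have "meval (projL n q) = (\<lambda>x. meval q (x(Suc n := 0)))" by (rule ext) (rule projL(2)[OF assms(1)])
  then show "incl_rel n m (meval (projL n q)) (meval q)"
    using e_gen_low_incl_rel[OF _ assms(2)] assms(1) by (simp add: Lambda_star_filt_iff)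
qed

lemma inclL_alg_hom: "inclL n \<in> alg_hom (Lambda_star n) (Lambda_star (Suc n))"
  unfolding alg_hom_iff
proof (intro conjI ballI allI)
  have eq: "meval (p + q) = (\<lambda>x. meval p x + meval q x)" "meval (p * q) = (\<lambda>x. meval p x * meval q x)"
    "meval (mconst c) = (\<lambda>x. c)" "meval 1 = (\<lambda>x. 1)" for p q c by auto
  show "inclL n \<in> carrier (Lambda_star n) \<rightarrow> carrier (Lambda_star (Suc n))"
    using inclL(2) Lambda_star_iff by blast
  show "inclL n \<one>\<^bsub>Lambda_star n\<^esub> = \<one>\<^bsub>Lambda_star (Suc n)\<^esub>"
    using inclL_eq[of n 0 1 1] incl_rel.const[of n 0 1] by (simp add: eq)
  fix p assume "p \<in> carrier (Lambda_star n)"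
  then obtain i where "p \<in> carrier (Lambda_star_filt n i)" using Lambda_star_iff by blast
  note p = inclL(1)[OF this]
  show "inclL n (c \<odot>\<^bsub>Lambda_star n\<^esub> p) = c \<odot>\<^bsub>Lambda_star (Suc n)\<^esub> inclL n p" for c
    using inclL_eq[of n i "mconst c * p" "mconst c * inclL n p"] incl_rel.mult[OF incl_rel.const[of n 0 c] p, of i]
    by (simp add: eq)
  fix q assume "q \<in> carrier (Lambda_star n)"
  then obtain j where "q \<in> carrier (Lambda_star_filt n j)" using Lambda_star_iff by blast
  note q = inclL(1)[OF this]
  have "incl_rel n (max i j) (\<lambda>x. meval p x + meval q x) (\<lambda>x. meval (inclL n p) x + meval (inclL n q) x)"
    by (intro incl_rel.add incl_rel_mono[OF p] incl_rel_mono[OF q]) auto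
  then show "inclL n (p \<oplus>\<^bsub>Lambda_star n\<^esub> q) = inclL n p \<oplus>\<^bsub>Lambda_star (Suc n)\<^esub> inclL n q"
    using inclL_eq[of n "max i j" "p + q" "inclL n p + inclL n q"] by (simp add: eq)
  show "inclL n (p \<otimes>\<^bsub>Lambda_star n\<^esub> q) = inclL n p \<otimes>\<^bsub>Lambda_star (Suc n)\<^esub> inclL n q"
    using inclL_eq[of n "i + j" "p * q" "inclL n p * inclL n q"] incl_rel.mult[OF p q order_refl] by (simp add: eq)
qed

lemma inclL_e_star: "k \<in> {1..n} \<Longrightarrow> inclL n (e_star n k) = e_star (Suc n) k"
  using incl_rel.gen[of k n k] by (intro inclL_eq) (simp add: meval_e_star)

lemma projL_carrier: "p \<in> carrier (Lambda_star (Suc n)) \<Longrightarrow> projL n p \<in> carrier (Lambda_star n)"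
  and meval_projL: "p \<in> carrier (Lambda_star (Suc n)) \<Longrightarrow> meval (projL n p) x = meval p (x(Suc n := 0))"
  using projL Lambda_star_iff by blast+

lemma projL_alg_hom: "projL n \<in> alg_hom (Lambda_star (Suc n)) (Lambda_star n)"
  unfolding alg_hom_iff
  by (auto intro!: projL_eq simp: projL_carrier meval_projL simp del: fun_upd_apply)

lemma projL_e_star: "projL n (e_star (Suc n) k) = e_star n k"
  by (intro projL_eq) (simp add: meval_e_star e_fun_last_0 del: fun_upd_apply)

lemma projL_e_star_top: "projL n (e_star (Suc n) (Suc n)) = 0"
  by (intro projL_eq) (simp add: meval_e_star e_fun_top)

lemma projL_surj: "projL n ` carrier (Lambda_star (Suc n)) = carrier (Lambda_star n)"
proof (rule subset_antisym; rule subsetI)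
  fix p assume p: "p \<in> carrier (Lambda_star n)"
  have "inclL n p \<in> carrier (Lambda_star (Suc n))" using p inclL_alg_hom[of n] by (auto simp: alg_hom_iff)
  then show "p \<in> projL n ` carrier (Lambda_star (Suc n))" using projL_inclL[OF p] by force
qed (auto simp: projL_carrier)

text \<open>\<open>inclL\<close> satisfies the description, its injectivity coming from the left
  inverse \<open>projL\<close>; any other candidate agrees with it on the generators, and
  \<open>extensional\<close> settles the values outside the carrier.\<close>

lemma incl_Lambda_eq: "incl_Lambda n = restrict (inclL n) (carrier (Lambda_star n))" (is "_ = ?f")
  unfolding incl_Lambda_def Suc_eq_plus1[symmetric]
proof (rule the_equality)
  have inj: "inj_on (inclL n) (carrier (Lambda_star n))" by (rule inj_on_inverseI) (rule projL_inclL)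
  show f: "?f \<in> alg_hom (Lambda_star n) (Lambda_star (Suc n)) \<and> ?f \<in> extensional (carrier (Lambda_star n)) \<and>
    inj_on ?f (carrier (Lambda_star n)) \<and> (\<forall>k\<in>{1..n}. ?f (e_star n k) = e_star (Suc n) k)"
    using alg_hom_restrict[OF inclL_alg_hom Lambda_star_closed] inj inclL_e_star e_star_carrier
    by (auto simp: inj_on_def)
  fix g assume g: "g \<in> alg_hom (Lambda_star n) (Lambda_star (Suc n)) \<and> g \<in> extensional (carrier (Lambda_star n)) \<and>
    inj_on g (carrier (Lambda_star n)) \<and> (\<forall>k\<in>{1..n}. g (e_star n k) = e_star (Suc n) k)"
  show "g = ?f"
  proof (rule extensionalityI[of g "carrier (Lambda_star n)"])
    show "g p = ?f p" if "p \<in> carrier (Lambda_star n)" for p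
      by (rule Lambda_alg_hom_unique[of g n "Lambda_star (Suc n)" ?f, OF _ _ _ that]) (use g f in auto)
  qed (use g in auto)
qed

lemma proj_Lambda_eq: "proj_Lambda n = restrict (projL n) (carrier (Lambda_star (Suc n)))" (is "_ = ?f")
  unfolding proj_Lambda_def Suc_eq_plus1[symmetric]
proof (rule the_equality)
  show f: "?f \<in> alg_hom (Lambda_star (Suc n)) (Lambda_star n) \<and> ?f \<in> extensional (carrier (Lambda_star (Suc n))) \<and>
    ?f ` carrier (Lambda_star (Suc n)) = carrier (Lambda_star n) \<and>
    (\<forall>k\<in>{1..n}. ?f (e_star (Suc n) k) = e_star n k) \<and> ?f (e_star (Suc n) (Suc n)) = 0"
    using alg_hom_restrict[OF projL_alg_hom Lambda_star_closed] projL_surj projL_e_star projL_e_star_top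
      e_star_carrier[of _ "Suc n"] by auto
  fix g assume g: "g \<in> alg_hom (Lambda_star (Suc n)) (Lambda_star n) \<and> g \<in> extensional (carrier (Lambda_star (Suc n))) \<and>
    g ` carrier (Lambda_star (Suc n)) = carrier (Lambda_star n) \<and>
    (\<forall>k\<in>{1..n}. g (e_star (Suc n) k) = e_star n k) \<and> g (e_star (Suc n) (Suc n)) = 0"
  show "g = ?f"
  proof (rule extensionalityI[of g "carrier (Lambda_star (Suc n))"])
    have gf: "g (e_star (Suc n) k) = ?f (e_star (Suc n) k)" if "k \<in> {1..Suc n}" for k
      using g f that by (cases "k = Suc n") (simp_all del: restrict_apply)
    show "g p = ?f p" if "p \<in> carrier (Lambda_star (Suc n))" for p
      by (rule Lambda_alg_hom_unique[of g "Suc n" "Lambda_star n" ?f, OF _ _ gf that]) (use g f in auto)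
  qed (use g in auto)
qed

section \<open>Transport of the maps to the center\<close>

definition HC_inv :: "nat \<Rightarrow> mpoly \<Rightarrow> tens set" where
  "HC_inv n = inv_into (carrier (zeta n)) (HC n)"

lemma HC_inv_HC: "z \<in> carrier (zeta n) \<Longrightarrow> HC_inv n (HC n z) = z"
  unfolding HC_inv_def by (rule inv_into_f_f[OF HC_inj])

lemma HC_HC_inv: "p \<in> carrier (Lambda_star n) \<Longrightarrow> HC n (HC_inv n p) = p"
  unfolding HC_inv_def using HC_bij[of n] by (intro f_inv_into_f) (simp add: bij_betw_def)

lemma HC_inv_alg_hom: "HC_inv n \<in> alg_hom (Lambda_star n) (zeta n)"
  unfolding HC_inv_def by (rule alg_hom_inv_into[OF HC_alg_hom HC_bij zeta_closed])

lemma HC_inv_bij: "bij_betw (HC_inv n) (carrier (Lambda_star n)) (carrier (zeta n))"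
  unfolding HC_inv_def by (rule bij_betw_inv_into[OF HC_bij])

lemma HC_carrier: "z \<in> carrier (zeta n) \<Longrightarrow> HC n z \<in> carrier (Lambda_star n)"
  using HC_alg_hom[of n] by (auto simp: alg_hom_iff)

lemma inclL_carrier: "p \<in> carrier (Lambda_star n) \<Longrightarrow> inclL n p \<in> carrier (Lambda_star (Suc n))"
  using inclL_alg_hom[of n] by (auto simp: alg_hom_iff)

lemma HC_inv_filt: "p \<in> carrier (Lambda_star_filt n m) \<Longrightarrow> HC_inv n p \<in> carrier (zeta_filt n m)"
proof -
  assume "p \<in> carrier (Lambda_star_filt n m)"
  then have "p \<in> HC n ` carrier (zeta_filt n m)" by (simp add: HC_image_filt)
  then obtain z where "p = HC n z" "z \<in> carrier (zeta_filt n m)" by (rule imageE)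
  moreover from this have "z \<in> carrier (zeta n)" using zeta_iff_filt by blast
  ultimately show ?thesis by (simp add: HC_inv_HC)
qed

text \<open>\<open>HC\<close> matches the Capelli elements with \<open>e_star\<close>, so
  \<open>inclL\<close> conjugated by it has the prescribed values on generators.\<close>

lemma incl_zeta_eq:
  "incl_zeta n = restrict (\<lambda>z. HC_inv (Suc n) (inclL n (HC n z))) (carrier (zeta n))" (is "_ = ?f")
  unfolding incl_zeta_def Suc_eq_plus1[symmetric]
proof (rule the_equality)
  have "(\<lambda>z. HC_inv (Suc n) (inclL n (HC n z))) \<in> alg_hom (zeta n) (zeta (Suc n))"
    by (rule alg_hom_comp[OF alg_hom_comp[OF HC_alg_hom inclL_alg_hom] HC_inv_alg_hom])
  then have hom: "?f \<in> alg_hom (zeta n) (zeta (Suc n))" by (rule alg_hom_restrict[OF _ zeta_closed])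
  have inj: "inj_on ?f (carrier (zeta n))"
  proof (rule inj_on_inverseI[where g="\<lambda>w. HC_inv n (projL n (HC (Suc n) w))"])
    show "HC_inv n (projL n (HC (Suc n) (?f z))) = z" if "z \<in> carrier (zeta n)" for z
      using that by (simp add: HC_HC_inv inclL_carrier HC_carrier projL_inclL HC_inv_HC)
  qed
  have gen: "?f (Capelli_H n k) = Capelli_H (Suc n) k" if "k \<in> {1..n}" for k
    using that HC_inv_HC[OF Capelli_H_zeta, of "Suc n" k] HC_Capelli_H[of k "Suc n"]
    by (simp add: Capelli_H_zeta HC_Capelli_H inclL_e_star)
  show f: "?f \<in> alg_hom (zeta n) (zeta (Suc n)) \<and> ?f \<in> extensional (carrier (zeta n)) \<and>
     inj_on ?f (carrier (zeta n)) \<and> (\<forall>k\<in>{1..n}. ?f (Capelli_H n k) = Capelli_H (Suc n) k)"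
    using hom inj gen by blast
  fix g assume g: "g \<in> alg_hom (zeta n) (zeta (Suc n)) \<and> g \<in> extensional (carrier (zeta n)) \<and>
     inj_on g (carrier (zeta n)) \<and> (\<forall>k\<in>{1..n}. g (Capelli_H n k) = Capelli_H (Suc n) k)"
  show "g = ?f"
  proof (rule extensionalityI[of g "carrier (zeta n)"])
    show "g z = ?f z" if "z \<in> carrier (zeta n)" for z
      by (rule zeta_alg_hom_unique[of g n "zeta (Suc n)" ?f, OF _ hom _ that]) (use g gen in auto)
  qed (use g in auto)
qed

lemma proj_zeta_eq:
  "proj_zeta n = restrict (\<lambda>w. HC_inv n (projL n (HC (Suc n) w))) (carrier (zeta (Suc n)))" (is "_ = ?f")
  unfolding proj_zeta_def Suc_eq_plus1[symmetric]
proof (rule the_equality)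
  have "(\<lambda>w. HC_inv n (projL n (HC (Suc n) w))) \<in> alg_hom (zeta (Suc n)) (zeta n)"
    by (rule alg_hom_comp[OF alg_hom_comp[OF HC_alg_hom projL_alg_hom] HC_inv_alg_hom])
  then have hom: "?f \<in> alg_hom (zeta (Suc n)) (zeta n)" by (rule alg_hom_restrict[OF _ zeta_closed])
  have "(\<lambda>w. HC_inv n (projL n (HC (Suc n) w))) ` carrier (zeta (Suc n)) =
    HC_inv n ` projL n ` HC (Suc n) ` carrier (zeta (Suc n))" by (simp add: image_image)
  also have "\<dots> = carrier (zeta n)"
    using HC_bij[of "Suc n"] HC_inv_bij[of n] by (simp add: bij_betw_def projL_surj)
  finally have img: "?f ` carrier (zeta (Suc n)) = carrier (zeta n)" by simp
  have gen: "?f (Capelli_H (Suc n) k) = Capelli_H n k" if "k \<in> {1..n}" for k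
    using that HC_inv_HC[OF Capelli_H_zeta, of n k] HC_Capelli_H[of k "Suc n"]
    by (simp add: Capelli_H_zeta HC_Capelli_H projL_e_star)
  \<comment> \<open>Preservation of zero is not among the clauses of \<open>alg_hom\<close>; it is
    computed from the constant tensor, for the value at the top Capelli element.\<close>
  have "meval (HC n (U_proj n (tens_const 0))) = (\<lambda>x. 0)" by (rule HC_HC_rel(2)[OF HC_rel.const[of n 0 0]])
  then have "HC n \<zero>\<^bsub>zeta n\<^esub> = 0" by (intro meval_inject) (simp add: U_gl_zero)
  moreover have "\<zero>\<^bsub>zeta n\<^esub> \<in> carrier (zeta n)" using HC_rel_zeta[OF HC_rel.const[of n 0 0]] by (simp add: U_gl_zero)
  ultimately have "HC_inv n 0 = \<zero>\<^bsub>zeta n\<^esub>" using HC_inv_HC by metis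
  then have top: "?f (Capelli_H (Suc n) (Suc n)) = \<zero>\<^bsub>zeta n\<^esub>"
    using HC_Capelli_H[of "Suc n" "Suc n"] by (simp add: Capelli_H_zeta projL_e_star_top)
  show "?f \<in> alg_hom (zeta (Suc n)) (zeta n) \<and> ?f \<in> extensional (carrier (zeta (Suc n))) \<and>
     ?f ` carrier (zeta (Suc n)) = carrier (zeta n) \<and>
     (\<forall>k\<in>{1..n}. ?f (Capelli_H (Suc n) k) = Capelli_H n k) \<and> ?f (Capelli_H (Suc n) (Suc n)) = \<zero>\<^bsub>zeta n\<^esub>"
    using hom img gen top by blast
  fix g assume g: "g \<in> alg_hom (zeta (Suc n)) (zeta n) \<and> g \<in> extensional (carrier (zeta (Suc n))) \<and>
     g ` carrier (zeta (Suc n)) = carrier (zeta n) \<and>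
     (\<forall>k\<in>{1..n}. g (Capelli_H (Suc n) k) = Capelli_H n k) \<and> g (Capelli_H (Suc n) (Suc n)) = \<zero>\<^bsub>zeta n\<^esub>"
  have gf: "g (Capelli_H (Suc n) k) = ?f (Capelli_H (Suc n) k)" if "k \<in> {1..Suc n}" for k
    using g gen[of k] top that by (cases "k = Suc n") (simp_all del: restrict_apply)
  show "g = ?f"
  proof (rule extensionalityI[of g "carrier (zeta (Suc n))"])
    show "g z = ?f z" if "z \<in> carrier (zeta (Suc n))" for z
      by (rule zeta_alg_hom_unique[of g "Suc n" "zeta n" ?f, OF _ hom gf that]) (use g in auto)
  qed (use g in auto)
qed

section \<open>Restriction to the filtered subspaces\<close>

lemma lin_hom_of_alg_hom:
  assumes "f \<in> alg_hom A B" "carrier A' \<subseteq> carrier A" "add A' = add A" "module.smult A' = module.smult A"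
    "add B' = add B" "module.smult B' = module.smult B" "\<And>x. x \<in> carrier A' \<Longrightarrow> f x \<in> carrier B'"
  shows "f \<in> lin_hom A' B'"
  using assms unfolding alg_hom_iff lin_hom_def by (auto simp: subset_iff)

lemma mutually_inverse_isosI:
  assumes "f \<in> lin_hom V W" "g \<in> lin_hom W V" "\<And>x. x \<in> carrier V \<Longrightarrow> g (f x) = x" "\<And>y. y \<in> carrier W \<Longrightarrow> f (g y) = y"
  shows "mutually_inverse_isos V W f g"
proof -
  have m: "f x \<in> carrier W" if "x \<in> carrier V" for x using assms(1) that by (auto simp: lin_hom_def)
  have m': "g y \<in> carrier V" if "y \<in> carrier W" for y using assms(2) that by (auto simp: lin_hom_def)
  have "bij_betw f (carrier V) (carrier W)" "bij_betw g (carrier W) (carrier V)"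
    using assms(3,4) m m' by (auto intro!: bij_betwI[where g=g] bij_betwI[where g=f])
  then show ?thesis using assms by (auto simp: mutually_inverse_isos_def lin_iso_def)
qed

lemma zeta_filt_subset: "carrier (zeta_filt n m) \<subseteq> carrier (zeta n)"
  using zeta_iff_filt by blast

lemma Lambda_star_filt_subset: "carrier (Lambda_star_filt n m) \<subseteq> carrier (Lambda_star n)"
  using Lambda_star_iff by blast

lemma HC_lin_iso: "HC n \<in> lin_iso (zeta_filt n m) (Lambda_star_filt n m)"
  unfolding lin_iso_def
proof (intro CollectI conjI)
  show "HC n \<in> lin_hom (zeta_filt n m) (Lambda_star_filt n m)"
    by (rule lin_hom_of_alg_hom[OF HC_alg_hom zeta_filt_subset]) (use HC_image_filt in auto)
  show "bij_betw (HC n) (carrier (zeta_filt n m)) (carrier (Lambda_star_filt n m))"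
    unfolding bij_betw_def using inj_on_subset[OF HC_inj zeta_filt_subset] HC_image_filt by blast
qed

theorem theorem7p2:
  fixes m n :: nat
  assumes "1 \<le> m" and "m \<le> n"
  shows
    "mutually_inverse_isos (zeta_filt n m) (zeta_filt (n + 1) m) (incl_zeta n) (proj_zeta n) \<and>
     mutually_inverse_isos (Lambda_star_filt n m) (Lambda_star_filt (n + 1) m)
       (incl_Lambda n) (proj_Lambda n) \<and>
     HC n \<in> lin_iso (zeta_filt n m) (Lambda_star_filt n m) \<and>
     HC (n + 1) \<in> lin_iso (zeta_filt (n + 1) m) (Lambda_star_filt (n + 1) m) \<and>
     (\<forall>z\<in>carrier (zeta_filt n m). HC (n + 1) (incl_zeta n z) = incl_Lambda n (HC n z)) \<and>
     (\<forall>w\<in>carrier (zeta_filt (n + 1) m). HC n (proj_zeta n w) = proj_Lambda n (HC (n + 1) w))"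
  unfolding Suc_eq_plus1[symmetric]
proof (intro conjI ballI HC_lin_iso)
  let ?N = "Suc n"
  have zc: "z \<in> carrier (zeta k)" if "z \<in> carrier (zeta_filt k m)" for z k using zeta_filt_subset that by blast
  have Lc: "p \<in> carrier (Lambda_star k)" if "p \<in> carrier (Lambda_star_filt k m)" for p k
    using Lambda_star_filt_subset that by blast
  have HCf: "HC k z \<in> carrier (Lambda_star_filt k m)" if "z \<in> carrier (zeta_filt k m)" for z k
    using HC_image_filt that by blast
  have iz: "incl_zeta n z = HC_inv ?N (inclL n (HC n z))" if "z \<in> carrier (zeta_filt n m)" for z
    using zc[OF that] by (simp add: incl_zeta_eq)
  have pz: "proj_zeta n w = HC_inv n (projL n (HC ?N w))" if "w \<in> carrier (zeta_filt ?N m)" for w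
    using zc[OF that] by (simp add: proj_zeta_eq)
  have iL: "incl_Lambda n p = inclL n p" if "p \<in> carrier (Lambda_star_filt n m)" for p
    using Lc[OF that] by (simp add: incl_Lambda_eq)
  have pL: "proj_Lambda n p = projL n p" if "p \<in> carrier (Lambda_star_filt ?N m)" for p
    using Lc[OF that] by (simp add: proj_Lambda_eq)
  have izf: "incl_zeta n z \<in> carrier (zeta_filt ?N m)" if "z \<in> carrier (zeta_filt n m)" for z
    unfolding iz[OF that] by (intro HC_inv_filt inclL(2) HCf that)
  have pzf: "proj_zeta n w \<in> carrier (zeta_filt n m)" if "w \<in> carrier (zeta_filt ?N m)" for w
    unfolding pz[OF that] by (intro HC_inv_filt projL(1) HCf that)
  have HCi: "HC ?N (incl_zeta n z) = inclL n (HC n z)" if "z \<in> carrier (zeta_filt n m)" for z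
    unfolding iz[OF that] by (intro HC_HC_inv Lc inclL(2) HCf that)
  have HCp: "HC n (proj_zeta n w) = projL n (HC ?N w)" if "w \<in> carrier (zeta_filt ?N m)" for w
    unfolding pz[OF that] by (intro HC_HC_inv Lc projL(1) HCf that)
  have hom_iz: "incl_zeta n \<in> alg_hom (zeta n) (zeta ?N)"
    unfolding incl_zeta_eq
    by (rule alg_hom_restrict[OF alg_hom_comp[OF alg_hom_comp[OF HC_alg_hom inclL_alg_hom] HC_inv_alg_hom] zeta_closed])
  have hom_pz: "proj_zeta n \<in> alg_hom (zeta ?N) (zeta n)"
    unfolding proj_zeta_eq
    by (rule alg_hom_restrict[OF alg_hom_comp[OF alg_hom_comp[OF HC_alg_hom projL_alg_hom] HC_inv_alg_hom] zeta_closed])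
  have hom_iL: "incl_Lambda n \<in> alg_hom (Lambda_star n) (Lambda_star ?N)"
    unfolding incl_Lambda_eq by (rule alg_hom_restrict[OF inclL_alg_hom Lambda_star_closed])
  have hom_pL: "proj_Lambda n \<in> alg_hom (Lambda_star ?N) (Lambda_star n)"
    unfolding proj_Lambda_eq by (rule alg_hom_restrict[OF projL_alg_hom Lambda_star_closed])
  show "mutually_inverse_isos (zeta_filt n m) (zeta_filt ?N m) (incl_zeta n) (proj_zeta n)"
  proof (rule mutually_inverse_isosI)
    show "incl_zeta n \<in> lin_hom (zeta_filt n m) (zeta_filt ?N m)"
      by (rule lin_hom_of_alg_hom[OF hom_iz zeta_filt_subset]) (use izf in auto)
    show "proj_zeta n \<in> lin_hom (zeta_filt ?N m) (zeta_filt n m)"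
      by (rule lin_hom_of_alg_hom[OF hom_pz zeta_filt_subset]) (use pzf in auto)
    show "proj_zeta n (incl_zeta n z) = z" if "z \<in> carrier (zeta_filt n m)" for z
      unfolding pz[OF izf[OF that]] HCi[OF that]
      using zc[OF that] by (simp add: projL_inclL HC_carrier HC_inv_HC)
    \<comment> \<open>This order of composition is where \<open>m \<le> n\<close> enters: in higher
      degree the projection loses the top generator.\<close>
    show "incl_zeta n (proj_zeta n w) = w" if "w \<in> carrier (zeta_filt ?N m)" for w
      unfolding iz[OF pzf[OF that]] HCp[OF that] inclL_projL[OF HCf[OF that] assms(2)]
      by (rule HC_inv_HC[OF zc[OF that]])
  qed
  show "mutually_inverse_isos (Lambda_star_filt n m) (Lambda_star_filt ?N m) (incl_Lambda n) (proj_Lambda n)"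
  proof (rule mutually_inverse_isosI)
    show "incl_Lambda n \<in> lin_hom (Lambda_star_filt n m) (Lambda_star_filt ?N m)"
      by (rule lin_hom_of_alg_hom[OF hom_iL Lambda_star_filt_subset]) (simp_all add: iL inclL(2))
    show "proj_Lambda n \<in> lin_hom (Lambda_star_filt ?N m) (Lambda_star_filt n m)"
      by (rule lin_hom_of_alg_hom[OF hom_pL Lambda_star_filt_subset]) (simp_all add: pL projL(1))
    show "proj_Lambda n (incl_Lambda n p) = p" if "p \<in> carrier (Lambda_star_filt n m)" for p
      unfolding iL[OF that] pL[OF inclL(2)[OF that]] by (rule projL_inclL[OF Lc[OF that]])
    show "incl_Lambda n (proj_Lambda n q) = q" if "q \<in> carrier (Lambda_star_filt ?N m)" for q
      unfolding pL[OF that] iL[OF projL(1)[OF that]] by (rule inclL_projL[OF that assms(2)])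
  qed
  show "HC ?N (incl_zeta n z) = incl_Lambda n (HC n z)" if "z \<in> carrier (zeta_filt n m)" for z
    unfolding HCi[OF that] iL[OF HCf[OF that]] ..
  show "HC n (proj_zeta n w) = proj_Lambda n (HC ?N w)" if "w \<in> carrier (zeta_filt ?N m)" for w
    unfolding HCp[OF that] pL[OF HCf[OF that]] ..
qed

end
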